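(* Let $u,v(\lambda,r),w\in S_\infty$, where $v(\lambda,r)$ is the $r$-shuffle associated with a partition $\lambda$, let $U\in\mathcal{RC}(u)$, and let $T$ be a tableau of transpositions of $v(\lambda,r)$. Assume that $w$ is an $r$-semi-shuffle or $\lambda$ is a hook, that $(w,U,T)$ is an $r$-Bruhat package, and that $E(w,T)$ is row and column strict. Then the outputs $R=U\rightarrow T$ and $Y=Y(U,T)$ of the inverse insertion algorithm described in the context satisfy $R\in\mathcal{RC}(w)$ and $Y\in\mathcal{RC}(v(\lambda,r))$. Moreover, $U=R\leftarrow Y$ and $T=T(R,Y)$, where $R\leftarrow Y$ and $T(R,Y)$ are the outputs of the insertion algorithm described in the context.
   Context: **Permutations.** $S_\infty$ is the group of permutations of $\mathbb N=\{1,2,\dots\}$ fixing all but finitely many integers; products are compositions of functions; $s_i=t_{i,i+1}$, where $t_{ij}$ is the transposition of $i$ and $j$; $l(w)$ is the Coxeter length. $w$ is an $r$-shuffle if $w(i)<w(i+1)$ for all $i\ne r$, and an $r$-semi-shuffle if $w(i)<w(i+1)$ for all $i>r$. For a partition $\lambda=(\lambda_1\ge\lambda_2\ge\dots)$ with at most $r$ nonzero parts, $v(\lambda,r)$ is the unique $r$-shuffle $v$ with $\lambda_j=v(r+1-j)-r-1+j$ for $1\le j\le r$. $\lambda$ is a hook if $\lambda=(\lambda_1,1,\dots,1)$ (rows and columns included). **Graphs.** A graph is a finite set $R\subset\mathbb N\times\mathbb N$ of crossings, $(i,j)$ meaning row $i$ (numbered from the top) and column $j$ (from the left). The crossing at $(i,j)$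 has label $i+j-1$. Reading labels from the top row to the bottom row, and from right to left in each row, gives a word $i_1\dots i_m$; set $w(R)=s_{i_1}\cdots s_{i_m}$ and $|R|=m$. $R$ is an rc-graph of $w(R)$ if this word is reduced, i.e. $|R|=l(w(R))$; $\mathcal{RC}(w)$ is the set of rc-graphs of $w$. Strands: at a place $(i,j)\in R$ the strand entering from the left leaves to the right (it is the horizontal strand) and the strand entering from below leaves at the top (the vertical strand), and they cross; at a place $(i,j)\notin R$ the strand entering from the left leaves at the top and the strand entering from below leaves to the right. Strand $i$ is the strand entering from the left end of row $i$; it ends at the top of column $w(R)(i)$. Write $a\boxplus b=\ell$ if strands $a$ and $b$ cross in row $\ell$ with $a$ the horizontal strand. $R_{\ge\ell}$ (resp. $R_\ell$) is the set of crossings of $R$ in rows $\ge\ell$ (resp. in row $\ell$). **Tableaux.** Boxes of the Young diagram of $\lambda$ ($\lambda_i$ boxes in row $i$, row 1 on top) are numbered $1,\dots,m$ starting with the bottom row and going up, left to right in each row. A tableau is filled up to $i$ if exactly boxes $1,\dots,i$ are filled. A tableau of integers is row strict if entries strictly increase left to right and weakly increase top to bottom, column strict if they weakly increase left to right and strictly increase top to bottom (for partially filled tableaux, conditions are on filled boxes). A tableau of transpositions of $v(\lambda,r)$ is a filling of the diagram of $\lambda$ by pairs $(ab)$ with $a\le r<b$; $|T|$ is its number of boxes. If $T$ has entry $(a_kb_k)$ in box $k$, put $w_i(T)=t_{a_1b_1}\cdots t_{a_ib_i}$, and $w(T)=w_m(T)$ where $m$ is the number of filled boxes. $T$ (filled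 up to $m$) is an $r$-Bruhat chain of $w$ if $l(w\,w_i(T))=l(w)+i$ for $1\le i\le m$. $(w,R,T)$ is an $r$-Bruhat package if $R$ is an rc-graph, $w\,w(T)=w(R)$ and $T$ is an $r$-Bruhat chain of $w$. $E(w,T)$ is the tableau of the same shape whose box $i$ contains $w\,w_i(T)(b_i)$ for each filled box $i$. For an $r$-Bruhat package $\mathcal P=(w,R,T)$ with $m$ filled boxes, $S_m(\mathcal P)=R$, and $S_{j}(\mathcal P)$ ($0\le j<m$) is obtained from $S_{j+1}(\mathcal P)$ by removing the (unique) crossing of strands $a_{j+1}$ and $b_{j+1}$; these are rc-graphs with $w(S_j(\mathcal P))=w\,w_j(T)$. **Words of $Y$.** Let $Y\in\mathcal{RC}(v(\lambda,r))$. Strand $s\le r$ crosses exactly $\lambda_{r+1-s}$ other strands; list the rows of these crossings (with repetition) in weakly decreasing order to get $word(Y,s)$, and let $word(Y)$ be the concatenation $word(Y,1)\cdots word(Y,r)$. Its $i$-th letter corresponds to box $i$ of $\lambda=:sh(Y)$. For each $\ell$, $w(Y_{\ge\ell})$ is again an $r$-shuffle, with shape $sh(Y_{\ge\ell})$ a subdiagram of $\lambda$, and $sh(Y_{\ge\ell+1})\subset sh(Y_{\ge\ell})$. **Insertion algorithm** (input $R\in\mathcal{RC}(w)$, $Y\in\mathcal{RC}(v(\lambda,r))$). Let $m_\ell=|Y_{\ge\ell}|$. Steps $(\ell,i)$, $r\ge\ell\ge1$, $0\le i\le m_\ell$, are performed in the order $(r,0),\dots,(r,m_r),(r-1,0),\dots,(1,m_1)$.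 Step $(\ell,i)$ produces a graph $R(\ell,i)$ with no crossings above row $\ell$ and a tableau of transpositions $T(\ell,i)$ of shape $sh(Y_{\ge\ell})$ filled up to $i$. Put $R(\ell)=R(\ell,m_\ell)$, $T(\ell)=T(\ell,m_\ell)$, $\mathcal P(\ell)=(w(R_{\ge\ell}),R(\ell),T(\ell))$. *Start:* $R(r,0)=R_{\ge r}$, $T(r,0)$ empty of shape $sh(Y_{\ge r})$. *Row-to-row step $(\ell,0)$, $\ell<r$:* $R(\ell,0)=S_0(\mathcal P(\ell+1))\cup R_\ell$, $T(\ell,0)$ empty of shape $sh(Y_{\ge\ell})$. For $i\ge1$ let $word(Y_{\ge\ell})=k_1\dots k_{m_\ell}$. *Insertion (if $k_i=\ell$):* insertion into a place $(\ell,j)$ not a crossing of $R(\ell,i-1)$ is allowed if the strand $c$ entering it from the left and the strand $d$ entering it from below satisfy $c\le r<d$. Take the rightmost allowed place of row $\ell$, with strands $c,d$; add a crossing there to $R(\ell,i-1)$ to get $R(\ell,i)$; put $(cd)$ into box $i$ of $T(\ell,i-1)$ to get $T(\ell,i)$. *Rectification (if $k_i>\ell$):* let $i_+$ be the number, in $sh(Y_{\ge\ell+1})$, of box $i$ of $sh(Y_{\ge\ell})$. Let $R'$ be $R(\ell,i-1)$ with the crossing of $S_{i_+}(\mathcal P(\ell+1))$ that is not in $S_{i_+-1}(\mathcal P(\ell+1))$ added; let $T'$ be $T(\ell,i-1)$ with the entry $(ab)$ of box $i_+$ of $T(\ell+1)$ put in box $i$. If $E(w(R_{\ge\ell}),T')$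 is row and column strict and $(w(R_{\ge\ell}),R',T')$ is an $r$-Bruhat package, set $R(\ell,i)=R'$, $T(\ell,i)=T'$. Otherwise: - if $b\boxplus a=\ell$ in $R'$, remove this crossing in row $\ell$ from $R'$ to get $R''$, and empty box $i$ of $T'$ to get $T''$; - otherwise box $i-1$ of $T'$ has an entry of the form $(af)$ and $b\boxplus f=\ell$ in $R'$; remove this crossing to get $R''$, and get $T''$ from $T'$ by emptying box $i$ and replacing the entry of box $i-1$ by $(ab)$. Let $(\ell,j_0)$ be the place of the removed crossing. In $R''$, insertion into a non-crossing place $(\ell,j)$ is allowed if, writing the strand entering from the left first and the strand entering from below second, the strands are either (first type) $c,d$ with $c\le r<d$, or (second type) $g,d$ with $r<d$, where $(eg)$ is the entry of box $i-1$ of $T''$. Take the rightmost allowed place with $j<j_0$ and add a crossing there to $R''$ to get $R(\ell,i)$. For the first type put $(cd)$ into box $i$ of $T''$ to get $T(\ell,i)$; for the second type replace the entry of box $i-1$ of $T''$ by $(ed)$ and put $(eg)$ into box $i$ to get $T(\ell,i)$. *End:* $R\leftarrow Y=R(1,m_1)$, $T(R,Y)=T(1,m_1)$. **Inverse insertion algorithm** (input $U$, $T$ as in the claim). It performs the same steps in the opposite order: $(1,m_1),(1,m_1-1),\dots,(1,0),(2,m_2),\dots,(2,0),\dots,(r,m_r),\dots,(r,0)$. *Start:* $m_1=|T|$, $R(1,m_1)=U$, $T(1,m_1)=T$. Step $(\ell,i)$ with $i\ge1$ constructs from $R(\ell,i),T(\ell,i)$ an rc-graph $R(\ell,i-1)$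 with no crossings above row $\ell$ and a tableau $T(\ell,i-1)$ filled up to $i-1$, as follows. Let $(cd)$ be the entry of box $i$ of $T(\ell,i)$, and let $(\ell_0,j_0)$ be the place where strands $c,d$ cross in $R(\ell,i)$. - *Case $\ell_0=\ell$.* Let $R''$ be $R(\ell,i)$ with this crossing removed and $T''$ be $T(\ell,i)$ with box $i$ emptied. If in $R''$ there is no non-crossing place $(\ell,j)$, $j>j_0$, such that the strand $b$ entering from the left and the strand $a$ entering from below satisfy $a\le r<b$, then the step is an *inverse insertion*: $R(\ell,i-1)=R''$, $T(\ell,i-1)=T''$. Otherwise it is an *inverse rectification* and continues as ( * ) below. - *Case $\ell_0\ne\ell$* (an *inverse rectification* ). If box $i-1$ of $T(\ell,i)$ has entry $(ef)$ with $c=e$ and $f\boxplus d=\ell$, let $R''$ be $R(\ell,i)$ with the crossing of $d$ and $f$ removed, let $T''$ be $T(\ell,i)$ with box $i$ emptied and $(ed)=(cd)$ placed in box $i-1$, and continue as ( * ). Otherwise $R(\ell,i-1)$ is $R(\ell,i)$ with the crossing of $c$ and $d$ removed and $T(\ell,i-1)$ is $T(\ell,i)$ with box $i$ emptied. - ( * ) In $R''$, insertion into a non-crossing place of row $\ell$ is allowed if, writing the strand entering from the left first and the strand entering from below second, the strands are (first type) $b,a$ with $a\le r<b$, or (second type) $g,d$ where $(eg)$ is the entry of box $i-1$ of $T''$ (here $d$ denotes the strand entering that place from below). Take the leftmost allowed place to the right of place $(\ell,j_0)$ and add a crossing there to get $R'$. If it is of the first type put $(ab)$ in box $i$ of $T''$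 to get $T'$; otherwise put $(ed)$ and $(eg)$ into boxes $i-1$ and $i$ of $T''$ to get $T'$. Now let $(ab)$ be the entry of box $i$ of $T'$; strands $a$ and $b$ cross below row $\ell$; remove this crossing from $R'$ to get $R(\ell,i-1)$, and empty box $i$ of $T'$ to get $T(\ell,i-1)$. Step $(\ell,0)$ ( *inverse row-to-row* ): let $(\ell,i_1),\dots,(\ell,i_{m_{\ell+1}})$, $i_1<i_2<\cdots$, be the inverse rectification steps of row $\ell$ (this defines $m_{\ell+1}$), and $i_0=0$. Set $R(\ell+1,m_{\ell+1})=R(\ell,m_\ell)_{\ge\ell+1}$; $T(\ell+1,m_{\ell+1})$ has shape the subdiagram of boxes $i_1,\dots,i_{m_{\ell+1}}$ of the shape of $T(\ell,m_\ell)$, and the entry $(a_kb_k)$ of its box $k$ is determined by $w(R(\ell,i_{k-1})_{\ge\ell+1})=w(R(\ell,i_k)_{\ge\ell+1})t_{a_kb_k}$. *End:* $U\rightarrow T=R(r,0)$. $Y(U,T)$ is defined by its word: $word(Y(U,T))=word_1$, where $word_{r+1}$ is empty and $word_\ell$, of length $m_\ell$, has as its $i_k$-th letter the $k$-th letter of $word_{\ell+1}$, for $(\ell,i_1),(\ell,i_2),\dots$ the inverse rectification steps of row $\ell$, and all other letters equal to $\ell$.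
   Formalization: The output U→T takes row ℓ<r from R(ℓ,0) and rows ≥r from R(r,0), instead of R(r,0) alone; in the inverse step with ℓ0≠ℓ the condition is d⊞f=ℓ instead of f⊞d=ℓ, and there j0 in ( * ) is the column of the removed crossing of d and f. *)

theory Defs
  imports "HOL-Combinatorics.Permutations" "HOL-Library.Monad_Syntax"
begin

section \<open>Permutations and partitions\<close>

text \<open>\<open>\<nat> = {1, 2, \<dots>}\<close>; every element of \<open>S_inf\<close> is extended by the value \<open>0\<close> at \<open>0\<close>.\<close>

type_synonym perm = "nat \<Rightarrow> nat"

definition S_inf :: "perm set" where
  "S_inf = {w. w permutes {1..} \<and> finite {i. w i \<noteq> i}}"

definition word_perm :: "nat list \<Rightarrow> perm" where
  "word_perm is = foldr (\<lambda>i p. transpose i (Suc i) \<circ> p) is id"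

definition coxeter_length :: "perm \<Rightarrow> nat" where
  "coxeter_length w = (LEAST n. \<exists>is. length is = n \<and> 0 \<notin> set is \<and> word_perm is = w)"

definition shuffle :: "nat \<Rightarrow> perm \<Rightarrow> bool" where
  "shuffle r w \<longleftrightarrow> (\<forall>i\<ge>1. i \<noteq> r \<longrightarrow> w i < w (i + 1))"

definition semi_shuffle :: "nat \<Rightarrow> perm \<Rightarrow> bool" where
  "semi_shuffle r w \<longleftrightarrow> (\<forall>i>r. w i < w (i + 1))"

text \<open>A partition is the list of its nonzero parts.\<close>

definition is_partition :: "nat list \<Rightarrow> bool" where
  "is_partition lam \<longleftrightarrow> sorted_wrt (\<ge>) lam \<and> 0 \<notin> set lam"

definition part :: "nat list \<Rightarrow> nat \<Rightarrow> nat" where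
  "part lam j = (if 1 \<le> j \<and> j \<le> length lam then lam ! (j - 1) else 0)"

definition hook :: "nat list \<Rightarrow> bool" where
  "hook lam \<longleftrightarrow> (\<forall>j\<ge>2. part lam j \<le> 1)"

text \<open>The equation is \<open>\<lambda>\<^sub>j = v (r + 1 - j) - r - 1 + j\<close> with the negative terms moved to the other
  side, so that there is no truncated subtraction.\<close>

definition shuffle_perm :: "nat list \<Rightarrow> nat \<Rightarrow> perm" where
  "shuffle_perm lam r = (THE v. v \<in> S_inf \<and> shuffle r v \<and>
     (\<forall>j\<in>{1..r}. part lam j + r + 1 = v (r + 1 - j) + j))"


section \<open>Graphs and strands\<close>

type_synonym graph = "(nat \<times> nat) set"

definition is_graph :: "graph \<Rightarrow> bool" where
  "is_graph R \<longleftrightarrow> finite R \<and> R \<subseteq> {1..} \<times> {1..}"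

definition graph_word :: "graph \<Rightarrow> nat list" where
  "graph_word R = concat (map (\<lambda>i. map (\<lambda>j. i + j - 1) (rev (sorted_list_of_set {j. (i, j) \<in> R})))
     (sorted_list_of_set (fst ` R)))"

definition graph_perm :: "graph \<Rightarrow> perm" where
  "graph_perm R = word_perm (graph_word R)"

definition rc_graph :: "graph \<Rightarrow> bool" where
  "rc_graph R \<longleftrightarrow> is_graph R \<and> card R = coxeter_length (graph_perm R)"

definition RC :: "perm \<Rightarrow> graph set" where
  "RC w = {R. rc_graph R \<and> graph_perm R = w}"

definition rows_ge :: "graph \<Rightarrow> nat \<Rightarrow> graph" where
  "rows_ge R l = {(i, j) \<in> R. l \<le> i}"

definition row :: "graph \<Rightarrow> nat \<Rightarrow> graph" where
  "row R l = {(i, j) \<in> R. i = l}"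

text \<open>\<open>from_left R s i j\<close> and \<open>from_below R s i j\<close>: strand \<open>s\<close> enters the place \<open>(i, j)\<close> from the left
  and from below, respectively. Rows are numbered from the top, so that a strand leaving
  \<open>(i + 1, j)\<close> at the top enters \<open>(i, j)\<close> from below.\<close>

inductive from_left :: "graph \<Rightarrow> nat \<Rightarrow> nat \<Rightarrow> nat \<Rightarrow> bool"
  and from_below :: "graph \<Rightarrow> nat \<Rightarrow> nat \<Rightarrow> nat \<Rightarrow> bool"
  for R :: graph where
  start: "1 \<le> s \<Longrightarrow> from_left R s s 1"
| left_right: "from_left R s i j \<Longrightarrow> (i, j) \<in> R \<Longrightarrow> from_left R s i (j + 1)"
| below_right: "from_below R s i j \<Longrightarrow> (i, j) \<notin> R \<Longrightarrow> from_left R s i (j + 1)"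
| below_top: "from_below R s (i + 1) j \<Longrightarrow> (i + 1, j) \<in> R \<Longrightarrow> 1 \<le> i \<Longrightarrow> from_below R s i j"
| left_top: "from_left R s (i + 1) j \<Longrightarrow> (i + 1, j) \<notin> R \<Longrightarrow> 1 \<le> i \<Longrightarrow> from_below R s i j"

text \<open>The crossings at which \<open>a\<close> is the horizontal and \<open>b\<close> the vertical strand; thus
  \<open>a \<boxplus> b = \<ell>\<close> holds in \<open>R\<close> iff \<open>(\<ell>, j) \<in> h_crossings R a b\<close> for some \<open>j\<close>.\<close>

definition h_crossings :: "graph \<Rightarrow> nat \<Rightarrow> nat \<Rightarrow> (nat \<times> nat) set" where
  "h_crossings R a b = {(i, j) \<in> R. from_left R a i j \<and> from_below R b i j}"

definition crossings :: "graph \<Rightarrow> nat \<Rightarrow> nat \<Rightarrow> (nat \<times> nat) set" where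
  "crossings R a b = h_crossings R a b \<union> h_crossings R b a"

definition free_place :: "graph \<Rightarrow> nat \<Rightarrow> nat \<Rightarrow> nat \<Rightarrow> nat \<Rightarrow> bool" where
  "free_place R l j x y \<longleftrightarrow> (l, j) \<notin> R \<and> from_left R x l j \<and> from_below R y l j"


section \<open>Tableaux\<close>

text \<open>A tableau filled up to \<open>i\<close> consists of its shape and the list of the entries of the boxes
  \<open>1, \<dots>, i\<close>. Thus the entry of box \<open>k\<close> is the list element with index \<open>k - 1\<close>, and the last
  element of the list is the entry of the last filled box.\<close>

type_synonym 'e tableau = "nat list \<times> 'e list"

type_synonym transpositions = "(nat \<times> nat) list"

definition boxes :: "nat list \<Rightarrow> (nat \<times> nat) list" where
  "boxes lam = concat (map (\<lambda>p. map (\<lambda>q. (p, q)) [1..<part lam p + 1]) (rev [1..<length lam + 1]))"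

definition box :: "nat list \<Rightarrow> nat \<Rightarrow> nat \<times> nat" where
  "box lam i = boxes lam ! (i - 1)"

definition row_strict :: "nat tableau \<Rightarrow> bool" where
  "row_strict T \<longleftrightarrow> (case T of (lam, xs) \<Rightarrow>
     \<forall>i\<in>{1..length xs}. \<forall>k\<in>{1..length xs}. \<forall>p q p' q'. box lam i = (p, q) \<longrightarrow> box lam k = (p', q') \<longrightarrow>
       (p = p' \<and> q < q' \<longrightarrow> xs ! (i - 1) < xs ! (k - 1)) \<and>
       (q = q' \<and> p < p' \<longrightarrow> xs ! (i - 1) \<le> xs ! (k - 1)))"

definition column_strict :: "nat tableau \<Rightarrow> bool" where
  "column_strict T \<longleftrightarrow> (case T of (lam, xs) \<Rightarrow>
     \<forall>i\<in>{1..length xs}. \<forall>k\<in>{1..length xs}. \<forall>p q p' q'. box lam i = (p, q) \<longrightarrow> box lam k = (p', q') \<longrightarrow>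
       (p = p' \<and> q < q' \<longrightarrow> xs ! (i - 1) \<le> xs ! (k - 1)) \<and>
       (q = q' \<and> p < p' \<longrightarrow> xs ! (i - 1) < xs ! (k - 1)))"

definition partial_tableau :: "nat \<Rightarrow> (nat \<times> nat) tableau \<Rightarrow> bool" where
  "partial_tableau r T \<longleftrightarrow> (case T of (lam, es) \<Rightarrow>
     length es \<le> length (boxes lam) \<and> (\<forall>(a, b)\<in>set es. 1 \<le> a \<and> a \<le> r \<and> r < b))"

definition full_tableau :: "nat \<Rightarrow> nat list \<Rightarrow> (nat \<times> nat) tableau \<Rightarrow> bool" where
  "full_tableau r lam T \<longleftrightarrow> partial_tableau r T \<and> fst T = lam \<and> length (snd T) = length (boxes lam)"

definition trans_perm :: "transpositions \<Rightarrow> perm" where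
  "trans_perm es = foldr (\<lambda>(a, b) p. transpose a b \<circ> p) es id"

definition bruhat_chain :: "nat \<Rightarrow> perm \<Rightarrow> (nat \<times> nat) tableau \<Rightarrow> bool" where
  "bruhat_chain r w T \<longleftrightarrow> partial_tableau r T \<and>
     (\<forall>i\<in>{1..length (snd T)}. coxeter_length (w \<circ> trans_perm (take i (snd T))) = coxeter_length w + i)"

definition bruhat_package :: "nat \<Rightarrow> perm \<Rightarrow> graph \<Rightarrow> (nat \<times> nat) tableau \<Rightarrow> bool" where
  "bruhat_package r w R T \<longleftrightarrow>
     rc_graph R \<and> w \<circ> trans_perm (snd T) = graph_perm R \<and> bruhat_chain r w T"

definition E :: "perm \<Rightarrow> (nat \<times> nat) tableau \<Rightarrow> nat tableau" where
  "E w T = (case T of (lam, es) \<Rightarrow>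
     (lam, map (\<lambda>i. (w \<circ> trans_perm (take i es)) (snd (es ! (i - 1)))) [1..<length es + 1]))"


section \<open>Choices made by the algorithms\<close>

text \<open>A run of an algorithm fails, with result \<open>None\<close>, as soon as an object which it refers to
  does not exist or is not unique.\<close>

definition only :: "'a set \<Rightarrow> 'a option" where
  "only A = (if is_singleton A then Some (the_elem A) else None)"

definition rightmost :: "(nat \<times> 'a) set \<Rightarrow> (nat \<times> 'a) option" where
  "rightmost A = only {x \<in> A. \<forall>y\<in>A. fst y \<le> fst x}"

definition leftmost :: "(nat \<times> 'a) set \<Rightarrow> (nat \<times> 'a) option" where
  "leftmost A = only {x \<in> A. \<forall>y\<in>A. fst x \<le> fst y}"

text \<open>\<open>unwind R es j\<close> is the graph \<open>S\<^sub>j\<close> of the package with graph \<open>R\<close> and entries \<open>es\<close>.\<close>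

definition unwind :: "graph \<Rightarrow> transpositions \<Rightarrow> nat \<Rightarrow> graph option" where
  "unwind R es j = fold (\<lambda>(a, b) Xo. do {
       X \<leftarrow> Xo;
       p \<leftarrow> only (crossings X a b);
       Some (X - {p}) }) (rev (drop j es)) (Some R)"


section \<open>Words of rc-graphs of shuffles\<close>

definition strand_word :: "graph \<Rightarrow> nat \<Rightarrow> nat list" where
  "strand_word Y s = rev (sorted_list_of_multiset
     (image_mset fst (mset_set {(i, j) \<in> Y. from_left Y s i j \<or> from_below Y s i j})))"

definition Y_word :: "nat \<Rightarrow> graph \<Rightarrow> nat list" where
  "Y_word r Y = concat (map (strand_word Y) [1..<r + 1])"

definition sh :: "nat \<Rightarrow> graph \<Rightarrow> nat list" where
  "sh r Y = (THE lam. is_partition lam \<and> length lam \<le> r \<and> graph_perm Y = shuffle_perm lam r)"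


section \<open>The insertion algorithm\<close>

text \<open>The state \<open>(X, es)\<close> after step \<open>(\<ell>, i)\<close> consists of \<open>X = R(\<ell>, i)\<close> and the list \<open>es\<close> of the
  \<open>i\<close> entries of \<open>T(\<ell>, i)\<close>.\<close>

type_synonym state = "graph \<times> transpositions"

definition insert_step :: "nat \<Rightarrow> nat \<Rightarrow> state \<Rightarrow> state option" where
  "insert_step r l st = (case st of (X, es) \<Rightarrow> do {
     (j, c, d) \<leftarrow> rightmost {(j, c, d). free_place X l j c d \<and> c \<le> r \<and> r < d};
     Some (insert (l, j) X, es @ [(c, d)]) })"

text \<open>\<open>rectify_removal\<close> returns the column \<open>j\<^sub>0\<close>, \<open>R''\<close> and the entries of \<open>T''\<close>. Its arguments are
  \<open>R'\<close>, the entries of the boxes \<open>1, \<dots>, i - 1\<close> of \<open>T'\<close>, and the entry \<open>(a b)\<close> of box \<open>i\<close> of \<open>T'\<close>.\<close>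

definition rectify_removal ::
  "nat \<Rightarrow> graph \<Rightarrow> transpositions \<Rightarrow> nat \<times> nat \<Rightarrow> (nat \<times> graph \<times> transpositions) option" where
  "rectify_removal l R' es ab = (case ab of (a, b) \<Rightarrow>
     if \<exists>j. (l, j) \<in> h_crossings R' b a then do {
       j0 \<leftarrow> only {j. (l, j) \<in> h_crossings R' b a};
       Some (j0, R' - {(l, j0)}, es) }
     else if es \<noteq> [] \<and> fst (last es) = a then do {
       j0 \<leftarrow> only {j. (l, j) \<in> h_crossings R' b (snd (last es))};
       Some (j0, R' - {(l, j0)}, butlast es @ [(a, b)]) }
     else None)"

text \<open>\<open>w = w(R\<^bsub>\<ge>\<ell>\<^esub>)\<close>, \<open>lam = sh(Y\<^bsub>\<ge>\<ell>\<^esub>)\<close>, and \<open>(Xp, lamp, esp)\<close> are the graph and the tableau of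
  \<open>\<P>(\<ell> + 1)\<close>. The number \<open>i\<^sub>+\<close> is \<open>ip\<close>.\<close>

definition rectify_step ::
  "nat \<Rightarrow> nat \<Rightarrow> perm \<Rightarrow> nat list \<Rightarrow> graph \<times> (nat \<times> nat) tableau \<Rightarrow> nat \<Rightarrow> state \<Rightarrow> state option" where
  "rectify_step r l w lam P i st = (case (P, st) of ((Xp, lamp, esp), (X, es)) \<Rightarrow> do {
     ip \<leftarrow> only {k \<in> {1..length (boxes lamp)}. box lamp k = box lam i};
     S \<leftarrow> unwind Xp esp ip;
     S' \<leftarrow> unwind Xp esp (ip - 1);
     let (a, b) = esp ! (ip - 1);
     let R' = X \<union> (S - S');
     let T' = (lam, es @ [(a, b)]);
     if row_strict (E w T') \<and> column_strict (E w T') \<and> bruhat_package r w R' T'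
     then Some (R', snd T')
     else do {
       (j0, R'', es'') \<leftarrow> rectify_removal l R' es (a, b);
       (j, x, d) \<leftarrow> rightmost {(j, x, d). free_place R'' l j x d \<and> j < j0 \<and> r < d \<and>
                      (x \<le> r \<or> es'' \<noteq> [] \<and> x = snd (last es''))};
       if x \<le> r then Some (insert (l, j) R'', es'' @ [(x, d)])
       else do {
         let (e, g) = last es'';
         Some (insert (l, j) R'', butlast es'' @ [(e, d), (e, g)]) } } })"

definition insertion_row ::
  "nat \<Rightarrow> graph \<Rightarrow> graph \<Rightarrow> nat \<Rightarrow> graph \<times> (nat \<times> nat) tableau \<Rightarrow> (graph \<times> (nat \<times> nat) tableau) option" where
  "insertion_row r R Y l P = (case P of (Xp, lamp, esp) \<Rightarrow> do {
     S0 \<leftarrow> unwind Xp esp 0;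
     let w = graph_perm (rows_ge R l);
     let lam = sh r (rows_ge Y l);
     let ks = Y_word r (rows_ge Y l);
     (X, es) \<leftarrow> fold (\<lambda>i sto. do {
         st \<leftarrow> sto;
         if ks ! (i - 1) = l then insert_step r l st else rectify_step r l w lam P i st })
       [1..<length ks + 1] (Some (S0 \<union> row R l, []));
     Some (X, lam, es) })"

text \<open>The result is the pair of \<open>R \<leftarrow> Y\<close> and \<open>T(R, Y)\<close>. The start \<open>R(r, 0) = R\<^bsub>\<ge>r\<^esub>\<close> is the
  row-to-row step \<open>(r, 0)\<close> for the package \<open>\<P>(r + 1)\<close> with graph \<open>R\<^bsub>\<ge>r+1\<^esub>\<close> and empty tableau.\<close>

definition insertion :: "nat \<Rightarrow> graph \<Rightarrow> graph \<Rightarrow> (graph \<times> (nat \<times> nat) tableau) option" where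
  "insertion r R Y = fold (\<lambda>l Po. do { P \<leftarrow> Po; insertion_row r R Y l P })
     (rev [1..<r + 1]) (Some (rows_ge R (r + 1), [], []))"


section \<open>The inverse insertion algorithm\<close>

text \<open>Part (*) of the step, from \<open>j\<^sub>0\<close>, \<open>R''\<close> and the entries of \<open>T''\<close>. If a place is of both types,
  the first type takes precedence.\<close>

definition inverse_rectify ::
  "nat \<Rightarrow> nat \<Rightarrow> nat \<Rightarrow> graph \<Rightarrow> transpositions \<Rightarrow> state option" where
  "inverse_rectify r l j0 R'' es'' = do {
     (j, x, y) \<leftarrow> leftmost {(j, x, y). free_place R'' l j x y \<and> j0 < j \<and>
                    (y \<le> r \<and> r < x \<or> es'' \<noteq> [] \<and> x = snd (last es''))};
     let R' = insert (l, j) R'';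
     let es' = (if y \<le> r \<and> r < x then es'' @ [(y, x)]
                else case last es'' of (e, g) \<Rightarrow> butlast es'' @ [(e, y), (e, g)]);
     let (a, b) = last es';
     p \<leftarrow> only {(i, k) \<in> crossings R' a b. l < i};
     Some (R' - {p}, butlast es') }"

text \<open>Step \<open>(\<ell>, i)\<close> applied to \<open>R(\<ell>, i)\<close> and the \<open>i \<ge> 1\<close> entries of \<open>T(\<ell>, i)\<close>. The Boolean tells
  whether the step is an inverse rectification. In the second case the strand \<open>d\<close> of the later
  entry \<open>(e d)\<close> is the horizontal one in its crossing with \<open>f\<close>, i.e. the condition is
  \<open>d \<boxplus> f = \<ell>\<close>: this is the configuration which an insertion of the second type creates.
  There \<open>j\<^sub>0\<close> is the column of the removed crossing of \<open>d\<close> and \<open>f\<close>.\<close>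

definition inverse_step :: "nat \<Rightarrow> nat \<Rightarrow> state \<Rightarrow> (state \<times> bool) option" where
  "inverse_step r l st = (case st of (X, es) \<Rightarrow> do {
     let (c, d) = last es;
     let es0 = butlast es;
     (l0, j0) \<leftarrow> only (crossings X c d);
     if l0 = l then do {
       let R'' = X - {(l0, j0)};
       if \<exists>j b a. free_place R'' l j b a \<and> j0 < j \<and> a \<le> r \<and> r < b
       then do { st' \<leftarrow> inverse_rectify r l j0 R'' es0; Some (st', True) }
       else Some ((R'', es0), False) }
     else if es0 \<noteq> [] \<and> fst (last es0) = c \<and> (\<exists>j. (l, j) \<in> h_crossings X d (snd (last es0)))
     then do {
       j1 \<leftarrow> only {j. (l, j) \<in> h_crossings X d (snd (last es0))};
       st' \<leftarrow> inverse_rectify r l j1 (X - {(l, j1)}) (butlast es0 @ [(c, d)]);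
       Some (st', True) }
     else Some ((X - {(l0, j0)}, es0), True) })"

text \<open>The state after \<open>n\<close> inverse steps in row \<open>\<ell>\<close>, and whether the last of them was an inverse
  rectification.\<close>

primrec inverse_steps :: "nat \<Rightarrow> nat \<Rightarrow> state \<Rightarrow> nat \<Rightarrow> (state \<times> bool) option" where
  "inverse_steps r l st 0 = Some (st, False)"
| "inverse_steps r l st (Suc n) = do { (st', _) \<leftarrow> inverse_steps r l st n; inverse_step r l st' }"

text \<open>For \<open>X = R(\<ell>, m\<^sub>\<ell>)\<close> and \<open>T = T(\<ell>, m\<^sub>\<ell>)\<close> the result consists of \<open>R(\<ell>, 0)\<close>, the list of the
  indices \<open>i\<^sub>1 < i\<^sub>2 < \<dots>\<close> of the inverse rectification steps, and \<open>R(\<ell>+1, m\<^bsub>\<ell>+1\<^esub>)\<close>,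
  \<open>T(\<ell>+1, m\<^bsub>\<ell>+1\<^esub>)\<close>. The list element \<open>sts ! i\<close> describes \<open>R(\<ell>, i)\<close>, \<open>T(\<ell>, i)\<close> and the kind of the
  step \<open>(\<ell>, i + 1)\<close>.\<close>

definition inverse_row ::
  "nat \<Rightarrow> nat \<Rightarrow> graph \<Rightarrow> (nat \<times> nat) tableau \<Rightarrow>
     (graph \<times> nat list \<times> graph \<times> (nat \<times> nat) tableau) option" where
  "inverse_row r l X T = (case T of (lam, es) \<Rightarrow> do {
     let m = length es;
     sts \<leftarrow> those (map (\<lambda>i. inverse_steps r l (X, es) (m - i)) [0..<m + 1]);
     let Rs = map (fst \<circ> fst) sts;
     let rect = filter (\<lambda>i. snd (sts ! (i - 1))) [1..<m + 1];
     mu \<leftarrow> only {mu. is_partition mu \<and> set (boxes mu) = box lam ` set rect};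
     ts \<leftarrow> those (map (\<lambda>k. only {(a, b). 1 \<le> a \<and> a \<le> r \<and> r < b \<and>
              graph_perm (rows_ge (Rs ! ((0 # rect) ! (k - 1))) (l + 1)) =
              graph_perm (rows_ge (Rs ! ((0 # rect) ! k)) (l + 1)) \<circ> transpose a b})
            [1..<length rect + 1]);
     Some (Rs ! 0, rect, rows_ge X (l + 1), mu, ts) })"

definition word_from_below :: "nat \<Rightarrow> nat \<Rightarrow> nat list \<Rightarrow> nat list \<Rightarrow> nat list" where
  "word_from_below l m rect ks =
     map (\<lambda>i. if i \<in> set rect then ks ! card {i' \<in> set rect. i' < i} else l) [1..<m + 1]"

text \<open>\<open>inverse_rows r n\<close> treats the rows \<open>r - n, \<dots>, r\<close>; it returns the graph \<open>U \<rightarrow> T\<close> and the word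
  \<open>word\<^bsub>r-n\<^esub>\<close>. Since \<open>R(\<ell>, 0)\<close> has the form \<open>S\<^sub>0(\<P>(\<ell> + 1)) \<union> R\<^sub>\<ell>\<close> and only its rows below \<open>\<ell>\<close> are
  processed further, row \<open>\<ell> < r\<close> of \<open>U \<rightarrow> T\<close> is row \<open>\<ell>\<close> of \<open>R(\<ell>, 0)\<close>, and \<open>R(r, 0)\<close> contributes the
  rows \<open>\<ge> r\<close>. In row \<open>r\<close> there must be no inverse rectification, since \<open>word\<^bsub>r+1\<^esub>\<close> is empty.\<close>

primrec inverse_rows ::
  "nat \<Rightarrow> nat \<Rightarrow> graph \<Rightarrow> (nat \<times> nat) tableau \<Rightarrow> (graph \<times> nat list) option" where
  "inverse_rows r 0 X T = do {
     (X0, rect, _, _) \<leftarrow> inverse_row r r X T;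
     if rect = [] then Some (X0, word_from_below r (length (snd T)) rect []) else None }"
| "inverse_rows r (Suc n) X T = do {
     let l = r - Suc n;
     (X0, rect, X', T') \<leftarrow> inverse_row r l X T;
     (R, ks) \<leftarrow> inverse_rows r n X' T';
     Some (row X0 l \<union> R, word_from_below l (length (snd T)) rect ks) }"

text \<open>The pair of \<open>U \<rightarrow> T\<close> and \<open>Y(U, T)\<close>. Words are only defined for rc-graphs of \<open>r\<close>-shuffles
  \<open>v(\<mu>, r)\<close>, so \<open>Y(U, T)\<close> is the graph of this kind with the computed word.\<close>

definition inverse_insertion ::
  "nat \<Rightarrow> graph \<Rightarrow> (nat \<times> nat) tableau \<Rightarrow> (graph \<times> graph) option" where
  "inverse_insertion r U T = do {
     (R, ks) \<leftarrow> inverse_rows r (r - 1) U T;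
     Y \<leftarrow> only {Y. (\<exists>mu. is_partition mu \<and> length mu \<le> r \<and> Y \<in> RC (shuffle_perm mu r)) \<and>
                 Y_word r Y = ks};
     Some (R, Y) }"

end

theory Submission
  imports Defs "HOL-Library.Multiset"
begin

text \<open>The inverse algorithm never fails, and each of its steps is undone by the corresponding step of
  the insertion algorithm. Let \<open>p\<close> and \<open>q\<close> be the permutations of the rows \<open>\<ge> l\<close> and \<open>> l\<close> of the current
  graph. Strand \<open>s\<close> enters \<open>(l, j)\<close> from the left iff \<open>q s < l + j \<le> p s + 1\<close>, so the places where the
  scans of row \<open>l\<close> stop can be compared through \<open>p\<close> and \<open>q\<close>. A step never changes the labels
  \<open>E(w, T)\<close> of the remaining boxes, and a rectification at \<open>(a b)\<close> gives the box the label \<open>q b\<close> in the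
  next tableau. If a box is rectified, then so is its left neighbour, with a smaller new label, and the
  box above any box is rectified. Hence the rectified boxes form a partition that differs from \<open>\<lambda>\<close> by a
  horizontal strip, and the tableau passed on to row \<open>l + 1\<close> is again row and column strict. In columns
  the hypotheses on \<open>w\<close> and \<open>\<lambda>\<close> are used: for a hook the boxes of the first column are filled
  consecutively, and for a semi-shuffle no two strands \<open>> r\<close> cross, so that entries are never
  exchanged and the strands \<open>> r\<close> decrease weakly up each column.

  The chain of partitions obtained from the rows determines an rc-graph of the shuffle, in which strand
  \<open>s \<le> r\<close> runs horizontally through consecutive crossings of each row. Its word determines it, because
  the letters of one strand decrease weakly while a strict ascent separates successive strands.\<close>

section \<open>Lengths of permutations\<close>

text \<open>The label that \<open>E\<close> gives to a box with entry \<open>(a b)\<close> is the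
  value of \<open>a\<close> just before the transposition, so it does not involve \<open>b\<close>.
  An exchange alters only the larger strands of two consecutive boxes with the same smaller strand;
  this is why it leaves the remaining labels alone and why scans can be compared through labels.
  Neighbours in a row are treated in consecutive steps, so a comparison of two steps settles the
  rows in general. A box and the one above it are usually separated by pieces of two rows, and
  strands \<open>> r\<close> may be moved in the meantime: this is where a hook or a semi-shuffle is
  called for. The assumption returns when a step is undone. After an exchange the insertion
  algorithm has to recognize that merely adding the old entry again is not admissible, and this is
  extracted from the strictness of \<open>E\<close>: in a hook, a descent between consecutive boxes
  is a step up in the first column.\<close>

definition generated :: "perm \<Rightarrow> bool" where
  "generated p \<longleftrightarrow> (\<exists>is. 0 \<notin> set is \<and> word_perm is = p)"

lemma word_perm_Nil [simp]: "word_perm [] = id"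
  by (simp add: word_perm_def)

lemma word_perm_Cons [simp]: "word_perm (i # is) = transpose i (Suc i) \<circ> word_perm is"
  by (simp add: word_perm_def)

lemma word_perm_append: "word_perm (xs @ ys) = word_perm xs \<circ> word_perm ys"
  by (induction xs) (simp_all add: comp_assoc)

lemma bij_word_perm: "bij (word_perm is)"
proof (induction "is")
  case (Cons i "is")
  show ?case unfolding word_perm_Cons by (rule bij_comp [OF Cons]) simp
qed (simp only: word_perm_Nil bij_id)

lemma word_perm_fixes: "\<forall>i\<in>set is. k \<noteq> i \<and> k \<noteq> Suc i \<Longrightarrow> word_perm is k = k"
  by (induction "is") (auto simp: transpose_def)

lemma word_perm_zero: "0 \<notin> set is \<Longrightarrow> word_perm is 0 = 0"
  by (rule word_perm_fixes) fastforce

lemma generated_word: "0 \<notin> set is \<Longrightarrow> generated (word_perm is)"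
  by (auto simp: generated_def)

lemma generated_id: "generated id"
  using generated_word [of "[]"] by simp

lemma generated_comp: "generated p \<Longrightarrow> generated q \<Longrightarrow> generated (p \<circ> q)"
proof -
  assume "generated p" "generated q"
  then obtain xs ys where "0 \<notin> set xs" "word_perm xs = p" "0 \<notin> set ys" "word_perm ys = q"
    by (auto simp: generated_def)
  then show ?thesis using generated_word [of "xs @ ys"] word_perm_append [of xs ys] by simp
qed

lemma generated_bij: "generated p \<Longrightarrow> bij p"
  using bij_word_perm by (auto simp: generated_def)

lemma generated_inj: "generated p \<Longrightarrow> p a = p b \<longleftrightarrow> a = b"
  using generated_bij by (metis bij_def injD)

lemma generated_zero: "generated p \<Longrightarrow> p 0 = 0"
  using word_perm_zero by (auto simp: generated_def)

lemma generated_inv: "generated p \<Longrightarrow> p (inv p k) = k" "generated p \<Longrightarrow> inv p (p a) = a"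
  using generated_bij by (metis bij_is_surj surj_f_inv_f, metis bij_is_inj inv_f_f)

lemma generated_inv_eq: "generated p \<Longrightarrow> inv p k = a \<longleftrightarrow> p a = k"
  using generated_inv by metis

lemma generated_transpose_adjacent: "1 \<le> i \<Longrightarrow> generated (transpose i (Suc i))"
  using generated_word [of "[i]"] by simp

lemma generated_transpose:
  assumes "1 \<le> a" "a < b" shows "generated (transpose a b)"
proof -
  have "generated (transpose a (Suc (a + n)))" for n
  proof (induction n)
    case 0
    then show ?case using assms generated_transpose_adjacent by simp
  next
    case (Suc n)
    have "transpose a (Suc (Suc (a + n))) =
        transpose (Suc (a + n)) (Suc (Suc (a + n))) \<circ> transpose a (Suc (a + n)) \<circ>
        transpose (Suc (a + n)) (Suc (Suc (a + n)))"
      by (auto simp: fun_eq_iff transpose_def)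
    then show ?case
      using generated_comp [OF generated_comp [OF _ Suc], of "transpose (Suc (a + n)) (Suc (Suc (a + n)))"]
        generated_transpose_adjacent [of "Suc (a + n)"] by (metis add_Suc_right le_add1 plus_1_eq_Suc)
  qed
  from this [of "b - a - 1"] show ?thesis using assms by simp
qed

lemma generated_comp_transpose:
  assumes "generated p" "1 \<le> a" "1 \<le> b" shows "generated (p \<circ> transpose a b)"
proof (cases a b rule: linorder_cases)
  case less
  then show ?thesis using assms generated_transpose generated_comp by blast
next
  case equal
  then have "p \<circ> transpose a b = p" by (simp add: fun_eq_iff)
  then show ?thesis using assms by metis
next
  case greater
  then show ?thesis
    using assms generated_transpose [of b a] generated_comp transpose_commute [of a b] by metis
qed

lemma coxeter_length_le: "0 \<notin> set is \<Longrightarrow> coxeter_length (word_perm is) \<le> length is"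
  unfolding coxeter_length_def by (rule Least_le) blast

lemma reduced_word:
  assumes "generated p"
  obtains "is" where "0 \<notin> set is" "word_perm is = p" "length is = coxeter_length p"
proof -
  have "\<exists>is. length is = coxeter_length p \<and> 0 \<notin> set is \<and> word_perm is = p"
    unfolding coxeter_length_def by (rule LeastI_ex) (use assms in \<open>auto simp: generated_def\<close>)
  then show ?thesis using that by blast
qed

lemma coxeter_length_id: "coxeter_length id = 0"
  using coxeter_length_le [of "[]"] by simp

text \<open>The exchange condition, by induction on the word. If the rest of the word already
  inverts \<open>a\<close> and \<open>b\<close>, a letter is deleted there. Otherwise the first
  letter \<open>i\<close> creates the inversion, so the rest sends \<open>a\<close> and
  \<open>b\<close> to \<open>i\<close> and \<open>i + 1\<close>, and deleting \<open>i\<close> has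
  the same effect as the transposition. All comparisons of lengths rest on this.\<close>

lemma word_deletion:
  assumes "a < b" "word_perm is b < word_perm is a" "0 \<notin> set is"
  shows "\<exists>js. Suc (length js) = length is \<and> 0 \<notin> set js \<and> word_perm js = word_perm is \<circ> transpose a b"
  using assms
proof (induction "is")
  case Nil
  then show ?case by simp
next
  case (Cons i "is")
  let ?u = "word_perm is"
  show ?case
  proof (cases "?u b < ?u a")
    case True
    then obtain js where "Suc (length js) = length is" "0 \<notin> set js" "word_perm js = ?u \<circ> transpose a b"
      using Cons.IH [OF Cons.prems(1) True] Cons.prems(3) list.set_intros(2) by metis
    then show ?thesis
      using Cons.prems by (intro exI [of _ "i # js"]) (simp add: comp_assoc del: comp_apply)
  next
    case False
    have "?u a \<noteq> ?u b" using Cons.prems(1) bij_word_perm by (metis bij_def injD less_irrefl)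
    with False have "?u a < ?u b" by simp
    with Cons.prems(2) have ab: "?u a = i" "?u b = Suc i"
      by (auto simp: transpose_def split: if_splits)
    have "word_perm (i # is) \<circ> transpose a b = ?u"
    proof
      fix k
      have "?u k = i \<longleftrightarrow> k = a" "?u k = Suc i \<longleftrightarrow> k = b"
        using ab bij_word_perm by (metis bij_def injD)+
      then show "(word_perm (i # is) \<circ> transpose a b) k = ?u k"
        using ab by (auto simp: transpose_def)
    qed
    then show ?thesis using Cons.prems(3) by (intro exI [of _ "is"]) (metis length_Cons list.set_intros(2))
  qed
qed

lemma coxeter_length_transpose_less:
  assumes "generated p" "1 \<le> a" "a < b" "p b < p a"
  shows "coxeter_length (p \<circ> transpose a b) < coxeter_length p"
proof -
  obtain "is" where "0 \<notin> set is" "word_perm is = p" "length is = coxeter_length p"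
    using reduced_word assms(1) .
  with word_deletion [of a b "is"] assms
  obtain js where "Suc (length js) = coxeter_length p" "0 \<notin> set js" "word_perm js = p \<circ> transpose a b"
    by auto
  then show ?thesis using coxeter_length_le [of js] by simp
qed

lemma transpose_comp_self [simp]: "p \<circ> transpose a b \<circ> transpose a b = p"
  by (auto simp: fun_eq_iff)

lemma coxeter_length_transpose_greater:
  assumes "generated p" "1 \<le> a" "a < b" "p a < p b"
  shows "coxeter_length p < coxeter_length (p \<circ> transpose a b)"
  using coxeter_length_transpose_less [of "p \<circ> transpose a b" a b] assms
    generated_comp_transpose [of p a b] by simp

lemma coxeter_length_transpose_less_iff:
  assumes "generated p" "1 \<le> a" "a < b"
  shows "coxeter_length p < coxeter_length (p \<circ> transpose a b) \<longleftrightarrow> p a < p b"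
  using coxeter_length_transpose_greater [OF assms] coxeter_length_transpose_less [OF assms]
    generated_inj [OF assms(1), of a b] assms(3) by (cases "p a" "p b" rule: linorder_cases) auto

text \<open>With \<open>p k\<close> strictly between, the transposition of \<open>a\<close> and
  \<open>b\<close> is a product of the transpositions of \<open>a, k\<close>, of \<open>k, b\<close>
  and again of \<open>a, k\<close>, each of which raises the length; the difference would be at
  least three.\<close>

lemma cover_between:
  assumes "generated p" "1 \<le> a" "a < k" "k < b" "coxeter_length (p \<circ> transpose a b) \<le> Suc (coxeter_length p)"
    "p a < p b"
  shows "p k < p a \<or> p b < p k"
proof (rule ccontr)
  assume "\<not> ?thesis"
  then have k: "p a < p k" "p k < p b"
    using assms(3,4) generated_inj [OF assms(1), of k] generated_inj [OF assms(1), of _ k]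
    by (auto simp: not_less le_less)
  let ?p1 = "p \<circ> transpose a k" let ?p2 = "?p1 \<circ> transpose k b" let ?p3 = "?p2 \<circ> transpose a k"
  have g: "generated ?p1" "generated ?p2" using assms generated_comp_transpose by auto
  have "coxeter_length p < coxeter_length ?p1" "coxeter_length ?p1 < coxeter_length ?p2"
    "coxeter_length ?p2 < coxeter_length ?p3"
    using assms k g by (auto intro!: coxeter_length_transpose_greater simp: transpose_def)
  moreover have "?p3 = p \<circ> transpose a b"
    using assms by (auto simp: fun_eq_iff transpose_def)
  ultimately show False using assms by simp
qed

lemma coxeter_length_Cons_le:
  assumes "generated u" "1 \<le> i"
  shows "coxeter_length (transpose i (Suc i) \<circ> u) \<le> Suc (coxeter_length u)"
proof -
  obtain "is" where "0 \<notin> set is" "word_perm is = u" "length is = coxeter_length u"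
    using reduced_word assms(1) .
  then show ?thesis using coxeter_length_le [of "i # is"] assms(2) by simp
qed

lemma transpose_conj:
  assumes "generated u"
  shows "transpose (u a) (u b) \<circ> u = u \<circ> transpose a b"
  using generated_inj [OF assms] by (auto simp: fun_eq_iff transpose_def)

text \<open>Multiplying on the left by an adjacent transposition of values is multiplying on the
  right by the transposition of the arguments that take them, so the comparison for right
  multiplication applies.\<close>

lemma coxeter_length_Cons:
  assumes "generated u" "1 \<le> a" "1 \<le> i" "u a = i" "u b = Suc i"
  shows "a < b \<Longrightarrow> coxeter_length (transpose i (Suc i) \<circ> u) = Suc (coxeter_length u)"
    and "b < a \<Longrightarrow> coxeter_length (transpose i (Suc i) \<circ> u) < coxeter_length u"
proof -
  have e: "transpose i (Suc i) \<circ> u = u \<circ> transpose a b"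
    using transpose_conj [OF assms(1), of a b] assms by simp
  have b: "1 \<le> b" using assms generated_zero [of u] by (metis Zero_not_Suc less_one not_le)
  { assume "a < b"
    then have "coxeter_length u < coxeter_length (transpose i (Suc i) \<circ> u)"
      using e coxeter_length_transpose_greater assms by simp
    then show "coxeter_length (transpose i (Suc i) \<circ> u) = Suc (coxeter_length u)"
      using coxeter_length_Cons_le [of u i] assms by simp }
  { assume "b < a"
    then show "coxeter_length (transpose i (Suc i) \<circ> u) < coxeter_length u"
      using e coxeter_length_transpose_less [of u b a] assms b by (simp add: transpose_commute) }
qed

section \<open>Strands\<close>

definition reads_before :: "nat \<times> nat \<Rightarrow> nat \<times> nat \<Rightarrow> bool" where
  "reads_before x y \<longleftrightarrow> fst x < fst y \<or> fst x = fst y \<and> snd y < snd x"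

definition reading :: "graph \<Rightarrow> (nat \<times> nat) list" where
  "reading R = concat (map (\<lambda>i. map (Pair i) (rev (sorted_list_of_set {j. (i, j) \<in> R})))
     (sorted_list_of_set (fst ` R)))"

lemma graph_word_reading: "graph_word R = map (\<lambda>(i, j). i + j - 1) (reading R)"
  by (simp add: graph_word_def reading_def map_concat comp_def)

lemma finite_row: "finite R \<Longrightarrow> finite {j. (i, j) \<in> R}"
  by (rule finite_subset [of _ "snd ` R"]) force+

lemma set_reading: "finite R \<Longrightarrow> set (reading R) = R"
  by (auto simp: reading_def finite_row image_iff Bex_def)

lemma sorted_wrt_concat_rows:
  assumes "sorted_wrt (<) is" "\<And>i. sorted_wrt (\<lambda>x y. y < x) (f i)"
  shows "sorted_wrt reads_before (concat (map (\<lambda>i. map (Pair i) (f i)) is))"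
  using assms(1)
proof (induction "is")
  case Nil
  then show ?case by simp
next
  case (Cons i "is")
  have "sorted_wrt reads_before (map (Pair i) (f i))"
    using assms(2) [of i] by (simp add: sorted_wrt_map reads_before_def)
  moreover have "reads_before (i, k) (i', k')" if "i' \<in> set is" for i' k k'
    using Cons.prems that by (simp add: reads_before_def)
  ultimately show ?case using Cons by (auto simp: sorted_wrt_append)
qed

lemma sorted_reading: "sorted_wrt reads_before (reading R)"
  unfolding reading_def
  by (rule sorted_wrt_concat_rows) (simp_all add: sorted_wrt_rev)

lemma sorted_wrt_unique:
  assumes "\<And>x y. R x y \<Longrightarrow> \<not> R y x"
  shows "sorted_wrt R xs \<Longrightarrow> sorted_wrt R ys \<Longrightarrow> set xs = set ys \<Longrightarrow> xs = ys"
proof (induction xs arbitrary: ys)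
  case Nil
  then show ?case by simp
next
  case (Cons x xs)
  then obtain y ys' where ys: "ys = y # ys'" by (cases ys) auto
  have irr: "\<not> R z z" for z using assms by blast
  have "x = y"
  proof (rule ccontr)
    assume "x \<noteq> y"
    then have "R x y" "R y x" using Cons.prems ys by auto
    then show False using assms by blast
  qed
  moreover have "x \<notin> set xs" "x \<notin> set ys'" using Cons.prems ys irr [of y] \<open>x = y\<close> by auto
  then have "set xs = set ys'" using Cons.prems(3) ys \<open>x = y\<close> by (metis Diff_insert_absorb list.simps(15))
  ultimately show ?case using Cons ys by simp
qed

lemma sorted_reads_before_unique:
  "sorted_wrt reads_before xs \<Longrightarrow> sorted_wrt reads_before ys \<Longrightarrow> set xs = set ys \<Longrightarrow> xs = ys"
  by (rule sorted_wrt_unique [where R = reads_before]) (auto simp: reads_before_def)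

lemma reading_Un:
  assumes "finite C" "finite D" "\<And>d c. d \<in> D \<Longrightarrow> c \<in> C \<Longrightarrow> reads_before d c"
  shows "reading (D \<union> C) = reading D @ reading C"
  by (rule sorted_reads_before_unique)
    (use assms in \<open>auto simp: sorted_reading sorted_wrt_append set_reading\<close>)

lemma graph_perm_Un:
  assumes "finite C" "finite D" "\<And>d c. d \<in> D \<Longrightarrow> c \<in> C \<Longrightarrow> reads_before d c"
  shows "graph_perm (D \<union> C) = graph_perm D \<circ> graph_perm C"
  by (simp add: graph_perm_def graph_word_reading reading_Un [OF assms] word_perm_append del: comp_apply)

lemma graph_perm_empty [simp]: "graph_perm {} = id"
  by (simp add: graph_perm_def graph_word_def)

lemma graph_perm_single: "1 \<le> i \<Longrightarrow> graph_perm {(i, j)} = transpose (i + j - 1) (i + j)"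
proof -
  assume "1 \<le> i"
  have "reading {(i, j)} = [(i, j)]"
    by (rule sorted_reads_before_unique) (auto simp: sorted_reading set_reading)
  then show ?thesis using \<open>1 \<le> i\<close> by (simp add: graph_perm_def graph_word_reading)
qed

lemma is_graph_subset: "is_graph X \<Longrightarrow> Y \<subseteq> X \<Longrightarrow> is_graph Y"
  by (auto simp: is_graph_def intro: finite_subset)

lemma is_graph_finite: "is_graph X \<Longrightarrow> finite X"
  by (simp add: is_graph_def)

lemma is_graph_insert: "is_graph (insert (i, j) X) \<longleftrightarrow> 1 \<le> i \<and> 1 \<le> j \<and> is_graph X"
  by (auto simp: is_graph_def)

lemma is_graph_rows_ge: "is_graph X \<Longrightarrow> is_graph (rows_ge X l)"
  by (erule is_graph_subset) (auto simp: rows_ge_def)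

lemma set_graph_word: "finite X \<Longrightarrow> set (graph_word X) = (\<lambda>(i, j). i + j - 1) ` X"
  by (simp add: graph_word_reading set_reading)

lemma generated_graph_perm: "is_graph X \<Longrightarrow> generated (graph_perm X)"
  unfolding graph_perm_def by (rule generated_word) (fastforce simp: set_graph_word is_graph_def)

lemma graph_perm_fixes:
  assumes "is_graph X" "\<And>i j. (i, j) \<in> X \<Longrightarrow> v \<noteq> i + j - 1 \<and> v \<noteq> i + j"
  shows "graph_perm X v = v"
proof -
  have *: "i + j = Suc (i + j - 1)" if "(i, j) \<in> X" for i j
    using assms(1) that by (auto simp: is_graph_def)
  show ?thesis
    unfolding graph_perm_def
    by (rule word_perm_fixes)
      (use assms * in \<open>fastforce simp: set_graph_word is_graph_finite\<close>)
qed

lemma word_perm_length: "length (graph_word X) = card X" if "finite X"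
proof -
  have "distinct (reading X)"
    using sorted_reading [of X]
    by (induction "reading X" arbitrary: X rule: list.induct)
      (metis sorted_reading distinct_conv_nth sorted_wrt_iff_nth_less linorder_neqE_nat
        reads_before_def less_irrefl)+
  then show ?thesis using that by (simp add: graph_word_reading distinct_card [symmetric] set_reading)
qed

lemma coxeter_length_graph_perm_le: "is_graph X \<Longrightarrow> coxeter_length (graph_perm X) \<le> card X"
  using coxeter_length_le [of "graph_word X"] word_perm_length [of X]
  by (fastforce simp: graph_perm_def set_graph_word is_graph_def)

section \<open>Strands as preimages of values of a partially read word\<close>

definition prior :: "graph \<Rightarrow> nat \<Rightarrow> nat \<Rightarrow> graph" where
  "prior X l j = {(i, k) \<in> X. l < i \<or> i = l \<and> k < j}"

definition below_perm :: "graph \<Rightarrow> nat \<Rightarrow> perm" where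
  "below_perm X l = graph_perm (rows_ge X l)"

text \<open>Words are products of functions, so the crossings read last act first:
  \<open>prior\<close> holds those that act before \<open>(l, j)\<close> is reached. After them the
  strand about to enter \<open>(l, j)\<close> from the left has the value \<open>l + j - 1\<close>,
  the smaller of the two values that a crossing there interchanges. The strand from below has the
  value \<open>l + j\<close>, which no crossing further left in the row touches.\<close>

definition left_strand :: "graph \<Rightarrow> nat \<Rightarrow> nat \<Rightarrow> nat" where
  "left_strand X l j = inv (graph_perm (prior X l j)) (l + j - 1)"

definition below_strand :: "graph \<Rightarrow> nat \<Rightarrow> nat \<Rightarrow> nat" where
  "below_strand X l j = inv (below_perm X (Suc l)) (l + j)"

lemma is_graph_prior: "is_graph X \<Longrightarrow> is_graph (prior X l j)"
  by (erule is_graph_subset) (auto simp: prior_def)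

lemma generated_below_perm: "is_graph X \<Longrightarrow> generated (below_perm X l)"
  unfolding below_perm_def by (intro generated_graph_perm is_graph_rows_ge)

lemma generated_prior: "is_graph X \<Longrightarrow> generated (graph_perm (prior X l j))"
  by (intro generated_graph_perm is_graph_prior)

lemma rows_ge_1: "is_graph X \<Longrightarrow> rows_ge X 1 = X"
  by (auto simp: rows_ge_def is_graph_def)

lemma prior_step:
  assumes "is_graph X"
  shows "graph_perm (prior X l (Suc j)) =
    (if (l, j) \<in> X then transpose (l + j - 1) (l + j) \<circ> graph_perm (prior X l j)
     else graph_perm (prior X l j))"
proof (cases "(l, j) \<in> X")
  case True
  then have e: "prior X l (Suc j) = {(l, j)} \<union> prior X l j"
    by (auto simp: prior_def)
  have "1 \<le> l" using True assms by (auto simp: is_graph_def)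
  have "graph_perm ({(l, j)} \<union> prior X l j) = graph_perm {(l, j)} \<circ> graph_perm (prior X l j)"
    by (rule graph_perm_Un)
      (use is_graph_finite [OF is_graph_prior [OF assms]] in \<open>auto simp: prior_def reads_before_def\<close>)
  then show ?thesis using True \<open>1 \<le> l\<close> e by (simp add: graph_perm_single del: comp_apply)
next
  case False
  then have "prior X l (Suc j) = prior X l j"
    by (auto simp: prior_def less_Suc_eq)
  then show ?thesis using False by simp
qed

lemma perm_ge:
  assumes "generated p" "\<And>v. v < k \<Longrightarrow> p v = v" "k \<le> v" shows "k \<le> p v"
  using assms generated_inj by (metis not_le)

lemma perm_less:
  assumes "generated p" "\<And>v. k \<le> v \<Longrightarrow> p v = v" "v < k" shows "p v < k"
  using assms generated_inj by (metis not_le)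

text \<open>Scanning a row from left to right, the values below the current column are final, and the
  values above it are still those of the lower rows.\<close>

lemma prior_after:
  assumes "is_graph X" "1 \<le> l" "1 \<le> j"
  shows "graph_perm (prior X l j) s < l + j - 1 \<Longrightarrow> below_perm X l s = graph_perm (prior X l j) s"
    and "l + j - 1 \<le> graph_perm (prior X l j) s \<Longrightarrow> l + j - 1 \<le> below_perm X l s"
proof -
  let ?D = "{(i, k) \<in> X. i = l \<and> j \<le> k}"
  have D: "is_graph ?D" using assms(1) by (rule is_graph_subset) auto
  have e: "rows_ge X l = ?D \<union> prior X l j" by (auto simp: rows_ge_def prior_def)
  have g: "below_perm X l = graph_perm ?D \<circ> graph_perm (prior X l j)"
    unfolding below_perm_def e
    by (rule graph_perm_Un)
      (use is_graph_finite [OF D] is_graph_finite [OF is_graph_prior [OF assms(1)]]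
        in \<open>auto simp: prior_def reads_before_def\<close>)
  have f: "graph_perm ?D v = v" if "v < l + j - 1" for v
    using D by (rule graph_perm_fixes) (use that in auto)
  show "graph_perm (prior X l j) s < l + j - 1 \<Longrightarrow> below_perm X l s = graph_perm (prior X l j) s"
    using f g by simp
  show "l + j - 1 \<le> graph_perm (prior X l j) s \<Longrightarrow> l + j - 1 \<le> below_perm X l s"
    using perm_ge [OF generated_graph_perm [OF D] f] g by simp
qed

lemma prior_before:
  assumes "is_graph X" "1 \<le> l"
  shows "l + j \<le> below_perm X (Suc l) s \<Longrightarrow> graph_perm (prior X l j) s = below_perm X (Suc l) s"
    and "below_perm X (Suc l) s < l + j \<Longrightarrow> graph_perm (prior X l j) s < l + j"
proof -
  let ?D = "{(i, k) \<in> X. i = l \<and> k < j}"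
  have D: "is_graph ?D" using assms(1) by (rule is_graph_subset) auto
  have e: "prior X l j = ?D \<union> rows_ge X (Suc l)" by (auto simp: rows_ge_def prior_def)
  have g: "graph_perm (prior X l j) = graph_perm ?D \<circ> below_perm X (Suc l)"
    unfolding below_perm_def e
    by (rule graph_perm_Un)
      (use is_graph_finite [OF D] is_graph_finite [OF is_graph_rows_ge [OF assms(1)]]
        in \<open>auto simp: rows_ge_def reads_before_def\<close>)
  have f: "graph_perm ?D v = v" if "l + j \<le> v" for v
    using D by (rule graph_perm_fixes) (use that in auto)
  show "l + j \<le> below_perm X (Suc l) s \<Longrightarrow> graph_perm (prior X l j) s = below_perm X (Suc l) s"
    using f g by simp
  show "below_perm X (Suc l) s < l + j \<Longrightarrow> graph_perm (prior X l j) s < l + j"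
    using perm_less [OF generated_graph_perm [OF D] f] g by simp
qed

lemma left_strand_prior: "is_graph X \<Longrightarrow> left_strand X l j = s \<longleftrightarrow> graph_perm (prior X l j) s = l + j - 1"
  unfolding left_strand_def by (rule generated_inv_eq [OF generated_prior])

lemma below_strand_iff: "is_graph X \<Longrightarrow> below_strand X l j = s \<longleftrightarrow> below_perm X (Suc l) s = l + j"
  unfolding below_strand_def by (rule generated_inv_eq [OF generated_below_perm])

lemma below_strand_prior:
  assumes "is_graph X" "1 \<le> l"
  shows "below_strand X l j = s \<longleftrightarrow> graph_perm (prior X l j) s = l + j"
proof -
  have "graph_perm (prior X l j) (below_strand X l j) = l + j"
    using prior_before(1) [OF assms, of j "below_strand X l j"]
      below_strand_iff [OF assms(1), of l j "below_strand X l j"] by simp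
  then show ?thesis using generated_inj [OF generated_prior [OF assms(1)]] by metis
qed

text \<open>The left strand at \<open>(l, j)\<close> is the one whose value is neither final nor
  still that of the lower rows.\<close>

lemma left_strand_iff:
  assumes "is_graph X" "1 \<le> l" "1 \<le> j"
  shows "left_strand X l j = s \<longleftrightarrow> below_perm X (Suc l) s < l + j \<and> l + j \<le> Suc (below_perm X l s)"
  unfolding left_strand_prior [OF assms(1)]
  using prior_after [OF assms, of s] prior_before(1) [OF assms(1,2), of j s]
    prior_before(2) [OF assms(1,2), of s j] assms(2,3) by linarith

lemma left_strand_Suc:
  assumes "is_graph X" "1 \<le> l" "1 \<le> j"
  shows "left_strand X l (Suc j) = (if (l, j) \<in> X then left_strand X l j else below_strand X l j)"
proof -
  have "graph_perm (prior X l j) (left_strand X l j) = l + j - 1"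
    "graph_perm (prior X l j) (below_strand X l j) = l + j"
    using left_strand_prior [OF assms(1), of l j "left_strand X l j"]
      below_strand_prior [OF assms(1,2), of j "below_strand X l j"] by simp_all
  then show ?thesis
    unfolding left_strand_prior [OF assms(1)]
    using assms by (simp add: prior_step transpose_def)
qed

lemma below_perm_fixes:
  assumes "is_graph X" "k < l" shows "below_perm X l k = k"
  unfolding below_perm_def
  using is_graph_rows_ge [OF assms(1)]
  by (rule graph_perm_fixes) (use assms in \<open>auto simp: rows_ge_def is_graph_def\<close>)

lemma below_perm_ge: "is_graph X \<Longrightarrow> l \<le> k \<Longrightarrow> l \<le> below_perm X l k"
  using perm_ge [OF generated_below_perm] below_perm_fixes by blast

lemma left_strand_one:
  assumes "is_graph X" "1 \<le> l" shows "left_strand X l 1 = l"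
  using below_perm_fixes [OF assms(1), of l "Suc l"] below_perm_ge [OF assms(1), of l l]
  by (subst left_strand_iff) (use assms in auto)

text \<open>A strand that leaves at the top of \<open>(l, j)\<close> has the value
  \<open>l + j - 1\<close> and keeps it for the rest of the row. At a crossing this is the vertical
  strand, at a free place, treated next, the one from the left.\<close>

lemma below_perm_crossing:
  assumes "is_graph X" "(l, j) \<in> X" shows "below_perm X l (below_strand X l j) = l + j - 1"
proof -
  have lj: "1 \<le> l" "1 \<le> j" using assms by (auto simp: is_graph_def)
  have "graph_perm (prior X l j) (below_strand X l j) = l + j"
    using below_strand_prior [OF assms(1) lj(1), of j "below_strand X l j"] by simp
  then have "graph_perm (prior X l (Suc j)) (below_strand X l j) = l + j - 1"
    using assms by (simp add: prior_step transpose_def)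
  then show ?thesis using prior_after(1) [OF assms(1) lj(1), of "Suc j" "below_strand X l j"] lj by simp
qed

lemma below_perm_free:
  assumes "is_graph X" "(l, j) \<notin> X" "1 \<le> l" "1 \<le> j"
  shows "below_perm X l (left_strand X l j) = l + j - 1"
proof -
  have "graph_perm (prior X l j) (left_strand X l j) = l + j - 1"
    using left_strand_prior [OF assms(1), of l j "left_strand X l j"] by simp
  then have "graph_perm (prior X l (Suc j)) (left_strand X l j) = l + j - 1"
    using assms by (simp add: prior_step transpose_def)
  then show ?thesis
    using prior_after(1) [OF assms(1,3), of "Suc j" "left_strand X l j"] assms by simp
qed

text \<open>A row lowers a value by at most one: a strand that enters from below at a crossing
  leaves at once, and one that enters at a free place moves on to the right.\<close>

lemma below_perm_mono:
  assumes "is_graph X" "1 \<le> l" shows "below_perm X (Suc l) s \<le> Suc (below_perm X l s)"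
proof (cases "below_perm X (Suc l) s \<le> l")
  case True
  then show ?thesis
    using below_perm_ge [OF assms(1), of l s] below_perm_fixes [OF assms(1), of s l]
      below_perm_fixes [OF assms(1), of s "Suc l"] by (cases "s < l") auto
next
  case False
  then obtain j where j: "below_perm X (Suc l) s = l + j" "1 \<le> j"
    by (metis not_less_eq_eq le_Suc_ex add_Suc_shift le_add1 plus_1_eq_Suc)
  then show ?thesis
    using prior_after(2) [OF assms j(2), of s] prior_before(1) [OF assms, of j s] by simp
qed

lemma left_strand_pos:
  assumes "is_graph X" "1 \<le> l" "1 \<le> j" shows "1 \<le> left_strand X l j"
proof (rule ccontr)
  assume "\<not> ?thesis"
  then have "left_strand X l j = 0" by simp
  then show False
    using left_strand_prior [OF assms(1)] generated_zero [OF generated_prior [OF assms(1), of l j]] assms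
    by simp
qed

lemma below_strand_pos:
  assumes "is_graph X" "1 \<le> l" shows "1 \<le> below_strand X l j"
proof (rule ccontr)
  assume "\<not> ?thesis"
  then have "below_strand X l j = 0" by simp
  then show False
    using below_strand_iff [OF assms(1)] generated_zero [OF generated_below_perm [OF assms(1), of "Suc l"]] assms
    by simp
qed

lemma left_strand_value: "is_graph X \<Longrightarrow> graph_perm (prior X l j) (left_strand X l j) = l + j - 1"
  unfolding left_strand_def by (rule generated_inv [OF generated_prior])

lemma below_strand_value: "is_graph X \<Longrightarrow> below_perm X (Suc l) (below_strand X l j) = l + j"
  unfolding below_strand_def by (rule generated_inv [OF generated_below_perm])

lemma below_strand_prior_value:
  "is_graph X \<Longrightarrow> 1 \<le> l \<Longrightarrow> graph_perm (prior X l j) (below_strand X l j) = l + j"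
  using prior_before(1) [of X l j "below_strand X l j"] below_strand_value [of X l j] by simp

lemma left_neq_below:
  assumes "is_graph X" "1 \<le> l" "1 \<le> j" shows "left_strand X l j \<noteq> below_strand X l j"
proof
  assume "left_strand X l j = below_strand X l j"
  then show False
    using left_strand_value [OF assms(1), of l j] below_strand_prior_value [OF assms(1,2), of j] assms(2)
    by simp
qed

lemma below_strand_inj: "is_graph X \<Longrightarrow> below_strand X l j = below_strand X l k \<longleftrightarrow> j = k"
  using below_strand_value [of X l j] below_strand_value [of X l k] by (cases "j = k") auto

section \<open>Adding and removing one crossing\<close>

lemma graph_perm_toggle:
  assumes X: "is_graph X" and ij: "1 \<le> i" "1 \<le> j"
    and D: "is_graph D" "\<And>d c. d \<in> D \<Longrightarrow> c \<in> insert (i, j) (prior X i j) \<Longrightarrow> reads_before d c"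
  shows "graph_perm (D \<union> insert (i, j) (prior X i j)) =
    graph_perm (D \<union> prior X i j) \<circ> transpose (left_strand X i j) (below_strand X i j)"
proof -
  let ?C = "prior X i j"
  have f: "finite ?C" "finite D" using is_graph_finite is_graph_prior X D by auto
  have "graph_perm (insert (i, j) ?C) = graph_perm ({(i, j)} \<union> ?C)" by simp
  also have "\<dots> = graph_perm {(i, j)} \<circ> graph_perm ?C"
    by (rule graph_perm_Un) (use f in \<open>auto simp: prior_def reads_before_def\<close>)
  also have "\<dots> = transpose (i + j - 1) (i + j) \<circ> graph_perm ?C"
    using ij by (simp add: graph_perm_single)
  \<comment> \<open>Conjugation by the permutation of the crossings that act before turns the
    adjacent transposition of values into the transposition of the strands that carry them.\<close>
  also have "\<dots> = graph_perm ?C \<circ> transpose (left_strand X i j) (below_strand X i j)"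
    using transpose_conj [OF generated_prior [OF X, of i j], of "left_strand X i j" "below_strand X i j"]
      left_strand_value [OF X, of i j]
      below_strand_prior_value [OF X ij(1), of j] ij(1) by (simp del: comp_apply)
  finally have "graph_perm (insert (i, j) ?C) =
    graph_perm ?C \<circ> transpose (left_strand X i j) (below_strand X i j)" .
  moreover have "graph_perm (D \<union> insert (i, j) ?C) = graph_perm D \<circ> graph_perm (insert (i, j) ?C)"
    by (rule graph_perm_Un) (use f D in auto)
  moreover have "graph_perm (D \<union> ?C) = graph_perm D \<circ> graph_perm ?C"
    by (rule graph_perm_Un) (use f D in auto)
  ultimately show ?thesis by (simp add: comp_assoc del: comp_apply)
qed

lemma below_perm_insert:
  assumes "is_graph X" "1 \<le> i" "1 \<le> j" "(i, j) \<notin> X"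
  shows "below_perm (insert (i, j) X) l =
    (if l \<le> i then below_perm X l \<circ> transpose (left_strand X i j) (below_strand X i j) else below_perm X l)"
proof (cases "l \<le> i")
  case True
  let ?D = "{(i', k) \<in> X. l \<le> i' \<and> (i' < i \<or> i' = i \<and> j < k)}"
  have D: "is_graph ?D" using assms(1) by (rule is_graph_subset) auto
  have e1: "rows_ge (insert (i, j) X) l = ?D \<union> insert (i, j) (prior X i j)"
    using True assms(4) by (auto simp: rows_ge_def prior_def)
  have e2: "rows_ge X l = ?D \<union> prior X i j"
    using True assms(4) by (auto simp: rows_ge_def prior_def) (metis linorder_neqE_nat)
  have "graph_perm (?D \<union> insert (i, j) (prior X i j)) =
      graph_perm (?D \<union> prior X i j) \<circ> transpose (left_strand X i j) (below_strand X i j)"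
    by (rule graph_perm_toggle [OF assms(1-3) D]) (auto simp: prior_def reads_before_def)
  then show ?thesis unfolding below_perm_def e1 [symmetric] e2 [symmetric] using True by metis
next
  case False
  then have "rows_ge (insert (i, j) X) l = rows_ge X l" by (auto simp: rows_ge_def)
  then show ?thesis using False by (simp add: below_perm_def)
qed

lemma inv_comp_transpose:
  assumes "generated p" shows "inv (p \<circ> transpose a b) k = transpose a b (inv p k)"
proof -
  have "inv (p \<circ> transpose a b) = (\<lambda>k. transpose a b (inv p k))"
    by (rule inv_equality) (use generated_inv [OF assms] in auto)
  then show ?thesis by simp
qed

lemma below_strand_insert:
  assumes "is_graph X" "1 \<le> i" "1 \<le> j" "(i, j) \<notin> X"
  shows "below_strand (insert (i, j) X) l k =
    (if l < i then transpose (left_strand X i j) (below_strand X i j) (below_strand X l k)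
     else below_strand X l k)"
  unfolding below_strand_def below_perm_insert [OF assms]
  using inv_comp_transpose [OF generated_below_perm [OF assms(1)]] by (simp add: Suc_le_eq)

text \<open>Only places in higher rows, or further right in row \<open>i\<close>, have
  \<open>(i, j)\<close> in their \<open>prior\<close>; there the two strands have traded the rest of
  their paths.\<close>

lemma left_strand_insert:
  assumes "is_graph X" "1 \<le> i" "1 \<le> j" "(i, j) \<notin> X"
  shows "left_strand (insert (i, j) X) l k =
    (if l < i \<or> l = i \<and> j < k then transpose (left_strand X i j) (below_strand X i j) (left_strand X l k)
     else left_strand X l k)"
proof (cases "l < i \<or> l = i \<and> j < k")
  case True
  let ?D = "{(i', k') \<in> prior X l k. i' < i \<or> i' = i \<and> j < k'}"
  have D: "is_graph ?D" using is_graph_prior [OF assms(1)] by (rule is_graph_subset) auto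
  have e1: "prior (insert (i, j) X) l k = ?D \<union> insert (i, j) (prior X i j)"
    using True assms(4) by (auto simp: prior_def)
  have e2: "prior X l k = ?D \<union> prior X i j"
    using True assms(4) by (auto simp: prior_def) (metis linorder_neqE_nat)+
  have "graph_perm (?D \<union> insert (i, j) (prior X i j)) =
      graph_perm (?D \<union> prior X i j) \<circ> transpose (left_strand X i j) (below_strand X i j)"
    by (rule graph_perm_toggle [OF assms(1-3) D]) (auto simp: prior_def reads_before_def)
  then have "graph_perm (prior (insert (i, j) X) l k) =
      graph_perm (prior X l k) \<circ> transpose (left_strand X i j) (below_strand X i j)"
    unfolding e1 [symmetric] e2 [symmetric] .
  then show ?thesis
    using True inv_comp_transpose [OF generated_prior [OF assms(1)]] by (simp add: left_strand_def)
next
  case False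
  then have "prior (insert (i, j) X) l k = prior X l k" by (auto simp: prior_def)
  then show ?thesis using False by (auto simp: left_strand_def)
qed

lemma prior_cong: "rows_ge X l = rows_ge Y l \<Longrightarrow> l \<le> i \<Longrightarrow> prior X i k = prior Y i k"
  unfolding prior_def rows_ge_def by (auto simp: set_eq_iff) (metis le_trans less_imp_le_nat)+

lemma left_strand_cong: "rows_ge X l = rows_ge Y l \<Longrightarrow> l \<le> i \<Longrightarrow> left_strand X i k = left_strand Y i k"
  unfolding left_strand_def using prior_cong [of X l Y i k] by simp

lemma rows_ge_rows_ge: "rows_ge (rows_ge X l) i = rows_ge X (max l i)"
  by (auto simp: rows_ge_def)

lemma rows_ge_mono: "rows_ge X l = rows_ge Y l \<Longrightarrow> l \<le> i \<Longrightarrow> rows_ge X i = rows_ge Y i"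
  using rows_ge_rows_ge [of X l i] rows_ge_rows_ge [of Y l i] by (simp add: max_def split: if_splits)

lemma below_perm_cong: "rows_ge X l = rows_ge Y l \<Longrightarrow> l \<le> i \<Longrightarrow> below_perm X i = below_perm Y i"
  using rows_ge_mono [of X l Y i] by (simp add: below_perm_def)

lemma below_strand_cong:
  "rows_ge X l = rows_ge Y l \<Longrightarrow> l \<le> Suc i \<Longrightarrow> below_strand X i k = below_strand Y i k"
  using below_perm_cong [of X l Y "Suc i"] by (simp add: below_strand_def)

section \<open>Reduced graphs\<close>

lemma rc_graph_insert_first:
  assumes "is_graph X" "1 \<le> l" "1 \<le> j" "X = prior X l j"
  shows "rc_graph (insert (l, j) X) \<longleftrightarrow> rc_graph X \<and> left_strand X l j < below_strand X l j"
proof -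
  have n: "(l, j) \<notin> X" by (subst assms(4)) (simp add: prior_def)
  let ?u = "graph_perm X" and ?a = "left_strand X l j" and ?b = "below_strand X l j"
  have g: "generated ?u" using assms(1) by (rule generated_graph_perm)
  have ab: "?u ?a = l + j - 1" "?u ?b = Suc (l + j - 1)"
    using left_strand_value [OF assms(1), of l j] below_strand_prior_value [OF assms(1,2), of j] assms(2)
    unfolding assms(4) [symmetric] by simp_all
  have e: "graph_perm (insert (l, j) X) = transpose (l + j - 1) (Suc (l + j - 1)) \<circ> ?u"
  proof -
    have "reads_before (l, j) c" if "c \<in> X" for c
    proof -
      have "c \<in> prior X l j" using that assms(4) by metis
      then show ?thesis by (auto simp: prior_def reads_before_def)
    qed
    then have "graph_perm ({(l, j)} \<union> X) = graph_perm {(l, j)} \<circ> ?u"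
      by (intro graph_perm_Un) (use is_graph_finite [OF assms(1)] in auto)
    then show ?thesis using assms(2) by (simp add: graph_perm_single del: comp_apply)
  qed
  have a: "1 \<le> ?a" using left_strand_pos assms by simp
  have c: "card (insert (l, j) X) = Suc (card X)" using n is_graph_finite [OF assms(1)] by simp
  have k: "1 \<le> l + j - 1" using assms(2,3) by simp
  have i: "is_graph (insert (l, j) X)" using assms by (simp add: is_graph_insert)
  show ?thesis
  proof (cases ?a ?b rule: linorder_cases)
    case less
    then show ?thesis
      using coxeter_length_Cons(1) [OF g a k ab] assms(1) e c i by (simp add: rc_graph_def)
  next
    case equal
    then show ?thesis using left_neq_below assms by simp
  next
    case greater
    then show ?thesis
      using coxeter_length_Cons(2) [OF g a k ab] assms(1) e c i coxeter_length_graph_perm_le [OF assms(1)]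
      by (simp add: rc_graph_def)
  qed
qed

text \<open>Crossings are taken off in reading order. The first one multiplies on the left by an
  adjacent transposition, which raises the length exactly if the smaller strand is horizontal, and
  taking it off does not alter the strands at the remaining places. The criterion is local, so it
  passes to any set of lower rows.\<close>

lemma rc_graph_iff:
  "rc_graph X \<longleftrightarrow> is_graph X \<and> (\<forall>(l, j) \<in> X. left_strand X l j < below_strand X l j)"
proof (cases "is_graph X")
  case True
  have "rc_graph X \<longleftrightarrow> (\<forall>(l, j) \<in> X. left_strand X l j < below_strand X l j)"
    using True
  proof (induction "card X" arbitrary: X rule: less_induct)
    case less
    show ?case
    proof (cases "X = {}")
      case True
      then show ?thesis using less.prems coxeter_length_id by (simp add: rc_graph_def)
    next
      case False
      have fin: "finite X" using less.prems by (rule is_graph_finite)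
      obtain l j xs where r: "reading X = (l, j) # xs"
        using set_reading [OF fin] False by (cases "reading X") auto
      have X: "(l, j) \<in> X" using set_reading [OF fin] r by (metis list.set_intros(1))
      have first: "y = (l, j) \<or> reads_before (l, j) y" if "y \<in> X" for y
        using that set_reading [OF fin] sorted_reading [of X] r by auto
      have lj: "1 \<le> l" "1 \<le> j" using X less.prems by (auto simp: is_graph_def)
      let ?Y = "X - {(l, j)}"
      have Y: "is_graph ?Y" using less.prems by (rule is_graph_subset) auto
      have ins: "insert (l, j) ?Y = X" using X by auto
      have p: "?Y = prior ?Y l j" using first by (fastforce simp: prior_def reads_before_def)
      have same: "left_strand X i k = left_strand ?Y i k \<and> below_strand X i k = below_strand ?Y i k"
        if "(i, k) \<in> X" for i k
        using first [OF that] left_strand_insert [OF Y lj, of i k] below_strand_insert [OF Y lj, of i k] ins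
        by (auto simp: reads_before_def)
      have "card ?Y < card X" using card_Diff1_less [OF fin X] .
      have split: "(\<forall>y\<in>X. P y) \<longleftrightarrow> P (l, j) \<and> (\<forall>y\<in>?Y. P y)" for P
        using X by blast
      have "rc_graph X \<longleftrightarrow> rc_graph ?Y \<and> left_strand ?Y l j < below_strand ?Y l j"
        using rc_graph_insert_first [OF Y lj p] ins by simp
      also have "\<dots> \<longleftrightarrow> (\<forall>(i, k) \<in> X. left_strand ?Y i k < below_strand ?Y i k)"
        unfolding less.hyps [OF \<open>card ?Y < card X\<close> Y] split by auto
      also have "\<dots> \<longleftrightarrow> (\<forall>(i, k) \<in> X. left_strand X i k < below_strand X i k)"
        by (rule ball_cong) (auto simp: same)
      finally show ?thesis .
    qed
  qed
  then show ?thesis using True by simp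
qed (simp add: rc_graph_def)

lemma rc_graph_is_graph: "rc_graph X \<Longrightarrow> is_graph X"
  by (simp add: rc_graph_def)

lemma rc_graph_crossing: "rc_graph X \<Longrightarrow> (l, j) \<in> X \<Longrightarrow> left_strand X l j < below_strand X l j"
  using rc_graph_iff by blast

lemma rc_graph_rows_ge:
  assumes "rc_graph X" shows "rc_graph (rows_ge X l)"
proof -
  have "left_strand (rows_ge X l) i k < below_strand (rows_ge X l) i k" if "(i, k) \<in> rows_ge X l" for i k
  proof -
    have *: "rows_ge (rows_ge X l) l = rows_ge X l" by (simp add: rows_ge_rows_ge)
    have "l \<le> i" "(i, k) \<in> X" using that by (auto simp: rows_ge_def)
    then show ?thesis
      using left_strand_cong [OF *, of i k] below_strand_cong [OF *, of i k] rc_graph_crossing [OF assms]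
      by simp
  qed
  then show ?thesis
    unfolding rc_graph_iff using is_graph_rows_ge rc_graph_is_graph [OF assms] by blast
qed

section \<open>Strands traced place by place\<close>

lemma strand_sound:
  assumes "is_graph X"
  shows from_left_sound: "from_left X s i j \<Longrightarrow> 1 \<le> i \<and> 1 \<le> j \<and> left_strand X i j = s"
    and from_below_sound: "from_below X s i j \<Longrightarrow> 1 \<le> i \<and> 1 \<le> j \<and> below_strand X i j = s"
proof (induction rule: from_left_from_below.inducts)
  case (start s)
  then show ?case using left_strand_one [OF assms] by simp
next
  case (left_right s i j)
  then show ?case using left_strand_Suc [OF assms] by simp
next
  case (below_right s i j)
  then show ?case using left_strand_Suc [OF assms] by simp
next
  case (below_top s i j)
  then show ?case
    using below_perm_crossing [OF assms, of "i + 1" j] below_strand_iff [OF assms, of i j s] by simp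
next
  case (left_top s i j)
  then show ?case
    using below_perm_free [OF assms, of "i + 1" j] below_strand_iff [OF assms, of i j s] by simp
qed

lemma ex_from_left:
  assumes "\<And>j. 1 \<le> j \<Longrightarrow> \<exists>s. from_below X s i j" "1 \<le> i" "1 \<le> j"
  shows "\<exists>s. from_left X s i j"
  using assms(3)
proof (induction j rule: dec_induct)
  case base
  then show ?case using start [OF assms(2)] by blast
next
  case (step j)
  then show ?case
    using assms(1) [of j] left_right [of X _ i j] below_right [of X _ i j] by (cases "(i, j) \<in> X") auto
qed

lemma ex_from_below:
  assumes "\<exists>s. from_left X s (Suc i) j" "\<exists>s. from_below X s (Suc i) j" "1 \<le> i"
  shows "\<exists>s. from_below X s i j"
  using assms below_top [of X _ i j] left_top [of X _ i j] by (cases "(Suc i, j) \<in> X") auto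

text \<open>Tracing a strand backwards may go down through many rows, so a place to start is needed.
  Below the last crossing every place is free and the strands turn at each of them, which gives
  existence there by induction on the column; the other rows follow from the bottom upwards.\<close>

lemma ex_strands:
  assumes "finite X" "1 \<le> j" "1 \<le> i"
  shows "(\<exists>s. from_left X s i j) \<and> (\<exists>s. from_below X s i j)"
proof -
  define M where "M = Suc (Max (insert 0 (fst ` X)))"
  have M: "(i, j) \<notin> X" if "M \<le> i" for i j
  proof
    assume "(i, j) \<in> X"
    then have "i \<le> Max (insert 0 (fst ` X))" using assms(1) by (intro Max_ge) force+
    then show False using that by (simp add: M_def)
  qed
  have high: "\<forall>i\<ge>max M 1. (\<exists>s. from_left X s i j) \<and> (\<exists>s. from_below X s i j)" if "1 \<le> j" for j
    using that
  proof (induction j rule: dec_induct)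
    case base
    have "from_left X i i 1 \<and> from_below X (Suc i) i 1" if "max M 1 \<le> i" for i
      using that M [of "i + 1" 1] start [of i X] start [of "Suc i" X] left_top [of X "Suc i" i 1] by auto
    then show ?case by blast
  next
    case (step j)
    have l: "\<exists>s. from_left X s i (Suc j)" if "max M 1 \<le> i" for i
      using that step.IH M [of i j] below_right [of X _ i j] by auto
    have "\<exists>s. from_below X s i (Suc j)" if "max M 1 \<le> i" for i
      using that l [of "Suc i"] M [of "i + 1" "Suc j"] left_top [of X _ i "Suc j"] by auto
    with l show ?case by blast
  qed
  have "\<forall>j\<ge>1. (\<exists>s. from_left X s i j) \<and> (\<exists>s. from_below X s i j)" if "1 \<le> i" for i
    using that
  proof (induction "M - i" arbitrary: i)
    case 0
    then show ?case using high by simp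
  next
    case (Suc n)
    then have "\<forall>j\<ge>1. (\<exists>s. from_left X s (Suc i) j) \<and> (\<exists>s. from_below X s (Suc i) j)"
      using Suc.hyps(1) [of "Suc i"] by simp
    then have "\<exists>s. from_below X s i j" if "1 \<le> j" for j
      using ex_from_below Suc.prems that by blast
    then show ?case using ex_from_left Suc.prems by blast
  qed
  then show ?thesis using assms by blast
qed

lemma from_left_iff:
  "is_graph X \<Longrightarrow> from_left X s i j \<longleftrightarrow> 1 \<le> i \<and> 1 \<le> j \<and> s = left_strand X i j"
  using from_left_sound ex_strands is_graph_finite by metis

lemma from_below_iff:
  "is_graph X \<Longrightarrow> from_below X s i j \<longleftrightarrow> 1 \<le> i \<and> 1 \<le> j \<and> s = below_strand X i j"
  using from_below_sound ex_strands is_graph_finite by metis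

lemma h_crossings_eq:
  assumes "is_graph X"
  shows "h_crossings X a b = {(i, j) \<in> X. left_strand X i j = a \<and> below_strand X i j = b}"
  using assms unfolding h_crossings_def
  by (auto simp: from_left_iff from_below_iff) (auto simp: is_graph_def)

lemma free_place_iff:
  assumes "is_graph X" "1 \<le> l"
  shows "free_place X l j x y \<longleftrightarrow>
    (l, j) \<notin> X \<and> 1 \<le> j \<and> x = left_strand X l j \<and> y = below_strand X l j"
  using assms by (auto simp: free_place_def from_left_iff from_below_iff)

text \<open>Two strands cross at most once. If row \<open>l\<close> undid the inversion,
  \<open>d\<close> would arrive from the left at the place that \<open>c\<close> enters from below.
  A crossing there would have the larger strand horizontal, and at a free place \<open>d\<close>
  would leave with a value that cannot exceed that of \<open>c\<close>.\<close>

lemma crossed_persists: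
  assumes "rc_graph X" "1 \<le> l" "c < d" "below_perm X (Suc l) d < below_perm X (Suc l) c"
  shows "below_perm X l d < below_perm X l c"
proof (rule ccontr)
  have X: "is_graph X" using assms(1) by (rule rc_graph_is_graph)
  let ?p = "below_perm X l" and ?q = "below_perm X (Suc l)"
  assume "\<not> ?thesis"
  then have p: "?p c < ?p d" using generated_inj [OF generated_below_perm [OF X], of l c d] assms(3) by simp
  have "l < ?q c"
  proof (rule ccontr)
    assume "\<not> l < ?q c"
    then have "?q d < l" using assms(4) by simp
    then have "d \<le> l" using below_perm_ge [OF X, of "Suc l" d] by linarith
    then have "?q d = d" "?q c = c" using below_perm_fixes [OF X] assms(3) by auto
    then show False using assms by simp
  qed
  then obtain j where j: "?q c = l + j" "1 \<le> j" by (metis less_imp_add_positive One_nat_def Suc_leI)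
  have c: "below_strand X l j = c" using j below_strand_iff [OF X] by simp
  have "?q c \<le> Suc (?p c)" using below_perm_mono [OF X assms(2)] .
  then have d: "left_strand X l j = d" using left_strand_iff [OF X assms(2) j(2)] j assms(4) p by simp
  show False
  proof (cases "(l, j) \<in> X")
    case True
    then show False using rc_graph_crossing [OF assms(1)] c d assms(3) by fastforce
  next
    case False
    then show False using below_perm_free [OF X False assms(2) j(2)] d p \<open>?q c \<le> Suc (?p c)\<close> j by simp
  qed
qed

text \<open>The crossing lies in the row that creates the inversion, in the column where the larger
  strand enters from below. This turns statements about crossings of given strands into comparisons
  of values of \<open>below_perm\<close>.\<close>

lemma row_crossing_iff:
  assumes "rc_graph X" "1 \<le> l" "1 \<le> c" "c < d"
  shows "(l, j) \<in> crossings X c d \<longleftrightarrow>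
    below_perm X (Suc l) c < below_perm X (Suc l) d \<and> below_perm X l d < below_perm X l c \<and>
    below_perm X (Suc l) d = l + j"
    and "(l, j) \<in> crossings X c d \<longleftrightarrow> (l, j) \<in> X \<and> left_strand X l j = c \<and> below_strand X l j = d"
proof -
  have X: "is_graph X" using assms(1) by (rule rc_graph_is_graph)
  let ?p = "below_perm X l" and ?q = "below_perm X (Suc l)"
  show *: "(l, j) \<in> crossings X c d \<longleftrightarrow> (l, j) \<in> X \<and> left_strand X l j = c \<and> below_strand X l j = d" for j
    unfolding crossings_def h_crossings_eq [OF X] using rc_graph_crossing [OF assms(1)] assms(4) by fastforce
  show "(l, j) \<in> crossings X c d \<longleftrightarrow> ?q c < ?q d \<and> ?p d < ?p c \<and> ?q d = l + j"
  proof
    assume "(l, j) \<in> crossings X c d"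
    then have j: "(l, j) \<in> X" "left_strand X l j = c" "below_strand X l j = d" using * by auto
    then have "1 \<le> j" using X by (auto simp: is_graph_def)
    then have "?q c < l + j" "l + j \<le> Suc (?p c)"
      using left_strand_iff [OF X assms(2)] j by auto
    moreover have "?q d = l + j" using j(3) below_strand_iff [OF X] by simp
    moreover have "?p d = l + j - 1" using below_perm_crossing [OF X j(1)] j(3) by simp
    moreover have "?p c \<noteq> ?p d" using generated_inj [OF generated_below_perm [OF X]] assms(4) by simp
    ultimately show "?q c < ?q d \<and> ?p d < ?p c \<and> ?q d = l + j" using assms(2) \<open>1 \<le> j\<close> by auto
  next
    assume j: "?q c < ?q d \<and> ?p d < ?p c \<and> ?q d = l + j"
    have "1 \<le> j"
    proof (rule ccontr)
      assume "\<not> 1 \<le> j"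
      then have "?q c < l" using j by simp
      moreover from this have "c < l"
        using below_perm_ge [OF X, of "Suc l" c] below_perm_fixes [OF X, of c "Suc l"] by linarith
      ultimately have "?p c < l" using below_perm_fixes [OF X] by simp
      moreover from this j have "?p d < l" by simp
      ultimately have "d < l" using below_perm_ge [OF X, of l d] by linarith
      then show False using j below_perm_fixes [OF X] assms(4) by simp
    qed
    have d: "below_strand X l j = d" using j below_strand_iff [OF X] by simp
    have "l + j \<le> Suc (?p d)" using below_perm_mono [OF X assms(2), of d] j by simp
    then have c: "left_strand X l j = c"
      by (intro iffD2 [OF left_strand_iff [OF X assms(2) \<open>1 \<le> j\<close>]] conjI) (use j in linarith)+
    have "(l, j) \<in> X"
      using below_perm_free [OF X _ assms(2) \<open>1 \<le> j\<close>] c j \<open>l + j \<le> Suc (?p d)\<close> by fastforce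
    then show "(l, j) \<in> crossings X c d" using * c d by simp
  qed
qed

lemma below_perm_high:
  assumes "is_graph X" shows "\<exists>M\<ge>l. below_perm X M = id"
proof -
  define M where "M = max l (Suc (Max (insert 0 (fst ` X))))"
  have "(i, j) \<notin> X" if "M \<le> i" for i j
  proof
    assume "(i, j) \<in> X"
    then have "i \<le> Max (insert 0 (fst ` X))" using is_graph_finite [OF assms] by (intro Max_ge) force+
    then show False using that by (simp add: M_def)
  qed
  then have "rows_ge X M = {}" by (auto simp: rows_ge_def)
  then show ?thesis by (intro exI [of _ M]) (simp add: M_def below_perm_def)
qed

text \<open>Read from the bottom upwards, the inversion of the pair appears exactly once, because it
  persists; the row where it appears holds the only crossing.\<close>

lemma crossings_single:
  assumes "rc_graph X" "1 \<le> l" "1 \<le> c" "c < d" "below_perm X l d < below_perm X l c"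
  shows "\<exists>i k. l \<le> i \<and> crossings X c d = {(i, k)}"
proof -
  have X: "is_graph X" using assms(1) by (rule rc_graph_is_graph)
  let ?inv = "\<lambda>i. below_perm X i d < below_perm X i c"
  obtain M where M: "l \<le> M" "below_perm X M = id" using below_perm_high [OF X] by blast
  have down: "?inv i" if "i \<le> i'" "1 \<le> i" "?inv i'" for i i'
    using that(1,3)
  proof (induction i' rule: dec_induct)
    case (step n)
    then show ?case using crossed_persists [OF assms(1) _ assms(4), of n] that(2) by simp
  qed
  have "\<exists>i\<ge>l. ?inv i \<and> \<not> ?inv (Suc i)"
  proof (rule ccontr)
    assume *: "\<not> ?thesis"
    have "?inv i" if "l \<le> i" for i
      using that by (induction i rule: dec_induct) (use * assms(5) in auto)
    then have "?inv M" using M(1) .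
    then show False using M assms(4) by simp
  qed
  then obtain i where i: "l \<le> i" "?inv i" "\<not> ?inv (Suc i)" by blast
  have ge: "1 \<le> i'" "1 \<le> k" if "(i', k) \<in> crossings X c d" for i' k
    using that X by (auto simp: crossings_def h_crossings_def is_graph_def)
  have lt: "below_perm X (Suc i) c < below_perm X (Suc i) d"
    using i(3) generated_inj [OF generated_below_perm [OF X], of "Suc i" c d] assms(4) by simp
  have row: "i' = i" if "(i', k) \<in> crossings X c d" for i' k
  proof -
    have "?inv i'" "\<not> ?inv (Suc i')"
      using row_crossing_iff(1) [OF assms(1) ge(1) [OF that] assms(3,4)] that by auto
    then show ?thesis using down [of "Suc i" i'] down [of "Suc i'" i] i ge(1) [OF that] by fastforce
  qed
  have "i < below_perm X (Suc i) d"
  proof (rule ccontr)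
    assume "\<not> ?thesis"
    then have "d \<le> i" using below_perm_ge [OF X, of "Suc i" d] by linarith
    then have "below_perm X i c = c" using below_perm_fixes [OF X, of c i] assms(4) by simp
    moreover have "d \<le> below_perm X i d"
      using below_perm_fixes [OF X, of d i] below_perm_ge [OF X, of i d] \<open>d \<le> i\<close> by (cases "d = i") auto
    ultimately show False using i(2) assms(4) by simp
  qed
  then obtain k where k: "below_perm X (Suc i) d = i + k" by (metis less_imp_add_positive)
  have i1: "1 \<le> i" using i(1) assms(2) by simp
  note iff = row_crossing_iff(1) [OF assms(1) i1 assms(3,4)]
  have "(i, k) \<in> crossings X c d" using iff [of k] i(2) lt k by simp
  moreover have "x = (i, k)" if "x \<in> crossings X c d" for x
  proof -
    obtain i' k' where x: "x = (i', k')" by (cases x)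
    then have "i' = i" using row that by simp
    then show ?thesis using iff [of k'] that k x by simp
  qed
  ultimately have "crossings X c d = {(i, k)}" by blast
  then show ?thesis using i(1) by blast
qed

section \<open>Chains and labels\<close>

lemma trans_perm_Nil [simp]: "trans_perm [] = id"
  by (simp add: trans_perm_def)

lemma trans_perm_append: "trans_perm (xs @ ys) = trans_perm xs \<circ> trans_perm ys"
  by (induction xs) (auto simp: trans_perm_def comp_assoc)

lemma trans_perm_single [simp]: "trans_perm [(a, b)] = transpose a b"
  by (simp add: trans_perm_def)

definition labels :: "perm \<Rightarrow> transpositions \<Rightarrow> nat list" where
  "labels w es = map (\<lambda>i. (w \<circ> trans_perm (take i es)) (snd (es ! (i - 1)))) [1..<length es + 1]"

lemma E_labels: "E w (lam, es) = (lam, labels w es)"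
  unfolding E_def labels_def by simp

lemma length_labels [simp]: "length (labels w es) = length es"
  unfolding labels_def length_map length_upt by simp

lemma labels_snoc: "labels w (es @ [(a, b)]) = labels w es @ [w (trans_perm es a)]"
proof -
  have "[1..<length (es @ [(a, b)]) + 1] = [1..<length es + 1] @ [Suc (length es)]"
    by simp
  then have "labels w (es @ [(a, b)]) =
      map (\<lambda>i. (w \<circ> trans_perm (take i (es @ [(a, b)]))) (snd ((es @ [(a, b)]) ! (i - 1)))) [1..<length es + 1] @
      [w (trans_perm es a)]"
    unfolding labels_def by (simp add: trans_perm_append)
  moreover have "map (\<lambda>i. (w \<circ> trans_perm (take i (es @ [(a, b)]))) (snd ((es @ [(a, b)]) ! (i - 1)))) [1..<length es + 1] =
      labels w es"
    unfolding labels_def by (rule map_cong) (auto simp: nth_append)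
  ultimately show ?thesis by simp
qed

text \<open>The chain condition without the shape, so that it can be followed entry by
  entry.\<close>

definition chain :: "nat \<Rightarrow> perm \<Rightarrow> transpositions \<Rightarrow> bool" where
  "chain r w es \<longleftrightarrow> (\<forall>(a, b)\<in>set es. 1 \<le> a \<and> a \<le> r \<and> r < b) \<and>
     (\<forall>i\<in>{1..length es}. coxeter_length (w \<circ> trans_perm (take i es)) = coxeter_length w + i)"

lemma bruhat_chain_iff:
  "bruhat_chain r w (lam, es) \<longleftrightarrow> length es \<le> length (boxes lam) \<and> chain r w es"
  by (auto simp: bruhat_chain_def partial_tableau_def chain_def)

lemma chain_Nil [simp]: "chain r w []"
  by (simp add: chain_def)

lemma chain_length:
  "chain r w es \<Longrightarrow> coxeter_length (w \<circ> trans_perm es) = coxeter_length w + length es"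
proof (cases "es = []")
  case False
  assume "chain r w es"
  then have "coxeter_length (w \<circ> trans_perm (take (length es) es)) = coxeter_length w + length es"
    using False unfolding chain_def by (metis atLeastAtMost_iff le_refl length_greater_0_conv less_one not_le)
  then show ?thesis by simp
qed simp

lemma chain_snoc:
  "chain r w (es @ [(a, b)]) \<longleftrightarrow> chain r w es \<and> 1 \<le> a \<and> a \<le> r \<and> r < b \<and>
     coxeter_length (w \<circ> trans_perm es \<circ> transpose a b) = Suc (coxeter_length (w \<circ> trans_perm es))"
proof -
  have e: "{1..length (es @ [(a, b)])} = insert (Suc (length es)) {1..length es}" by auto
  have "(\<forall>i\<in>{1..length es}. coxeter_length (w \<circ> trans_perm (take i (es @ [(a, b)]))) = coxeter_length w + i)
      \<longleftrightarrow> (\<forall>i\<in>{1..length es}. coxeter_length (w \<circ> trans_perm (take i es)) = coxeter_length w + i)"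
    by (rule ball_cong) auto
  then have "chain r w (es @ [(a, b)]) \<longleftrightarrow> chain r w es \<and> 1 \<le> a \<and> a \<le> r \<and> r < b \<and>
     coxeter_length (w \<circ> (trans_perm es \<circ> transpose a b)) = Suc (coxeter_length w + length es)"
    unfolding chain_def e by (auto simp: trans_perm_append simp del: comp_apply)
  then show ?thesis using chain_length [of r w es] by (auto simp: comp_assoc simp del: comp_apply)
qed

lemma generated_trans_perm: "\<forall>(a, b)\<in>set es. 1 \<le> a \<and> 1 \<le> b \<Longrightarrow> generated (trans_perm es)"
proof (induction es rule: rev_induct)
  case Nil
  show ?case unfolding trans_perm_Nil by (rule generated_id)
next
  case (snoc e es)
  then show ?case
    using generated_comp_transpose [of "trans_perm es" "fst e" "snd e"]
    by (cases e) (auto simp: trans_perm_append simp del: comp_apply)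
qed

lemma chain_generated: "generated w \<Longrightarrow> chain r w es \<Longrightarrow> generated (w \<circ> trans_perm es)"
  by (rule generated_comp [OF _ generated_trans_perm]) (auto simp: chain_def)

text \<open>The two strands at the place are the same with and without the crossing, so these are
  the formulas for an insertion read backwards.\<close>

lemma below_perm_remove:
  assumes "is_graph X" "(i, j) \<in> X"
  shows "below_perm (X - {(i, j)}) l =
    (if l \<le> i then below_perm X l \<circ> transpose (left_strand X i j) (below_strand X i j) else below_perm X l)"
    and "left_strand (X - {(i, j)}) l k =
    (if l < i \<or> l = i \<and> j < k then transpose (left_strand X i j) (below_strand X i j) (left_strand X l k)
     else left_strand X l k)"
    and "below_strand (X - {(i, j)}) l k =
    (if l < i then transpose (left_strand X i j) (below_strand X i j) (below_strand X l k)
     else below_strand X l k)"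
proof -
  let ?Y = "X - {(i, j)}"
  have Y: "is_graph ?Y" using assms(1) by (rule is_graph_subset) auto
  have ij: "1 \<le> i" "1 \<le> j" "(i, j) \<notin> ?Y" using assms by (auto simp: is_graph_def)
  have X: "insert (i, j) ?Y = X" using assms(2) by auto
  have s: "left_strand X i j = left_strand ?Y i j" "below_strand X i j = below_strand ?Y i j"
    using left_strand_insert [OF Y ij, of i j] below_strand_insert [OF Y ij, of i j] X by simp_all
  show "below_perm ?Y l =
    (if l \<le> i then below_perm X l \<circ> transpose (left_strand X i j) (below_strand X i j) else below_perm X l)"
    using below_perm_insert [OF Y ij, of l] X s by (simp del: comp_apply)
  show "left_strand ?Y l k =
    (if l < i \<or> l = i \<and> j < k then transpose (left_strand X i j) (below_strand X i j) (left_strand X l k)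
     else left_strand X l k)"
    using left_strand_insert [OF Y ij, of l k] X s by simp
  show "below_strand ?Y l k =
    (if l < i then transpose (left_strand X i j) (below_strand X i j) (below_strand X l k)
     else below_strand X l k)"
    using below_strand_insert [OF Y ij, of l k] X s by simp
qed

lemma graph_perm_below:
  "rows_ge X l = X \<Longrightarrow> graph_perm X = below_perm X l"
  by (simp add: below_perm_def)

lemma only_eq_Some: "only A = Some x \<longleftrightarrow> A = {x}"
  by (auto simp: only_def is_singleton_def)

lemma leftmostI:
  assumes "(j, z) \<in> A" "\<And>k y. (k, y) \<in> A \<Longrightarrow> j \<le> k" "\<And>y. (j, y) \<in> A \<Longrightarrow> y = z"
  shows "leftmost A = Some (j, z)"
proof -
  have "x = (j, z)" if "x \<in> A" "\<forall>y\<in>A. fst x \<le> fst y" for x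
  proof -
    obtain k y where x: "x = (k, y)" by (cases x)
    have "k = j" using that(1) assms(2) [of k y] bspec [OF that(2) assms(1)] x by simp
    then show ?thesis using that(1) assms(3) x by blast
  qed
  moreover have "\<forall>y\<in>A. fst (j, z) \<le> fst y" using assms(2) by auto
  ultimately show ?thesis unfolding leftmost_def only_eq_Some using assms(1) by blast
qed

lemma rightmostI:
  assumes "(j, z) \<in> A" "\<And>k y. (k, y) \<in> A \<Longrightarrow> k \<le> j" "\<And>y. (j, y) \<in> A \<Longrightarrow> y = z"
  shows "rightmost A = Some (j, z)"
proof -
  have "x = (j, z)" if "x \<in> A" "\<forall>y\<in>A. fst y \<le> fst x" for x
  proof -
    obtain k y where x: "x = (k, y)" by (cases x)
    have "k = j" using that(1) assms(2) [of k y] bspec [OF that(2) assms(1)] x by simp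
    then show ?thesis using that(1) assms(3) x by blast
  qed
  moreover have "\<forall>y\<in>A. fst y \<le> fst (j, z)" using assms(2) by auto
  ultimately show ?thesis unfolding rightmost_def only_eq_Some using assms(1) by blast
qed

text \<open>Strands \<open>\<le> r\<close> are called red, the others blue.\<close>

locale row_algorithm =
  fixes r l :: nat and w :: perm
  assumes l_pos: "1 \<le> l" and l_le_r: "l \<le> r" and gen_w: "generated w"
begin

abbreviation p :: "graph \<Rightarrow> perm" where "p X \<equiv> below_perm X l"
abbreviation q :: "graph \<Rightarrow> perm" where "q X \<equiv> below_perm X (Suc l)"
abbreviation L :: "graph \<Rightarrow> nat \<Rightarrow> nat" where "L X j \<equiv> left_strand X l j"
abbreviation B :: "graph \<Rightarrow> nat \<Rightarrow> nat" where "B X j \<equiv> below_strand X l j"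

lemma L_I: "is_graph X \<Longrightarrow> 1 \<le> j \<Longrightarrow> q X s < l + j \<Longrightarrow> l + j \<le> Suc (p X s) \<Longrightarrow> L X j = s"
  using left_strand_iff [of X l j s] l_pos by simp

lemma L_D: "is_graph X \<Longrightarrow> 1 \<le> j \<Longrightarrow> L X j = s \<Longrightarrow> q X s < l + j \<and> l + j \<le> Suc (p X s)"
  using left_strand_iff [of X l j s] l_pos by simp

lemma B_I: "is_graph X \<Longrightarrow> q X s = l + j \<Longrightarrow> B X j = s"
  using below_strand_iff [of X l j s] by simp

lemma B_D: "is_graph X \<Longrightarrow> B X j = s \<Longrightarrow> q X s = l + j"
  using below_strand_iff [of X l j s] by simp

lemma exit_free: "is_graph X \<Longrightarrow> 1 \<le> j \<Longrightarrow> (l, j) \<notin> X \<Longrightarrow> L X j = s \<Longrightarrow> Suc (p X s) = l + j"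
  using below_perm_free [of X l j] l_pos by simp

lemma exit_crossing: "is_graph X \<Longrightarrow> (l, j) \<in> X \<Longrightarrow> B X j = s \<Longrightarrow> Suc (p X s) = l + j"
  using below_perm_crossing [of X l j] l_pos by simp

lemma L_Suc: "is_graph X \<Longrightarrow> 1 \<le> j \<Longrightarrow> L X (Suc j) = (if (l, j) \<in> X then L X j else B X j)"
  using left_strand_Suc [of X l j] l_pos by simp

lemma q_le_p: "is_graph X \<Longrightarrow> q X s \<le> Suc (p X s)"
  using below_perm_mono [of X l s] l_pos by simp

lemma p_inj: "is_graph X \<Longrightarrow> p X s = p X t \<longleftrightarrow> s = t"
  using generated_inj [OF generated_below_perm] .

lemma q_inj: "is_graph X \<Longrightarrow> q X s = q X t \<longleftrightarrow> s = t"
  using generated_inj [OF generated_below_perm] .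

text \<open>A Bruhat package for graphs in the rows \<open>\<ge> l\<close>, without the shape. The
  permutation \<open>w\<close> stays fixed throughout the row; it will be that of the rows
  \<open>\<ge> l\<close> of the recovered graph.\<close>

definition package :: "graph \<Rightarrow> transpositions \<Rightarrow> bool" where
  "package X es \<longleftrightarrow> rc_graph X \<and> rows_ge X l = X \<and> w \<circ> trans_perm es = p X \<and> chain r w es"

lemma package_graph: "package X es \<Longrightarrow> is_graph X"
  by (simp add: package_def rc_graph_is_graph)

lemma package_rc: "package X es \<Longrightarrow> rc_graph X"
  by (simp add: package_def)

lemma package_card:
  "package X es \<Longrightarrow> card X = coxeter_length w + length es"
  using chain_length [of r w es] graph_perm_below [of X l] by (simp add: package_def rc_graph_def)

text \<open>To see that a graph of the right size and permutation is reduced, it suffices that the last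
  transposition of the chain increases the length.\<close>

lemma packageI:
  assumes "is_graph X" "rows_ge X l = X" "w \<circ> trans_perm (es @ [(a, b)]) = p X" "chain r w es"
    "1 \<le> a" "a \<le> r" "r < b" "w (trans_perm es a) < w (trans_perm es b)"
    "card X = coxeter_length w + Suc (length es)"
  shows "package X (es @ [(a, b)])"
proof -
  let ?w = "w \<circ> trans_perm es"
  have g: "generated ?w" using chain_generated gen_w assms(4) by blast
  have pX: "p X = ?w \<circ> transpose a b"
    using assms(3) by (simp add: trans_perm_append comp_assoc del: comp_apply)
  have "coxeter_length ?w < coxeter_length (?w \<circ> transpose a b)"
    using coxeter_length_transpose_greater [OF g, of a b] assms by simp
  moreover have "coxeter_length (p X) \<le> card X"
    using coxeter_length_graph_perm_le [OF assms(1)] graph_perm_below [OF assms(2)] by simp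
  ultimately have c: "coxeter_length (?w \<circ> transpose a b) = Suc (coxeter_length ?w)"
    "coxeter_length (p X) = card X"
    using pX chain_length [OF assms(4)] assms(9) by (simp_all del: comp_apply)
  then have "chain r w (es @ [(a, b)])" using assms by (simp add: chain_snoc)
  moreover have "rc_graph X" using c(2) assms(1) graph_perm_below [OF assms(2)] by (simp add: rc_graph_def)
  ultimately show ?thesis using assms by (simp add: package_def)
qed

text \<open>The last fact is the covering condition of the final transposition; below it serves to
  exclude a third strand between two given ones.\<close>

lemma package_last:
  assumes "package X (es @ [(c, d)])"
  shows "1 \<le> c" "c \<le> r" "r < d" "generated (w \<circ> trans_perm es)" "chain r w es"
    "p X = w \<circ> trans_perm es \<circ> transpose c d"
    "p X d = w (trans_perm es c)" "p X c = w (trans_perm es d)" "p X d < p X c"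
    "\<And>k. c < k \<Longrightarrow> k < d \<Longrightarrow> p X k < p X d \<or> p X c < p X k"
proof -
  let ?w = "w \<circ> trans_perm es"
  show c: "1 \<le> c" "c \<le> r" "r < d" "chain r w es" using assms by (auto simp: package_def chain_snoc)
  show g: "generated ?w" using chain_generated gen_w c(4) by blast
  show pX: "p X = ?w \<circ> transpose c d"
    using assms by (simp add: package_def trans_perm_append comp_assoc del: comp_apply)
  then show e: "p X d = w (trans_perm es c)" "p X c = w (trans_perm es d)" by simp_all
  have len: "coxeter_length (?w \<circ> transpose c d) = Suc (coxeter_length ?w)"
    using assms by (simp add: package_def chain_snoc)
  then have lt: "?w c < ?w d" using coxeter_length_transpose_less_iff [OF g c(1), of d] c by simp
  then show "p X d < p X c" using e by simp
  show "p X k < p X d \<or> p X c < p X k" if "c < k" "k < d" for k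
    using cover_between [OF g c(1) that] len lt e that by (simp add: pX)
qed

text \<open>The strand carried along the scan stays blue. At a free place it is replaced by the
  strand from below, which is blue by \<open>none\<close>; at a crossing it goes on, and the
  vertical strand, being larger, is blue as well.\<close>

lemma blue_tail:
  assumes X: "is_graph X" and j0: "1 \<le> j0" "r < L X (Suc j0)"
    and none: "\<And>j. j0 < j \<Longrightarrow> j < j1 \<Longrightarrow> (l, j) \<notin> X \<Longrightarrow> r < L X j \<Longrightarrow> r < B X j"
    and red: "rc_graph X"
  shows "j0 < j \<Longrightarrow> j \<le> j1 \<Longrightarrow> r < L X j" and "j0 < j \<Longrightarrow> j < j1 \<Longrightarrow> r < B X j"
proof -
  have B: "r < B X j" if "r < L X j" "j0 < j" "j < j1" for j
    using none [OF that(2,3) _ that(1)] rc_graph_crossing [OF red, of l j] that(1) by fastforce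
  have *: "j \<le> j1 \<Longrightarrow> r < L X j" if "Suc j0 \<le> j" for j
    using that
  proof (induction j rule: dec_induct)
    case base
    then show ?case using j0 by simp
  next
    case (step j)
    then show ?case using L_Suc [OF X, of j] B [of j] by simp
  qed
  then show "j0 < j \<Longrightarrow> j \<le> j1 \<Longrightarrow> r < L X j" by simp
  show "j0 < j \<Longrightarrow> j < j1 \<Longrightarrow> r < B X j" using * [of j] B [of j] by simp
qed

text \<open>A strand that leaves the row right of \<open>j0\<close> is one of the two strands at its
  last place, and both are blue by \<open>blue_tail\<close>. Read the other way, a red strand
  leaving there forces the scan to stop.\<close>

lemma no_red_exit:
  assumes X: "rc_graph X" and j0: "1 \<le> j0" "r < L X (Suc j0)"
    and none: "\<And>j. j0 < j \<Longrightarrow> (l, j) \<notin> X \<Longrightarrow> r < L X j \<Longrightarrow> r < B X j"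
    and s: "l + j0 \<le> p X s"
  shows "r < s"
proof -
  have g: "is_graph X" using X by (rule rc_graph_is_graph)
  define j where "j = Suc (p X s) - l"
  have j: "Suc (p X s) = l + j" "j0 < j" using s by (simp_all add: j_def)
  note b = blue_tail [OF g j0 none X, of "Suc j" j]
  have "s = L X j \<or> s = B X j"
  proof (cases "(l, j) \<in> X")
    case True
    then show ?thesis using exit_crossing [OF g True refl] p_inj [OF g, of s "B X j"] j by simp
  next
    case False
    then show ?thesis using exit_free [OF g _ False refl] p_inj [OF g, of s "L X j"] j by simp
  qed
  then show ?thesis using b j by auto
qed

section \<open>Single inverse steps\<close>

text \<open>The two ways into the scan of an inverse step. Here the crossing of the last box lies in
  row \<open>l\<close>. In \<open>start_swap\<close> the last two boxes share their red strand and
  the crossing removed is that of their blue strands, while the last pair itself crosses lower down,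
  which is recorded by \<open>q X d < q X e\<close>.\<close>

definition start_row :: "graph \<Rightarrow> transpositions \<Rightarrow> graph \<Rightarrow> transpositions \<Rightarrow> nat \<Rightarrow> bool" where
  "start_row X es X'' es'' j0 \<longleftrightarrow> (\<exists>c d. es = es'' @ [(c, d)] \<and> (l, j0) \<in> X \<and> L X j0 = c \<and> B X j0 = d \<and>
     X'' = X - {(l, j0)})"

definition start_swap :: "graph \<Rightarrow> transpositions \<Rightarrow> graph \<Rightarrow> transpositions \<Rightarrow> nat \<Rightarrow> bool" where
  "start_swap X es X'' es'' j0 \<longleftrightarrow> (\<exists>es1 e f d. es = es1 @ [(e, f), (e, d)] \<and> (l, j0) \<in> X \<and>
     L X j0 = d \<and> B X j0 = f \<and> q X d < q X e \<and> X'' = X - {(l, j0)} \<and> es'' = es1 @ [(e, d)])"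

text \<open>The state between the removal of a crossing and its reinsertion, common to both
  algorithms: \<open>(l, j0)\<close> is a place where the insertion algorithm is allowed to insert,
  of the first type if its left strand is red and of the second type otherwise.\<close>

definition middle :: "graph \<Rightarrow> transpositions \<Rightarrow> nat \<Rightarrow> bool" where
  "middle X es j0 \<longleftrightarrow> package X es \<and> 1 \<le> j0 \<and> (l, j0) \<notin> X \<and> r < B X j0 \<and>
     (L X j0 \<le> r \<or> es \<noteq> [] \<and> L X j0 = snd (last es))"

lemma remove_row:
  assumes "is_graph X" "(l, j0) \<in> X"
  shows "p (X - {(l, j0)}) = p X \<circ> transpose (L X j0) (B X j0)" "q (X - {(l, j0)}) = q X"
    "\<And>j. L (X - {(l, j0)}) j = (if j0 < j then transpose (L X j0) (B X j0) (L X j) else L X j)"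
    "\<And>j. B (X - {(l, j0)}) j = B X j"
  using below_perm_remove [OF assms] by (simp_all del: comp_apply)

lemma remove_facts:
  assumes "package X es" "(l, j0) \<in> X"
  shows "is_graph (X - {(l, j0)})" "rows_ge (X - {(l, j0)}) l = X - {(l, j0)}"
    "Suc (card (X - {(l, j0)})) = card X" "1 \<le> j0"
proof -
  have X: "is_graph X" using assms(1) by (rule package_graph)
  show "is_graph (X - {(l, j0)})" using X by (rule is_graph_subset) auto
  show "rows_ge (X - {(l, j0)}) l = X - {(l, j0)}"
    using assms(1) by (auto simp: package_def rows_ge_def)
  show "Suc (card (X - {(l, j0)})) = card X"
    using card_Suc_Diff1 [OF is_graph_finite [OF X] assms(2)] .
  show "1 \<le> j0" using X assms(2) by (auto simp: is_graph_def)
qed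

lemma start_row_middle:
  assumes P: "package X es" and s: "start_row X es X'' es'' j0"
  shows "middle X'' es'' j0" "labels w es'' = butlast (labels w es)" "L X'' j0 \<le> r" "L X'' j0 = L X j0"
    "L X'' (Suc j0) = B X j0" "q X'' = q X" "\<And>j. B X'' j = B X j"
proof -
  obtain c d where cd: "es = es'' @ [(c, d)]" "(l, j0) \<in> X" "L X j0 = c" "B X j0 = d" "X'' = X - {(l, j0)}"
    using s by (auto simp: start_row_def)
  have X: "is_graph X" using P by (rule package_graph)
  note f = remove_facts [OF P cd(2), folded cd(5)] and t = remove_row [OF X cd(2), folded cd(5)]
  note last = package_last [OF P [unfolded cd(1)]]
  have pX: "p X'' = w \<circ> trans_perm es''"
    using t(1) last(6) cd(3,4) by (simp del: comp_apply)
  have "card X'' = coxeter_length (p X'')"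
    using package_card [OF P] f(3) cd(1) chain_length [OF last(5)] pX by simp
  then have "rc_graph X''" using f(1) graph_perm_below [OF f(2)] by (simp add: rc_graph_def)
  then have P'': "package X'' es''" using f(2) pX last(5) by (simp add: package_def)
  show L: "L X'' j0 = L X j0" using t(3) by simp
  show "q X'' = q X" by (rule t(2))
  show B: "B X'' j = B X j" for j by (rule t(4))
  show "L X'' j0 \<le> r" using L cd(3) last(2) by simp
  show "labels w es'' = butlast (labels w es)" using cd(1) by (simp add: labels_snoc)
  have n: "(l, j0) \<notin> X''" using cd(5) by simp
  show "L X'' (Suc j0) = B X j0" using L_Suc [OF f(1,4)] n B by simp
  show "middle X'' es'' j0" using P'' f(4) n B L cd(3,4) last(2,3) by (simp add: middle_def)
qed

text \<open>Without the crossing of \<open>d\<close> and \<open>f\<close>, the product of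
  \<open>(e f)\<close> and \<open>(e d)\<close> becomes \<open>(e d)\<close> alone. That the shorter
  list is again a chain is checked by size: there is one crossing less, and \<open>(e d)\<close>
  raises the length because \<open>e\<close>, \<open>f\<close>, \<open>d\<close> have increasing
  values before the two boxes.\<close>

lemma start_swap_middle:
  assumes P: "package X es" and s: "start_swap X es X'' es'' j0"
  shows "middle X'' es'' j0" "labels w es'' = butlast (labels w es)"
    "es'' \<noteq> []" "L X'' j0 = snd (last es'')" "L X'' j0 = L X j0" "r < L X j0"
    "L X'' (Suc j0) = B X j0" "q X'' = q X" "\<And>j. B X'' j = B X j"
proof -
  obtain es1 e f d where cd: "es = es1 @ [(e, f), (e, d)]" "(l, j0) \<in> X" "L X j0 = d" "B X j0 = f"
    "q X d < q X e" "X'' = X - {(l, j0)}" "es'' = es1 @ [(e, d)]"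
    using s by (auto simp: start_swap_def)
  have X: "is_graph X" using P by (rule package_graph)
  note fa = remove_facts [OF P cd(2), folded cd(6)] and t = remove_row [OF X cd(2), folded cd(6)]
  have es: "es = (es1 @ [(e, f)]) @ [(e, d)]" using cd(1) by simp
  note last = package_last [OF P [unfolded es]]
  have ch: "chain r w es1" "1 \<le> e" "e \<le> r" "r < f"
    using last(5) by (simp_all add: chain_snoc)
  let ?w1 = "w \<circ> trans_perm es1"
  have g1: "generated ?w1" using chain_generated gen_w ch(1) by blast
  have "coxeter_length ?w1 < coxeter_length (?w1 \<circ> transpose e f)"
    using last(5) by (simp add: chain_snoc)
  then have ef: "?w1 e < ?w1 f" using coxeter_length_transpose_less_iff [OF g1, of e f] ch by simp
  have df: "d < f" using rc_graph_crossing [OF package_rc [OF P] cd(2)] cd(3,4) by simp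
  have ed: "e < d" using ch last(3) by simp
  have "p X d = ?w1 f" "p X e = ?w1 d"
    using last(7,8) ed df by (simp_all add: trans_perm_append transpose_def)
  then have wd: "?w1 f < ?w1 d" using last(9) by simp
  have "transpose e f \<circ> transpose e d \<circ> transpose d f = transpose e d"
    using ed df by (auto simp: fun_eq_iff transpose_def)
  then have pX: "w \<circ> trans_perm es'' = p X''"
    using t(1) last(6) cd(3,4,7) by (simp add: trans_perm_append comp_assoc del: comp_apply)
  have "card X'' = coxeter_length w + Suc (length es1)"
    using package_card [OF P] fa(3) cd(1) by simp
  then have P'': "package X'' es''"
    using packageI [OF fa(1,2), of es1 e d] pX cd(7) ch last(3) ef wd by simp
  show L: "L X'' j0 = L X j0" using t(3) by simp
  show "q X'' = q X" by (rule t(2))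
  show B: "B X'' j = B X j" for j by (rule t(4))
  show "es'' \<noteq> []" using cd(7) by simp
  show l2: "L X'' j0 = snd (last es'')" using L cd(3,7) by simp
  show "r < L X j0" using cd(3) last(3) by simp
  have "labels w es = (labels w es1 @ [w (trans_perm es1 e)]) @ [w (trans_perm (es1 @ [(e, f)]) e)]"
    unfolding es labels_snoc ..
  then show "labels w es'' = butlast (labels w es)" by (simp only: cd(7) labels_snoc butlast_snoc)
  have n: "(l, j0) \<notin> X''" using cd(6) by simp
  show "L X'' (Suc j0) = B X j0" using L_Suc [OF fa(1,4)] n B by simp
  show "middle X'' es'' j0" using P'' fa(4) n B l2 cd(4,7) ch(4) by (simp add: middle_def)
qed

text \<open>The outcome of the scan from \<open>j0\<close>: a crossing is added at
  \<open>(l, j1)\<close>, and the crossing of \<open>a\<close> with the strand arriving there from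
  the left is taken out below row \<open>l\<close>. In the second type two boxes exchange blue
  strands and the later one is emptied; in effect the last box of \<open>es\<close> has its blue
  strand replaced by the one from below.\<close>

definition found :: "graph \<Rightarrow> transpositions \<Rightarrow> nat \<Rightarrow> nat \<Rightarrow> nat \<Rightarrow> graph \<Rightarrow> transpositions \<Rightarrow> bool" where
  "found X es j0 j1 a X' es' \<longleftrightarrow> j0 < j1 \<and> (l, j1) \<notin> X \<and> r < L X j1 \<and>
     (\<forall>j. j0 < j \<and> j < j1 \<and> (l, j) \<notin> X \<and> r < L X j \<longrightarrow> r < B X j \<and> (es = [] \<or> L X j \<noteq> snd (last es))) \<and>
     1 \<le> a \<and> a \<le> r \<and>
     (\<exists>i k. l < i \<and> (i, k) \<in> X \<and> crossings X a (L X j1) = {(i, k)} \<and> X' = insert (l, j1) (X - {(i, k)})) \<and>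
     (B X j1 = a \<and> es' = es \<or>
      r < B X j1 \<and> (\<exists>es1. es = es1 @ [(a, L X j1)] \<and> es' = es1 @ [(a, B X j1)]))"

lemma middle_facts:
  assumes "middle X es j0"
  shows "package X es" "is_graph X" "rc_graph X" "1 \<le> j0" "(l, j0) \<notin> X" "r < B X j0" "L X (Suc j0) = B X j0"
    "r < L X (Suc j0)"
  using assms L_Suc [of X j0] by (auto simp: middle_def package_graph package_rc)

lemma found_tail:
  assumes m: "middle X es j0" and f: "found X es j0 j1 a X' es'"
  shows "j0 < j \<Longrightarrow> j \<le> j1 \<Longrightarrow> r < L X j" "j0 < j \<Longrightarrow> j < j1 \<Longrightarrow> r < B X j"
  using blue_tail [OF middle_facts(2) [OF m] middle_facts(4) [OF m] middle_facts(8) [OF m] _ middle_facts(3) [OF m],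
      of j1 j] f by (auto simp: found_def)

text \<open>Place \<open>(l, j0)\<close> is free, so every strand from further left has left the row
  by then; the strand found at \<open>j1\<close> entered from below at column \<open>j0\<close> or
  later.\<close>

lemma cursor_entry:
  assumes m: "middle X es j0" and j1: "j0 < j1"
  shows "l + j0 \<le> q X (L X j1)" "q X (L X j1) < l + j1"
proof -
  note g = middle_facts(2) [OF m] and j0 = middle_facts(4) [OF m]
  have 1: "q X (L X j1) < l + j1 \<and> l + j1 \<le> Suc (p X (L X j1))"
    using L_D [OF g _ refl, of j1] j1 by simp
  then show "q X (L X j1) < l + j1" by simp
  show "l + j0 \<le> q X (L X j1)"
  proof (rule ccontr)
    assume "\<not> ?thesis"
    then have "L X j0 = L X j1" using L_I [OF g j0, of "L X j1"] 1 j1 by simp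
    then show False using exit_free [OF g j0 middle_facts(5) [OF m]] 1 j1 by simp
  qed
qed

lemma crossed_below_single:
  assumes "rc_graph X" "1 \<le> a" "a < b" "q X b < q X a"
  obtains i k where "l < i" "(i, k) \<in> X" "crossings X a b = {(i, k)}"
    "left_strand X i k = a" "below_strand X i k = b"
proof -
  obtain i k where ik: "Suc l \<le> i" "crossings X a b = {(i, k)}"
    using crossings_single [OF assms(1) _ assms(2-4)] by auto
  then have "1 \<le> i" by simp
  from row_crossing_iff(2) [OF assms(1) this assms(2,3), of k] ik that show ?thesis by auto
qed

text \<open>A place with blue strands, the left one being in the last box, is of the second type. Comparing
  the exits of the three strands involved shows that the two new boxes still form a chain.\<close>

lemma second_type:
  assumes m: "middle X (es1 @ [(e, g)]) j0" and j1: "j0 < j1" "(l, j1) \<notin> X" "L X j1 = g" "r < B X j1"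
  shows "q X g < q X e" "g < B X j1"
    "w (trans_perm es1 e) < w (trans_perm es1 (B X j1))" "w (trans_perm es1 (B X j1)) < w (trans_perm es1 g)"
proof -
  note P = middle_facts(1) [OF m] and G = middle_facts(2) [OF m] and rc = middle_facts(3) [OF m]
  note last = package_last [OF P]
  let ?y = "B X j1"
  have j: "1 \<le> j1" using j1 by simp
  have pg: "Suc (p X g) = l + j1" using exit_free [OF G j j1(2,3)] .
  have qg: "q X g < l + j1" using L_D [OF G j j1(3)] by simp
  have qy: "q X ?y = l + j1" using B_D [OF G refl] .
  have eg: "e < g" "e < ?y" using last(2,3) j1(4) by simp_all
  have "e \<noteq> ?y" using eg by simp
  then have "q X e \<noteq> l + j1" using qy q_inj [OF G, of e ?y] by simp
  moreover have "\<not> q X e < l + j1"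
    using L_I [OF G j, of e] last(9) pg j1(3) eg(1) by fastforce
  ultimately have qe: "l + j1 < q X e" by simp
  with qg show "q X g < q X e" by simp
  have gy: "g \<noteq> ?y" using qg qy by auto
  have py: "p X g < p X ?y"
    using q_le_p [OF G, of ?y] qy pg p_inj [OF G, of g ?y] gy by simp
  have pe: "p X ?y < p X e"
  proof (rule ccontr)
    assume "\<not> ?thesis"
    then have lt: "p X e < p X ?y" using p_inj [OF G, of e ?y] eg by simp
    define k where "k = q X e - l"
    have k: "q X e = l + k" "1 \<le> k" "j1 < k" using qe by (simp_all add: k_def)
    have Bk: "B X k = e" using B_I [OF G k(1)] .
    have Lk: "L X k = ?y"
      by (rule L_I [OF G k(2)]) (use qy k lt q_le_p [OF G, of e] in linarith)+
    show False
    proof (cases "(l, k) \<in> X")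
      case True
      then show False using rc_graph_crossing [OF rc, of l k] Bk Lk eg by simp
    next
      case False
      then show False using exit_free [OF G k(2) False Lk] lt q_le_p [OF G, of e] k by simp
    qed
  qed
  show "g < ?y"
  proof (rule ccontr)
    assume "\<not> ?thesis"
    then have "?y < g" using gy by simp
    then show False using last(10) [of ?y] eg py pe by simp
  qed
  have "trans_perm es1 ?y = trans_perm es1 (transpose e g ?y)" using gy eg by (simp add: transpose_def)
  then have wy: "w (trans_perm es1 ?y) = p X ?y" using last(6) by simp
  show "w (trans_perm es1 e) < w (trans_perm es1 ?y)" using wy py last(7) by simp
  show "w (trans_perm es1 ?y) < w (trans_perm es1 g)" using wy pe last(8) by simp
qed

text \<open>Let \<open>b = L X j1\<close>. Taking out the lower crossing multiplies by the
  transposition of \<open>a\<close> and \<open>b\<close>, after which \<open>a\<close> arrives from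
  the left at \<open>j1\<close>. In the first type the strand from below was \<open>a\<close> and
  has become \<open>b\<close>, so the two changes cancel in \<open>p X\<close>; in the second they
  combine to replace \<open>b\<close> in the last transposition by the strand from below.\<close>

lemma found_effect:
  assumes m: "middle X es j0" and f: "found X es j0 j1 a X' es'"
  shows "q X' = q X \<circ> transpose a (L X j1)"
    "\<And>j. B X' j = transpose a (L X j1) (B X j)"
    "\<And>j. j \<le> j1 \<Longrightarrow> L X' j = transpose a (L X j1) (L X j)"
    "\<And>j. (l, j) \<in> X' \<longleftrightarrow> j = j1 \<or> (l, j) \<in> X"
    "package X' es'" "labels w es' = labels w es"
    "es' = es \<Longrightarrow> p X' = p X" "q X (L X j1) < q X a"
proof -
  note P = middle_facts(1) [OF m] and G = middle_facts(2) [OF m] and rc = middle_facts(3) [OF m]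
  let ?b = "L X j1" and ?y = "B X j1"
  obtain i k where ik: "l < i" "(i, k) \<in> X" "crossings X a ?b = {(i, k)}" "X' = insert (l, j1) (X - {(i, k)})"
    and j1: "j0 < j1" "(l, j1) \<notin> X" "r < ?b" and a: "1 \<le> a" "a \<le> r"
    and es': "?y = a \<and> es' = es \<or> r < ?y \<and> (\<exists>es1. es = es1 @ [(a, ?b)] \<and> es' = es1 @ [(a, ?y)])"
    using f by (auto simp: found_def)
  have ab: "a < ?b" using a j1 by simp
  have i1: "1 \<le> i" using ik(1) by simp
  from row_crossing_iff(2) [OF rc i1 a(1) ab, of k] ik(3)
  have s: "left_strand X i k = a" "below_strand X i k = ?b" by auto
  let ?Y = "X - {(i, k)}" and ?t = "transpose a ?b"
  have Y: "is_graph ?Y" using G by (rule is_graph_subset) auto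
  note rem = below_perm_remove [OF G ik(2), unfolded s]
  have Yf: "q ?Y = q X \<circ> ?t" "p ?Y = p X \<circ> ?t" "\<And>j. B ?Y j = ?t (B X j)" "\<And>j. L ?Y j = ?t (L X j)"
    using rem [of "Suc l"] rem [of l] ik(1) by (simp_all del: comp_apply)
  have j: "1 \<le> j1" "(l, j1) \<notin> ?Y" using j1 by auto
  have ne: "?b \<noteq> ?y" using left_neq_below [OF G l_pos j(1)] .
  note ins = below_perm_insert [OF Y l_pos j] below_strand_insert [OF Y l_pos j] left_strand_insert [OF Y l_pos j]
  show q': "q X' = q X \<circ> ?t" using ins(1) [of "Suc l"] ik(4) Yf by (simp del: comp_apply)
  show "B X' j = ?t (B X j)" for j using ins(2) [of l j] ik(4) Yf by simp
  show "L X' j = ?t (L X j)" if "j \<le> j1" for j using ins(3) [of l j] ik(4) Yf that by simp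
  show "(l, j) \<in> X' \<longleftrightarrow> j = j1 \<or> (l, j) \<in> X" for j using ik(1,4) by auto
  have pX': "p X' = p X \<circ> ?t \<circ> transpose a (?t ?y)"
    using ins(1) [of l] ik(4) Yf by (simp del: comp_apply)
  have X': "is_graph X'" using ik(4) Y j l_pos by (simp add: is_graph_insert)
  have rows: "rows_ge X' l = X'" using P ik(4) by (auto simp: package_def rows_ge_def)
  have card: "card X' = card X"
    using ik(2,4) j(2) is_graph_finite [OF G] is_graph_finite [OF Y] card_Suc_Diff1 [of X "(i, k)"] by simp
  show lt: "q X ?b < q X a"
  proof (rule ccontr)
    assume "\<not> ?thesis"
    then have "q X a < q X ?b" using q_inj [OF G, of a ?b] ab by simp
    moreover from row_crossing_iff(1) [OF rc i1 a(1) ab, of k] ik(3)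
    have "below_perm X i ?b < below_perm X i a" by auto
    moreover have "Suc l \<le> i" using ik(1) by simp
    then have "below_perm X i ?b < below_perm X i a \<Longrightarrow> q X ?b < q X a"
    proof (induction i rule: dec_induct)
      case (step n)
      then show ?case using crossed_persists [OF rc _ ab, of n] by simp
    qed
    ultimately show False by simp
  qed
  from es' show "package X' es'"
  proof (elim disjE conjE exE)
    assume y: "?y = a" "es' = es"
    then have "p X' = p X" using pX' by (simp add: transpose_commute del: comp_apply)
    then show "package X' es'"
      using P X' rows card y graph_perm_below [OF rows] graph_perm_below [of X l]
      by (simp add: package_def rc_graph_def)
  next
    fix es1
    assume y: "r < ?y" "es = es1 @ [(a, ?b)]" "es' = es1 @ [(a, ?y)]"
    note st = second_type [OF m [unfolded y(2)] j1(1,2) refl y(1)]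
    note last = package_last [OF P [unfolded y(2)]]
    have "?t ?y = ?y" using ne y(1) a by (simp add: transpose_def)
    then have "p X' = w \<circ> trans_perm es'"
      using pX' last(6) y(3) by (simp add: trans_perm_append comp_assoc del: comp_apply)
    moreover have "card X' = coxeter_length w + Suc (length es1)"
      using card package_card [OF P] y(2) by simp
    ultimately show "package X' es'"
      using packageI [OF X' rows, of es1 a ?y] st last(5) a y by simp
  qed
  from es' show "labels w es' = labels w es" by (auto simp: labels_snoc)
  show "p X' = p X" if "es' = es"
    using es'
  proof (elim disjE conjE exE)
    assume "?y = a"
    then show "p X' = p X" using pX' by (simp add: transpose_commute del: comp_apply)
  next
    fix es1 assume "es = es1 @ [(a, ?b)]" "es' = es1 @ [(a, ?y)]"
    then show "p X' = p X" using that ne by simp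
  qed
qed

lemma crossings_below_cong:
  assumes "is_graph X" "is_graph Y" "rows_ge X (Suc l) = rows_ge Y (Suc l)"
  shows "{(i, k) \<in> crossings X a b. l < i} = {(i, k) \<in> crossings Y a b. l < i}"
proof -
  have "(i, k) \<in> crossings X a b \<longleftrightarrow> (i, k) \<in> crossings Y a b" if "l < i" for i k
  proof -
    have "left_strand X i k = left_strand Y i k" "below_strand X i k = below_strand Y i k"
      using left_strand_cong [OF assms(3), of i k] below_strand_cong [OF assms(3), of i k] that by simp_all
    moreover have "(i, k) \<in> rows_ge X (Suc l) \<longleftrightarrow> (i, k) \<in> rows_ge Y (Suc l)" using assms(3) by simp
    then have "(i, k) \<in> X \<longleftrightarrow> (i, k) \<in> Y" using that by (simp add: rows_ge_def)
    ultimately show ?thesis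
      unfolding crossings_def h_crossings_eq [OF assms(1)] h_crossings_eq [OF assms(2)] by simp
  qed
  then show ?thesis by auto
qed

text \<open>Given one place of the first type, the scan stops at a least column, and the strand
  arriving there is blue. It crosses the chosen red strand below row \<open>l\<close>: in the first
  type the red one enters at \<open>j1\<close>, further right than the blue one did; in the second
  type this is part of \<open>second_type\<close>.\<close>

lemma inverse_rectify_found:
  assumes m: "middle X es j0" and ex: "\<exists>j>j0. (l, j) \<notin> X \<and> r < L X j \<and> B X j \<le> r"
  shows "\<exists>j1 a X' es'. found X es j0 j1 a X' es' \<and> inverse_rectify r l j0 X es = Some (X', es')"
proof -
  note P = middle_facts(1) [OF m] and G = middle_facts(2) [OF m] and rc = middle_facts(3) [OF m]
  let ?ok = "\<lambda>j. j0 < j \<and> (l, j) \<notin> X \<and> (B X j \<le> r \<and> r < L X j \<or> es \<noteq> [] \<and> L X j = snd (last es))"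
  let ?A = "{(j, x, y). free_place X l j x y \<and> j0 < j \<and> (y \<le> r \<and> r < x \<or> es \<noteq> [] \<and> x = snd (last es))}"
  define j1 where "j1 = (LEAST j. ?ok j)"
  obtain j2 where "?ok j2" using ex by blast
  then have ok: "?ok j1" unfolding j1_def by (rule LeastI)
  have least: "j1 \<le> j" if "?ok j" for j unfolding j1_def using that by (rule Least_le)
  let ?b = "L X j1" and ?y = "B X j1"
  have j: "1 \<le> j1" using ok by simp
  have A: "(j, x, y) \<in> ?A \<longleftrightarrow> ?ok j \<and> x = L X j \<and> y = B X j" for j x y
    by (auto simp: free_place_iff [OF G l_pos])
  have lm: "leftmost ?A = Some (j1, ?b, ?y)"
    by (rule leftmostI) (use A ok least in auto)
  have none: "r < B X j \<and> (es = [] \<or> L X j \<noteq> snd (last es))"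
    if "j0 < j" "j < j1" "(l, j) \<notin> X" "r < L X j" for j
    using least [of j] that by fastforce
  have blue: "r < ?b"
    using blue_tail(1) [OF G middle_facts(4,8) [OF m] _ rc, of j1 j1] none ok by blast
  have es: "es \<noteq> [] \<Longrightarrow> butlast es @ [last es] = es" by simp
  have pb: "Suc (p X ?b) = l + j1" using exit_free [OF G j _ refl] ok by simp
  have qy: "q X ?y = l + j1" using B_D [OF G refl] .
  have qb: "q X ?b < l + j1" using cursor_entry(2) [OF m] ok by simp
  obtain a where a: "1 \<le> a" "a \<le> r" "q X ?b < q X a" "?y \<le> r \<Longrightarrow> a = ?y"
    "r < ?y \<Longrightarrow> es \<noteq> [] \<and> last es = (a, ?b)"
  proof (cases "?y \<le> r")
    case True
    show thesis by (rule that [of ?y]) (use True qb qy below_strand_pos [OF G l_pos] in auto)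
  next
    case False
    with ok have ne: "es \<noteq> []" "?b = snd (last es)" by auto
    obtain e g where eg: "last es = (e, g)" by (cases "last es")
    then have es2: "es = butlast es @ [(e, g)]" using ne(1) by (metis append_butlast_last_id)
    have g: "?b = g" using ne(2) eg by simp
    have "q X g < q X e"
      using second_type(1) [of X "butlast es" e g j0 j1] m es2 ok g False by simp
    moreover have "1 \<le> e" "e \<le> r" using package_last(1,2) [of X "butlast es" e g] P es2 by simp_all
    ultimately show thesis using that [of e] g eg ne False by simp
  qed
  have ab: "a < ?b" using a blue by simp
  obtain i k where ik: "l < i" "(i, k) \<in> X" "crossings X a ?b = {(i, k)}"
    using crossed_below_single [OF rc a(1) ab a(3)] by metis
  let ?X' = "insert (l, j1) (X - {(i, k)})"
  let ?es' = "if ?y \<le> r then es else butlast es @ [(a, ?y)]"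
  have last_box: "?y = a \<and> ?es' = es \<or> r < ?y \<and> (\<exists>es1. es = es1 @ [(a, ?b)] \<and> ?es' = es1 @ [(a, ?y)])"
  proof (cases "?y \<le> r")
    case True
    then show ?thesis using a(4) by simp
  next
    case False
    then have "es = butlast es @ [(a, ?b)]" using a(5) by (metis append_butlast_last_id not_le)
    then show ?thesis using False by auto
  qed
  have "\<exists>i k. l < i \<and> (i, k) \<in> X \<and> crossings X a ?b = {(i, k)} \<and> ?X' = insert (l, j1) (X - {(i, k)})"
    using ik by blast
  moreover have "j0 < j1" "(l, j1) \<notin> X" using ok by simp_all
  ultimately have "found X es j0 j1 a ?X' ?es'"
    unfolding found_def using none blue a(1,2) last_box by blast
  moreover have "inverse_rectify r l j0 X es = Some (?X', ?es')"
  proof -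
    let ?R = "insert (l, j1) X"
    have R: "is_graph ?R" using G j l_pos by (simp add: is_graph_insert)
    have "{(i, k) \<in> crossings ?R a ?b. l < i} = {(i, k) \<in> crossings X a ?b. l < i}"
      by (rule crossings_below_cong [OF R G]) (auto simp: rows_ge_def)
    also have "\<dots> = {(i, k)}" using ik by auto
    finally have on: "only {(i, k) \<in> crossings ?R a ?b. l < i} = Some (i, k)"
      by (simp add: only_eq_Some)
    have d: "?R - {(i, k)} = ?X'" using ik(1) by auto
    show ?thesis
    proof (cases "?y \<le> r")
      case True
      then show ?thesis using a(4) blue on d unfolding inverse_rectify_def lm by (simp add: Let_def)
    next
      case False
      then show ?thesis using a(5) blue on d unfolding inverse_rectify_def lm by (simp add: Let_def butlast_append)
    qed
  qed
  ultimately show ?thesis by blast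
qed

end

section \<open>Semi-shuffles along chains\<close>

lemma semi_shuffle_less:
  assumes "semi_shuffle r w" "r < i" "i < j" shows "w i < w j"
proof -
  have "Suc i \<le> j" using assms(3) by simp
  then show ?thesis
  proof (induction j rule: dec_induct)
    case base
    then show ?case using assms(1,2) by (simp add: semi_shuffle_def)
  next
    case (step n)
    then have "w n < w (n + 1)" using assms(1,2) unfolding semi_shuffle_def by simp
    then show ?case using step by simp
  qed
qed

text \<open>Only the blue neighbours of \<open>b\<close> matter. The right one exceeds the new,
  smaller value at \<open>b\<close>. The value of the left one is below \<open>w b\<close>, and the
  covering condition leaves none between \<open>w a\<close> and \<open>w b\<close>, so it is below
  \<open>w a\<close>, the new value at \<open>b\<close>.\<close>

lemma semi_shuffle_cover:
  assumes g: "generated w" and s: "semi_shuffle r w" and ab: "1 \<le> a" "a \<le> r" "r < b"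
    and len: "coxeter_length (w \<circ> transpose a b) = Suc (coxeter_length w)"
  shows "semi_shuffle r (w \<circ> transpose a b)"
proof -
  have lt: "w a < w b" using coxeter_length_transpose_less_iff [OF g ab(1), of b] ab len by simp
  have "w (transpose a b i) < w (transpose a b (Suc i))" if "r < i" for i
  proof -
    have step: "w i < w (Suc i)" using semi_shuffle_less [OF s that, of "Suc i"] by simp
    consider "i = b" | "Suc i = b" | "i \<noteq> b" "Suc i \<noteq> b" by blast
    then show ?thesis
    proof cases
      case 1
      then show ?thesis using ab step lt that by (simp add: transpose_def)
    next
      case 2
      then have "w i < w a \<or> w b < w i"
        using cover_between [OF g ab(1), of i b] that ab lt len by simp
      then show ?thesis using 2 ab step that by (auto simp: transpose_def)
    next
      case 3
      then show ?thesis using ab step that by (simp add: transpose_def)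
    qed
  qed
  then show ?thesis by (simp add: semi_shuffle_def)
qed

lemma semi_shuffle_chain:
  "generated w \<Longrightarrow> semi_shuffle r w \<Longrightarrow> chain r w es \<Longrightarrow> semi_shuffle r (w \<circ> trans_perm es)"
proof (induction es rule: rev_induct)
  case Nil
  then show ?case by simp
next
  case (snoc e es)
  obtain a b where e: "e = (a, b)" by (cases e)
  have c: "chain r w es" "1 \<le> a" "a \<le> r" "r < b"
    "coxeter_length (w \<circ> trans_perm es \<circ> transpose a b) = Suc (coxeter_length (w \<circ> trans_perm es))"
    using snoc.prems(3) e by (simp_all add: chain_snoc)
  then have "semi_shuffle r (w \<circ> trans_perm es \<circ> transpose a b)"
    using semi_shuffle_cover [OF chain_generated [OF snoc.prems(1) c(1)] _ c(2-5)] snoc by simp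
  then show ?case using e by (simp add: trans_perm_append comp_assoc del: comp_apply)
qed

context row_algorithm
begin

section \<open>The kinds of inverse steps\<close>

definition step_insert :: "graph \<Rightarrow> transpositions \<Rightarrow> graph \<Rightarrow> transpositions \<Rightarrow> nat \<Rightarrow> bool" where
  "step_insert X es X' es' j0 \<longleftrightarrow> start_row X es X' es' j0 \<and>
     (\<forall>j>j0. (l, j) \<notin> X' \<longrightarrow> r < L X' j \<longrightarrow> r < B X' j)"

text \<open>The last conjunct excludes the configuration of \<open>start_swap\<close>; the
  comparison of consecutive steps in a row depends on it.\<close>

definition step_trivial :: "graph \<Rightarrow> transpositions \<Rightarrow> graph \<Rightarrow> transpositions \<Rightarrow> nat \<Rightarrow> nat \<Rightarrow> bool" where
  "step_trivial X es X' es' c d \<longleftrightarrow> es = es' @ [(c, d)] \<and>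
     (\<exists>i k. l < i \<and> crossings X c d = {(i, k)} \<and> X' = X - {(i, k)}) \<and>
     \<not> (es' \<noteq> [] \<and> fst (last es') = c \<and> (\<exists>j. (l, j) \<in> X \<and> L X j = d \<and> B X j = snd (last es')))"

definition step_move ::
  "graph \<Rightarrow> transpositions \<Rightarrow> graph \<Rightarrow> transpositions \<Rightarrow> nat \<Rightarrow> nat \<Rightarrow> bool" where
  "step_move X es X' es' a b \<longleftrightarrow> (\<exists>X'' es'' j0 j1. (start_row X es X'' es'' j0 \<or> start_swap X es X'' es'' j0) \<and>
     found X'' es'' j0 j1 a X' es' \<and> b = L X'' j1)"

text \<open>In both kinds \<open>a\<close> and \<open>b\<close> are the strands whose crossing below
  row \<open>l\<close> disappears; they become an entry of the tableau of the next row.\<close>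

definition step_rectify ::
  "graph \<Rightarrow> transpositions \<Rightarrow> graph \<Rightarrow> transpositions \<Rightarrow> nat \<Rightarrow> nat \<Rightarrow> bool" where
  "step_rectify X es X' es' a b \<longleftrightarrow> step_trivial X es X' es' a b \<or> step_move X es X' es' a b"

lemma start_middle:
  assumes "package X es" "start_row X es X'' es'' j0 \<or> start_swap X es X'' es'' j0"
  shows "middle X'' es'' j0" "labels w es'' = butlast (labels w es)" "q X'' = q X" "\<And>j. B X'' j = B X j"
    "L X'' j0 = L X j0" "(l, j0) \<in> X" "X'' = X - {(l, j0)}"
proof -
  have "middle X'' es'' j0 \<and> labels w es'' = butlast (labels w es) \<and> q X'' = q X \<and> (\<forall>j. B X'' j = B X j) \<and>
    L X'' j0 = L X j0 \<and> (l, j0) \<in> X \<and> X'' = X - {(l, j0)}"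
    using assms(2)
  proof
    assume s: "start_row X es X'' es'' j0"
    then have "(l, j0) \<in> X \<and> X'' = X - {(l, j0)}" by (auto simp: start_row_def)
    then show ?thesis using start_row_middle [OF assms(1) s] by blast
  next
    assume s: "start_swap X es X'' es'' j0"
    then have "(l, j0) \<in> X \<and> X'' = X - {(l, j0)}" by (auto simp: start_swap_def)
    then show ?thesis using start_swap_middle [OF assms(1) s] by blast
  qed
  then show "middle X'' es'' j0" "labels w es'' = butlast (labels w es)" "q X'' = q X" "\<And>j. B X'' j = B X j"
    "L X'' j0 = L X j0" "(l, j0) \<in> X" "X'' = X - {(l, j0)}" by blast+
qed

lemma crossed_below:
  assumes rc: "rc_graph X" and ab: "1 \<le> a" "a < b" and c: "crossings X a b = {(i, k)}" and i: "l < i"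
  shows "q X b < q X a" "left_strand X i k = a" "below_strand X i k = b" "(i, k) \<in> X"
proof -
  have i1: "1 \<le> i" using i by simp
  from row_crossing_iff(2) [OF rc i1 ab, of k] c
  show "left_strand X i k = a" "below_strand X i k = b" "(i, k) \<in> X" by auto
  from row_crossing_iff(1) [OF rc i1 ab, of k] c
  have inv: "below_perm X i b < below_perm X i a" by auto
  have "Suc l \<le> i" using i by simp
  from this inv show "q X b < q X a"
  proof (induction i rule: dec_induct)
    case (step n)
    then show ?case using crossed_persists [OF rc _ ab(2), of n] by simp
  qed
qed

lemma trivial_effect:
  assumes P: "package X es" and s: "step_trivial X es X' es' c d"
  shows "package X' es'" "labels w es' = butlast (labels w es)" "q X d < q X c"
    "q X' = q X \<circ> transpose c d" "p X' = p X \<circ> transpose c d"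
    "\<And>j. L X' j = transpose c d (L X j)" "\<And>j. B X' j = transpose c d (B X j)"
    "\<And>j. (l, j) \<in> X' \<longleftrightarrow> (l, j) \<in> X"
proof -
  obtain i k where es: "es = es' @ [(c, d)]" and ik: "l < i" "crossings X c d = {(i, k)}" "X' = X - {(i, k)}"
    using s by (auto simp: step_trivial_def)
  have X: "is_graph X" and rc: "rc_graph X" using P package_graph package_rc by auto
  note last = package_last [OF P [unfolded es]]
  have cd: "c < d" using last by simp
  note cb = crossed_below [OF rc last(1) cd ik(2,1)]
  show "q X d < q X c" by (rule cb(1))
  note rem = below_perm_remove [OF X cb(4), unfolded cb(2,3), folded ik(3)]
  show "q X' = q X \<circ> transpose c d" using rem(1) [of "Suc l"] ik(1) by (simp del: comp_apply)
  show pX': "p X' = p X \<circ> transpose c d" using rem(1) [of l] ik(1) by (simp del: comp_apply)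
  show "L X' j = transpose c d (L X j)" for j using rem(2) [of l j] ik(1) by simp
  show "B X' j = transpose c d (B X j)" for j using rem(3) [of l j] ik(1) by simp
  show "(l, j) \<in> X' \<longleftrightarrow> (l, j) \<in> X" for j using ik(1,3) by auto
  have pw: "p X' = w \<circ> trans_perm es'" using pX' last(6) by (simp del: comp_apply)
  have X': "is_graph X'" using X ik(3) by (auto intro: is_graph_subset)
  have rows: "rows_ge X' l = X'" using P ik(3) by (auto simp: package_def rows_ge_def)
  have "Suc (card X') = card X" using card_Suc_Diff1 [OF is_graph_finite [OF X] cb(4)] ik(3) by simp
  then have "card X' = coxeter_length (p X')"
    using package_card [OF P] es chain_length [OF last(5)] pw by simp
  then have "rc_graph X'" using X' graph_perm_below [OF rows] by (simp add: rc_graph_def)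
  then show "package X' es'" using rows pw last(5) by (simp add: package_def)
  show "labels w es' = butlast (labels w es)" using es by (simp add: labels_snoc)
qed

lemma move_effect:
  assumes P: "package X es" and s: "step_move X es X' es' a b"
  shows "package X' es'" "labels w es' = butlast (labels w es)" "q X b < q X a" "q X' = q X \<circ> transpose a b"
    "1 \<le> a" "a \<le> r" "r < b"
proof -
  obtain X'' es'' j0 j1 where st: "start_row X es X'' es'' j0 \<or> start_swap X es X'' es'' j0"
    and f: "found X'' es'' j0 j1 a X' es'" and b: "b = L X'' j1"
    using s by (auto simp: step_move_def)
  note m = start_middle [OF P st]
  note e = found_effect [OF m(1) f]
  show "package X' es'" by (rule e(5))
  show "labels w es' = butlast (labels w es)" using e(6) m(2) by simp
  show "q X b < q X a" "q X' = q X \<circ> transpose a b" using e(1,8) m(3) b by simp_all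
  show "1 \<le> a" "a \<le> r" "r < b" using f b by (auto simp: found_def)
qed

text \<open>What the next row sees of a rectification: one crossing of \<open>a\<close> and
  \<open>b\<close> fewer in the rows \<open>> l\<close>, and \<open>q X b < q X a\<close>. Read
  backwards this is a link of a Bruhat chain for the lower rows. The crossing is described inside
  \<open>rows_ge X (Suc l)\<close> because \<open>unwind\<close> works on that graph.\<close>

lemma rectify_effect:
  assumes P: "package X es" and s: "step_rectify X es X' es' a b"
  shows "package X' es'" "labels w es' = butlast (labels w es)" "q X b < q X a" "q X' = q X \<circ> transpose a b"
    "1 \<le> a" "a \<le> r" "r < b"
    "\<exists>i k. l < i \<and> (i, k) \<in> X \<and> crossings (rows_ge X (Suc l)) a b = {(i, k)} \<and>
       rows_ge X' (Suc l) = rows_ge X (Suc l) - {(i, k)}"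
proof -
  show *: "package X' es'" "labels w es' = butlast (labels w es)" "q X b < q X a" "q X' = q X \<circ> transpose a b"
    "1 \<le> a" "a \<le> r" "r < b"
  proof -
    have "package X' es' \<and> labels w es' = butlast (labels w es) \<and> q X b < q X a \<and>
      q X' = q X \<circ> transpose a b \<and> 1 \<le> a \<and> a \<le> r \<and> r < b"
      using s unfolding step_rectify_def
    proof
      assume t: "step_trivial X es X' es' a b"
      then have "es = es' @ [(a, b)]" by (simp add: step_trivial_def)
      then show ?thesis using trivial_effect(1-4) [OF P t] package_last(1-3) [of X es' a b] P by blast
    next
      assume t: "step_move X es X' es' a b"
      then show ?thesis using move_effect [OF P t] by blast
    qed
    then show "package X' es'" "labels w es' = butlast (labels w es)" "q X b < q X a"
      "q X' = q X \<circ> transpose a b" "1 \<le> a" "a \<le> r" "r < b" by blast+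
  qed
  have X: "is_graph X" using P package_graph by simp
  have eq: "{(i, k) \<in> crossings (rows_ge X (Suc l)) a b. l < i} = {(i, k) \<in> crossings X a b. l < i}"
    by (rule crossings_below_cong [OF is_graph_rows_ge [OF X] X]) (simp add: rows_ge_rows_ge)
  have low: "{(i, k) \<in> crossings (rows_ge X (Suc l)) a b. l < i} = crossings (rows_ge X (Suc l)) a b"
    by (auto simp: crossings_def h_crossings_def rows_ge_def)
  have ab: "a < b" using * by simp
  have fin: "crossings (rows_ge X (Suc l)) a b = {(i, k)}" if "l < i" "crossings X a b = {(i, k)}" for i k
    using eq low that by auto
  show "\<exists>i k. l < i \<and> (i, k) \<in> X \<and> crossings (rows_ge X (Suc l)) a b = {(i, k)} \<and>
       rows_ge X' (Suc l) = rows_ge X (Suc l) - {(i, k)}"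
  proof (cases "step_trivial X es X' es' a b")
    case True
    then obtain i k where ik: "l < i" "crossings X a b = {(i, k)}" "X' = X - {(i, k)}"
      by (auto simp: step_trivial_def)
    then have "(i, k) \<in> X" using crossed_below(4) [OF package_rc [OF P] *(5) ab] by blast
    moreover have "rows_ge X' (Suc l) = rows_ge X (Suc l) - {(i, k)}" using ik by (auto simp: rows_ge_def)
    ultimately show ?thesis using fin ik by blast
  next
    case False
    then have "step_move X es X' es' a b" using s by (simp add: step_rectify_def)
    then obtain X'' es'' j0 j1 where st: "start_row X es X'' es'' j0 \<or> start_swap X es X'' es'' j0"
      and f: "found X'' es'' j0 j1 a X' es'" and b: "b = L X'' j1"
      by (auto simp: step_move_def)
    note m = start_middle [OF P st]
    obtain i k where ik: "l < i" "(i, k) \<in> X''" "crossings X'' a b = {(i, k)}"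
      "X' = insert (l, j1) (X'' - {(i, k)})"
      using f b by (auto simp: found_def)
    have "rows_ge X'' (Suc l) = rows_ge X (Suc l)" using m(7) by (auto simp: rows_ge_def)
    then have "{(i, k) \<in> crossings X'' a b. l < i} = {(i, k) \<in> crossings X a b. l < i}"
      using crossings_below_cong [OF middle_facts(2) [OF m(1)] X] by simp
    then have "crossings (rows_ge X (Suc l)) a b = {(i, k)}" using eq low ik(1,3) by auto
    moreover have "rows_ge X' (Suc l) = rows_ge X (Suc l) - {(i, k)}"
      unfolding ik(4) m(7) using ik(1) by (auto simp: rows_ge_def)
    moreover have "(i, k) \<in> X" using ik(2) m(7) by simp
    ultimately show ?thesis using ik(1) by blast
  qed
qed

lemma insert_effect:
  assumes P: "package X es" and s: "step_insert X es X' es' j0"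
  shows "package X' es'" "labels w es' = butlast (labels w es)" "rows_ge X' (Suc l) = rows_ge X (Suc l)"
proof -
  have st: "start_row X es X' es' j0" using s by (simp add: step_insert_def)
  show "package X' es'" using middle_facts(1) [OF start_row_middle(1) [OF P st]] .
  show "labels w es' = butlast (labels w es)" using start_row_middle(2) [OF P st] .
  show "rows_ge X' (Suc l) = rows_ge X (Suc l)" using st by (auto simp: start_row_def rows_ge_def)
qed

text \<open>The step is always defined. What has to be excluded is a scan without a stopping place
  after the configuration of \<open>start_swap\<close>: there the red strand of the last box leaves
  the row further right than the removed crossing, so \<open>no_red_exit\<close> would make it
  blue.\<close>

lemma inverse_step_cases:
  assumes P: "package X es" and ne: "es \<noteq> []"
  obtains (insertion) X' es' j0 where
      "inverse_step r l (X, es) = Some ((X', es'), False)" "step_insert X es X' es' j0"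
    | (rectification) X' es' a b where
      "inverse_step r l (X, es) = Some ((X', es'), True)" "step_rectify X es X' es' a b"
proof -
  obtain c d where "last es = (c, d)" by (cases "last es")
  then obtain es0 where es: "es = es0 @ [(c, d)]" using ne by (metis append_butlast_last_id)
  have X: "is_graph X" and rc: "rc_graph X" using P package_graph package_rc by auto
  note last = package_last [OF P [unfolded es]]
  have cd: "c < d" using last by simp
  obtain i k where ik: "l \<le> i" "crossings X c d = {(i, k)}"
    using crossings_single [OF rc l_pos last(1) cd last(9)] by blast
  have on: "only (crossings X c d) = Some (i, k)" using ik by (simp add: only_eq_Some)
  show thesis
  proof (cases "i = l")
    case True
    let ?X = "X - {(l, k)}"
    have lk: "(l, k) \<in> X" "L X k = c" "B X k = d"
      using row_crossing_iff(2) [OF rc l_pos last(1) cd, of k] ik True by auto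
    have st: "start_row X es ?X es0 k" using lk es by (auto simp: start_row_def)
    note m = start_row_middle(1) [OF P st]
    note G = middle_facts(2) [OF m]
    have ex: "(\<exists>j b a. free_place ?X l j b a \<and> k < j \<and> a \<le> r \<and> r < b) \<longleftrightarrow>
        (\<exists>j>k. (l, j) \<notin> ?X \<and> r < L ?X j \<and> B ?X j \<le> r)"
      using free_place_iff [OF G l_pos] by auto
    show thesis
    proof (cases "\<exists>j>k. (l, j) \<notin> ?X \<and> r < L ?X j \<and> B ?X j \<le> r")
      case True
      from inverse_rectify_found [OF m True] obtain j1 a X' es'
        where f: "found ?X es0 k j1 a X' es'" "inverse_rectify r l k ?X es0 = Some (X', es')" by blast
      have "(\<exists>j b a. free_place ?X l j b a \<and> k < j \<and> a \<le> r \<and> r < b) = True"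
        using ex True by blast
      then have "inverse_step r l (X, es) = Some ((X', es'), True)"
        unfolding inverse_step_def using es on \<open>i = l\<close> f(2) by (simp add: Let_def)
      moreover have "step_rectify X es X' es' a (L ?X j1)"
        using st f(1) by (auto simp: step_rectify_def step_move_def)
      ultimately show thesis using that(2) by blast
    next
      case False
      then have "(\<exists>j b a. free_place ?X l j b a \<and> k < j \<and> a \<le> r \<and> r < b) = False"
        using ex by blast
      then have "inverse_step r l (X, es) = Some ((?X, es0), False)"
        unfolding inverse_step_def using es on \<open>i = l\<close> by (auto simp: Let_def)
      moreover have "step_insert X es ?X es0 k"
        using st False by (auto simp: step_insert_def not_le)
      ultimately show thesis using that(1) by blast
    qed
  next
    case False
    then have i: "l < i" using ik by simp
    show thesis
    proof (cases "es0 \<noteq> [] \<and> fst (last es0) = c \<and> (\<exists>j. (l, j) \<in> X \<and> L X j = d \<and> B X j = snd (last es0))")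
      case True
      then obtain j where j: "(l, j) \<in> X" "L X j = d" "B X j = snd (last es0)" by blast
      obtain f where "last es0 = (c, f)" using True by (metis prod.collapse)
      then obtain es1 where es0: "es0 = es1 @ [(c, f)]" using True by (metis append_butlast_last_id)
      let ?X = "X - {(l, j)}" and ?es = "es1 @ [(c, d)]"
      have st: "start_swap X es ?X ?es j"
        unfolding start_swap_def using es es0 j crossed_below(1) [OF rc last(1) cd ik(2) i] by auto
      note m = start_swap_middle(1) [OF P st]
      note G = middle_facts(2) [OF m] and P'' = middle_facts(1) [OF m]
      have pd: "Suc (p ?X d) = l + j"
        using exit_free [OF G middle_facts(4,5) [OF m]] start_swap_middle(4) [OF P st] by simp
      have ex: "\<exists>k>j. (l, k) \<notin> ?X \<and> r < L ?X k \<and> B ?X k \<le> r"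
      proof (rule ccontr)
        assume none: "\<not> ?thesis"
        have "l + j \<le> p ?X c" using package_last(9) [OF P''] pd by simp
        then have "r < c"
          using no_red_exit [OF middle_facts(3,4,8) [OF m]] none not_le by metis
        then show False using last(2) by simp
      qed
      from inverse_rectify_found [OF m ex] obtain j1 a X' es'
        where f: "found ?X ?es j j1 a X' es'" "inverse_rectify r l j ?X ?es = Some (X', es')" by blast
      have h: "(l, j') \<in> h_crossings X d (snd (last es0)) \<longleftrightarrow> j' = j" for j'
        unfolding h_crossings_eq [OF X] using j below_strand_inj [OF X, of l j' j] by auto
      have on1: "only {j'. (l, j') \<in> h_crossings X d (snd (last es0))} = Some j"
        unfolding h by (simp add: only_eq_Some)
      have "inverse_step r l (X, es) = Some ((X', es'), True)"
        unfolding inverse_step_def using es es0 on i f(2) True h on1 by (auto simp: butlast_append)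
      moreover have "step_rectify X es X' es' a (L ?X j1)"
        using st f(1) by (auto simp: step_rectify_def step_move_def)
      ultimately show thesis using that(2) by blast
    next
      case False
      have "\<not> (es0 \<noteq> [] \<and> fst (last es0) = c \<and> (\<exists>j. (l, j) \<in> h_crossings X d (snd (last es0))))"
        unfolding h_crossings_eq [OF X] using False by auto
      then have "inverse_step r l (X, es) = Some ((X - {(i, k)}, es0), True)"
        unfolding inverse_step_def using es on i by auto
      moreover have "step_rectify X es (X - {(i, k)}) es0 c d"
        unfolding step_rectify_def step_trivial_def using es i ik(2) False by blast
      ultimately show thesis using that(2) by blast
    qed
  qed
qed

text \<open>Since the inverse scan met no stopping place, all strands arriving from the left beyond
  \<open>j0\<close> are blue; hence \<open>j0\<close> is the rightmost place where an insertion is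
  allowed.\<close>

lemma insert_step_inverse:
  assumes P: "package X es" and s: "step_insert X es X' es' j0"
  shows "insert_step r l (X', es') = Some (X, es)"
proof -
  have st: "start_row X es X' es' j0" using s by (simp add: step_insert_def)
  obtain c d where cd: "es = es' @ [(c, d)]" "(l, j0) \<in> X" "L X j0 = c" "B X j0 = d" "X' = X - {(l, j0)}"
    using st by (auto simp: start_row_def)
  note m = start_row_middle [OF P st]
  note G = middle_facts(2) [OF m(1)]
  have L: "r < L X' j" if "j0 < j" for j
    using blue_tail(1) [OF G middle_facts(4,8) [OF m(1)] _ middle_facts(3) [OF m(1)], of j j] s that
    by (auto simp: step_insert_def)
  have "rightmost {(j, c, d). free_place X' l j c d \<and> c \<le> r \<and> r < d} = Some (j0, c, d)"
  proof (rule rightmostI)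
    show "(j0, c, d) \<in> {(j, c, d). free_place X' l j c d \<and> c \<le> r \<and> r < d}"
      using free_place_iff [OF G l_pos] middle_facts(4,5,6) [OF m(1)] m(3,4,7) cd(3,4) by simp
  next
    fix j y
    assume "(j, y) \<in> {(j, c, d). free_place X' l j c d \<and> c \<le> r \<and> r < d}"
    then have "L X' j \<le> r" using free_place_iff [OF G l_pos] by auto
    then show "j \<le> j0" using L [of j] by fastforce
  next
    fix y
    assume "(j0, y) \<in> {(j, c, d). free_place X' l j c d \<and> c \<le> r \<and> r < d}"
    then show "y = (c, d)" using free_place_iff [OF G l_pos] m(4,7) cd(3,4) by (cases y) simp
  qed
  moreover have "insert (l, j0) X' = X" using cd(2,5) by auto
  ultimately show ?thesis unfolding insert_step_def using cd(1) by simp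
qed

section \<open>Comparison of consecutive steps\<close>

lemma last_label:
  assumes "package X es" "es \<noteq> []"
  shows "last (labels w es) = p X (snd (last es))"
proof -
  obtain c d where "last es = (c, d)" by (cases "last es")
  then have es: "es = butlast es @ [(c, d)]" using assms(2) by (metis append_butlast_last_id)
  have "labels w es = labels w (butlast es) @ [w (trans_perm (butlast es) c)]"
    by (subst es) (rule labels_snoc)
  moreover have "p X d = w (trans_perm (butlast es) c)"
    using package_last(7) [of X "butlast es" c d] assms(1) es by simp
  ultimately show ?thesis using \<open>last es = (c, d)\<close> by simp
qed

text \<open>If the last pair crosses in row \<open>l\<close>, its label gives the column: the
  vertical strand leaves with the value \<open>l + j0 - 1\<close>, and this value is the
  label.\<close>

lemma start_row_last:
  assumes P: "package X es" and s: "start_row X es X'' es'' j0"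
  shows "es \<noteq> []" "(l, j0) \<in> X" "L X j0 = fst (last es)" "B X j0 = snd (last es)"
    "Suc (last (labels w es)) = l + j0"
proof -
  show es: "es \<noteq> []" "(l, j0) \<in> X" "L X j0 = fst (last es)" "B X j0 = snd (last es)"
    using s by (auto simp: start_row_def)
  show "Suc (last (labels w es)) = l + j0"
    using last_label [OF P es(1)] exit_crossing [OF package_graph [OF P] es(2,4)] by simp
qed

text \<open>Here the last label only bounds the start of the scan, but the label of the box before
  it determines the start: once the crossing is removed, the blue strand now in that box leaves at
  \<open>j0\<close>.\<close>

lemma start_swap_last:
  assumes P: "package X es" and s: "start_swap X es X'' es'' j0"
  shows "es \<noteq> []" "(l, j0) \<in> X" "L X j0 = snd (last es)" "q X (snd (last es)) < q X (fst (last es))"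
    "l + j0 \<le> Suc (last (labels w es))" "Suc (last (labels w es'')) = l + j0" "r < snd (last es)"
proof -
  show es: "es \<noteq> []" "(l, j0) \<in> X" "L X j0 = snd (last es)" "q X (snd (last es)) < q X (fst (last es))"
    using s by (auto simp: start_swap_def)
  note m = start_swap_middle [OF P s]
  have "1 \<le> j0" using middle_facts(4) [OF m(1)] .
  then show "l + j0 \<le> Suc (last (labels w es))"
    using last_label [OF P es(1)] L_D [OF package_graph [OF P] _ es(3)] by simp
  show "Suc (last (labels w es'')) = l + j0"
    using last_label [OF middle_facts(1) [OF m(1)] m(3)]
      exit_free [OF middle_facts(2) [OF m(1)] middle_facts(4,5) [OF m(1)] m(4)] by simp
  show "r < snd (last es)" using m(6) es(3) by simp
qed

lemma start_position:
  assumes P: "package X es" and s: "start_row X es X'' es'' j0 \<or> start_swap X es X'' es'' j0"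
  shows "(l, j0) \<in> X" "l + j0 \<le> Suc (last (labels w es))" "es \<noteq> []"
  using s start_row_last [OF P, of X'' es'' j0] start_swap_last [OF P, of X'' es'' j0] by auto

lemma move_start:
  assumes P: "package X es" and s: "step_move X es X' es' a b"
  obtains X'' es'' j0 j1 where "start_row X es X'' es'' j0 \<or> start_swap X es X'' es'' j0"
    "middle X'' es'' j0" "found X'' es'' j0 j1 a X' es'" "b = L X'' j1" "q X'' = q X"
    "\<And>j. B X'' j = B X j" "l + j0 \<le> q X b" "q X b < l + j1"
proof -
  obtain X'' es'' j0 j1 where st: "start_row X es X'' es'' j0 \<or> start_swap X es X'' es'' j0"
    and f: "found X'' es'' j0 j1 a X' es'" and b: "b = L X'' j1"
    using s by (auto simp: step_move_def)
  note m = start_middle [OF P st]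
  have "j0 < j1" using f by (simp add: found_def)
  from cursor_entry [OF m(1) this] m(3) b
  have "l + j0 \<le> q X b" "q X b < l + j1" by simp_all
  then show thesis using that [OF st m(1) f b m(3) m(4)] by blast
qed

lemma blue_enters: "is_graph X \<Longrightarrow> r < s \<Longrightarrow> l < q X s"
  using below_perm_ge [of X "Suc l" s] l_le_r by simp

lemma insert_stop:
  assumes P: "package X es" and s: "step_insert X es X' es' j0" and j: "j0 < j" shows "r < B X j"
proof -
  have st: "start_row X es X' es' j0" using s by (simp add: step_insert_def)
  note m = start_row_middle [OF P st]
  have "r < B X' j"
    using blue_tail(2) [OF middle_facts(2,4,8) [OF m(1)] _ middle_facts(3) [OF m(1)], of "Suc j" j] s j
    by (auto simp: step_insert_def)
  then show ?thesis using m(7) by simp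
qed

lemma move_stop:
  assumes m: "middle X'' es'' j0" and f: "found X'' es'' j0 j1 a X' es'" and j: "j0 < j" "B X'' j \<le> r"
  shows "j1 \<le> j"
  using found_tail(2) [OF m f j(1)] j(2) by fastforce

text \<open>After a rectification the red strand \<open>a\<close> enters the row where \<open>b\<close> entered it before. It stops
  the next scan if that scan starts further left.\<close>

lemma row_stop:
  assumes P': "package X' es'" and es': "es' \<noteq> []" and a: "B X' j \<le> r"
    and x: "Suc (last (labels w es')) \<le> l + j" and free: "(l, j) \<notin> X' \<or> Suc (last (labels w es')) < l + j"
  shows "\<not> step_insert X' es' X2 es2 k" and "step_rectify X' es' X2 es2 a2 b2 \<Longrightarrow> q X' b2 < l + j"
proof -
  have G: "is_graph X'" using P' by (rule package_graph)
  have start: "k < j" if "start_row X' es' X'' es'' k \<or> start_swap X' es' X'' es'' k" for X'' es'' k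
  proof -
    have "l + k \<le> l + j" "(l, k) \<in> X'" using start_position [OF P' that] x by simp_all
    then show ?thesis using free start_position(2) [OF P' that] by (cases "k = j") auto
  qed
  show "\<not> step_insert X' es' X2 es2 k"
    using start [of X2 es2 k] insert_stop [OF P', of X2 es2 k j] a by (auto simp: step_insert_def)
  assume s: "step_rectify X' es' X2 es2 a2 b2"
  show "q X' b2 < l + j"
  proof (cases "step_move X' es' X2 es2 a2 b2")
    case True
    then obtain X'' es'' k j1 where st: "start_row X' es' X'' es'' k \<or> start_swap X' es' X'' es'' k"
      and m: "middle X'' es'' k" and f: "found X'' es'' k j1 a2 X2 es2" and B: "\<And>j. B X'' j = B X' j"
      and v: "q X' b2 < l + j1"
      using move_start [OF P' True] by metis
    have "j1 \<le> j" using move_stop [OF m f start [OF st]] B a by simp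
    then show ?thesis using v by simp
  next
    case False
    then have "step_trivial X' es' X2 es2 a2 b2" using s by (simp add: step_rectify_def)
    then have e: "es' = es2 @ [(a2, b2)]" by (simp add: step_trivial_def)
    then have "q X' b2 \<le> Suc (last (labels w es'))" using q_le_p [OF G, of b2] last_label [OF P' es'] by simp
    moreover have "r < b2" using package_last(3) [of X' es2 a2 b2] P' e by simp
    then have "q X' b2 \<noteq> l + j" using B_I [OF G, of b2 j] a by auto
    ultimately show ?thesis using x by simp
  qed
qed

text \<open>Where \<open>b\<close> entered the row, \<open>a\<close> enters afterwards. The place is
  free because at a crossing \<open>b\<close> would have left at once and not reached
  \<open>j1\<close>.\<close>

lemma move_landing:
  assumes P: "package X es" and s: "step_move X es X' es' a b"
  shows "B X' (q X b - l) = a" "(l, q X b - l) \<notin> X'" "l < q X b"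
proof -
  obtain X'' es'' j0 j1 where st: "start_row X es X'' es'' j0 \<or> start_swap X es X'' es'' j0"
    and m: "middle X'' es'' j0" and f: "found X'' es'' j0 j1 a X' es'" and b: "b = L X'' j1"
    and qq: "q X'' = q X" and v: "l + j0 \<le> q X b" "q X b < l + j1"
    using move_start [OF P s] by metis
  note e = found_effect [OF m f] and G = middle_facts(2) [OF m]
  let ?j = "q X b - l"
  show "l < q X b" using v(1) middle_facts(4) [OF m] by simp
  then have j: "q X b = l + ?j" by simp
  have Bb: "B X'' ?j = b" using B_I [OF G, of b ?j] qq j by simp
  then show "B X' ?j = a" using e(2) [of ?j] b by simp
  have j1: "1 \<le> j1" "(l, j1) \<notin> X''" using f by (auto simp: found_def)
  have "(l, ?j) \<notin> X''"
  proof
    assume "(l, ?j) \<in> X''"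
    then have "Suc (p X'' b) = l + ?j" using exit_crossing [OF G _ Bb] by simp
    then show False using exit_free [OF G j1 b [symmetric]] v(2) j by simp
  qed
  then show "(l, ?j) \<notin> X'" using e(4) [of ?j] v by auto
qed

text \<open>Red \<open>a\<close> now enters the row at the column \<open>j\<close> where
  \<open>b\<close> used to enter, and it stops any scan that starts left of \<open>j\<close>. The
  smaller label makes the next scan start there, except possibly after a trivial step, when
  \<open>a\<close> runs to the right from the free place \<open>(l, j)\<close>. To start on that
  run, the next scan would need the configuration of an exchange in the step before, which
  \<open>step_trivial\<close> excludes.\<close>

lemma row_consecutive:
  assumes P: "package X es" and s: "step_rectify X es X' es' a b" and es': "es' \<noteq> []"
    and xy: "last (labels w es') < last (labels w es)"
  shows "\<not> step_insert X' es' X2 es2 k" and "step_rectify X' es' X2 es2 a2 b2 \<Longrightarrow> q X' b2 < q X b"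
proof -
  note eff = rectify_effect [OF P s]
  have G: "is_graph X" and G': "is_graph X'" and rc: "rc_graph X" and rc': "rc_graph X'"
    using P eff(1) package_graph package_rc by auto
  note P' = eff(1)
  define j where "j = q X b - l"
  have j: "q X b = l + j" "1 \<le> j" using blue_enters [OF G eff(7)] by (simp_all add: j_def)
  have qa: "q X' a = l + j" using eff(4) j by simp
  have Ba: "B X' j = a" using B_I [OF G' qa] .
  let ?x = "last (labels w es')" and ?y = "last (labels w es)"
  have "\<not> step_insert X' es' X2 es2 k \<and> (step_rectify X' es' X2 es2 a2 b2 \<longrightarrow> q X' b2 < l + j)"
  proof (cases "step_move X es X' es' a b")
    case True
    then obtain X'' es'' j0 j1 where st: "start_row X es X'' es'' j0 \<or> start_swap X es X'' es'' j0"
      and m: "middle X'' es'' j0" and f: "found X'' es'' j0 j1 a X' es'" and v: "l + j0 \<le> q X b"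
      using move_start [OF P] by metis
    have "(l, j) \<notin> X'" using move_landing(2) [OF P True] j by simp
    moreover have "Suc ?x \<le> l + j"
    proof (cases "start_row X es X'' es'' j0")
      case True
      then show ?thesis using start_row_last(5) [OF P True] xy v j by simp
    next
      case False
      then have "start_swap X es X'' es'' j0" using st by simp
      then show ?thesis using start_swap_last(6) [OF P] found_effect(6) [OF m f] v j by simp
    qed
    ultimately show ?thesis using row_stop [OF P' es', of j] Ba eff(6) by blast
  next
    case False
    then have t: "step_trivial X es X' es' a b" using s by (simp add: step_rectify_def)
    then have es: "es = es' @ [(a, b)]"
      and nt: "\<not> (fst (last es') = a \<and> (\<exists>j. (l, j) \<in> X \<and> L X j = b \<and> B X j = snd (last es')))"
      using es' by (auto simp: step_trivial_def)
    note T = trivial_effect [OF P t]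
    note last = package_last [OF P [unfolded es]]
    have y: "?y = p X b" using last_label [OF P] es by simp
    have pa: "p X' a = ?y" "p X' b = p X a" using T(5) y by simp_all
    have LX: "L X k = transpose a b (L X' k)" for k using T(6) [of k] by simp
    have BX: "B X k = transpose a b (B X' k)" for k using T(7) [of k] by simp
    show ?thesis
    proof (cases "(l, j) \<in> X'")
      case True
      then have "Suc ?y = l + j" using exit_crossing [OF G' True Ba] pa by simp
      then show ?thesis using row_stop [OF P' es', of j] Ba eff(6) xy by simp
    next
      case free: False
      \<comment> \<open>From the free place \<open>(l, j)\<close> strand \<open>a\<close> runs
        horizontally until it leaves with the value \<open>?y\<close>.\<close>
      have La: "L X' k = a" if "j < k" "l + k \<le> Suc ?y" for k
        using L_I [OF G', of k a] qa pa that by simp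
      have cross: "L X k = b \<and> B X k = B X' k \<and> b < B X k \<and> (l, k) \<in> X" if "j < k" "l + k \<le> Suc ?y" "(l, k) \<in> X'" for k
      proof -
        have Lk: "L X k = b" using LX [of k] La [OF that(1,2)] by simp
        have k: "(l, k) \<in> X" using T(8) that(3) by simp
        have lt: "b < B X k" using rc_graph_crossing [OF rc k] Lk by simp
        have "B X' k \<noteq> b" using BX [of k] lt last(2,3) by (auto simp: transpose_def)
        moreover have "B X' k \<noteq> a" using Ba below_strand_inj [OF G', of l k j] that(1) by auto
        ultimately show ?thesis using Lk k lt BX [of k] by (simp add: transpose_def)
      qed
      have no_late: "\<not> j < k" if st: "start_row X' es' X'' es'' k \<or> start_swap X' es' X'' es'' k" for X'' es'' k
      proof
        assume jk: "j < k"
        note pos = start_position [OF P' st]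
        have lk: "l + k \<le> Suc ?y" using pos(2) xy by simp
        have Lk: "L X' k = a" using La [OF jk lk] .
        note cr = cross [OF jk lk pos(1)]
        show False
        proof (cases "start_row X' es' X'' es'' k")
          case True
          from start_row_last [OF P' True] Lk cr nt show False by auto
        next
          case False
          then have "start_swap X' es' X'' es'' k" using st by simp
          from start_swap_last(3,7) [OF P' this] Lk eff(6) show False by simp
        qed
      qed
      have "k < j \<or> k = j" if "start_row X' es' X'' es'' k \<or> start_swap X' es' X'' es'' k" for X'' es'' k
        using no_late [OF that] by auto
      then have start: "k < j" if "start_row X' es' X'' es'' k \<or> start_swap X' es' X'' es'' k" for X'' es'' k
        using that start_position(1) [OF P' that] free by fastforce
      have "\<not> step_insert X' es' X2 es2 k"
        using start [of X2 es2 k] insert_stop [OF P', of X2 es2 k j] Ba eff(6) by (auto simp: step_insert_def)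
      moreover have "q X' b2 < l + j" if s2: "step_rectify X' es' X2 es2 a2 b2"
      proof (cases "step_move X' es' X2 es2 a2 b2")
        case True
        then obtain X'' es'' k j1 where st: "start_row X' es' X'' es'' k \<or> start_swap X' es' X'' es'' k"
          and m: "middle X'' es'' k" and f: "found X'' es'' k j1 a2 X2 es2" and B: "\<And>j. B X'' j = B X' j"
          and v: "q X' b2 < l + j1"
          using move_start [OF P' True] by metis
        have "j1 \<le> j" using move_stop [OF m f start [OF st]] B Ba eff(6) by simp
        then show ?thesis using v by simp
      next
        case False
        then have t2: "step_trivial X' es' X2 es2 a2 b2" using s2 by (simp add: step_rectify_def)
        then have es2: "es' = es2 @ [(a2, b2)]" by (simp add: step_trivial_def)
        note last2 = package_last [OF P' [unfolded es2]]
        have x: "p X' b2 = ?x" using last_label [OF P' es'] es2 by simp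
        show ?thesis
        proof (rule ccontr)
          assume "\<not> ?thesis"
          moreover have "b2 \<noteq> a" using last2(3) eff(6) by simp
          then have "q X' b2 \<noteq> l + j" using qa q_inj [OF G', of b2 a] by simp
          ultimately have gt: "l + j < q X' b2" by simp
          define k where "k = q X' b2 - l"
          have k: "q X' b2 = l + k" "j < k" using gt by (simp_all add: k_def)
          have Bk: "B X' k = b2" using B_I [OF G' k(1)] .
          have kx: "l + k \<le> Suc ?x" using q_le_p [OF G', of b2] k x by simp
          then have ky: "l + k \<le> Suc ?y" using xy by simp
          have Lk: "L X' k = a" using La [OF k(2) ky] .
          have k1: "1 \<le> k" using k(2) by simp
          have inX': "(l, k) \<in> X'"
            using exit_free [OF G' k1 _ Lk] pa kx xy by fastforce
          note cr = cross [OF k(2) ky inX']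
          \<comment> \<open>With \<open>a2 = a\<close> this crossing of \<open>b\<close> and
            \<open>b2\<close> would be the exchange configuration in \<open>X\<close>. The covering
            conditions then make \<open>a2\<close> leave before \<open>a\<close>, so it enters on
            the run of \<open>a\<close> and crosses it; but by \<open>cross\<close> every vertical
            strand on that run is larger than \<open>b\<close>, hence blue.\<close>
          have a2: "a2 \<noteq> a" using nt cr Bk es2 by auto
          have u: "p X' a2 < ?y"
          proof (cases a2 a rule: linorder_cases)
            case less
            moreover have "a < b2" using last2(3) eff(6) by simp
            ultimately show ?thesis using last2(10) [of a] pa x xy by simp
          next
            case equal
            then show ?thesis using a2 by simp
          next
            case greater
            have b: "a2 < b" "b < b2" using last2(2) last(3) cr Bk by simp_all
            then have "p X' a2 < p X a" using last2(10) [of b] pa x xy last(9) y by simp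
            moreover have "p X a2 = p X' a2" using T(5) a2 b by (simp add: transpose_def)
            ultimately show ?thesis using last(10) [of a2] greater b y by auto
          qed
          define h where "h = q X' a2 - l"
          have "q X' b2 < q X' a2" using trivial_effect(3) [OF P' t2] .
          then have h: "q X' a2 = l + h" "j < h" using k by (simp_all add: h_def)
          have hu: "l + h \<le> Suc (p X' a2)" using q_le_p [OF G', of a2] h by simp
          then have hy: "l + h \<le> Suc ?y" using u by simp
          have Lh: "L X' h = a" using La [OF h(2) hy] .
          have h1: "1 \<le> h" using h(2) by simp
          have "(l, h) \<in> X'"
            using exit_free [OF G' h1 _ Lh] pa hu u by fastforce
          then have "b < B X' h" using cross [OF h(2) hy] by simp
          moreover have "B X' h = a2" using B_I [OF G' h(1)] .
          ultimately show False using last2(2) last(3) by simp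
        qed
      qed
      ultimately show ?thesis by blast
    qed
  qed
  then show "\<not> step_insert X' es' X2 es2 k" "step_rectify X' es' X2 es2 a2 b2 \<Longrightarrow> q X' b2 < q X b"
    using j by simp_all
qed

end

text \<open>The label of a box \<open>(a b)\<close> is the old value of \<open>a\<close>, which the
  transposition raises, and later transpositions never lower the value of a red strand.\<close>

lemma chain_red_above:
  assumes "generated w" "chain r w es" "z \<in> set (labels w es)"
  shows "\<exists>s. s \<le> r \<and> z < w (trans_perm es s)"
  using assms(2,3)
proof (induction es rule: rev_induct)
  case Nil
  then show ?case by (simp add: labels_def)
next
  case (snoc e es)
  obtain a b where e: "e = (a, b)" by (cases e)
  have c: "chain r w es" "1 \<le> a" "a \<le> r" "r < b"
    "coxeter_length (w \<circ> trans_perm es \<circ> transpose a b) = Suc (coxeter_length (w \<circ> trans_perm es))"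
    using snoc.prems(1) e by (simp_all add: chain_snoc)
  have lt: "w (trans_perm es a) < w (trans_perm es b)"
    using coxeter_length_transpose_less_iff [OF chain_generated [OF assms(1) c(1)] c(2), of b] c by simp
  have new: "w (trans_perm (es @ [e]) a) = w (trans_perm es b)"
    using e by (simp add: trans_perm_append)
  have "z = w (trans_perm es a) \<or> z \<in> set (labels w es)"
    using snoc.prems(2) e by (auto simp: labels_snoc)
  then show ?case
  proof
    assume "z = w (trans_perm es a)"
    then show ?thesis using lt new c(3) by metis
  next
    assume "z \<in> set (labels w es)"
    then obtain s where s: "s \<le> r" "z < w (trans_perm es s)" using snoc.IH c(1) by blast
    show ?thesis
    proof (cases "s = a")
      case True
      then show ?thesis using lt new s c(3) by (intro exI [of _ a]) simp
    next
      case False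
      then have "trans_perm (es @ [e]) s = trans_perm es s" using e s c(4) by (simp add: trans_perm_append transpose_def)
      then show ?thesis using s by metis
    qed
  qed
qed

context row_algorithm
begin

text \<open>A larger label among the earlier boxes would mean that some red strand leaves the row
  beyond the start of the scan; it would have stopped the scan, and the step would not be an inverse
  insertion. For columns this shows that the upper of two boxes is rectified.\<close>

lemma insert_no_larger:
  assumes P: "package X es" and s: "step_insert X es X' es' j0" and z: "z \<in> set (labels w es')"
  shows "z \<le> last (labels w es)"
proof (rule ccontr)
  assume large: "\<not> ?thesis"
  have st: "start_row X es X' es' j0" using s by (simp add: step_insert_def)
  note m = start_row_middle(1) [OF P st]
  note P' = middle_facts(1) [OF m]
  obtain t where t: "t \<le> r" "z < w (trans_perm es' t)"
    using chain_red_above [OF gen_w _ z, of r] P' by (auto simp: package_def)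
  have "p X' t = w (trans_perm es' t)" using P' by (simp add: package_def fun_eq_iff)
  then have "l + j0 \<le> p X' t" using start_row_last(5) [OF P st] t large by simp
  moreover have "r < B X' j" if "j0 < j" "(l, j) \<notin> X'" "r < L X' j" for j
    using s that by (simp add: step_insert_def)
  ultimately have "r < t" using no_red_exit [OF middle_facts(3,4,8) [OF m]] by blast
  then show False using t by simp
qed

text \<open>A strand in the last box which is the horizontal one at some scanned place also leaves the row
  at a free scanned place, where the scan would have stopped.\<close>

lemma second_type_place:
  assumes m: "middle X es j0" and f: "found X es j0 j1 a X' es'" and es: "es \<noteq> []" "r < snd (last es)"
    and k: "j0 < k" "k < j1" and L: "L X k = snd (last es)"
  shows "L X j1 = snd (last es)"
proof (rule ccontr)
  assume ne: "\<not> ?thesis"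
  note G = middle_facts(2) [OF m]
  let ?g = "snd (last es)"
  define h where "h = Suc (p X ?g) - l"
  have k1: "1 \<le> k" using k by simp
  note D = L_D [OF G k1 L]
  have h: "Suc (p X ?g) = l + h" "k \<le> h" using D unfolding h_def by linarith+
  have Lh: "L X h = ?g" using L_I [OF G, of h ?g] h D k by simp
  have "(l, h) \<notin> X"
  proof
    assume "(l, h) \<in> X"
    then have "L X (Suc h) = ?g" using L_Suc [OF G, of h] Lh h k by simp
    then show False using L_D [OF G, of "Suc h" ?g] h by simp
  qed
  moreover have "h < j1"
  proof (rule ccontr)
    assume "\<not> h < j1"
    then have "L X j1 = ?g" using L_I [OF G, of j1 ?g] h D k by simp
    then show False using ne by simp
  qed
  moreover have "\<forall>j. j0 < j \<and> j < j1 \<and> (l, j) \<notin> X \<and> r < L X j \<longrightarrow>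
      r < B X j \<and> (es = [] \<or> L X j \<noteq> snd (last es))"
    using f by (simp add: found_def)
  ultimately show False using h k es Lh by (metis less_le_trans)
qed

text \<open>Again \<open>a\<close> enters at the column \<open>j\<close> where \<open>b\<close> used
  to enter. With the larger label the next scan starts to the right of \<open>j\<close>, and so it
  ends with a strand that entered right of \<open>j\<close>; if the next step is trivial, the blue
  strand of its box is shown to have entered right of \<open>j\<close> as well.\<close>

lemma column_consecutive:
  assumes P: "package X es" and s: "step_rectify X es X' es' a b" and es': "es' \<noteq> []"
    and xy: "last (labels w es) < last (labels w es')" and s2: "step_rectify X' es' X2 es2 a2 b2"
  shows "q X b < q X' b2"
proof -
  note eff = rectify_effect [OF P s]
  note P' = eff(1)
  note eff2 = rectify_effect [OF P' s2]
  have G: "is_graph X" and G': "is_graph X'" and rc: "rc_graph X" and rc': "rc_graph X'"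
    using P eff(1) package_graph package_rc by auto
  define j where "j = q X b - l"
  have j: "q X b = l + j" "1 \<le> j" using blue_enters [OF G eff(7)] by (simp_all add: j_def)
  have qa: "q X' a = l + j" using eff(4) j by simp
  have Ba: "B X' j = a" using B_I [OF G' qa] .
  let ?x = "last (labels w es')" and ?y = "last (labels w es)"
  have ne: "q X' t \<noteq> l + j" if "r < t" for t
    using qa q_inj [OF G', of t a] that eff(6) by auto
  have x: "p X' (snd (last es')) = ?x" using last_label [OF P' es'] by simp
  have trivial2: "es' = es2 @ [(a2, b2)]" "q X' b2 < q X' a2" if "step_trivial X' es' X2 es2 a2 b2"
    using that trivial_effect(3) [OF P' that] by (simp_all add: step_trivial_def)
  have move2: thesis
    if mv: "step_move X' es' X2 es2 a2 b2"
      and rest: "\<And>k. (l, k) \<in> X' \<Longrightarrow> l + k \<le> q X' b2 \<Longrightarrow> L X' k = fst (last es') \<and> B X' k = snd (last es') \<and> Suc ?x = l + k \<Longrightarrow> thesis"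
      "\<And>k. (l, k) \<in> X' \<Longrightarrow> l + k \<le> q X' b2 \<Longrightarrow> L X' k = snd (last es') \<Longrightarrow> r < snd (last es') \<Longrightarrow>
        q X' (snd (last es')) < q X' (fst (last es')) \<Longrightarrow> thesis"
    for thesis
  proof -
    obtain X'' es'' k j1 where st: "start_row X' es' X'' es'' k \<or> start_swap X' es' X'' es'' k"
      and v: "l + k \<le> q X' b2"
      using move_start [OF P' mv] by metis
    show thesis
      using st
    proof
      assume st: "start_row X' es' X'' es'' k"
      show thesis using rest(1) [of k] start_row_last [OF P' st] v by simp
    next
      assume st: "start_swap X' es' X'' es'' k"
      show thesis using rest(2) [of k] start_swap_last [OF P' st] v by simp
    qed
  qed
  show ?thesis
  proof (cases "step_trivial X es X' es' a b")
    case True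
    then have es: "es = es' @ [(a, b)]" by (simp add: step_trivial_def)
    have pa: "p X' a = ?y" using trivial_effect(5) [OF P True] last_label [OF P] es by simp
    have jy: "l + j \<le> Suc ?y" using q_le_p [OF G', of a] qa pa by simp
    \<comment> \<open>If such a strand had entered left of \<open>j\<close>, it would arrive at
      \<open>(l, j)\<close> from the left. It cannot cross the smaller strand \<open>a\<close> there
      horizontally, and at a free place it would leave too early.\<close>
    have pass: "l + j < q X' t" if "r < t" "?y < p X' t" for t
    proof (rule ccontr)
      assume "\<not> ?thesis"
      then have "q X' t < l + j" using ne [OF that(1)] by simp
      then have Lt: "L X' j = t" using L_I [OF G' j(2), of t] jy that(2) by simp
      show False
      proof (cases "(l, j) \<in> X'")
        case True
        then show False using rc_graph_crossing [OF rc' True] Lt Ba that(1) eff(6) by simp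
      next
        case False
        then show False using exit_free [OF G' j(2) False Lt] jy that(2) by simp
      qed
    qed
    show ?thesis
    proof (cases "step_move X' es' X2 es2 a2 b2")
      case True
      then show ?thesis
      proof (rule move2)
        fix k assume "l + k \<le> q X' b2" "L X' k = fst (last es') \<and> B X' k = snd (last es') \<and> Suc ?x = l + k"
        then show ?thesis using jy xy j by simp
      next
        fix k assume k: "(l, k) \<in> X'" "l + k \<le> q X' b2" "L X' k = snd (last es')" "r < snd (last es')"
        have "1 \<le> k" using k(1) G' by (auto simp: is_graph_def)
        then have "q X' (snd (last es')) < l + k" using L_D [OF G' _ k(3)] by simp
        then show ?thesis using pass [OF k(4)] x xy k(2) j by simp
      qed
    next
      case False
      then have t2: "step_trivial X' es' X2 es2 a2 b2" using s2 by (simp add: step_rectify_def)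
      then show ?thesis using pass [OF eff2(7)] trivial2(1) [OF t2] x xy j by simp
    qed
  next
    case False
    then have mv: "step_move X es X' es' a b" using s by (simp add: step_rectify_def)
    obtain X'' es'' j0 j1 where st: "start_row X es X'' es'' j0 \<or> start_swap X es X'' es'' j0"
      and m: "middle X'' es'' j0" and f: "found X'' es'' j0 j1 a X' es'" and b: "b = L X'' j1"
      and qq: "q X'' = q X" and v: "l + j0 \<le> q X b" "q X b < l + j1"
      using move_start [OF P mv] by metis
    note e = found_effect [OF m f] and G'' = middle_facts(2) [OF m] and rc'' = middle_facts(3) [OF m]
    note t = e(2,3) [folded b]
    have jj: "j0 \<le> j" "j < j1" using v j by simp_all
    have j1: "1 \<le> j1" "(l, j1) \<notin> X''" "j0 < j1" using f by (auto simp: found_def)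
    \<comment> \<open>An exchange would make the last label at least as large as the one before
      it.\<close>
    have "\<not> start_swap X es X'' es'' j0"
    proof
      assume "start_swap X es X'' es'' j0"
      from start_swap_last(5,6) [OF P this] e(6) xy show False by simp
    qed
    then have st: "start_row X es X'' es'' j0" using st by simp
    have y: "Suc ?y = l + j0" using start_row_last(5) [OF P st] .
    have free: "(l, j) \<notin> X'" using move_landing(2) [OF P mv] j by simp
    have qab: "q X'' b < q X'' a" using e(8) b by simp
    have qb: "q X'' b = l + j" using qq j by simp
    show ?thesis
    proof (cases "es' = es''")
      case True
      have pX': "p X' = p X''" using e(7) True by simp
      let ?g = "snd (last es')"
      have late: "l + j0 \<le> q X'' ?g"
      proof (rule ccontr)
        assume "\<not> ?thesis"
        then have "L X'' j0 = ?g"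
          using L_I [OF G'' middle_facts(4) [OF m], of ?g] x pX' y xy by simp
        then show False using exit_free [OF G'' middle_facts(4,5) [OF m]] x pX' y xy by simp
      qed
      have stop: "L X'' k \<noteq> ?g" if "j0 < k" "k < j1" "r < ?g" "?g \<noteq> b" for k
        using second_type_place [OF m f _ _ that(1,2)] es' True that b by auto
      have Lb: "L X'' k \<noteq> b" if "1 \<le> k" "k \<le> j" for k
        using L_D [OF G'' that(1), of b] qb that by auto
      have La: "L X'' k \<noteq> a" if "1 \<le> k" "k \<le> j" for k
        using L_D [OF G'' that(1), of a] qb qab that by auto
      have LX': "L X' k = L X'' k" if "1 \<le> k" "k \<le> j" for k
        using t(2) [of k] La [OF that] Lb [OF that] that jj by (simp add: transpose_def)
      show ?thesis
      proof (cases "step_move X' es' X2 es2 a2 b2")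
        case mv2: True
        then show ?thesis
        proof (rule move2)
          fix k assume k: "(l, k) \<in> X'" "l + k \<le> q X' b2"
            "L X' k = fst (last es') \<and> B X' k = ?g \<and> Suc ?x = l + k"
          have j0k: "j0 < k" using k(3) y xy by simp
          have red: "fst (last es') \<le> r"
            using package_last(2) [of X' "butlast es'" "fst (last es')" ?g] P' es' by simp
          have "j < k"
          proof (rule ccontr)
            assume "\<not> j < k"
            then have "L X' k = L X'' k" using LX' [of k] j0k by simp
            moreover have "r < L X'' k" using found_tail(1) [OF m f j0k] \<open>\<not> j < k\<close> jj by simp
            ultimately show False using red k(3) by simp
          qed
          then show ?thesis using k(2) j by simp
        next
          fix k assume k: "(l, k) \<in> X'" "l + k \<le> q X' b2" "L X' k = ?g" "r < ?g"
          have k1: "1 \<le> k" using k(1) G' by (auto simp: is_graph_def)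
          have "j < k"
          proof (rule ccontr)
            assume "\<not> j < k"
            then have kj: "k < j" using k(1) free by (cases "k = j") auto
            then have Lk: "L X'' k = ?g" using LX' [OF k1] k(3) by simp
            then have gb: "?g \<noteq> b" using Lb [OF k1] kj by auto
            have "q X'' ?g < l + k" using L_D [OF G'' k1 Lk] by simp
            then have "j0 < k" using late by simp
            then show False using stop [OF _ _ k(4) gb] kj jj Lk by simp
          qed
          then show ?thesis using k(2) j by simp
        qed
      next
        case False
        then have t2: "step_trivial X' es' X2 es2 a2 b2" using s2 by (simp add: step_rectify_def)
        note es2 = trivial2 [OF t2]
        have g: "?g = b2" using es2(1) by simp
        note last2 = package_last [OF P' [unfolded es2(1)]]
        have b2a: "b2 \<noteq> a" using eff2(7) eff(6) by simp
        show ?thesis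
        proof (cases "b2 = b")
          case True
          then show ?thesis using qab e(1) b qq by simp
        next
          case b2b: False
          have q2: "q X' b2 = q X'' b2" using e(1) b b2a b2b by (simp add: transpose_def)
          show ?thesis
          proof (rule ccontr)
            assume "\<not> ?thesis"
            then have lt: "q X'' b2 < l + j" using ne [OF eff2(7)] q2 j by simp
            define k where "k = q X'' b2 - l"
            have k: "q X'' b2 = l + k" "j0 \<le> k" "k < j" using late g lt by (simp_all add: k_def)
            have k1: "1 \<le> k" using k(2) middle_facts(4) [OF m] by simp
            have Bk: "B X'' k = b2" using B_I [OF G'' k(1)] .
            show False
            proof (cases "(l, k) \<in> X''")
              case False
              then have "L X'' (Suc k) = b2" using L_Suc [OF G'' k1] Bk by simp
              then show False using stop [of "Suc k"] k jj g b2b eff2(7) by simp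
            next
              case cr: True
              then have j0k: "j0 < k" using k(2) middle_facts(5) [OF m] by (cases "k = j0") auto
              \<comment> \<open>The blue \<open>?t\<close> crosses \<open>b2\<close> here; its
                number and its value both lie between those of \<open>a2\<close> and
                \<open>b2\<close>, against the covering condition of \<open>(a2 b2)\<close>.\<close>
              let ?t = "L X'' k"
              have tb: "r < ?t" "?t < b2"
                using found_tail(1) [OF m f j0k] k jj rc_graph_crossing [OF rc'' cr] Bk by simp_all
              have pk: "Suc (p X'' b2) = l + k" using exit_crossing [OF G'' cr Bk] .
              have Lt: "q X'' ?t < l + k" "l + k \<le> Suc (p X'' ?t)" using L_D [OF G'' k1 refl] by simp_all
              have "p X'' ?t \<noteq> p X'' b2" using p_inj [OF G'', of ?t b2] tb by simp
              then have gt: "p X'' b2 < p X'' ?t" using Lt pk by simp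
              have "?t \<noteq> b" using Lb [OF k1] k by simp
              then have "\<not> l + j1 \<le> Suc (p X'' ?t)"
                using L_I [OF G'' j1(1), of ?t] Lt k jj b by auto
              then have small: "Suc (p X'' ?t) < l + j1" by simp
              have "l + j1 \<le> q X'' a2"
              proof (rule ccontr)
                assume c: "\<not> ?thesis"
                have "a2 \<noteq> a"
                proof
                  assume "a2 = a"
                  moreover have "B X'' j1 = a"
                    using f True left_neq_below [OF G'' l_pos j1(1)] by (auto simp: found_def)
                  then have "q X'' a = l + j1" using B_D [OF G''] by blast
                  ultimately show False using c by simp
                qed
                moreover have "a2 \<noteq> b" using eff2(6) eff(7) by simp
                ultimately have q2a: "q X' a2 = q X'' a2" using e(1) b by (simp add: transpose_def)
                define h where "h = q X'' a2 - l"
                have h: "q X'' a2 = l + h" "k < h" "h < j1" using es2(2) q2 q2a k c by (simp_all add: h_def)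
                have "r < B X'' h" using found_tail(2) [OF m f, of h] h j0k by simp
                then show False using B_I [OF G'' h(1)] eff2(6) by simp
              qed
              then have "p X'' ?t \<le> p X'' a2" using q_le_p [OF G'', of a2] small by simp
              moreover have "a2 < ?t" using eff2(6) tb by simp
              ultimately show False using last2(10) [of ?t] tb gt pX' by simp
            qed
          qed
        qed
      qed
    next
      case False
      then obtain es1 where y2: "r < B X'' j1" "es'' = es1 @ [(a, b)]" "es' = es1 @ [(a, B X'' j1)]"
        using f b by (auto simp: found_def)
      let ?c = "B X'' j1"
      have c: "?c \<noteq> a" "?c \<noteq> b"
        using y2(1) eff(6) left_neq_below [OF G'' l_pos j1(1)] b by auto
      have Bc: "B X' j1 = ?c" using t(1) [of j1] c by (simp add: transpose_def)
      then have qc: "q X' ?c = l + j1" by (rule B_D [OF G'])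
      show ?thesis
      proof (cases "step_move X' es' X2 es2 a2 b2")
        case mv2: True
        then show ?thesis
        proof (rule move2)
          fix k assume k: "(l, k) \<in> X'" "l + k \<le> q X' b2"
            "L X' k = fst (last es') \<and> B X' k = snd (last es') \<and> Suc ?x = l + k"
          have "B X' k = B X' j1" using k(3) y2(3) Bc by simp
          then have "k = j1" using below_strand_inj [OF G'] by simp
          then show ?thesis using k(2) v(2) by simp
        next
          assume "q X' (snd (last es')) < q X' (fst (last es'))"
          then show ?thesis using y2(3) qc qa jj by simp
        qed
      next
        case False
        then have t2: "step_trivial X' es' X2 es2 a2 b2" using s2 by (simp add: step_rectify_def)
        then show ?thesis using trivial2 [OF t2] y2(3) qc qa jj by simp
      qed
    qed
  qed
qed

lemma bruhat_package_iff:
  assumes "rows_ge X l = X" "length es \<le> length (boxes lam)"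
  shows "bruhat_package r w X (lam, es) \<longleftrightarrow> package X es"
  using assms graph_perm_below [OF assms(1)] by (auto simp: bruhat_package_def package_def bruhat_chain_iff)

text \<open>The lower crossing added back is the one that the inverse step took out. After a trivial
  step this restores \<open>X\<close>. After a move it gives \<open>X''\<close> with a crossing at
  \<open>(l, j1)\<close>, which the test has to reject. In the first type the larger strand is
  horizontal there, so the graph is not reduced. The second type is impossible for semi-shuffles,
  and otherwise \<open>cons\<close> shows that the labels are not strict. Then the crossing at
  \<open>j1\<close> is removed, and as no place between is allowed, \<open>j0\<close> is
  refilled.\<close>

lemma rectify_step_inverse:
  assumes P: "package X es" and s: "step_rectify X es X' es' a b" and i: "i = length es"
    and ip: "only {k \<in> {1..length (boxes lamp)}. box lamp k = box lam i} = Some ip"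
    and un: "unwind Xp esp ip = Some (rows_ge X (Suc l))" "unwind Xp esp (ip - 1) = Some (rows_ge X' (Suc l))"
    and ab: "esp ! (ip - 1) = (a, b)"
    and strict: "row_strict (lam, labels w es)" "column_strict (lam, labels w es)"
    and len: "length es \<le> length (boxes lam)"
    and cons: "semi_shuffle r w \<or> (\<forall>xs. 2 \<le> i \<longrightarrow> length xs = i \<longrightarrow> row_strict (lam, xs) \<longrightarrow>
      column_strict (lam, xs) \<longrightarrow> labels w es ! (i - 1) < labels w es ! (i - 2) \<longrightarrow> xs ! (i - 1) < xs ! (i - 2))"
  shows "rectify_step r l w lam (Xp, lamp, esp) i (X', es') = Some (X, es)"
proof -
  have X: "is_graph X" and rc: "rc_graph X" and rows: "rows_ge X l = X"
    using P package_graph package_rc by (auto simp: package_def)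
  define R where "R = X' \<union> (rows_ge X (Suc l) - rows_ge X' (Suc l))"
  let ?ok = "row_strict (E w (lam, es' @ [(a, b)])) \<and> column_strict (E w (lam, es' @ [(a, b)])) \<and>
    bruhat_package r w R (lam, es' @ [(a, b)])"
  note eff = rectify_effect [OF P s]
  obtain i1 k1 where ik: "l < i1" "(i1, k1) \<in> X" "rows_ge X' (Suc l) = rows_ge X (Suc l) - {(i1, k1)}"
    using eff(8) by blast
  then have R: "R = insert (i1, k1) X'" unfolding R_def by (auto simp: rows_ge_def)
  show ?thesis
  proof (cases "step_trivial X es X' es' a b")
    case True
    then obtain i2 k2 where es: "es = es' @ [(a, b)]" and ik2: "l < i2" "crossings X a b = {(i2, k2)}" "X' = X - {(i2, k2)}"
      by (auto simp: step_trivial_def)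
    have "(i2, k2) \<in> X" using crossed_below(4) [OF rc eff(5) _ ik2(2,1)] eff(6,7) by simp
    then have "(i2, k2) \<in> rows_ge X (Suc l)" "(i2, k2) \<notin> rows_ge X' (Suc l)"
      using ik2 by (auto simp: rows_ge_def)
    then have "(i2, k2) = (i1, k1)" using ik(3) by blast
    then have "R = X" using R ik(2) ik2(3) by auto
    moreover from this have "?ok"
      using strict es bruhat_package_iff [OF rows len] P by (simp add: E_labels)
    ultimately show ?thesis
      unfolding rectify_step_def using ip un ab es by (simp add: R_def Let_def)
  next
    case False
    then have "step_move X es X' es' a b" using s by (simp add: step_rectify_def)
    then obtain X'' es'' j0 j1 where st: "start_row X es X'' es'' j0 \<or> start_swap X es X'' es'' j0"
      and m: "middle X'' es'' j0" and f: "found X'' es'' j0 j1 a X' es'" and b: "b = L X'' j1"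
      using move_start [OF P] by metis
    have lab: "labels w es'' = butlast (labels w es)" and Xeq: "(l, j0) \<in> X" "X'' = X - {(l, j0)}"
      and LB: "L X'' j0 = L X j0" "B X'' j0 = B X j0"
      using start_middle [OF P st] by simp_all
    note G = middle_facts(2) [OF m] and rc'' = middle_facts(3) [OF m] and P'' = middle_facts(1) [OF m]
    have j1: "1 \<le> j1" "(l, j1) \<notin> X''" "j0 < j1" using f by (auto simp: found_def)
    obtain i2 k2 where ik2: "l < i2" "(i2, k2) \<in> X''" "X' = insert (l, j1) (X'' - {(i2, k2)})"
      using f by (auto simp: found_def)
    have "(i2, k2) \<in> rows_ge X (Suc l)" "(i2, k2) \<notin> rows_ge X' (Suc l)"
      using ik2 Xeq by (auto simp: rows_ge_def)
    then have "(i2, k2) = (i1, k1)" using ik(3) by blast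
    then have RX: "R = insert (l, j1) X''" using R ik2 by auto
    have GR: "is_graph R" using RX G l_pos j1 by (simp add: is_graph_insert)
    have BR: "B R k = B X'' k" for k
      using below_strand_insert [OF G l_pos j1(1,2), of l k] RX by simp
    have LR: "L R k = (if j1 < k then transpose b (B X'' j1) (L X'' k) else L X'' k)" for k
      using left_strand_insert [OF G l_pos j1(1,2), of l k] RX b by simp
    have RX'': "R - {(l, j1)} = X''" using RX j1 by auto
    have h: "(l, k) \<in> h_crossings R s t \<longleftrightarrow> (l, k) \<in> R \<and> L R k = s \<and> B R k = t" for k s t
      using h_crossings_eq [OF GR] by simp
    have on: "only {k. (l, k) \<in> h_crossings R b (B X'' j1)} = Some j1"
    proof -
      have "(l, k) \<in> h_crossings R b (B X'' j1) \<longleftrightarrow> k = j1" for k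
        using h [of k b "B X'' j1"] BR [of k] LR [of k] below_strand_inj [OF G, of l k j1] RX b by auto
      then show ?thesis by (simp add: only_eq_Some)
    qed
    have "\<not> ?ok \<and> rectify_removal l R es' (a, b) = Some (j1, X'', es'')"
    proof (cases "es' = es''")
      case True
      have c: "B X'' j1 = a" using f True left_neq_below [OF G l_pos j1(1)] by (auto simp: found_def)
      have cr: "(l, j1) \<in> h_crossings R b a" using h [of j1 b a] RX BR LR b c by simp
      have "\<not> rc_graph R"
        using rc_graph_crossing [of R l j1] RX BR [of j1] LR [of j1] b c eff(6,7) by auto
      moreover have "rectify_removal l R es' (a, b) = Some (j1, X'', es'')"
        unfolding rectify_removal_def using cr on c RX'' True by auto
      ultimately show ?thesis by (simp add: bruhat_package_def)
    next
      case False
      then obtain es1 where y: "r < B X'' j1" "es'' = es1 @ [(a, b)]" "es' = es1 @ [(a, B X'' j1)]"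
        using f b by (auto simp: found_def)
      let ?c = "B X'' j1"
      note st2 = second_type [OF m [unfolded y(2)] j1(3,2) b [symmetric] y(1)]
      have ch: "chain r w es1" using package_last(5) [OF P'' [unfolded y(2)]] .
      have ns: "\<not> semi_shuffle r w"
      proof
        assume "semi_shuffle r w"
        then have "semi_shuffle r (w \<circ> trans_perm es1)" using semi_shuffle_chain [OF gen_w _ ch] by simp
        from semi_shuffle_less [OF this eff(7) st2(2)] st2(4) show False by simp
      qed
      have start: "start_row X es X'' es'' j0"
      proof (rule ccontr)
        assume "\<not> ?thesis"
        then have "start_swap X es X'' es'' j0" using st by simp
        from start_swap_middle(4) [OF P this] y(2) have "L X'' j0 = b" by simp
        then have "Suc (p X'' b) = l + j0" using exit_free [OF G middle_facts(4,5) [OF m]] by simp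
        moreover have "Suc (p X'' b) = l + j1" using exit_free [OF G j1(1,2) b [symmetric]] .
        ultimately show False using j1 by simp
      qed
      have les: "length es = Suc (Suc (length es1))" using start y(2) by (auto simp: start_row_def)
      have px: "Suc (w (trans_perm es1 a)) = l + j1"
        using package_last(7) [OF P'' [unfolded y(2)]] exit_free [OF G j1(1,2) b [symmetric]] by simp
      have "labels w es \<noteq> []" using les by (metis length_labels list.size(3) nat.distinct(1))
      then have labs: "labels w es = labels w es1 @ [w (trans_perm es1 a), last (labels w es)]"
        using lab y(2) by (metis append_butlast_last_id labels_snoc append.assoc append_Cons append_Nil)
      then have "labels w es ! (i - 1) = last (labels w es)" "labels w es ! (i - 2) = w (trans_perm es1 a)"
        using les i by (metis diff_Suc_1 diff_Suc_Suc last_conv_nth length_labels \<open>labels w es \<noteq> []\<close>,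
            metis diff_Suc_Suc diff_zero length_labels nth_append_length numeral_2_eq_2)
      then have desc: "labels w es ! (i - 1) < labels w es ! (i - 2)"
        using px start_row_last(5) [OF P start] j1 by simp
      \<comment> \<open>The labels of the tableau that the insertion algorithm tries: its last two
        ascend, whereas those of \<open>es\<close> descend.\<close>
      define xs where "xs = labels w (es' @ [(a, b)])"
      have tc: "trans_perm (es1 @ [(a, ?c)]) a = trans_perm es1 ?c" by (simp add: trans_perm_append)
      have "xs = labels w es1 @ [w (trans_perm es1 a), w (trans_perm es1 ?c)]"
        unfolding xs_def labels_snoc y(3) tc by simp
      then have xs: "length xs = i" "xs ! (i - 2) < xs ! (i - 1)"
        using i les st2(3) by (simp_all add: nth_append)
      then have "\<not> (row_strict (lam, xs) \<and> column_strict (lam, xs))"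
        using cons ns desc les i by fastforce
      then have "\<not> ?ok" by (auto simp: E_labels xs_def)
      have nh: "\<not> (\<exists>k. (l, k) \<in> h_crossings R b a)"
      proof
        assume "\<exists>k. (l, k) \<in> h_crossings R b a"
        then obtain k where k: "(l, k) \<in> R" "L R k = b" "B X'' k = a" using h BR by auto
        then have "k \<noteq> j1" using y(1) eff(6) by auto
        then have kX: "(l, k) \<in> X''" using k(1) RX by simp
        have "L X'' k = b \<or> L X'' k = ?c" using k(2) LR [of k] by (auto simp: transpose_def split: if_splits)
        then show False using rc_graph_crossing [OF rc'' kX] k(3) eff(6,7) y(1) by auto
      qed
      have "rectify_removal l R es' (a, b) = Some (j1, X'', es'')"
        unfolding rectify_removal_def using nh on RX'' y(2,3) by simp
      then show ?thesis using \<open>\<not> ?ok\<close> by simp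
    qed
    then have nok: "\<not> ?ok" and rem: "rectify_removal l R es' (a, b) = Some (j1, X'', es'')" by simp_all
    let ?A = "{(j, x, d). free_place X'' l j x d \<and> j < j1 \<and> r < d \<and> (x \<le> r \<or> es'' \<noteq> [] \<and> x = snd (last es''))}"
    have rm: "rightmost ?A = Some (j0, L X j0, B X j0)"
    proof (rule rightmostI)
      show "(j0, L X j0, B X j0) \<in> ?A"
        using free_place_iff [OF G l_pos] m j1 LB by (auto simp: middle_def)
    next
      fix k z assume kz: "(k, z) \<in> ?A"
      show "k \<le> j0"
      proof (rule ccontr)
        assume "\<not> k \<le> j0"
        then have k: "j0 < k" "k < j1" "(l, k) \<notin> X''" "L X'' k \<le> r \<or> es'' \<noteq> [] \<and> L X'' k = snd (last es'')"
          using kz free_place_iff [OF G l_pos] by auto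
        have "r < L X'' k" using found_tail(1) [OF m f k(1)] k(2) by simp
        then show False using f k by (auto simp: found_def)
      qed
    next
      fix z assume "(j0, z) \<in> ?A"
      then show "z = (L X j0, B X j0)" using free_place_iff [OF G l_pos] LB by (cases z) auto
    qed
    have restored: "insert (l, j0) X'' = X" using Xeq by auto
    show ?thesis
      using st
    proof
      assume s: "start_row X es X'' es'' j0"
      then have "es = es'' @ [(L X j0, B X j0)]" by (auto simp: start_row_def)
      moreover have "L X j0 \<le> r" using start_row_middle(3,4) [OF P s] by simp
      ultimately show ?thesis
        unfolding rectify_step_def using ip un ab nok rem rm restored by (auto simp: R_def [symmetric] Let_def)
    next
      assume s: "start_swap X es X'' es'' j0"
      then obtain es1 e f d where "es = es1 @ [(e, f), (e, d)]" "B X j0 = f" "es'' = es1 @ [(e, d)]"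
        by (auto simp: start_swap_def)
      moreover have "\<not> L X j0 \<le> r" using start_swap_middle(6) [OF P s] by simp
      ultimately show ?thesis
        unfolding rectify_step_def using ip un ab nok rem rm restored by (auto simp: R_def [symmetric] Let_def)
    qed
  qed
qed

end

section \<open>Boxes of partitions\<close>

definition box_before :: "nat \<times> nat \<Rightarrow> nat \<times> nat \<Rightarrow> bool" where
  "box_before x y \<longleftrightarrow> fst y < fst x \<or> fst x = fst y \<and> snd x < snd y"

lemma box_before_asym: "box_before x y \<Longrightarrow> \<not> box_before y x"
  by (auto simp: box_before_def)

lemma part_beyond: "length lam < p \<Longrightarrow> part lam p = 0"
  by (simp add: part_def)

lemma part_pos: "is_partition lam \<Longrightarrow> 1 \<le> p \<Longrightarrow> p \<le> length lam \<Longrightarrow> 1 \<le> part lam p"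
proof -
  assume "is_partition lam" "1 \<le> p" "p \<le> length lam"
  then have "lam ! (p - 1) \<in> set lam" "0 \<notin> set lam" by (simp_all add: is_partition_def)
  then have "lam ! (p - 1) \<noteq> 0" by metis
  then show ?thesis using \<open>1 \<le> p\<close> \<open>p \<le> length lam\<close> by (simp add: part_def)
qed

lemma part_antimono:
  assumes "is_partition lam" "1 \<le> p" "p \<le> p'" shows "part lam p' \<le> part lam p"
proof (cases "p' \<le> length lam \<and> p < p'")
  case True
  then have "p - 1 < p' - 1" "p' - 1 < length lam" using assms(2) by auto
  then have "lam ! (p' - 1) \<le> lam ! (p - 1)"
    using assms(1) sorted_wrt_nth_less [of "(\<ge>)" lam "p - 1" "p' - 1"] by (simp add: is_partition_def)
  then show ?thesis using True assms by (simp add: part_def)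
next
  case False
  then show ?thesis using assms by (cases "p = p'") (auto simp: part_def)
qed

lemma set_boxes: "set (boxes lam) = {(p, q). 1 \<le> p \<and> 1 \<le> q \<and> q \<le> part lam p}"
proof -
  have "p \<le> length lam" if "1 \<le> q" "q \<le> part lam p" for p q
    using part_beyond [of lam p] that by (cases "p \<le> length lam") auto
  then show ?thesis by (fastforce simp: boxes_def less_Suc_eq_le)
qed

lemma sorted_boxes: "sorted_wrt box_before (boxes lam)"
proof -
  have "sorted_wrt box_before (concat (map (\<lambda>p. map (\<lambda>q. (p, q)) [1..<part lam p + 1]) ps))"
    if "sorted_wrt (\<lambda>x y. y < x) ps" for ps
    using that
  proof (induction ps)
    case Nil
    then show ?case by simp
  next
    case (Cons p ps)
    have "sorted_wrt box_before (map (\<lambda>q. (p, q)) [1..<part lam p + 1])"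
      unfolding sorted_wrt_map box_before_def by (simp del: upt_Suc)
    moreover have "\<forall>x\<in>set (map (\<lambda>q. (p, q)) [1..<part lam p + 1]).
      \<forall>y\<in>set (concat (map (\<lambda>p. map (\<lambda>q. (p, q)) [1..<part lam p + 1]) ps)). box_before x y"
      using Cons.prems by (auto simp: box_before_def)
    ultimately show ?case using Cons by (simp only: list.map concat.simps sorted_wrt_append sorted_wrt.simps)
  qed
  moreover have "sorted_wrt (\<lambda>x y. y < x) (rev [1..<length lam + 1])"
    unfolding sorted_wrt_rev by (rule sorted_wrt_upt)
  ultimately show ?thesis unfolding boxes_def by blast
qed

lemma box_less:
  assumes "1 \<le> i" "i < k" "k \<le> length (boxes lam)" shows "box_before (box lam i) (box lam k)"
  unfolding box_def using sorted_wrt_nth_less [OF sorted_boxes [of lam], of "i - 1" "k - 1"] assms by simp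

lemma box_less_iff:
  assumes "i \<in> {1..length (boxes lam)}" "k \<in> {1..length (boxes lam)}"
  shows "box_before (box lam i) (box lam k) \<longleftrightarrow> i < k"
  using box_less [of i k lam] box_less [of k i lam] box_before_asym [of "box lam i" "box lam k"] assms
  by (cases i k rule: linorder_cases) (auto simp: box_before_def)

lemma box_inj:
  assumes "i \<in> {1..length (boxes lam)}" "k \<in> {1..length (boxes lam)}" "box lam i = box lam k" shows "i = k"
  using box_less_iff [OF assms(1,2)] box_less_iff [OF assms(2,1)] assms(3)
  by (cases i k rule: linorder_cases) (auto simp: box_before_def)

lemma box_in: "i \<in> {1..length (boxes lam)} \<Longrightarrow> box lam i \<in> set (boxes lam)"
  unfolding box_def by (rule nth_mem) auto

lemma box_ex:
  assumes "x \<in> set (boxes lam)" obtains i where "i \<in> {1..length (boxes lam)}" "box lam i = x"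
proof -
  obtain n where "n < length (boxes lam)" "boxes lam ! n = x" using assms by (metis in_set_conv_nth)
  then show thesis using that [of "Suc n"] by (simp add: box_def)
qed

lemma box_next:
  assumes "i \<in> {1..length (boxes lam)}" "y \<in> set (boxes lam)" "box_before (box lam i) y"
    "\<And>z. z \<in> set (boxes lam) \<Longrightarrow> box_before (box lam i) z \<Longrightarrow> box_before z y \<Longrightarrow> False"
  shows "Suc i \<in> {1..length (boxes lam)}" "box lam (Suc i) = y"
proof -
  obtain k where k: "k \<in> {1..length (boxes lam)}" "box lam k = y" using box_ex assms(2) .
  then have ik: "i < k" using box_less_iff [OF assms(1) k(1)] assms(3) by simp
  then show S: "Suc i \<in> {1..length (boxes lam)}" using k by simp
  show "box lam (Suc i) = y"
  proof (cases "k = Suc i")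
    case False
    then have "Suc i < k" using ik by simp
    then have "box_before (box lam (Suc i)) y" using box_less_iff [OF S k(1)] k(2) by simp
    moreover have "box_before (box lam i) (box lam (Suc i))" using box_less_iff [OF assms(1) S] by simp
    ultimately show ?thesis using assms(4) [OF box_in [OF S]] by simp
  qed (use k in simp)
qed

lemma box_right:
  assumes "i \<in> {1..length (boxes lam)}" "box lam i = (p, q)" "(p, Suc q) \<in> set (boxes lam)"
  shows "Suc i \<in> {1..length (boxes lam)}" "box lam (Suc i) = (p, Suc q)"
proof -
  have "box_before (box lam i) (p, Suc q)" using assms(2) by (simp add: box_before_def)
  moreover have False if "box_before (box lam i) z" "box_before z (p, Suc q)" for z
    using that assms(2) by (auto simp: box_before_def)
  ultimately show "Suc i \<in> {1..length (boxes lam)}" "box lam (Suc i) = (p, Suc q)"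
    using box_next [OF assms(1,3)] by blast+
qed

lemma box_up:
  assumes "i \<in> {1..length (boxes lam)}" "box lam i = (Suc p, q)" "q = part lam (Suc p)" "(p, 1) \<in> set (boxes lam)"
  shows "Suc i \<in> {1..length (boxes lam)}" "box lam (Suc i) = (p, 1)"
proof -
  have "box_before (box lam i) (p, 1)" using assms(2) by (simp add: box_before_def)
  moreover have False if "z \<in> set (boxes lam)" "box_before (box lam i) z" "box_before z (p, 1)" for z
  proof (cases z)
    case (Pair a b)
    then have "1 \<le> b" "b \<le> part lam a" using that(1) by (simp_all add: set_boxes)
    then show False using that(2,3) assms(2,3) Pair by (cases "a = Suc p") (auto simp: box_before_def)
  qed
  ultimately show "Suc i \<in> {1..length (boxes lam)}" "box lam (Suc i) = (p, 1)"
    using box_next [OF assms(1,4)] by blast+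
qed

lemma partition_eqI:
  assumes "is_partition mu" "is_partition nu" "\<And>p. 1 \<le> p \<Longrightarrow> part mu p = part nu p"
  shows "mu = nu"
proof -
  have len: "length x \<le> length y" if "is_partition x" "\<And>p. 1 \<le> p \<Longrightarrow> part x p = part y p" for x y
  proof (rule ccontr)
    assume "\<not> ?thesis"
    then show False using part_pos [OF that(1), of "length x"] that(2) [of "length x"] part_beyond [of y "length x"]
      by simp
  qed
  have l: "length mu = length nu" using len [OF assms(1)] len [OF assms(2)] assms(3) by (metis le_antisym)
  then show ?thesis
  proof (rule nth_equalityI)
    fix n assume "n < length mu"
    then show "mu ! n = nu ! n" using assms(3) [of "Suc n"] l by (simp add: part_def)
  qed
qed

lemma boxes_eqI:
  assumes "is_partition mu" "is_partition nu" "set (boxes mu) = set (boxes nu)"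
  shows "mu = nu"
proof (rule partition_eqI [OF assms(1,2)])
  fix p :: nat assume p: "1 \<le> p"
  have "q \<le> part mu p \<longleftrightarrow> q \<le> part nu p" if "1 \<le> q" for q
  proof -
    have "(p, q) \<in> set (boxes mu) \<longleftrightarrow> (p, q) \<in> set (boxes nu)" using assms(3) by simp
    then show ?thesis using that p unfolding set_boxes by simp
  qed
  from this [of "part mu p"] this [of "part nu p"] show "part mu p = part nu p"
    by (cases "part mu p"; cases "part nu p") auto
qed

lemma partition_of_function:
  fixes f :: "nat \<Rightarrow> nat"
  assumes "\<And>p. 1 \<le> p \<Longrightarrow> f (Suc p) \<le> f p" "\<And>p. n < p \<Longrightarrow> f p = 0"
  obtains mu where "is_partition mu" "\<And>p. 1 \<le> p \<Longrightarrow> part mu p = f p"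
proof -
  define k where "k = (LEAST k. f (Suc k) = 0)"
  have k: "f (Suc k) = 0" unfolding k_def by (rule LeastI [of _ n]) (simp add: assms)
  have pos: "f (Suc i) \<noteq> 0" if "i < k" for i using that unfolding k_def by (rule not_less_Least)
  have anti: "f p' \<le> f p" if "1 \<le> p" "p \<le> p'" for p p'
    using that(2,1) by (induction p' rule: dec_induct) (auto intro: le_trans [OF assms(1)])
  define mu where "mu = map (\<lambda>i. f (Suc i)) [0..<k]"
  have "sorted_wrt (\<ge>) mu" unfolding mu_def sorted_wrt_map
    by (rule sorted_wrt_mono_rel [OF _ sorted_wrt_upt]) (use anti in auto)
  moreover have "0 \<notin> set mu" unfolding mu_def using pos by fastforce
  ultimately have "is_partition mu" by (simp add: is_partition_def)
  moreover have "part mu p = f p" if "1 \<le> p" for p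
  proof (cases "p \<le> k")
    case True
    then have "p - 1 < k" "Suc (p - 1) = p" using that by auto
    then show ?thesis using that True by (simp add: part_def mu_def)
  next
    case False
    then have "f p \<le> f (Suc k)" by (intro anti) auto
    then show ?thesis using False k by (simp add: part_def mu_def)
  qed
  ultimately show thesis using that by blast
qed

lemma strict_tableau_iff:
  "row_strict (lam, xs) \<and> column_strict (lam, xs) \<longleftrightarrow>
    (\<forall>i\<in>{1..length xs}. \<forall>k\<in>{1..length xs}. \<forall>p q p' q'. box lam i = (p, q) \<longrightarrow> box lam k = (p', q') \<longrightarrow>
      (p = p' \<and> q < q' \<or> q = q' \<and> p < p') \<longrightarrow> xs ! (i - 1) < xs ! (k - 1))"
  unfolding row_strict_def column_strict_def by (simp, meson less_imp_le)

section \<open>A row of the inverse algorithm\<close>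

context row_algorithm
begin

lemma package_semi:
  assumes "semi_shuffle r w" "package X es"
  shows "semi_shuffle r (p X)" "semi_shuffle r (q X)"
proof -
  show s: "semi_shuffle r (p X)"
  proof -
    have e: "w \<circ> trans_perm es = p X" "chain r w es" using assms(2) by (simp_all add: package_def)
    show ?thesis using semi_shuffle_chain [OF gen_w assms(1) e(2)] unfolding e(1) .
  qed
  have "q X i < q X (Suc i)" if "r < i" for i
  proof (rule ccontr)
    assume "\<not> ?thesis"
    then have "q X (Suc i) < q X i" using q_inj [OF package_graph [OF assms(2)], of i "Suc i"] by simp
    then have "p X (Suc i) < p X i" using crossed_persists [OF package_rc [OF assms(2)] l_pos, of i "Suc i"] by simp
    then show False using semi_shuffle_less [OF s that, of "Suc i"] by simp
  qed
  then show "semi_shuffle r (q X)" by (simp add: semi_shuffle_def)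
qed

text \<open>For a semi-shuffle no two blue strands cross, so the scan only meets free places.\<close>

lemma blue_free:
  assumes s: "semi_shuffle r w" and P: "package X es" and j: "1 \<le> j" "r < L X j"
  shows "(l, j) \<notin> X"
proof
  assume c: "(l, j) \<in> X"
  note G = package_graph [OF P]
  have lt: "L X j < B X j" using rc_graph_crossing [OF package_rc [OF P] c] .
  have "p X (L X j) < p X (B X j)" using semi_shuffle_less [OF package_semi(1) [OF s P] j(2) lt] .
  moreover have "Suc (p X (B X j)) = l + j" using exit_crossing [OF G c refl] .
  ultimately show False using L_D [OF G j(1) refl] by simp
qed

lemma semi_start:
  assumes s: "semi_shuffle r w" and P: "package X es"
  shows "\<not> start_swap X es X'' es'' j0"
proof
  assume sw: "start_swap X es X'' es'' j0"
  have "1 \<le> j0" using remove_facts(4) [OF P start_swap_last(2) [OF P sw]] .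
  then show False
    using blue_free [OF s P _ start_swap_middle(6) [OF P sw]] start_swap_last(2) [OF P sw] by simp
qed

text \<open>All scanned places are free, so each blue strand met enters from below and leaves one
  column further on; the strands met leave with consecutive values. Blue values increase with the
  number of the strand, so these are all the strands from \<open>B X j0\<close> to
  \<open>L X j1\<close>.\<close>

lemma semi_found:
  assumes s: "semi_shuffle r w" and m: "middle X es j0" and f: "found X es j0 j1 a X' es'"
  shows "es' = es" "B X j0 \<le> L X j1" "\<And>t. B X j0 \<le> t \<Longrightarrow> t < L X j1 \<Longrightarrow> p X' (Suc t) = Suc (p X' t)"
proof -
  note P = middle_facts(1) [OF m] and G = middle_facts(2) [OF m]
  have S: "semi_shuffle r (p X)" using package_semi(1) [OF s P] .
  have j1: "1 \<le> j1" "(l, j1) \<notin> X" "j0 < j1" using f by (auto simp: found_def)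
  show es: "es' = es"
  proof (rule ccontr)
    assume "es' \<noteq> es"
    then obtain es1 where y: "r < B X j1" "es = es1 @ [(a, L X j1)]"
      using f by (auto simp: found_def)
    note st = second_type [OF m [unfolded y(2)] j1(3,2) refl y(1)]
    have "chain r w es1" using package_last(5) [OF P [unfolded y(2)]] .
    then have "semi_shuffle r (w \<circ> trans_perm es1)" using semi_shuffle_chain [OF gen_w s] by simp
    moreover have "r < L X j1" using f by (simp add: found_def)
    ultimately have "w (trans_perm es1 (L X j1)) < w (trans_perm es1 (B X j1))"
      using semi_shuffle_less [of r "w \<circ> trans_perm es1" "L X j1" "B X j1"] st(2) by simp
    then show False using st(4) by simp
  qed
  have pX: "p X' = p X" using found_effect(7) [OF m f es] .
  have L: "L X (Suc j) = B X j" "Suc (p X (B X j)) = l + Suc j" "r < B X j" if "j0 \<le> j" "j < j1" for j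
  proof -
    have j: "1 \<le> j" using that middle_facts(4) [OF m] by simp
    have n: "(l, j) \<notin> X"
    proof (cases "j = j0")
      case True
      then show ?thesis using middle_facts(5) [OF m] by simp
    next
      case False
      then show ?thesis using blue_free [OF s P j] found_tail(1) [OF m f, of j] that by simp
    qed
    show L: "L X (Suc j) = B X j" using L_Suc [OF G j] n by simp
    have blue: "r < L X (Suc j)" using found_tail(1) [OF m f, of "Suc j"] that by simp
    then show "r < B X j" using L by simp
    have "(l, Suc j) \<notin> X" using blue_free [OF s P _ blue] by simp
    then show "Suc (p X (B X j)) = l + Suc j" using exit_free [OF G _ _ L, of] by simp
  qed
  have last: "L X j1 = B X (j1 - 1)" using L(1) [of "j1 - 1"] j1 middle_facts(4) [OF m] by simp
  have le: "t \<le> t'" if "r < t" "r < t'" "p X t \<le> p X t'" for t t'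
    using semi_shuffle_less [OF S that(2), of t] that(3) by fastforce
  have j1': "j0 \<le> j1 - 1" "j1 - 1 < j1" "Suc (j1 - 1) = j1" using j1 by simp_all
  show "B X j0 \<le> L X j1"
    unfolding last by (rule le) (use L [of j0] L [OF j1'(1,2)] j1 in auto)
  fix t assume t: "B X j0 \<le> t" "t < L X j1"
  have tr: "r < t" using t(1) L(3) [of j0] j1 by simp
  have lower: "l + j0 \<le> p X t"
  proof (cases "B X j0 = t")
    case True
    then show ?thesis using L(2) [of j0] j1 by simp
  next
    case False
    then show ?thesis using semi_shuffle_less [OF S L(3) [of j0], of t] t(1) L(2) [of j0] j1 by simp
  qed
  have upper: "Suc (p X t) < l + j1"
    using semi_shuffle_less [OF S tr t(2)] L(2) [OF j1'(1,2)] j1' last by simp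
  define h where "h = p X t - l"
  have h: "p X t = l + h" "j0 \<le> h" "Suc h < j1" using lower upper by (simp_all add: h_def)
  have "p X t = p X (B X h)" using L(2) [of h] h by simp
  then have th: "t = B X h" using p_inj [OF G] by simp
  have next': "Suc (p X (B X (Suc h))) = l + Suc (Suc h)" "r < B X (Suc h)" using L(2,3) [of "Suc h"] h by simp_all
  have "t < B X (Suc h)"
  proof (rule ccontr)
    assume "\<not> ?thesis"
    then have "B X (Suc h) < t \<or> B X (Suc h) = t" by auto
    then show False using semi_shuffle_less [OF S next'(2), of t] next'(1) h(1) by auto
  qed
  then have "p X (Suc t) \<le> p X (B X (Suc h))"
    using semi_shuffle_less [OF S, of "Suc t" "B X (Suc h)"] tr by (cases "Suc t = B X (Suc h)") auto
  moreover have "p X t < p X (Suc t)" using semi_shuffle_less [OF S tr, of "Suc t"] by simp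
  ultimately show "p X' (Suc t) = Suc (p X' t)" using next'(1) h(1) pX by simp
qed

lemma semi_rectify:
  assumes s: "semi_shuffle r w" and P: "package X (es @ [(c, d)])"
    and st: "step_rectify X (es @ [(c, d)]) X' es' a b"
  shows "es' = es" "d \<le> b" "\<And>t. d \<le> t \<Longrightarrow> t < b \<Longrightarrow> p X' (Suc t) = Suc (p X' t)"
proof -
  have "es' = es \<and> d \<le> b \<and> (\<forall>t. d \<le> t \<longrightarrow> t < b \<longrightarrow> p X' (Suc t) = Suc (p X' t))"
  proof (cases "step_trivial X (es @ [(c, d)]) X' es' a b")
    case True
    then show ?thesis by (simp add: step_trivial_def)
  next
    case False
    then have mv: "step_move X (es @ [(c, d)]) X' es' a b" using st by (simp add: step_rectify_def)
    obtain X'' es'' j0 j1 where "start_row X (es @ [(c, d)]) X'' es'' j0 \<or> start_swap X (es @ [(c, d)]) X'' es'' j0"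
      and m: "middle X'' es'' j0" and f: "found X'' es'' j0 j1 a X' es'" and b: "b = L X'' j1"
      and BB: "\<And>j. B X'' j = B X j"
      using move_start [OF P mv] by metis
    then have start: "start_row X (es @ [(c, d)]) X'' es'' j0" using semi_start [OF s P] by blast
    then have "es'' = es" "B X j0 = d" by (auto simp: start_row_def)
    then show ?thesis using semi_found [OF s m f] BB b by auto
  qed
  then show "es' = es" "d \<le> b" "\<And>t. d \<le> t \<Longrightarrow> t < b \<Longrightarrow> p X' (Suc t) = Suc (p X' t)" by blast+
qed

end

text \<open>The inverse steps of a row, numbered like the boxes: step \<open>i\<close> leads from
  \<open>G i\<close> to \<open>G (i - 1)\<close>, \<open>K i\<close> says that it is a
  rectification, and \<open>A i\<close>, \<open>D i\<close> are the strands whose lower crossing it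
  takes out. The list \<open>xs\<close> holds the labels of the full tableau. The insertion steps
  will later run through the same states with \<open>i\<close> increasing.\<close>

locale row_run = row_algorithm r l w for r l w +
  fixes lam :: "nat list" and xs :: "nat list" and m :: nat and G :: "nat \<Rightarrow> graph"
    and T :: "nat \<Rightarrow> transpositions" and K :: "nat \<Rightarrow> bool" and A D :: "nat \<Rightarrow> nat"
  assumes pkg: "i \<le> m \<Longrightarrow> package (G i) (T i)"
    and len_T: "i \<le> m \<Longrightarrow> length (T i) = i"
    and lab_T: "i \<le> m \<Longrightarrow> labels w (T i) = take i xs"
    and rectified: "1 \<le> i \<Longrightarrow> i \<le> m \<Longrightarrow> K i \<Longrightarrow> step_rectify (G i) (T i) (G (i - 1)) (T (i - 1)) (A i) (D i)"
    and inserted: "1 \<le> i \<Longrightarrow> i \<le> m \<Longrightarrow> \<not> K i \<Longrightarrow> \<exists>j0. step_insert (G i) (T i) (G (i - 1)) (T (i - 1)) j0"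
    and lam: "is_partition lam" and m: "m = length (boxes lam)" and len_xs: "length xs = m"
    and rows: "row_strict (lam, xs)" and columns: "column_strict (lam, xs)"
    and semi_or_hook: "semi_shuffle r w \<or> hook lam"
begin

abbreviation v :: "nat \<Rightarrow> nat" where "v i \<equiv> q (G i) (D i)"

lemma strict:
  assumes "i \<in> {1..m}" "k \<in> {1..m}" "box lam i = (a, b)" "box lam k = (a', b')"
    "a = a' \<and> b < b' \<or> b = b' \<and> a < a'"
  shows "xs ! (i - 1) < xs ! (k - 1)"
  using strict_tableau_iff [of lam xs] rows columns assms len_xs by blast

lemma last_lab: "1 \<le> i \<Longrightarrow> i \<le> m \<Longrightarrow> last (labels w (T i)) = xs ! (i - 1)"
  using lab_T [of i] len_xs take_Suc_conv_app_nth [of "i - 1" xs] by simp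

lemma T_ne: "1 \<le> i \<Longrightarrow> i \<le> m \<Longrightarrow> T i \<noteq> []"
  using len_T [of i] by auto

lemma row_adjacent:
  assumes "1 \<le> i" "Suc i \<le> m" "xs ! (i - 1) < xs ! i" "K (Suc i)"
  shows "K i \<and> v i < v (Suc i)"
proof -
  have P: "package (G (Suc i)) (T (Suc i))" and s: "step_rectify (G (Suc i)) (T (Suc i)) (G i) (T i) (A (Suc i)) (D (Suc i))"
    using pkg [of "Suc i"] rectified [of "Suc i"] assms by simp_all
  have xy: "last (labels w (T i)) < last (labels w (T (Suc i)))" and ne: "T i \<noteq> []"
    using last_lab [of i] last_lab [of "Suc i"] T_ne [of i] assms by simp_all
  note c = row_consecutive [OF P s ne xy]
  have k: "K i" using inserted [of i] c(1) assms by (metis Suc_leD)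
  then have "step_rectify (G i) (T i) (G (i - 1)) (T (i - 1)) (A i) (D i)" using rectified [of i] assms by simp
  then show ?thesis using k c(2) by blast
qed

lemma row_all:
  assumes "i < k" "i \<in> {1..m}" "k \<in> {1..m}" "box lam i = (x, a)" "box lam k = (x, b)" "K k"
  shows "K i \<and> v i < v k"
  using assms
proof (induction k arbitrary: b rule: less_induct)
  case (less k)
  obtain k' where k': "k = Suc k'" using less.prems(1) by (cases k) auto
  have ik: "i \<le> k'" "k' \<in> {1..m}" using less.prems k' by auto
  obtain x' b' where b': "box lam k' = (x', b')" by (cases "box lam k'")
  have "i = k' \<or> box_before (box lam i) (box lam k')"
    using box_less_iff [of i lam k'] ik less.prems(2) m by auto
  moreover have bk: "box_before (box lam k') (box lam k)"
    using box_less_iff [of k' lam k] ik less.prems(3) m k' by auto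
  ultimately have x': "x' = x" "b' < b" using b' less.prems(4,5) by (auto simp: box_before_def)
  have "xs ! (k' - 1) < xs ! k'" using strict [OF ik(2) less.prems(3) b' less.prems(5)] x' k' by simp
  then have a: "K k' \<and> v k' < v k" using row_adjacent [of k'] ik k' less.prems by simp
  show ?case
  proof (cases "i = k'")
    case True
    then show ?thesis using a by simp
  next
    case False
    then have "K i \<and> v i < v k'"
      using less.IH [of k' b'] ik k' less.prems b' x' a by simp
    then show ?thesis using a by simp
  qed
qed

text \<open>The box below is numbered earlier and has the larger label, but by
  \<open>insert_no_larger\<close> no earlier label exceeds that of an inverse insertion.\<close>

lemma column_rectified:
  assumes "i \<in> {1..m}" "k \<in> {1..m}" "box lam i = (x, a)" "box lam k = (Suc x, a)"
  shows "K i" "k < i"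
proof -
  show ki: "k < i" using box_less_iff [of k lam i] assms m by (simp add: box_before_def)
  show "K i"
  proof (rule ccontr)
    assume "\<not> K i"
    then obtain j0 where s: "step_insert (G i) (T i) (G (i - 1)) (T (i - 1)) j0" using inserted [of i] assms by auto
    have P: "package (G i) (T i)" using pkg assms by simp
    have lt: "xs ! (i - 1) < xs ! (k - 1)" using strict [OF assms(1-4)] by simp
    have "i - 1 \<le> m" using assms(1) by auto
    then have "labels w (T (i - 1)) = take (i - 1) xs" by (rule lab_T)
    moreover have "xs ! (k - 1) \<in> set (take (i - 1) xs)"
    proof -
      have "take (i - 1) xs ! (k - 1) = xs ! (k - 1)" "k - 1 < length (take (i - 1) xs)"
        using ki assms(1,2) len_xs by auto
      then show ?thesis by (metis nth_mem)
    qed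
    ultimately have "xs ! (k - 1) \<le> xs ! (i - 1)"
      using insert_no_larger [OF P s] last_lab [of i] assms(1) by simp
    then show False using lt by simp
  qed
qed

text \<open>In a hook a column with two boxes is the first one, and the lower box is alone in its
  row. So the upper box is numbered directly after it and \<open>column_consecutive\<close>
  applies.\<close>

lemma hook_column:
  assumes "hook lam" "i \<in> {1..m}" "k \<in> {1..m}" "box lam i = (x, a)" "box lam k = (Suc x, a)" "K k"
  shows "i = Suc k" "v i < v k"
proof -
  have ib: "1 \<le> x" "1 \<le> a" "a \<le> part lam x" "a \<le> part lam (Suc x)"
    using box_in [of i lam] box_in [of k lam] assms m by (auto simp: set_boxes)
  have "part lam (Suc x) \<le> 1" using assms(1) ib(1) by (simp add: hook_def)
  then have a: "a = 1" "part lam (Suc x) = 1" using ib by simp_all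
  then have "(x, 1) \<in> set (boxes lam)" using ib by (simp add: set_boxes)
  then have "box lam (Suc k) = box lam i" "Suc k \<in> {1..m}"
    using box_up [of k lam x a] assms a m by simp_all
  then show ik: "i = Suc k" using box_inj [of i lam "Suc k"] assms m by simp
  have Ki: "K i" using column_rectified(1) [OF assms(2-5)] .
  have s: "step_rectify (G i) (T i) (G k) (T k) (A i) (D i)"
    "step_rectify (G k) (T k) (G (k - 1)) (T (k - 1)) (A k) (D k)"
    using rectified [of i] rectified [of k] assms Ki ik by simp_all
  have "xs ! (i - 1) < xs ! (k - 1)" using strict [OF assms(2-5)] by simp
  then have "last (labels w (T i)) < last (labels w (T k))" using last_lab [of i] last_lab [of k] assms by simp
  then have "v i < v k" using column_consecutive [OF pkg [of i] s(1) T_ne [of k] _ s(2)] assms by simp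
  then show "v i < v k" .
qed

lemma q_step:
  assumes "1 \<le> i" "i \<le> m"
  shows "K i \<Longrightarrow> q (G (i - 1)) = q (G i) \<circ> transpose (A i) (D i)"
    and "\<not> K i \<Longrightarrow> rows_ge (G (i - 1)) (Suc l) = rows_ge (G i) (Suc l)"
    and "\<not> K i \<Longrightarrow> q (G (i - 1)) = q (G i)"
proof -
  show "K i \<Longrightarrow> q (G (i - 1)) = q (G i) \<circ> transpose (A i) (D i)"
    using rectify_effect(4) [OF pkg [OF assms(2)] rectified [OF assms]] by simp
  show *: "\<not> K i \<Longrightarrow> rows_ge (G (i - 1)) (Suc l) = rows_ge (G i) (Suc l)"
    using insert_effect(3) [OF pkg [OF assms(2)]] inserted [OF assms] by blast
  show "\<not> K i \<Longrightarrow> q (G (i - 1)) = q (G i)"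
    using * by (simp add: below_perm_def)
qed

lemma rect_colors: "1 \<le> i \<Longrightarrow> i \<le> m \<Longrightarrow> K i \<Longrightarrow> 1 \<le> A i \<and> A i \<le> r \<and> r < D i \<and> v i < q (G i) (A i)"
  using rectify_effect(3,5,6,7) [OF pkg rectified] by blast

section \<open>Blue strands along rows for a semi-shuffle\<close>

context
  assumes semi: "semi_shuffle r w"
begin

lemma T_butlast: "1 \<le> i \<Longrightarrow> i \<le> m \<Longrightarrow> T (i - 1) = butlast (T i)"
proof -
  assume i: "1 \<le> i" "i \<le> m"
  obtain c d where "last (T i) = (c, d)" by (cases "last (T i)")
  then have T: "T i = butlast (T i) @ [(c, d)]" using T_ne [OF i] by (metis append_butlast_last_id)
  show ?thesis
  proof (cases "K i")
    case True
    then show ?thesis using semi_rectify(1) [OF semi, of "G i" "butlast (T i)" c d] pkg [OF i(2)] rectified [OF i] T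
      by metis
  next
    case False
    then obtain j0 where "start_row (G i) (T i) (G (i - 1)) (T (i - 1)) j0"
      using inserted [OF i] by (auto simp: step_insert_def)
    then show ?thesis by (auto simp: start_row_def)
  qed
qed

text \<open>Without exchanges every step just drops the last entry, so all tableaux are initial
  parts of one list and an entry depends on its box alone.\<close>

lemma T_take: "i \<le> m \<Longrightarrow> T i = take i (T m)"
proof (induction "m - i" arbitrary: i)
  case 0
  then show ?case using len_T [of m] by simp
next
  case (Suc n)
  then have "T (Suc i) = take (Suc i) (T m)" by simp
  then show ?case using T_butlast [of "Suc i"] Suc.hyps(2) len_T [of m] by (simp add: butlast_take)
qed

abbreviation eb :: "nat \<Rightarrow> nat" where "eb i \<equiv> snd (T m ! (i - 1))"
abbreviation ea :: "nat \<Rightarrow> nat" where "ea i \<equiv> fst (T m ! (i - 1))"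

lemma T_snoc: "1 \<le> i \<Longrightarrow> i \<le> m \<Longrightarrow> T i = T (i - 1) @ [(ea i, eb i)]"
  using T_take [of i] T_take [of "i - 1"] take_Suc_conv_app_nth [of "i - 1" "T m"] len_T [of m] by simp

lemma p_step:
  assumes "1 \<le> i" "i \<le> m"
  shows "p (G i) = p (G (i - 1)) \<circ> transpose (ea i) (eb i)" "ea i \<le> r" "r < eb i"
    "p (G i) (eb i) = xs ! (i - 1)" "p (G (i - 1)) (ea i) = xs ! (i - 1)"
    "p (G (i - 1)) (ea i) < p (G (i - 1)) (eb i)" "1 \<le> ea i"
    "\<And>t. r < t \<Longrightarrow> t < eb i \<Longrightarrow> p (G (i - 1)) t < xs ! (i - 1)"
proof -
  have P: "package (G i) (T (i - 1) @ [(ea i, eb i)])" using pkg [OF assms(2)] T_snoc [OF assms] by simp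
  note last = package_last [OF P]
  have P': "package (G (i - 1)) (T (i - 1))" using pkg assms by simp
  then have pp: "w \<circ> trans_perm (T (i - 1)) = p (G (i - 1))" by (simp add: package_def)
  show "p (G i) = p (G (i - 1)) \<circ> transpose (ea i) (eb i)" using last(6) pp by (simp del: comp_apply)
  then have tr: "p (G i) s = p (G (i - 1)) (transpose (ea i) (eb i) s)" for s by simp
  show ab: "ea i \<le> r" "r < eb i" "1 \<le> ea i" using last by simp_all
  show pb: "p (G i) (eb i) = xs ! (i - 1)"
    using last_label [OF pkg [OF assms(2)] T_ne [OF assms]] last_lab [OF assms] T_snoc [OF assms] by simp
  then show pa: "p (G (i - 1)) (ea i) = xs ! (i - 1)" using tr [of "eb i"] by simp
  show lt: "p (G (i - 1)) (ea i) < p (G (i - 1)) (eb i)" using tr [of "eb i"] tr [of "ea i"] last(9) by simp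
  fix t assume t: "r < t" "t < eb i"
  have "p (G i) t = p (G (i - 1)) t" using tr [of t] t ab by (simp add: transpose_def)
  moreover have "p (G (i - 1)) t < p (G (i - 1)) (eb i)"
    using semi_shuffle_less [OF package_semi(1) [OF semi P'] t] .
  ultimately show "p (G (i - 1)) t < xs ! (i - 1)"
    using last(10) [of t] t ab tr [of "ea i"] pb by simp
qed

lemma p_unchanged:
  assumes "k \<le> i" "i \<le> m" "r < t" "\<And>h. k < h \<Longrightarrow> h \<le> i \<Longrightarrow> eb h \<noteq> t"
  shows "p (G i) t = p (G k) t"
  using assms
proof (induction i rule: dec_induct)
  case (step n)
  note st = p_step [of "Suc n"]
  have "eb (Suc n) \<noteq> t" using step.prems(3) [of "Suc n"] step.hyps by simp
  moreover have "ea (Suc n) \<noteq> t" using st(2) step.prems(1,2) by simp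
  ultimately have "p (G (Suc n)) t = p (G n) t"
    using st(1) step.prems(1) by (simp add: transpose_def)
  then show ?case using step by simp
qed simp

lemma q_unchanged:
  assumes "k \<le> i" "i \<le> m" "r < t" "\<And>h. k < h \<Longrightarrow> h \<le> i \<Longrightarrow> K h \<Longrightarrow> D h \<noteq> t"
  shows "q (G i) t = q (G k) t"
  using assms
proof (induction i rule: dec_induct)
  case (step n)
  have "q (G (Suc n)) t = q (G n) t"
  proof (cases "K (Suc n)")
    case True
    then have "q (G n) = q (G (Suc n)) \<circ> transpose (A (Suc n)) (D (Suc n))"
      using q_step(1) [of "Suc n"] step.prems by simp
    moreover have "A (Suc n) \<noteq> t" "D (Suc n) \<noteq> t"
      using rect_colors [of "Suc n"] step.prems step.hyps True by auto
    ultimately show ?thesis by (simp add: transpose_def)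
  next
    case False
    then show ?thesis using q_step(3) [of "Suc n"] step.prems by simp
  qed
  then show ?case using step by simp
qed simp

text \<open>In \<open>G i\<close> the strand \<open>eb i\<close> has its own label as value, while
  \<open>eb (Suc i)\<close> still has a value above its own, larger label; blue strands are ordered
  like their values.\<close>

lemma b_row_adjacent:
  assumes "1 \<le> i" "Suc i \<le> m" "xs ! (i - 1) < xs ! i" shows "eb i < eb (Suc i)"
proof (rule ccontr)
  assume n: "\<not> ?thesis"
  note 1 = p_step [of i] and 2 = p_step [of "Suc i"]
  have S: "semi_shuffle r (p (G i))" using package_semi(1) [OF semi pkg] assms by simp
  have "p (G i) (eb (Suc i)) \<le> p (G i) (eb i)"
    using n semi_shuffle_less [OF S, of "eb (Suc i)" "eb i"] 2 assms
    by (cases "eb (Suc i) = eb i") auto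
  then show False using 1 2 assms by simp
qed

lemma D_row_adjacent:
  assumes "1 \<le> i" "Suc i \<le> m" "xs ! (i - 1) < xs ! i" "K (Suc i)" shows "D i < D (Suc i)"
proof (rule ccontr)
  assume n: "\<not> ?thesis"
  have k: "K i" "v i < v (Suc i)" using row_adjacent [OF assms] by simp_all
  have S: "semi_shuffle r (q (G i))" using package_semi(2) [OF semi pkg] assms by simp
  have c: "r < D (Suc i)" "v (Suc i) < q (G (Suc i)) (A (Suc i))" using rect_colors [of "Suc i"] assms by simp_all
  have "q (G i) (D (Suc i)) \<le> v i"
    using n semi_shuffle_less [OF S c(1), of "D i"] by (cases "D (Suc i) = D i") auto
  moreover have "q (G i) (D (Suc i)) = q (G (Suc i)) (A (Suc i))"
    using q_step(1) [of "Suc i"] assms by simp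
  ultimately show False using c k by simp
qed

lemma between_boxes:
  assumes "i \<in> {1..m}" "k \<in> {1..m}" "box lam i = (x, y)" "box lam k = (Suc x, y)" "k < h" "h < i"
  shows "(\<exists>y'>y. box lam h = (Suc x, y')) \<or> (\<exists>y'<y. box lam h = (x, y') \<and> 1 \<le> y')"
proof -
  have h: "h \<in> {1..m}" using assms by auto
  have "box_before (box lam k) (box lam h)" "box_before (box lam h) (box lam i)"
    using box_less_iff [of k lam h] box_less_iff [of h lam i] assms h m by simp_all
  moreover have "1 \<le> snd (box lam h)" using box_in [of h lam] h m by (auto simp: set_boxes)
  ultimately show ?thesis using assms(3,4) by (cases "box lam h") (auto simp: box_before_def)
qed

lemma b_row:
  assumes "i < k" "i \<in> {1..m}" "k \<in> {1..m}" "box lam i = (x, y)" "box lam k = (x, y')"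
  shows "eb i < eb k"
  using assms
proof (induction k arbitrary: y' rule: less_induct)
  case (less k)
  obtain k' where k': "k = Suc k'" using less.prems(1) by (cases k) auto
  have ik: "i \<le> k'" "k' \<in> {1..m}" using less.prems k' by auto
  obtain x' c where c: "box lam k' = (x', c)" by (cases "box lam k'")
  have "i = k' \<or> box_before (box lam i) (box lam k')"
    using box_less_iff [of i lam k'] ik less.prems(2) m by auto
  moreover have "box_before (box lam k') (box lam k)"
    using box_less_iff [of k' lam k] ik less.prems(3) m k' by auto
  ultimately have x': "x' = x" "c < y'" using c less.prems(4,5) by (auto simp: box_before_def)
  have "xs ! (k' - 1) < xs ! k'" using strict [OF ik(2) less.prems(3) c less.prems(5)] x' k' by simp
  then have a: "eb k' < eb k" using b_row_adjacent [of k'] ik k' less.prems by simp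
  show ?case
  proof (cases "i = k'")
    case True
    then show ?thesis using a by simp
  next
    case False
    then have "eb i < eb k'" using less.IH [of k' c] ik k' less.prems c x' by simp
    then show ?thesis using a by simp
  qed
qed

lemma D_row:
  assumes "i < k" "i \<in> {1..m}" "k \<in> {1..m}" "box lam i = (x, y)" "box lam k = (x, y')" "K k"
  shows "D i < D k"
  using assms
proof (induction k arbitrary: y' rule: less_induct)
  case (less k)
  obtain k' where k': "k = Suc k'" using less.prems(1) by (cases k) auto
  have ik: "i \<le> k'" "k' \<in> {1..m}" using less.prems k' by auto
  obtain x' c where c: "box lam k' = (x', c)" by (cases "box lam k'")
  have "i = k' \<or> box_before (box lam i) (box lam k')"
    using box_less_iff [of i lam k'] ik less.prems(2) m by auto
  moreover have "box_before (box lam k') (box lam k)"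
    using box_less_iff [of k' lam k] ik less.prems(3) m k' by auto
  ultimately have x': "x' = x" "c < y'" using c less.prems(4,5) by (auto simp: box_before_def)
  have "xs ! (k' - 1) < xs ! k'" using strict [OF ik(2) less.prems(3) c less.prems(5)] x' k' by simp
  then have a: "D k' < D k" "K k'"
    using D_row_adjacent [of k'] row_adjacent [of k'] ik k' less.prems by simp_all
  show ?case
  proof (cases "i = k'")
    case True
    then show ?thesis using a by simp
  next
    case False
    then have "D i < D k'" using less.IH [of k' c] ik k' less.prems c x' a by simp
    then show ?thesis using a by simp
  qed
qed

end

end

lemma down_closed_interval:
  fixes S :: "nat set"
  assumes "finite S" "\<And>y y'. y \<in> S \<Longrightarrow> 1 \<le> y' \<Longrightarrow> y' \<le> y \<Longrightarrow> y' \<in> S" "0 \<notin> S"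
  shows "S = {1..card S}"
proof (cases "S = {}")
  case False
  have pos: "1 \<le> y" if "y \<in> S" for y using assms(3) that by (cases y) auto
  define M where "M = Max S"
  have M: "M \<in> S" "\<And>y. y \<in> S \<Longrightarrow> y \<le> M"
    unfolding M_def using Max_in [OF assms(1) False] Max_ge [OF assms(1)] by blast+
  have "y \<in> S \<longleftrightarrow> y \<in> {1..M}" for y using assms(2) [OF M(1), of y] pos [of y] M(2) [of y] by auto
  then have e: "S = {1..M}" by blast
  have "card S = M" unfolding e by simp
  then show ?thesis using e by simp
qed simp

context row_run
begin

context
  assumes semi: "semi_shuffle r w"
begin

lemma row_box:
  assumes "k \<in> {1..m}" "box lam k = (x, y)" "1 \<le> y'" "y' \<le> y"
  obtains i where "i \<in> {1..m}" "box lam i = (x, y')"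
proof -
  have "(x, y') \<in> set (boxes lam)" using box_in [of k lam] assms m by (simp add: set_boxes)
  then show thesis using box_ex that m by metis
qed

lemma row_index_less:
  assumes "i \<in> {1..m}" "k \<in> {1..m}" "box lam i = (x, y)" "box lam k = (x, y')" "y < y'"
  shows "i < k"
  using box_less_iff [of i lam k] assms m by (simp add: box_before_def)

text \<open>Between the two boxes come the rest of the lower row and the start of the upper one. The
  former have larger blue strands by \<open>b_row\<close>, the latter smaller ones by induction on
  the column. So \<open>eb k\<close> keeps the label of \<open>k\<close> as its value; this exceeds
  the label of \<open>i\<close>, while a blue strand before \<open>eb i\<close> has a value below
  that label.\<close>

lemma b_column:
  assumes "i \<in> {1..m}" "k \<in> {1..m}" "box lam i = (x, y)" "box lam k = (Suc x, y)"
  shows "eb i \<le> eb k \<and> p (G (i - 1)) (eb k) = xs ! (k - 1)"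
  using assms
proof (induction y arbitrary: i k rule: less_induct)
  case (less y)
  note i = less.prems(1) and k = less.prems(2)
  have ki: "k < i" using column_rectified(2) [OF less.prems] .
  have other: "eb h \<noteq> eb k" if h: "k < h" "h \<le> i - 1" for h
  proof -
    have hm: "h \<in> {1..m}" "h < i" using h i by auto
    from between_boxes [OF semi less.prems h(1) hm(2)] show ?thesis
    proof (elim disjE exE conjE)
      fix y' assume "y < y'" "box lam h = (Suc x, y')"
      then show ?thesis using b_row [OF semi h(1) k hm(1) less.prems(4)] by auto
    next
      fix y' assume y': "y' < y" "box lam h = (x, y')" "1 \<le> y'"
      obtain k' where k': "k' \<in> {1..m}" "box lam k' = (Suc x, y')"
        using row_box [OF k less.prems(4) y'(3)] y'(1) by auto
      have "eb h \<le> eb k'" using less.IH [OF y'(1) hm(1) k'(1) y'(2) k'(2)] by simp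
      moreover have "eb k' < eb k"
        using b_row [OF semi row_index_less [OF k'(1) k k'(2) less.prems(4) y'(1)] k'(1) k k'(2) less.prems(4)] .
      ultimately show ?thesis by simp
    qed
  qed
  have pk: "p (G k) (eb k) = xs ! (k - 1)" "r < eb k" using p_step(3,4) [OF semi, of k] k by auto
  have e: "p (G (i - 1)) (eb k) = xs ! (k - 1)"
    using p_unchanged [OF semi, of k "i - 1" "eb k"] other ki i pk by auto
  have "\<not> eb k < eb i"
  proof
    assume "eb k < eb i"
    then have "p (G (i - 1)) (eb k) < xs ! (i - 1)" using p_step(8) [OF semi, of i "eb k"] i pk(2) by simp
    then show False using e strict [OF i k less.prems(3,4)] by simp
  qed
  then show ?case using e by simp
qed

lemma D_eb:
  assumes "i \<in> {1..m}" "K i"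
  shows "eb i \<le> D i" "\<And>t. eb i \<le> t \<Longrightarrow> t < D i \<Longrightarrow> p (G (i - 1)) (Suc t) = Suc (p (G (i - 1)) t)"
proof -
  have i: "1 \<le> i" "i \<le> m" using assms(1) by simp_all
  have T: "T i = T (i - 1) @ [(fst (T m ! (i - 1)), eb i)]" using T_snoc [OF semi i] by simp
  note s = semi_rectify [OF semi pkg [OF i(2), unfolded T] rectified [OF i assms(2), unfolded T]]
  show "eb i \<le> D i" using s(2) .
  show "p (G (i - 1)) (Suc t) = Suc (p (G (i - 1)) t)" if "eb i \<le> t" "t < D i" for t
    using s(3) that by simp
qed

text \<open>Suppose \<open>eb k < D i\<close>. By \<open>D_eb\<close> the strand after
  \<open>eb k\<close> has the next value in \<open>G (i - 1)\<close>, but in \<open>G k\<close> it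
  had a larger one, so it occurs in a box between. That box lies to the right of \<open>k\<close>,
  which forces \<open>eb (Suc k) = Suc (eb k)\<close>. Now the claim for the next column and
  \<open>D i < D (Suc i)\<close> contradict each other; hence the induction from the right end of
  the lower row.\<close>

lemma D_column:
  assumes "i \<in> {1..m}" "k \<in> {1..m}" "box lam i = (x, y)" "box lam k = (Suc x, y)"
  shows "D i \<le> eb k"
  using assms
proof (induction "part lam (Suc x) - y" arbitrary: i k y rule: less_induct)
  case less
  note i = less.prems(1) and k = less.prems(2)
  have ki: "k < i" and Ki: "K i" using column_rectified [OF less.prems] by simp_all
  have bc: "eb i \<le> eb k" "p (G (i - 1)) (eb k) = xs ! (k - 1)" using b_column [OF less.prems] by simp_all
  have rk: "r < eb k" "ea \<le> r" if "ea = fst (T m ! (k - 1))" for ea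
    using p_step(2,3) [OF semi, of k] k that by auto
  show ?case
  proof (rule ccontr)
    assume "\<not> ?case"
    then have lt: "eb k < D i" by simp
    let ?t = "Suc (eb k)"
    have next': "p (G (i - 1)) ?t = Suc (xs ! (k - 1))" using D_eb(2) [OF i Ki bc(1) lt] bc(2) by simp
    have S: "semi_shuffle r (p (G (k - 1)))"
      by (rule package_semi(1) [OF semi pkg]) (use k in auto)
    note st = p_step [OF semi, of k]
    have "p (G (k - 1)) (eb k) < p (G (k - 1)) ?t" using semi_shuffle_less [OF S rk(1) [OF refl], of ?t] by simp
    moreover have "p (G k) ?t = p (G (k - 1)) ?t"
      using st(1) rk [OF refl] k by (simp add: transpose_def)
    ultimately have "Suc (xs ! (k - 1)) < p (G k) ?t" using st(5,6) k by simp
    then have "p (G (i - 1)) ?t \<noteq> p (G k) ?t" using next' by simp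
    moreover have "k \<le> i - 1" "i - 1 \<le> m" "r < ?t" using ki i rk(1) [OF refl] by auto
    ultimately obtain h where h: "k < h" "h \<le> i - 1" "eb h = ?t"
      using p_unchanged [OF semi, of k "i - 1" ?t] by blast
    have hm: "h \<in> {1..m}" "h < i" using h i by auto
    from between_boxes [OF semi less.prems h(1) hm(2)] show False
    proof (elim disjE exE conjE)
      fix y' assume y': "y < y'" "box lam h = (Suc x, y')"
      have bx: "1 \<le> x" "1 \<le> y" using box_in [of i lam] i less.prems(3) m by (auto simp: set_boxes)
      have "y' \<le> part lam (Suc x)" using box_in [of h lam] hm y' m by (auto simp: set_boxes)
      then have inb: "(Suc x, Suc y) \<in> set (boxes lam)" "(x, Suc y) \<in> set (boxes lam)"
        using y' bx part_antimono [OF lam bx(1), of "Suc x"] by (auto simp: set_boxes)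
      have k1: "Suc k \<in> {1..m}" "box lam (Suc k) = (Suc x, Suc y)"
        using box_right [of k lam "Suc x" y] k less.prems(4) inb m by simp_all
      have i1: "Suc i \<in> {1..m}" "box lam (Suc i) = (x, Suc y)"
        using box_right [of i lam x y] i less.prems(3) inb m by simp_all
      have "eb k < eb (Suc k)" using b_row [OF semi _ k k1(1) less.prems(4) k1(2)] by simp
      moreover have "eb (Suc k) \<le> eb h"
      proof (cases "h = Suc k")
        case False
        then show ?thesis using b_row [OF semi _ k1(1) hm(1) k1(2) y'(2)] h(1) by simp
      qed simp
      ultimately have e: "eb (Suc k) = ?t" using h(3) by simp
      have "part lam (Suc x) - Suc y < part lam (Suc x) - y"
        using \<open>y' \<le> part lam (Suc x)\<close> y'(1) by simp
      then have "D (Suc i) \<le> eb (Suc k)" using less.hyps [OF _ i1(1) k1(1) i1(2) k1(2)] by blast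
      moreover have "K (Suc i)" using column_rectified(1) [OF i1(1) k1(1) i1(2) k1(2)] .
      then have "D i < D (Suc i)" using D_row [OF semi _ i i1(1) less.prems(3) i1(2)] by simp
      ultimately show False using lt e by simp
    next
      fix y' assume y': "y' < y" "box lam h = (x, y')"
      then have "eb h < eb i" using b_row [OF semi hm(2,1) i y'(2) less.prems(3)] by simp
      then show False using bc(1) h(3) by simp
    qed
  qed
qed

text \<open>The strands satisfy \<open>D i \<le> eb k \<le> D k\<close>, and \<open>D k\<close> is
  not touched between the two boxes. In \<open>G (i - 1)\<close> the value of \<open>D i\<close> in
  the lower rows exceeds \<open>v i\<close> and is at most that of \<open>D k\<close>, which is
  \<open>v k\<close>.\<close>

lemma semi_column:
  assumes "i \<in> {1..m}" "k \<in> {1..m}" "box lam i = (x, y)" "box lam k = (Suc x, y)" "K k"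
  shows "v i < v k"
proof -
  have ki: "k < i" and Ki: "K i" using column_rectified [OF assms(1-4)] by simp_all
  have D: "D i \<le> D k" using D_column [OF assms(1-4)] D_eb(1) [OF assms(2,5)] by simp
  have ck: "r < D k" using rect_colors [of k] assms by simp
  have ci: "r < D i" "v i < q (G i) (A i)" using rect_colors [of i] assms(1) Ki by simp_all
  have "D h \<noteq> D k" if h: "k < h" "h \<le> i - 1" "K h" for h
  proof -
    have hm: "h \<in> {1..m}" "h < i" using h assms(1) by auto
    from between_boxes [OF semi assms(1-4) h(1) hm(2)] show ?thesis
    proof (elim disjE exE conjE)
      fix y' assume "y < y'" "box lam h = (Suc x, y')"
      then show ?thesis using D_row [OF semi h(1) assms(2) hm(1) assms(4) _ h(3)] by auto
    next
      fix y' assume "y' < y" "box lam h = (x, y')"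
      then show ?thesis using D_row [OF semi hm(2,1) assms(1) _ assms(3) Ki] D by auto
    qed
  qed
  then have vk: "q (G (i - 1)) (D k) = v k"
    using q_unchanged [OF semi, of k "i - 1" "D k"] ki assms(1) ck by auto
  have S: "semi_shuffle r (q (G (i - 1)))"
    by (rule package_semi(2) [OF semi pkg]) (use assms(1) in auto)
  have "q (G (i - 1)) (D i) = q (G i) (A i)" using q_step(1) [of i] assms(1) Ki by simp
  moreover have "q (G (i - 1)) (D i) \<le> q (G (i - 1)) (D k)"
    using semi_shuffle_less [OF S ci(1), of "D k"] D by (cases "D i = D k") auto
  ultimately show ?thesis using ci(2) vk by simp
qed

end

lemma column_adjacent:
  assumes "i \<in> {1..m}" "k \<in> {1..m}" "box lam i = (x, y)" "box lam k = (Suc x, y)" "K k"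
  shows "v i < v k"
  using semi_or_hook semi_column [OF _ assms] hook_column(2) [OF _ assms] by blast

lemma column_all:
  assumes "i \<in> {1..m}" "k \<in> {1..m}" "box lam i = (x, y)" "box lam k = (x', y)" "x < x'" "K k"
  shows "v i < v k"
  using assms
proof (induction x' arbitrary: k)
  case 0
  then show ?case by simp
next
  case (Suc x')
  have x: "1 \<le> x" "1 \<le> y" using box_in [of i lam] Suc.prems m by (auto simp: set_boxes)
  have "y \<le> part lam (Suc x')" using box_in [of k lam] Suc.prems m by (simp add: set_boxes)
  moreover have "part lam (Suc x') \<le> part lam x'" using part_antimono [OF lam, of x' "Suc x'"] x Suc.prems(5) by simp
  ultimately have "(x', y) \<in> set (boxes lam)" using x Suc.prems(5) by (simp add: set_boxes)
  then obtain j where j: "j \<in> {1..m}" "box lam j = (x', y)" using box_ex [of "(x', y)" lam] m by blast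
  have jk: "v j < v k" using column_adjacent [OF j(1) Suc.prems(2) j(2) Suc.prems(4,6)] .
  have Kj: "K j" using column_rectified(1) [OF j(1) Suc.prems(2) j(2) Suc.prems(4)] .
  show ?case
  proof (cases "x = x'")
    case True
    then have "i = j" using box_inj [of i lam j] j Suc.prems(1,3) m by simp
    then show ?thesis using jk by simp
  next
    case False
    then have "v i < v j" using Suc.IH [OF Suc.prems(1) j(1) Suc.prems(3) j(2) _ Kj] Suc.prems(5) by simp
    then show ?thesis using jk by simp
  qed
qed

section \<open>The tableau passed on to the next row\<close>

definition rect :: "nat \<Rightarrow> nat list" where
  "rect i = filter K [1..<Suc i]"

abbreviation ts :: "nat \<Rightarrow> transpositions" where
  "ts i \<equiv> map (\<lambda>h. (A h, D h)) (rect i)"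

lemma rect_0 [simp]: "rect 0 = []"
  by (simp add: rect_def)

lemma rect_Suc: "rect (Suc i) = (if K (Suc i) then rect i @ [Suc i] else rect i)"
  by (simp add: rect_def)

lemma rect_split: "i \<le> m \<Longrightarrow> rect m = rect i @ filter K [Suc i..<Suc m]"
proof -
  assume "i \<le> m"
  then have "[1..<Suc m] = [1..<Suc i] @ [Suc i..<Suc m]"
    by (metis Suc_le_mono le_add1 plus_1_eq_Suc upt_add_eq_append le_Suc_ex add_Suc)
  then show ?thesis by (simp add: rect_def del: upt_Suc)
qed

lemma set_rect: "set (rect i) = {h \<in> {1..i}. K h}"
  by (auto simp: rect_def less_Suc_eq_le simp del: upt_Suc)

lemma distinct_rect: "distinct (rect i)"
  unfolding rect_def by (rule distinct_filter) (rule distinct_upt)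

lemma rect_at:
  assumes "1 \<le> i" "i \<le> m" "K i"
  shows "length (rect (i - 1)) < length (rect m)" "rect m ! length (rect (i - 1)) = i"
    "take (length (rect (i - 1))) (rect m) = rect (i - 1)" "length (rect i) = Suc (length (rect (i - 1)))"
proof -
  have "rect i = rect (i - 1) @ [i]" using rect_Suc [of "i - 1"] assms by simp
  then have "rect m = rect (i - 1) @ [i] @ filter K [Suc i..<Suc m]" "length (rect i) = Suc (length (rect (i - 1)))"
    using rect_split [OF assms(2)] by simp_all
  then show "length (rect (i - 1)) < length (rect m)" "rect m ! length (rect (i - 1)) = i"
    "take (length (rect (i - 1))) (rect m) = rect (i - 1)" "length (rect i) = Suc (length (rect (i - 1)))"
    by simp_all
qed

lemma rect_before:
  assumes "k < length (rect m)"
  shows "rect (rect m ! k - 1) = take k (rect m)" "rect (rect m ! k) = take (Suc k) (rect m)"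
    "1 \<le> rect m ! k" "rect m ! k \<le> m" "K (rect m ! k)"
proof -
  let ?i = "rect m ! k"
  have i: "?i \<in> set (rect m)" using assms by simp
  then show i': "1 \<le> ?i" "?i \<le> m" "K ?i" unfolding set_rect by simp_all
  note at = rect_at [OF i']
  have "length (rect (?i - 1)) = k"
    using nth_eq_iff_index_eq [OF distinct_rect at(1) assms] at(2) by simp
  then show 1: "rect (?i - 1) = take k (rect m)" using at(3) by simp
  have "rect ?i = rect (?i - 1) @ [?i]" using rect_Suc [of "?i - 1"] i' by simp
  then show "rect ?i = take (Suc k) (rect m)" using 1 assms by (simp add: take_Suc_conv_app_nth)
qed

text \<open>The choice only provides a name: existence is proved next, and uniqueness, which the
  algorithm demands, in \<open>only_mu\<close>.\<close>

definition mu :: "nat list" where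
  "mu = (SOME mu. is_partition mu \<and> set (boxes mu) = box lam ` set (rect m))"

text \<open>By \<open>row_all\<close> the rectified boxes fill an initial part of each row; by
  \<open>column_rectified\<close> this part covers everything that has a box of the row below under
  it, so the sizes decrease weakly.\<close>

lemma mu: "is_partition mu" "set (boxes mu) = box lam ` set (rect m)"
proof -
  define S where "S = box lam ` set (rect m)"
  have S_I: "(x, y) \<in> S" if "i \<in> {1..m}" "K i" "box lam i = (x, y)" for i x y
  proof -
    have "i \<in> set (rect m)" using that by (simp add: set_rect)
    then show ?thesis unfolding S_def using that(3) by (metis imageI)
  qed
  have S_D: "\<exists>i\<in>{1..m}. K i \<and> box lam i = (x, y)" if "(x, y) \<in> S" for x y
    using that unfolding S_def set_rect by auto
  have "finite S" unfolding S_def by simp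
  have fin: "finite {y. (x, y) \<in> S}" for x
    using \<open>finite S\<close> by (rule finite_row)
  have pos: "1 \<le> x \<and> 1 \<le> y \<and> y \<le> part lam x" if "(x, y) \<in> S" for x y
  proof -
    obtain i where "i \<in> {1..m}" "box lam i = (x, y)" using S_D \<open>(x, y) \<in> S\<close> by blast
    then show ?thesis using box_in [of i lam] m by (simp add: set_boxes)
  qed
  have down: "(x, y') \<in> S" if "(x, y) \<in> S" "1 \<le> y'" "y' \<le> y" for x y y'
  proof -
    obtain k where k: "k \<in> {1..m}" "K k" "box lam k = (x, y)" using S_D \<open>(x, y) \<in> S\<close> by blast
    have "(x, y') \<in> set (boxes lam)" using pos [OF that(1)] that by (simp add: set_boxes)
    then obtain i where i: "i \<in> {1..m}" "box lam i = (x, y')" using box_ex [of "(x, y')" lam] m by blast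
    show ?thesis
    proof (cases "y' = y")
      case False
      then have "i < k" using box_less_iff [of i lam k] i k m that(3) by (simp add: box_before_def)
      then have "K i" using row_all [OF _ i(1) k(1) i(2) k(3,2)] by simp
      then show ?thesis using S_I i by blast
    qed (use that in simp)
  qed
  have up: "(x, y) \<in> S" if "(Suc x, y) \<in> set (boxes lam)" "1 \<le> x" for x y
  proof -
    obtain k where k: "k \<in> {1..m}" "box lam k = (Suc x, y)"
      using box_ex [of "(Suc x, y)" lam] \<open>(Suc x, y) \<in> set (boxes lam)\<close> m by blast
    have "(x, y) \<in> set (boxes lam)" using that part_antimono [OF lam that(2), of "Suc x"] by (simp add: set_boxes)
    then obtain i where i: "i \<in> {1..m}" "box lam i = (x, y)" using box_ex [of "(x, y)" lam] m by blast
    then show ?thesis using column_rectified(1) [OF i(1) k(1) i(2) k(2)] S_I [OF i(1)] i(2) by blast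
  qed
  have sub: "x \<in> set (boxes lam)" if "x \<in> S" for x
    using that pos by (cases x) (simp add: set_boxes)
  let ?f = "\<lambda>x. card {y. (x, y) \<in> S}"
  have int: "{y. (x, y) \<in> S} = {1..?f x}" for x
    by (rule down_closed_interval) (use fin down pos [of x 0] in auto)
  have "?f (Suc x) \<le> ?f x" if "1 \<le> x" for x
    by (rule card_mono [OF fin]) (use up that sub in auto)
  moreover have "?f x = 0" if "length lam < x" for x
  proof -
    have "{y. (x, y) \<in> S} = {}" using pos part_beyond [OF that] by fastforce
    then show ?thesis by simp
  qed
  ultimately obtain nu where nu: "is_partition nu" "\<And>x. 1 \<le> x \<Longrightarrow> part nu x = ?f x"
    using partition_of_function [of ?f "length lam"] by blast
  have "set (boxes nu) = S"
  proof (rule set_eqI)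
    fix z :: "nat \<times> nat"
    obtain x y where z: "z = (x, y)" by (cases z)
    have mem: "(x, y) \<in> S \<longleftrightarrow> y \<in> {1..?f x}" using int [of x] by blast
    have "z \<in> set (boxes nu) \<longleftrightarrow> 1 \<le> x \<and> 1 \<le> y \<and> y \<le> ?f x"
      unfolding z set_boxes using nu(2) [of x] by auto
    also have "\<dots> \<longleftrightarrow> 1 \<le> x \<and> (x, y) \<in> S" using mem by simp
    also have "\<dots> \<longleftrightarrow> z \<in> S" using pos z by blast
    finally show "z \<in> set (boxes nu) \<longleftrightarrow> z \<in> S" .
  qed
  then have "\<exists>mu. is_partition mu \<and> set (boxes mu) = box lam ` set (rect m)" using nu(1) S_def by blast
  then have "is_partition mu \<and> set (boxes mu) = box lam ` set (rect m)"
    unfolding mu_def by (rule someI_ex)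
  then show "is_partition mu" "set (boxes mu) = box lam ` set (rect m)" by simp_all
qed

lemma only_mu: "only {mu. is_partition mu \<and> set (boxes mu) = box lam ` set (rect m)} = Some mu"
proof -
  have "nu = mu" if "is_partition nu" "set (boxes nu) = box lam ` set (rect m)" for nu
    using boxes_eqI [OF that(1) mu(1)] that(2) mu(2) by simp
  then have "is_partition nu \<and> set (boxes nu) = box lam ` set (rect m) \<longleftrightarrow> nu = mu" for nu
    using mu by blast
  then show ?thesis unfolding only_eq_Some by (simp only: singleton_conv)
qed

lemma boxes_mu: "boxes mu = map (box lam) (rect m)"
proof (rule sorted_wrt_unique [where R = box_before, OF box_before_asym sorted_boxes])
  have "sorted_wrt (<) (rect m)" unfolding rect_def by (rule sorted_wrt_filter) (rule sorted_wrt_upt)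
  then show "sorted_wrt box_before (map (box lam) (rect m))"
    unfolding sorted_wrt_map
    by (rule sorted_wrt_mono_rel [rotated]) (use box_less_iff [of _ lam] m in \<open>auto simp: set_rect\<close>)
qed (use mu in auto)

lemma box_mu:
  assumes "k \<in> {1..length (rect m)}" shows "box mu k = box lam (rect m ! (k - 1))"
proof -
  have "k - 1 < length (rect m)" using assms by auto
  then show ?thesis unfolding box_def [of mu] boxes_mu by simp
qed

lemma mu_interlaces:
  assumes "1 \<le> x" shows "part mu x \<le> part lam x" "part lam (Suc x) \<le> part mu x"
proof -
  have "(x, y) \<in> set (boxes lam)" if "(x, y) \<in> set (boxes mu)" for y
    using that box_in [of _ lam] m unfolding mu(2) by (auto simp: set_rect)
  then show "part mu x \<le> part lam x" using assms by (cases "part mu x") (auto simp: set_boxes)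
  have "(x, y) \<in> set (boxes mu)" if s: "(Suc x, y) \<in> set (boxes lam)" for y
  proof -
    obtain k where k: "k \<in> {1..m}" "box lam k = (Suc x, y)"
      using box_ex [of "(Suc x, y)" lam] s m by blast
    have "(x, y) \<in> set (boxes lam)" using s assms part_antimono [OF lam assms, of "Suc x"] by (simp add: set_boxes)
    then obtain i where i: "i \<in> {1..m}" "box lam i = (x, y)" using box_ex [of "(x, y)" lam] m by blast
    then have "i \<in> set (rect m)" using column_rectified(1) [OF i(1) k(1) i(2) k(2)] unfolding set_rect by simp
    then show ?thesis unfolding mu(2) using i by force
  qed
  then show "part lam (Suc x) \<le> part mu x" using assms by (cases "part lam (Suc x)") (auto simp: set_boxes)
qed

abbreviation w1 :: perm where "w1 \<equiv> q (G 0)"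

lemma q_ts: "i \<le> m \<Longrightarrow> w1 \<circ> trans_perm (ts i) = q (G i)"
proof (induction i)
  case 0
  then show ?case by simp
next
  case (Suc i)
  have IH: "w1 \<circ> trans_perm (ts i) = q (G i)" using Suc.prems by (intro Suc.IH) simp
  show ?case
  proof (cases "K (Suc i)")
    case True
    have "q (G i) = q (G (Suc i)) \<circ> transpose (A (Suc i)) (D (Suc i))" using q_step(1) [of "Suc i"] Suc.prems True by simp
    then have "q (G i) \<circ> transpose (A (Suc i)) (D (Suc i)) = q (G (Suc i))" by (simp del: comp_apply)
    then show ?thesis using True IH [symmetric] by (simp add: rect_Suc trans_perm_append comp_assoc del: comp_apply)
  next
    case False
    then have e: "ts (Suc i) = ts i" by (simp add: rect_Suc)
    show ?thesis unfolding e IH using q_step(3) [of "Suc i"] Suc.prems False by simp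
  qed
qed

text \<open>The lower rows of every \<open>G i\<close> form a reduced graph, and a rectification
  takes exactly one crossing out of it; so the lengths along the list change by one.\<close>

lemma chain_ts: "i \<le> m \<Longrightarrow> chain r w1 (ts i) \<and> labels w1 (ts i) = map v (rect i)"
proof (induction i)
  case 0
  then show ?case by (simp add: labels_def)
next
  case (Suc i)
  show ?case
  proof (cases "K (Suc i)")
    case True
    have rc: "rc_graph (rows_ge (G j) (Suc l))" if "j \<le> m" for j
      using rc_graph_rows_ge package_rc [OF pkg [OF that]] by blast
    have len: "coxeter_length (q (G j)) = card (rows_ge (G j) (Suc l))" if "j \<le> m" for j
      using rc [OF that] by (simp add: rc_graph_def below_perm_def)
    obtain h k where hk: "l < h" "(h, k) \<in> G (Suc i)"
      "rows_ge (G i) (Suc l) = rows_ge (G (Suc i)) (Suc l) - {(h, k)}"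
      using rectify_effect(8) [OF pkg rectified, of "Suc i"] Suc.prems True by auto
    have "finite (rows_ge (G (Suc i)) (Suc l))" using is_graph_finite rc_graph_is_graph rc Suc.prems by blast
    moreover have "(h, k) \<in> rows_ge (G (Suc i)) (Suc l)" using hk by (simp add: rows_ge_def)
    ultimately have "card (rows_ge (G (Suc i)) (Suc l)) = Suc (card (rows_ge (G i) (Suc l)))"
      using hk(3) by (metis card_Suc_Diff1)
    then have L: "coxeter_length (q (G (Suc i))) = Suc (coxeter_length (q (G i)))" using len Suc.prems by simp
    have q1: "w1 \<circ> trans_perm (ts i) = q (G i)" using q_ts Suc.prems by simp
    have q2: "w1 \<circ> trans_perm (ts i) \<circ> transpose (A (Suc i)) (D (Suc i)) = q (G (Suc i))"
      using q_step(1) [of "Suc i"] Suc.prems True q1 by (simp del: comp_apply)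
    have e: "ts (Suc i) = ts i @ [(A (Suc i), D (Suc i))]" using True by (simp add: rect_Suc)
    have c: "chain r w1 (ts (Suc i))"
      unfolding e chain_snoc q2 unfolding q1 using Suc L rect_colors [of "Suc i"] True by simp
    have "w1 (trans_perm (ts i) (A (Suc i))) = q (G i) (A (Suc i))" using q1 by (simp add: fun_eq_iff)
    also have "\<dots> = v (Suc i)" using q_step(1) [of "Suc i"] Suc.prems True by simp
    finally have "labels w1 (ts (Suc i)) = map v (rect (Suc i))"
      unfolding e labels_snoc using Suc True by (simp add: rect_Suc)
    then show ?thesis using c by simp
  next
    case False
    then show ?thesis using Suc by (simp add: rect_Suc)
  qed
qed

lemma ts_strict:
  "row_strict (mu, labels w1 (ts m)) \<and> column_strict (mu, labels w1 (ts m))"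
proof -
  let ?n = "length (rect m)"
  have lab: "labels w1 (ts m) = map v (rect m)" using chain_ts [of m] by simp
  have "map v (rect m) ! (i - 1) < map v (rect m) ! (k - 1)"
    if ik: "i \<in> {1..?n}" "k \<in> {1..?n}" and b: "box mu i = (x, y)" "box mu k = (x', y')"
      and d: "x = x' \<and> y < y' \<or> y = y' \<and> x < x'" for i k x y x' y'
  proof -
    let ?i = "rect m ! (i - 1)" and ?k = "rect m ! (k - 1)"
    have n: "i - 1 < ?n" "k - 1 < ?n" using ik by auto
    have I: "?i \<in> {1..m}" "?k \<in> {1..m}" "K ?k" using rect_before(3-5) n by auto
    have B: "box lam ?i = (x, y)" "box lam ?k = (x', y')" using box_mu ik b by simp_all
    have "v ?i < v ?k"
      using d
    proof
      assume d: "x = x' \<and> y < y'"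
      then have "?i < ?k" using box_less_iff [of ?i lam ?k] I B m by (simp add: box_before_def)
      then show ?thesis using row_all [OF _ I(1,2) B(1) _ I(3)] B(2) d by blast
    next
      assume d: "y = y' \<and> x < x'"
      then show ?thesis using column_all [OF I(1,2) B(1) _ _ I(3)] B(2) by blast
    qed
    then show ?thesis using n by simp
  qed
  then show ?thesis unfolding strict_tableau_iff lab length_map by blast
qed

end

lemma row_Un_rows_ge:
  assumes "rows_ge X l = X" shows "row X l \<union> rows_ge X (Suc l) = X"
proof -
  have "l \<le> a" if "(a, b) \<in> X" for a b
  proof -
    have "(a, b) \<in> rows_ge X l" using that assms by simp
    then show ?thesis by (simp add: rows_ge_def)
  qed
  then show ?thesis by (fastforce simp: rows_ge_def row_def)
qed

lemma those_map_Some: "(\<And>x. x \<in> set ys \<Longrightarrow> f x = Some (g x)) \<Longrightarrow> those (map f ys) = Some (map g ys)"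
  by (induction ys) auto

lemma strictD:
  assumes "row_strict (lam, ys)" "column_strict (lam, ys)" "i \<in> {1..length ys}" "k \<in> {1..length ys}"
    "box lam i = (x, y)" "box lam k = (x', y')" "x = x' \<and> y < y' \<or> y = y' \<and> x < x'"
  shows "ys ! (i - 1) < ys ! (k - 1)"
  using strict_tableau_iff [of lam ys] assms by blast

lemma colored_transpose_eq:
  assumes g: "generated u" and ab: "a \<le> r" "r < b" "a' \<le> r" "r < b'"
    and e: "u \<circ> transpose a b = u \<circ> transpose a' b'"
  shows "a = a' \<and> b = b'"
proof -
  have "u (transpose a b a) = u (transpose a' b' a)" using e by (metis comp_apply)
  then have "transpose a' b' a = b" using generated_inj [OF g] by simp
  then show ?thesis using ab by (auto simp: transpose_def split: if_splits)
qed

section \<open>The row of the inverse algorithm and its reversal\<close>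

context row_run
begin

text \<open>The algorithm compares the lower rows after successive rectifications. Inverse
  insertions in between leave these rows alone, so \<open>G\<close> may be taken right after the
  step in question. The colours of \<open>a\<close> and \<open>b\<close> make the transposition
  unique.\<close>

lemma transposition_only:
  assumes k: "k \<in> {1..length (rect m)}"
  shows "only {(a, b). 1 \<le> a \<and> a \<le> r \<and> r < b \<and>
      q (G ((0 # rect m) ! (k - 1))) = q (G ((0 # rect m) ! k)) \<circ> transpose a b} =
    Some (A (rect m ! (k - 1)), D (rect m ! (k - 1)))"
proof -
  let ?i = "rect m ! (k - 1)" and ?j = "(0 # rect m) ! (k - 1)"
  have k1: "k - 1 < length (rect m)" using k by auto
  note b = rect_before [OF k1]
  have "?j \<le> m \<and> rect ?j = take (k - 1) (rect m)"
  proof (cases "k - 1")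
    case (Suc n)
    then have n: "n < length (rect m)" "?j = rect m ! n" using k1 by simp_all
    show ?thesis using rect_before(2,4) [OF n(1)] n(2) Suc by simp
  qed simp
  then have j: "?j \<le> m" "rect ?j = rect (?i - 1)" using b(1) by simp_all
  have i1: "?i - 1 \<le> m" using b(4) by simp
  have "q (G ?j) = q (G (?i - 1))" using q_ts [OF j(1)] q_ts [OF i1] j(2) by metis
  also have "\<dots> = q (G ?i) \<circ> transpose (A ?i) (D ?i)" using q_step(1) [OF b(3,4,5)] .
  finally have e: "q (G ?j) = q (G ?i) \<circ> transpose (A ?i) (D ?i)" .
  have ik: "(0 # rect m) ! k = ?i" using k by (cases k) auto
  have c: "1 \<le> A ?i" "A ?i \<le> r" "r < D ?i" using rect_colors [OF b(3,4,5)] by simp_all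
  have g: "generated (q (G ?i))" using generated_below_perm package_graph pkg b(4) by blast
  have "(1 \<le> a \<and> a \<le> r \<and> r < b \<and> q (G ?j) = q (G ?i) \<circ> transpose a b) \<longleftrightarrow> (a, b) = (A ?i, D ?i)" for a b
  proof
    assume h: "1 \<le> a \<and> a \<le> r \<and> r < b \<and> q (G ?j) = q (G ?i) \<circ> transpose a b"
    then have "q (G ?i) \<circ> transpose a b = q (G ?i) \<circ> transpose (A ?i) (D ?i)"
      using trans [OF sym e] by blast
    then show "(a, b) = (A ?i, D ?i)" using colored_transpose_eq [OF g] h c by blast
  next
    assume "(a, b) = (A ?i, D ?i)"
    then show "1 \<le> a \<and> a \<le> r \<and> r < b \<and> q (G ?j) = q (G ?i) \<circ> transpose a b"
      using c e by (simp del: comp_apply)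
  qed
  then have "{(a, b). 1 \<le> a \<and> a \<le> r \<and> r < b \<and> q (G ?j) = q (G ?i) \<circ> transpose a b} = {(A ?i, D ?i)}"
    by (simp del: comp_apply)
  then show ?thesis unfolding only_eq_Some ik .
qed

lemma inverse_row_result:
  assumes steps: "\<And>i. i \<le> m \<Longrightarrow> inverse_steps r l (G m, T m) (m - i) = Some ((G i, T i), K (Suc i))"
  shows "inverse_row r l (G m) (lam, T m) = Some (G 0, rect m, rows_ge (G m) (Suc l), mu, ts m)"
proof -
  define sts where "sts = map (\<lambda>i. ((G i, T i), K (Suc i))) [0..<m + 1]"
  have len: "length (T m) = m" using len_T [of m] by simp
  have t: "those (map (\<lambda>i. inverse_steps r l (G m, T m) (m - i)) [0..<m + 1]) = Some sts"
    unfolding sts_def by (rule those_map_Some) (use steps in auto)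
  have nth: "sts ! i = ((G i, T i), K (Suc i))" if "i \<le> m" for i
    using that unfolding sts_def by (simp del: upt_Suc)
  define Rs where "Rs = map (fst \<circ> fst) sts"
  have Rs: "Rs ! i = G i" if "i \<le> m" for i
    using that nth [OF that] unfolding Rs_def by (simp add: sts_def del: upt_Suc)
  have rec: "filter (\<lambda>i. snd (sts ! (i - 1))) [1..<m + 1] = rect m"
    unfolding rect_def by (rule filter_cong) (use nth in auto)
  have tsm: "those (map (\<lambda>k. only {(a, b). 1 \<le> a \<and> a \<le> r \<and> r < b \<and>
      graph_perm (rows_ge (Rs ! ((0 # rect m) ! (k - 1))) (l + 1)) =
      graph_perm (rows_ge (Rs ! ((0 # rect m) ! k)) (l + 1)) \<circ> transpose a b})
      [1..<length (rect m) + 1]) = Some (ts m)"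
  proof -
    have le: "(0 # rect m) ! k \<le> m" if "k \<le> length (rect m)" for k
      using that rect_before(4) [of "k - 1"] by (cases k) auto
    have "those (map (\<lambda>k. only {(a, b). 1 \<le> a \<and> a \<le> r \<and> r < b \<and>
        graph_perm (rows_ge (Rs ! ((0 # rect m) ! (k - 1))) (l + 1)) =
        graph_perm (rows_ge (Rs ! ((0 # rect m) ! k)) (l + 1)) \<circ> transpose a b})
        [1..<length (rect m) + 1]) =
      Some (map (\<lambda>k. (A (rect m ! (k - 1)), D (rect m ! (k - 1)))) [1..<length (rect m) + 1])"
    proof (rule those_map_Some)
      fix k assume "k \<in> set [1..<length (rect m) + 1]"
      then have k: "k \<in> {1..length (rect m)}" by auto
      then have "k - 1 \<le> length (rect m)" "k \<le> length (rect m)" by auto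
      then have "Rs ! ((0 # rect m) ! (k - 1)) = G ((0 # rect m) ! (k - 1))" "Rs ! ((0 # rect m) ! k) = G ((0 # rect m) ! k)"
        using Rs [OF le] by blast+
      then show "only {(a, b). 1 \<le> a \<and> a \<le> r \<and> r < b \<and>
        graph_perm (rows_ge (Rs ! ((0 # rect m) ! (k - 1))) (l + 1)) =
        graph_perm (rows_ge (Rs ! ((0 # rect m) ! k)) (l + 1)) \<circ> transpose a b} =
        Some (A (rect m ! (k - 1)), D (rect m ! (k - 1)))"
        using transposition_only [OF k] by (simp add: below_perm_def)
    qed
    also have "map (\<lambda>k. (A (rect m ! (k - 1)), D (rect m ! (k - 1)))) [1..<length (rect m) + 1] = ts m"
      by (rule nth_equalityI) (simp_all del: upt_Suc)
    finally show ?thesis .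
  qed
  show ?thesis
    unfolding inverse_row_def prod.case Let_def len t bind.bind_lunit Rs_def [symmetric] rec only_mu tsm
    using Rs [of 0] by simp
qed

text \<open>Unwinding the next package takes out the same crossings in the same order as the
  rectifications did. This identifies the crossing that a rectification step of the insertion
  algorithm adds back.\<close>

lemma unwind_rows:
  "i \<le> m \<Longrightarrow> unwind (rows_ge (G m) (Suc l)) (ts m) (length (rect i)) = Some (rows_ge (G i) (Suc l))"
proof (induction "m - i" arbitrary: i)
  case 0
  then show ?case by (simp add: unwind_def)
next
  case (Suc n)
  then have i: "Suc i \<le> m" by simp
  have IH: "unwind (rows_ge (G m) (Suc l)) (ts m) (length (rect (Suc i))) = Some (rows_ge (G (Suc i)) (Suc l))"
    using Suc.hyps(1) [of "Suc i"] Suc.hyps(2) i by simp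
  show ?case
  proof (cases "K (Suc i)")
    case True
    have "rect m = rect i @ Suc i # filter K [Suc (Suc i)..<Suc m]"
      using rect_split [OF i] True by (simp add: rect_Suc)
    then have d: "drop (length (rect i)) (ts m) = (A (Suc i), D (Suc i)) # drop (length (rect (Suc i))) (ts m)"
      using True by (simp add: rect_Suc)
    obtain h k where "crossings (rows_ge (G (Suc i)) (Suc l)) (A (Suc i)) (D (Suc i)) = {(h, k)}"
      "rows_ge (G i) (Suc l) = rows_ge (G (Suc i)) (Suc l) - {(h, k)}"
      using rectify_effect(8) [OF pkg rectified, of "Suc i"] i True by auto
    then show ?thesis using IH unfolding unwind_def d by (simp add: only_def)
  next
    case False
    then show ?thesis using IH q_step(2) [of "Suc i"] i by (simp add: rect_Suc)
  qed
qed

text \<open>A descent between consecutive boxes means that the second one starts a new row; in a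
  hook it then lies directly above the first, so every strict filling descends there.\<close>

lemma same_row_ascent:
  assumes i: "2 \<le> i" "i \<le> m" and hook: "hook lam" and desc: "xs ! (i - 1) < xs ! (i - 2)"
    and ys: "length ys = i" "row_strict (lam, ys)" "column_strict (lam, ys)"
  shows "ys ! (i - 1) < ys ! (i - 2)"
proof -
  obtain x y where b1: "box lam (i - 1) = (x, y)" by (cases "box lam (i - 1)")
  obtain x' y' where b2: "box lam i = (x', y')" by (cases "box lam i")
  have I: "i - 1 \<in> {1..m}" "i \<in> {1..m}" using i by auto
  have "box_before (x, y) (x', y')" using box_less [of "i - 1" i lam] i b1 b2 m by simp
  moreover have "\<not> (x = x' \<and> y < y')"
    using strict [OF I b1 b2] desc by (auto simp: numeral_2_eq_2)
  ultimately have x: "x' < x" by (auto simp: box_before_def)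
  have pos: "1 \<le> x'" "1 \<le> y" "y \<le> part lam x"
    using box_in [of "i - 1" lam] box_in [of i lam] I b1 b2 m by (auto simp: set_boxes)
  then obtain x0 where x0: "x = Suc x0" "1 \<le> x0" using x by (cases x) auto
  have "part lam x \<le> 1" using hook x0 by (simp add: hook_def)
  then have y: "y = 1" "part lam x = 1" using pos by simp_all
  have "(x0, 1) \<in> set (boxes lam)"
    using part_antimono [OF lam x0(2), of "Suc x0"] y x0 by (simp add: set_boxes)
  moreover have "i - 1 \<in> {1..length (boxes lam)}" "box lam (i - 1) = (Suc x0, y)" "y = part lam (Suc x0)"
    using I(1) b1 x0 y m by simp_all
  ultimately have "box lam (Suc (i - 1)) = (x0, 1)" by (intro box_up(2))
  then have "box lam i = (x0, 1)" using i by simp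
  moreover have "box lam (i - 1) = (Suc x0, 1)" "i \<in> {1..length ys}" "i - 1 \<in> {1..length ys}"
    using b1 x0 y ys(1) i by auto
  ultimately have "ys ! (i - 1) < ys ! (i - 1 - 1)"
    using strictD [OF ys(2,3), of i "i - 1" x0 1 "Suc x0" 1] by simp
  then show ?thesis by (simp add: numeral_2_eq_2)
qed

lemma insertion_steps:
  assumes ks: "\<And>i. 1 \<le> i \<Longrightarrow> i \<le> m \<Longrightarrow> ks ! (i - 1) = l \<longleftrightarrow> \<not> K i" and "i \<le> m"
  shows "fold (\<lambda>i sto. do {
      st \<leftarrow> sto;
      if ks ! (i - 1) = l then insert_step r l st
      else rectify_step r l w lam (rows_ge (G m) (Suc l), mu, ts m) i st }) [1..<Suc i] (Some (G 0, T 0)) = Some (G i, T i)"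
  using assms(2)
proof (induction i)
  case 0
  then show ?case by simp
next
  case (Suc i)
  have "(if ks ! (Suc i - 1) = l then insert_step r l (G i, T i)
      else rectify_step r l w lam (rows_ge (G m) (Suc l), mu, ts m) (Suc i) (G i, T i)) = Some (G (Suc i), T (Suc i))"
  proof (cases "K (Suc i)")
    case False
    then obtain j0 where "step_insert (G (Suc i)) (T (Suc i)) (G i) (T i) j0"
      using inserted [of "Suc i"] Suc.prems by auto
    then show ?thesis using insert_step_inverse [OF pkg] ks [of "Suc i"] Suc.prems False by simp
  next
    case True
    let ?n = "length (rect i)"
    note at = rect_at [of "Suc i", simplified, OF Suc.prems True]
    have s: "step_rectify (G (Suc i)) (T (Suc i)) (G i) (T i) (A (Suc i)) (D (Suc i))"
      using rectified [of "Suc i"] Suc.prems True by simp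
    have bx: "length (boxes mu) = length (rect m)" by (simp add: boxes_mu)
    have "Suc ?n \<in> {1..length (boxes mu)}" "box mu (Suc ?n) = box lam (Suc i)"
      using at bx box_mu [of "Suc ?n"] by simp_all
    then have "{k \<in> {1..length (boxes mu)}. box mu k = box lam (Suc i)} = {Suc ?n}"
      using box_inj [of _ mu "Suc ?n"] by auto
    then have ip: "only {k \<in> {1..length (boxes mu)}. box mu k = box lam (Suc i)} = Some (Suc ?n)"
      unfolding only_eq_Some .
    have un: "unwind (rows_ge (G m) (Suc l)) (ts m) (Suc ?n) = Some (rows_ge (G (Suc i)) (Suc l))"
      "unwind (rows_ge (G m) (Suc l)) (ts m) (Suc ?n - 1) = Some (rows_ge (G i) (Suc l))"
      using unwind_rows [of "Suc i"] unwind_rows [of i] at(4) Suc.prems by simp_all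
    have ab: "ts m ! (Suc ?n - 1) = (A (Suc i), D (Suc i))" using at by simp
    have lab: "labels w (T (Suc i)) = take (Suc i) xs" using lab_T Suc.prems by simp
    have st: "row_strict (lam, labels w (T (Suc i)))" "column_strict (lam, labels w (T (Suc i)))"
      using strict_tableau_iff [of lam xs] strict_tableau_iff [of lam "take (Suc i) xs"] rows columns lab len_xs Suc.prems
      by auto
    have cons: "semi_shuffle r w \<or> (\<forall>ys. 2 \<le> Suc i \<longrightarrow> length ys = Suc i \<longrightarrow> row_strict (lam, ys) \<longrightarrow>
      column_strict (lam, ys) \<longrightarrow> labels w (T (Suc i)) ! (Suc i - 1) < labels w (T (Suc i)) ! (Suc i - 2) \<longrightarrow>
      ys ! (Suc i - 1) < ys ! (Suc i - 2))"
    proof (cases "semi_shuffle r w")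
      case False
      then have "hook lam" using semi_or_hook by simp
      then show ?thesis using same_row_ascent [of "Suc i"] lab Suc.prems by auto
    qed simp
    have "rectify_step r l w lam (rows_ge (G m) (Suc l), mu, ts m) (Suc i) (G i, T i) = Some (G (Suc i), T (Suc i))"
      by (rule rectify_step_inverse [OF pkg [OF Suc.prems] s _ ip un ab st _ cons])
        (use len_T [OF Suc.prems] Suc.prems m in simp_all)
    then show ?thesis using ks [of "Suc i"] Suc.prems True by simp
  qed
  then show ?case using Suc by simp
qed

lemma insertion_row_result:
  assumes R: "row R l = row (G 0) l" and wR: "graph_perm (rows_ge R l) = w" and sh: "sh r (rows_ge Y l) = lam"
    and len: "length (Y_word r (rows_ge Y l)) = m"
    and ks: "\<And>i. 1 \<le> i \<Longrightarrow> i \<le> m \<Longrightarrow> Y_word r (rows_ge Y l) ! (i - 1) = l \<longleftrightarrow> \<not> K i"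
  shows "insertion_row r R Y l (rows_ge (G m) (Suc l), mu, ts m) = Some (G m, lam, T m)"
proof -
  have P0: "package (G 0) (T 0)" and T0: "T 0 = []" using pkg [of 0] len_T [of 0] by simp_all
  have "rows_ge (G 0) l = G 0" using P0 by (simp add: package_def)
  then have "rows_ge (G 0) (Suc l) \<union> row (G 0) l = G 0" using row_Un_rows_ge [of "G 0" l] by blast
  then have S0: "rows_ge (G 0) (Suc l) \<union> row R l = G 0" using R by simp
  have un: "unwind (rows_ge (G m) (Suc l)) (ts m) 0 = Some (rows_ge (G 0) (Suc l))"
    using unwind_rows [of 0] by simp
  show ?thesis
    unfolding insertion_row_def prod.case un Let_def wR sh len bind.bind_lunit S0
    using insertion_steps [OF ks, of m] T0 by simp
qed

end

context row_algorithm
begin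

lemma row_run_exists:
  assumes P: "package X es" and lam: "is_partition lam" and m: "length es = length (boxes lam)"
    and st: "row_strict (lam, labels w es)" "column_strict (lam, labels w es)"
    and sh: "semi_shuffle r w \<or> hook lam"
  obtains G T K A D where "row_run r l w lam (labels w es) (length es) G T K A D"
    "G (length es) = X" "T (length es) = es"
    "\<And>i. i \<le> length es \<Longrightarrow> inverse_steps r l (X, es) (length es - i) = Some ((G i, T i), K (Suc i))"
proof -
  let ?m = "length es" and ?xs = "labels w es"
  have ex: "\<exists>X' es' f. inverse_steps r l (X, es) n = Some ((X', es'), f) \<and> package X' es' \<and>
      length es' = ?m - n \<and> labels w es' = take (?m - n) ?xs" if "n \<le> ?m" for n
    using that
  proof (induction n)
    case 0
    show ?case by (intro exI [of _ X] exI [of _ es] exI [of _ False]) (simp add: P)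
  next
    case (Suc n)
    then obtain X' es' f where IH: "inverse_steps r l (X, es) n = Some ((X', es'), f)" "package X' es'"
      "length es' = ?m - n" "labels w es' = take (?m - n) ?xs" by auto
    have ne: "es' \<noteq> []" using IH(3) Suc.prems by auto
    have "\<exists>X2 es2 f2. inverse_step r l (X', es') = Some ((X2, es2), f2) \<and> package X2 es2 \<and>
        labels w es2 = butlast (labels w es')"
      using IH(2) ne
    proof (cases rule: inverse_step_cases)
      case (insertion X2 es2 j0)
      then show ?thesis using insert_effect [OF IH(2) insertion(2)] by blast
    next
      case (rectification X2 es2 a b)
      then show ?thesis using rectify_effect(1,2) [OF IH(2) rectification(2)] by blast
    qed
    then obtain X2 es2 f2 where s: "inverse_step r l (X', es') = Some ((X2, es2), f2)" "package X2 es2"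
      "labels w es2 = butlast (labels w es')" by blast
    have l2: "labels w es2 = take (?m - Suc n) ?xs" using s(3) IH(4) by (simp add: butlast_take)
    then have "length es2 = ?m - Suc n" by (metis length_labels length_take min.absorb2 diff_le_self)
    then show ?case using IH(1) s l2 by auto
  qed
  define st' where "st' n = the (inverse_steps r l (X, es) n)" for n
  define G where "G i = fst (fst (st' (?m - i)))" for i
  define T where "T i = snd (fst (st' (?m - i)))" for i
  \<comment> \<open>The flag that comes with the state \<open>i\<close> tells the kind of step
    \<open>i + 1\<close>, hence the shift.\<close>
  define K where "K i = snd (st' (Suc ?m - i))" for i
  have steps: "inverse_steps r l (X, es) (?m - i) = Some ((G i, T i), K (Suc i))" if "i \<le> ?m" for i
    using ex [of "?m - i"] unfolding G_def T_def K_def st'_def by auto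
  have props: "package (G i) (T i)" "length (T i) = i" "labels w (T i) = take i ?xs" if "i \<le> ?m" for i
    using ex [of "?m - i"] steps [OF that] that by auto
  have step: "inverse_step r l (G i, T i) = Some ((G (i - 1), T (i - 1)), K i)" if "1 \<le> i" "i \<le> ?m" for i
  proof -
    have "?m - (i - 1) = Suc (?m - i)" "Suc (i - 1) = i" using that by simp_all
    then show ?thesis using steps [of "i - 1"] steps [of i] that by simp
  qed
  define A where "A i = fst (SOME ab. step_rectify (G i) (T i) (G (i - 1)) (T (i - 1)) (fst ab) (snd ab))" for i
  define D where "D i = snd (SOME ab. step_rectify (G i) (T i) (G (i - 1)) (T (i - 1)) (fst ab) (snd ab))" for i
  have kinds: "(K i \<longrightarrow> step_rectify (G i) (T i) (G (i - 1)) (T (i - 1)) (A i) (D i)) \<and>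
      (\<not> K i \<longrightarrow> (\<exists>j0. step_insert (G i) (T i) (G (i - 1)) (T (i - 1)) j0))" if "1 \<le> i" "i \<le> ?m" for i
  proof -
    have ne: "T i \<noteq> []" using props(2) [OF that(2)] that by auto
    show ?thesis using props(1) [OF that(2)] ne
    proof (cases rule: inverse_step_cases)
      case (insertion X2 es2 j0)
      then show ?thesis using step [OF that] by auto
    next
      case (rectification X2 es2 a b)
      then have "step_rectify (G i) (T i) (G (i - 1)) (T (i - 1)) (fst (a, b)) (snd (a, b))" "K i"
        using step [OF that] by auto
      then show ?thesis unfolding A_def D_def
        using someI [of "\<lambda>ab. step_rectify (G i) (T i) (G (i - 1)) (T (i - 1)) (fst ab) (snd ab)" "(a, b)"] by blast
    qed
  qed
  have "row_run r l w lam ?xs ?m G T K A D"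
    by unfold_locales (use props kinds lam m st sh in auto)
  moreover have "G ?m = X" "T ?m = es" using steps [of ?m] by simp_all
  ultimately show thesis using that steps by blast
qed

end

section \<open>Graphs of shuffles\<close>

lemma graph_perm_S_inf:
  assumes "is_graph X" shows "graph_perm X \<in> S_inf"
proof -
  have g: "generated (graph_perm X)" using assms by (rule generated_graph_perm)
  have "graph_perm X permutes {1..}"
    unfolding permutes_def
  proof (intro conjI allI impI)
    fix x :: nat assume "x \<notin> {1..}"
    then have "x = 0" by simp
    then show "graph_perm X x = x" using generated_zero [OF g] by simp
  next
    fix y show "\<exists>!x. graph_perm X x = y"
      using generated_inv(1) [OF g, of y] generated_inj [OF g] by (intro ex1I [of _ "inv (graph_perm X) y"]) auto
  qed
  moreover have "{i. graph_perm X i \<noteq> i} \<subseteq> (\<lambda>(i, j). i + j - 1) ` X \<union> (\<lambda>(i, j). i + j) ` X"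
    using graph_perm_fixes [OF assms] by force
  then have "finite {i. graph_perm X i \<noteq> i}"
    by (rule finite_subset) (use is_graph_finite [OF assms] in auto)
  ultimately show ?thesis by (simp add: S_inf_def)
qed

lemma shuffle_less:
  assumes "shuffle r u" "1 \<le> i" "i < j" "j \<le> r \<or> r < i" shows "u i < u j"
proof -
  have "Suc i \<le> j" using assms(3) by simp
  then show ?thesis using assms(4)
  proof (induction j rule: dec_induct)
    case base
    then show ?case using assms(1,2) by (auto simp: shuffle_def)
  next
    case (step n)
    have "1 \<le> n" "n \<noteq> r" using step assms(2) by auto
    then have "u n < u (n + 1)" using assms(1) unfolding shuffle_def by simp
    moreover have "u i < u n" using step by auto
    ultimately show ?case by simp
  qed
qed

text \<open>Both functions list the same set increasingly. At the first difference the smaller value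
  would have to occur in the other list, but it is too late for the places before \<open>n\<close>
  and too small for those from \<open>n\<close> on.\<close>

lemma first_difference:
  assumes "f ` {r<..} = g ` {r<..}" "shuffle r f" "shuffle r g" "r < n" "f n < g n"
    "\<And>k. k < n \<Longrightarrow> f k = g k"
  shows False
proof -
  have "f n \<in> g ` {r<..}" using assms(1,4) by blast
  then obtain k where k: "r < k" "f n = g k" by auto
  show False
  proof (cases k n rule: linorder_cases)
    case less
    then have "f k = f n" using assms(6) k by simp
    then show False using shuffle_less [OF assms(2), of k n] less k by simp
  next
    case equal
    then show False using k assms(5) by simp
  next
    case greater
    then show False using shuffle_less [OF assms(3), of n k] k assms(4,5) by simp
  qed
qed

lemma shuffle_unique:
  assumes u: "u \<in> S_inf" "shuffle r u" and v: "v \<in> S_inf" "shuffle r v"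
    and eq: "\<And>s. 1 \<le> s \<Longrightarrow> s \<le> r \<Longrightarrow> u s = v s"
  shows "u = v"
proof
  have img: "w ` {r<..} = {1..} - w ` {1..r}" if "w \<in> S_inf" for w
  proof -
    have p: "w permutes {1..}" using that by (simp add: S_inf_def)
    have "{r<..} = {1..} - {1..r}" by auto
    then have "w ` {r<..} = w ` {1..} - w ` {1..r}" using image_set_diff [OF permutes_inj [OF p]] by metis
    then show ?thesis using permutes_image [OF p] by simp
  qed
  have "u ` {1..r} = v ` {1..r}" by (rule image_cong) (use eq in auto)
  then have same: "u ` {r<..} = v ` {r<..}" using img u(1) v(1) by simp
  have u0: "u 0 = 0" "v 0 = 0" using u(1) v(1) by (auto simp: S_inf_def permutes_def)
  fix n show "u n = v n"
  proof (induction n rule: less_induct)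
    case (less n)
    show ?case
    proof (cases "r < n")
      case True
      have "\<not> u n < v n" using first_difference [OF same u(2) v(2) True] less by blast
      moreover have "\<not> v n < u n" using first_difference [OF same [symmetric] v(2) u(2) True] less by fastforce
      ultimately show ?thesis by simp
    next
      case False
      then show ?thesis using eq [of n] u0 by (cases n) auto
    qed
  qed
qed

definition shuffle_spec :: "nat list \<Rightarrow> nat \<Rightarrow> perm \<Rightarrow> bool" where
  "shuffle_spec lam r v \<longleftrightarrow> v \<in> S_inf \<and> shuffle r v \<and> (\<forall>j\<in>{1..r}. part lam j + r + 1 = v (r + 1 - j) + j)"

lemma shuffle_spec_value:
  assumes "shuffle_spec lam r v" "1 \<le> s" "s \<le> r" shows "v s = part lam (r + 1 - s) + s"
proof -
  have "r + 1 - s \<in> {1..r}" "r + 1 - (r + 1 - s) = s" using assms by auto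
  then have "part lam (r + 1 - s) + r + 1 = v s + (r + 1 - s)" using assms(1) unfolding shuffle_spec_def by metis
  then show ?thesis using assms by simp
qed

lemma shuffle_perm_eq: "shuffle_spec lam r v \<Longrightarrow> shuffle_perm lam r = v"
proof -
  assume v: "shuffle_spec lam r v"
  have "u = v" if "shuffle_spec lam r u" for u
  proof (rule shuffle_unique [of u r v])
    show "u \<in> S_inf" "shuffle r u" "v \<in> S_inf" "shuffle r v"
      using that v by (simp_all add: shuffle_spec_def)
    show "u s = v s" if "1 \<le> s" "s \<le> r" for s
      using shuffle_spec_value [OF \<open>shuffle_spec lam r u\<close> that] shuffle_spec_value [OF v that] by simp
  qed
  then have "(THE u. shuffle_spec lam r u) = v" using v by (rule_tac the_equality [where P = "shuffle_spec lam r"])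
  then show ?thesis by (simp only: shuffle_perm_def shuffle_spec_def)
qed

section \<open>Rc-graphs of a shuffle and their words\<close>

locale shuffle_graph =
  fixes r :: nat and Y :: graph
  assumes rc: "rc_graph Y" and sh_Y: "shuffle r (graph_perm Y)"
begin

abbreviation W :: "nat \<Rightarrow> perm" where "W l \<equiv> below_perm Y l"

lemma graph: "is_graph Y"
  using rc by (rule rc_graph_is_graph)

lemma W_shuffle:
  assumes "1 \<le> l" "1 \<le> i" "i < j" "j \<le> r \<or> r < i" shows "W l i < W l j"
proof (rule ccontr)
  assume "\<not> ?thesis"
  then have "W l j < W l i" using generated_inj [OF generated_below_perm [OF graph], of l i j] assms(3) by simp
  with assms(1) have "W 1 j < W 1 i"
  proof (induction l rule: dec_induct)
    case (step n)
    then show ?case using crossed_persists [OF rc _ assms(3), of n] by simp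
  qed
  then show False
    using shuffle_less [OF sh_Y assms(2-4)] rows_ge_1 [OF graph] by (simp add: below_perm_def)
qed

text \<open>Inversions persist upwards and a shuffle has none between strands of one colour. So the
  smaller, horizontal strand of a crossing is red and the vertical one blue.\<close>

lemma crossing_colors:
  assumes "(l, j) \<in> Y" shows "left_strand Y l j \<le> r" "r < below_strand Y l j" "l \<le> left_strand Y l j"
proof -
  let ?a = "left_strand Y l j" and ?b = "below_strand Y l j"
  have lj: "1 \<le> l" "1 \<le> j" using assms graph by (auto simp: is_graph_def)
  have ab: "?a < ?b" using rc_graph_crossing [OF rc assms] .
  have a: "1 \<le> ?a" using left_strand_pos [OF graph lj] .
  have L: "W (Suc l) ?a < l + j" "l + j \<le> Suc (W l ?a)" using left_strand_iff [OF graph lj, of ?a] by simp_all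
  have p: "W l ?b = l + j - 1" using below_perm_crossing [OF graph assms] .
  have "W l ?a \<noteq> W l ?b" using generated_inj [OF generated_below_perm [OF graph]] ab by simp
  then have lt: "W l ?b < W l ?a" using L p by simp
  show "?a \<le> r" using W_shuffle [OF lj(1) a ab] lt by fastforce
  show "r < ?b" using W_shuffle [OF lj(1) a ab] lt by fastforce
  show "l \<le> ?a"
  proof (rule ccontr)
    assume "\<not> ?thesis"
    then show False using L below_perm_fixes [OF graph, of ?a l] lj by simp
  qed
qed

text \<open>Red strands are never vertical; so among the places where \<open>s\<close> arrives from
  the left only the last one, where it leaves, is free.\<close>

lemma row_iff:
  assumes "1 \<le> l" "1 \<le> j" "1 \<le> s" "s \<le> r"
  shows "(l, j) \<in> Y \<and> left_strand Y l j = s \<longleftrightarrow> W (Suc l) s < l + j \<and> l + j \<le> W l s"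
proof
  assume c: "(l, j) \<in> Y \<and> left_strand Y l j = s"
  then have L: "W (Suc l) s < l + j" "l + j \<le> Suc (W l s)" using left_strand_iff [OF graph assms(1,2), of s] by simp_all
  have "W l (below_strand Y l j) = l + j - 1" using below_perm_crossing [OF graph] c by simp
  moreover have "below_strand Y l j \<noteq> s" using crossing_colors(2) [of l j] c assms(4) by auto
  ultimately have "Suc (W l s) \<noteq> l + j"
    using generated_inj [OF generated_below_perm [OF graph], of l s "below_strand Y l j"] by auto
  then show "W (Suc l) s < l + j \<and> l + j \<le> W l s" using L by simp
next
  assume c: "W (Suc l) s < l + j \<and> l + j \<le> W l s"
  then have L: "left_strand Y l j = s" using left_strand_iff [OF graph assms(1,2), of s] by simp
  then show "(l, j) \<in> Y \<and> left_strand Y l j = s"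
    using below_perm_free [OF graph _ assms(1,2)] c by fastforce
qed

lemma below_red: "(l, j) \<in> Y \<Longrightarrow> s \<le> r \<Longrightarrow> below_strand Y l j \<noteq> s"
  using crossing_colors(2) by fastforce

lemma W_mono:
  assumes "1 \<le> l" "1 \<le> s" "s \<le> r" shows "W (Suc l) s \<le> W l s"
proof (rule ccontr)
  assume n: "\<not> ?thesis"
  then have q: "W (Suc l) s = Suc (W l s)" using below_perm_mono [OF graph assms(1), of s] by simp
  show False
  proof (cases "l \<le> W l s")
    case False
    then show False using q below_perm_ge [OF graph, of l s] below_perm_fixes [OF graph, of s "Suc l"]
        below_perm_fixes [OF graph, of s l] by (cases "l \<le> s") auto
  next
    case True
    then obtain j where j: "W (Suc l) s = l + j" "1 \<le> j" using q by (metis add_Suc_right le_Suc_ex le_add1 plus_1_eq_Suc)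
    then have b: "below_strand Y l j = s" using below_strand_iff [OF graph] by simp
    then have "(l, j) \<notin> Y" using below_red assms(3) by blast
    then have "left_strand Y l (Suc j) = s" using left_strand_Suc [OF graph assms(1) j(2)] b by simp
    then show False using left_strand_iff [OF graph assms(1), of "Suc j" s] j q by simp
  qed
qed

text \<open>Otherwise strand \<open>s\<close> would still be running where \<open>Suc s\<close>
  enters from below; two red strands do not cross, so \<open>s\<close> would leave there, with a
  smaller value.\<close>

lemma W_interlace:
  assumes "1 \<le> l" "1 \<le> s" "Suc s \<le> r" shows "W l s < W (Suc l) (Suc s)"
proof (rule ccontr)
  assume n: "\<not> ?thesis"
  have lt: "W (Suc l) s < W (Suc l) (Suc s)" using W_shuffle [of "Suc l" s "Suc s"] assms by simp
  have "l < W (Suc l) (Suc s)"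
  proof (rule ccontr)
    assume "\<not> ?thesis"
    then have "Suc s \<le> l" using below_perm_ge [OF graph, of "Suc l" "Suc s"] by linarith
    then have "W (Suc l) (Suc s) = Suc s" "W l s = s" using below_perm_fixes [OF graph] by simp_all
    then show False using n by simp
  qed
  then obtain j where j: "W (Suc l) (Suc s) = l + j" "1 \<le> j"
    by (metis less_imp_add_positive One_nat_def Suc_leI)
  then have b: "below_strand Y l j = Suc s" using below_strand_iff [OF graph] by simp
  have L: "left_strand Y l j = s" using left_strand_iff [OF graph assms(1) j(2), of s] lt n j by simp
  have "(l, j) \<notin> Y" using below_red [of l j "Suc s"] b assms(3) by blast
  then have "W l s = l + j - 1" using below_perm_free [OF graph _ assms(1) j(2)] L by simp
  then show False using n j by simp
qed

lemma W_fixes: "s < l \<Longrightarrow> W l s = s"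
  using below_perm_fixes [OF graph] by simp

lemma W_ge_self:
  assumes "1 \<le> l" "s \<le> r" shows "s \<le> W l s"
proof (cases "s < l")
  case False
  have "l + k \<le> W l (l + k)" if "l + k \<le> r" for k
    using that
  proof (induction k)
    case 0
    then show ?case using below_perm_ge [OF graph, of l l] by simp
  next
    case (Suc k)
    then show ?case using W_shuffle [of l "l + k" "l + Suc k"] assms(1) by simp
  qed
  from this [of "s - l"] False assms(2) show ?thesis by simp
qed (simp add: W_fixes)

lemma strand_word_count:
  assumes "1 \<le> l" "1 \<le> s" "s \<le> r"
  shows "count (mset (strand_word (rows_ge Y l) s)) i = (if l \<le> i then W i s - W (Suc i) s else 0)"
proof -
  let ?Y = "rows_ge Y l"
  have g: "is_graph ?Y" using is_graph_rows_ge graph by blast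
  let ?S = "{(i, j) \<in> ?Y. from_left ?Y s i j \<or> from_below ?Y s i j}"
  have S: "(i, j) \<in> ?S \<longleftrightarrow> l \<le> i \<and> 1 \<le> j \<and> W (Suc i) s < i + j \<and> i + j \<le> W i s" for i j
  proof (cases "l \<le> i \<and> 1 \<le> j")
    case True
    have e: "rows_ge ?Y l = rows_ge Y l" by (simp add: rows_ge_rows_ge)
    have st: "left_strand ?Y i j = left_strand Y i j" "below_strand ?Y i j = below_strand Y i j"
      using left_strand_cong [OF e, of i j] below_strand_cong [OF e, of i j] True by simp_all
    have i: "1 \<le> i" using True assms(1) by simp
    have "(i, j) \<in> ?S \<longleftrightarrow> (i, j) \<in> Y \<and> (left_strand Y i j = s \<or> below_strand Y i j = s)"
      using from_left_iff [OF g] from_below_iff [OF g] st True i by (auto simp: rows_ge_def)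
    also have "\<dots> \<longleftrightarrow> (i, j) \<in> Y \<and> left_strand Y i j = s" using below_red assms(3) by blast
    finally show ?thesis using row_iff [OF i _ assms(2,3), of j] True by simp
  next
    case False
    then show ?thesis using g by (auto simp: rows_ge_def is_graph_def)
  qed
  have fin: "finite ?S" by (rule finite_subset [OF _ is_graph_finite [OF g]]) auto
  have "count (mset (strand_word ?Y s)) i = card {x \<in> ?S. fst x = i}"
    using fin by (simp add: strand_word_def count_image_mset vimage_def Int_def conj_commute)
  \<comment> \<open>The crossings of \<open>s\<close> in row \<open>i\<close> are indexed by
    \<open>k = i + j\<close>, which runs through an interval and can be counted.\<close>
  also have "{x \<in> ?S. fst x = i} = (\<lambda>k. (i, k - i)) ` (if l \<le> i then {W (Suc i) s<..W i s} else {})"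
  proof (rule set_eqI)
    fix x show "x \<in> {x \<in> ?S. fst x = i} \<longleftrightarrow> x \<in> (\<lambda>k. (i, k - i)) ` (if l \<le> i then {W (Suc i) s<..W i s} else {})"
    proof (cases "l \<le> i \<and> fst x = i")
      case True
      then obtain j where x: "x = (i, j)" by (cases x) auto
      have ge: "i \<le> W (Suc i) s \<or> W i s = s \<and> s < i"
        using below_perm_ge [OF graph, of "Suc i" s] below_perm_fixes [OF graph, of s "Suc i"]
          below_perm_fixes [OF graph, of s i] by (cases s i rule: linorder_cases) auto
      have "x \<in> {x \<in> ?S. fst x = i} \<longleftrightarrow> 1 \<le> j \<and> W (Suc i) s < i + j \<and> i + j \<le> W i s"
        using S [of i j] x True by simp
      also have "\<dots> \<longleftrightarrow> (\<exists>k. W (Suc i) s < k \<and> k \<le> W i s \<and> j = k - i)"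
      proof
        assume "1 \<le> j \<and> W (Suc i) s < i + j \<and> i + j \<le> W i s"
        then show "\<exists>k. W (Suc i) s < k \<and> k \<le> W i s \<and> j = k - i" by (intro exI [of _ "i + j"]) simp
      next
        assume "\<exists>k. W (Suc i) s < k \<and> k \<le> W i s \<and> j = k - i"
        then obtain k where k: "W (Suc i) s < k" "k \<le> W i s" "j = k - i" by blast
        have "W (Suc i) s = s" if "s < i" using W_fixes [of s "Suc i"] that by simp
        then have "i < k" using k ge by auto
        then show "1 \<le> j \<and> W (Suc i) s < i + j \<and> i + j \<le> W i s" using k by simp
      qed
      finally show ?thesis using x True by auto
    next
      case False
      then show ?thesis using S by (cases x) auto
    qed
  qed
  also have "card \<dots> = (if l \<le> i then W i s - W (Suc i) s else 0)"
  proof (cases "l \<le> i")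
    case True
    have "i \<le> W (Suc i) s \<or> W i s = s \<and> W (Suc i) s = s"
      using below_perm_ge [OF graph, of "Suc i" s] below_perm_fixes [OF graph, of s "Suc i"]
        below_perm_fixes [OF graph, of s i] by (cases s i rule: linorder_cases) auto
    then have "inj_on (\<lambda>k. (i, k - i)) {W (Suc i) s<..W i s}" by (auto simp: inj_on_def)
    then show ?thesis using True by (simp add: card_image)
  qed simp
  finally show ?thesis .
qed

lemma sorted_strand_word: "sorted_wrt (\<ge>) (strand_word Z s)"
  unfolding strand_word_def sorted_wrt_rev
  using sorted_sorted_list_of_multiset by (simp add: sorted_wrt_iff_nth_less sorted_iff_nth_mono)

text \<open>Let \<open>i\<close> be the smallest letter of strand \<open>s\<close>. Since
  \<open>s\<close> has a crossing in row \<open>i\<close>, interlacing puts \<open>Suc s\<close>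
  above its own number already in the rows below \<open>i\<close>. So it has a crossing in one of
  these, and its first and largest letter exceeds \<open>i\<close>.\<close>

lemma strand_word_ascent:
  assumes "1 \<le> s" "Suc s \<le> r" "strand_word Y s \<noteq> []"
  shows "strand_word Y (Suc s) \<noteq> [] \<and> last (strand_word Y s) < hd (strand_word Y (Suc s))"
proof -
  have Y1: "rows_ge Y 1 = Y" using rows_ge_1 [OF graph] .
  note cnt = strand_word_count [of 1, unfolded Y1]
  let ?i = "last (strand_word Y s)"
  have "?i \<in># mset (strand_word Y s)" using assms(3) by simp
  then have "count (mset (strand_word Y s)) ?i \<noteq> 0" by simp
  then have i: "1 \<le> ?i" "W (Suc ?i) s < W ?i s" using cnt [of s ?i] assms by (auto split: if_splits)
  have "s \<le> W (Suc ?i) s" using W_ge_self [of "Suc ?i" s] assms by simp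
  then have big: "Suc s < W (Suc ?i) (Suc s)" using i(2) W_interlace [OF i(1) assms(1,2)] by simp
  have "\<exists>h>?i. W (Suc h) (Suc s) < W h (Suc s)"
  proof (rule ccontr)
    assume "\<not> ?thesis"
    then have le: "W h (Suc s) \<le> W (Suc h) (Suc s)" if "?i < h" for h using that by (meson not_le)
    obtain M where M: "Suc ?i \<le> M" "W M = id" using below_perm_high [OF graph] by blast
    have "W (Suc ?i) (Suc s) \<le> W M (Suc s)"
      using M(1) by (induction M rule: dec_induct) (use le le_trans in \<open>auto intro: le_trans\<close>)
    then show False using big M(2) by simp
  qed
  then obtain h where h: "?i < h" "W (Suc h) (Suc s) < W h (Suc s)" by blast
  then have "count (mset (strand_word Y (Suc s))) h \<noteq> 0" using cnt [of "Suc s" h] assms by simp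
  then have hin: "h \<in> set (strand_word Y (Suc s))" by (metis count_eq_zero_iff set_mset_mset)
  then obtain z zs where z: "strand_word Y (Suc s) = z # zs" by (cases "strand_word Y (Suc s)") auto
  then have "h \<le> z" using sorted_strand_word [of Y "Suc s"] hin by auto
  then show ?thesis using z h(1) by simp
qed

lemma graph_eq: "Y = {(l, j). 1 \<le> l \<and> 1 \<le> j \<and> (\<exists>s. 1 \<le> s \<and> s \<le> r \<and> W (Suc l) s < l + j \<and> l + j \<le> W l s)}"
proof (rule set_eqI)
  fix x :: "nat \<times> nat"
  obtain l j where x: "x = (l, j)" by (cases x)
  show "x \<in> Y \<longleftrightarrow> x \<in> {(l, j). 1 \<le> l \<and> 1 \<le> j \<and> (\<exists>s. 1 \<le> s \<and> s \<le> r \<and> W (Suc l) s < l + j \<and> l + j \<le> W l s)}"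
  proof
    assume "x \<in> Y"
    then have c: "(l, j) \<in> Y" using x by simp
    then have lj: "1 \<le> l" "1 \<le> j" using graph by (auto simp: is_graph_def)
    have "1 \<le> left_strand Y l j" "left_strand Y l j \<le> r"
      using crossing_colors [OF c] left_strand_pos [OF graph lj] by simp_all
    then show "x \<in> {(l, j). 1 \<le> l \<and> 1 \<le> j \<and> (\<exists>s. 1 \<le> s \<and> s \<le> r \<and> W (Suc l) s < l + j \<and> l + j \<le> W l s)}"
      using row_iff [OF lj] c lj x by blast
  next
    assume "x \<in> {(l, j). 1 \<le> l \<and> 1 \<le> j \<and> (\<exists>s. 1 \<le> s \<and> s \<le> r \<and> W (Suc l) s < l + j \<and> l + j \<le> W l s)}"
    then show "x \<in> Y" using row_iff x by blast
  qed
qed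

text \<open>The values are recovered from the word by adding up the crossings in the rows
  \<open>\<ge> l\<close>; by \<open>graph_eq\<close> they determine the graph.\<close>

lemma W_count:
  assumes "1 \<le> s" "s \<le> r" "1 \<le> l"
  shows "W l s = s + size (filter_mset (\<lambda>i. l \<le> i) (mset (strand_word Y s)))"
proof -
  have Y1: "rows_ge Y 1 = Y" using rows_ge_1 [OF graph] .
  note cnt = strand_word_count [of 1 s, unfolded Y1]
  let ?f = "\<lambda>l. size (filter_mset (\<lambda>i. l \<le> i) (mset (strand_word Y s)))"
  have split: "?f l = ?f (Suc l) + count (mset (strand_word Y s)) l" for l
  proof -
    have "filter_mset (\<lambda>i. l \<le> i) (mset (strand_word Y s)) =
        filter_mset (\<lambda>i. Suc l \<le> i) (mset (strand_word Y s)) + filter_mset (\<lambda>i. i = l) (mset (strand_word Y s))"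
      by (rule multiset_eqI) auto
    then show ?thesis by (simp add: filter_eq_replicate_mset)
  qed
  obtain M where M: "l \<le> M" "W M = id" using below_perm_high [OF graph] by blast
  obtain N where N: "M \<le> N" "\<forall>i\<in>set (strand_word Y s). i < N"
    using finite_nat_set_iff_bounded [of "set (strand_word Y s)"] by (metis List.finite_set le_cases less_le_trans)
  have "W N s = s"
    using N(1)
  proof (induction N rule: dec_induct)
    case base
    then show ?case using M by simp
  next
    case (step n)
    have "1 \<le> n" using step M assms by simp
    then show ?case using W_mono [OF _ assms(1,2), of n] step.IH
        W_ge_self [of "Suc n" s] assms(2) by simp
  qed
  moreover have "?f N = 0" using N(2) by (auto simp: filter_empty_conv simp flip: mset_filter)
  ultimately have base: "W N s = s + ?f N" by simp
  have "l \<le> N" using M N by simp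
  then show ?thesis
  proof (induction l rule: inc_induct)
    case base
    then show ?case using \<open>W N s = s + ?f N\<close> by simp
  next
    case (step n)
    have n: "1 \<le> n" using step assms(3) by simp
    have "count (mset (strand_word Y s)) n = W n s - W (Suc n) s" using cnt [of n] assms n by simp
    then show ?case using split [of n] step.IH W_mono [OF n assms(1,2)] by simp
  qed
qed

end

lemma map_boxes: "map f (boxes lam) = concat (map (\<lambda>x. map (\<lambda>y. f (x, y)) [1..<Suc (part lam x)]) (rev [1..<Suc (length lam)]))"
  by (simp add: boxes_def map_concat comp_def)

text \<open>Strand \<open>s\<close> belongs to row \<open>r + 1 - s\<close> of the diagram, so the
  numbering of boxes from the bottom row upwards runs through the strands in increasing
  order.\<close>

lemma boxes_rows:
  assumes "length lam \<le> r"
  shows "map f (boxes lam) = concat (map (\<lambda>s. map (\<lambda>y. f (r + 1 - s, y)) [1..<Suc (part lam (r + 1 - s))]) [1..<r + 1])"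
proof -
  let ?g = "\<lambda>x. map (\<lambda>y. f (x, y)) [1..<Suc (part lam x)]"
  have up: "[1..<Suc r] = [1..<Suc (length lam)] @ [Suc (length lam)..<Suc r]"
    using assms by (metis Suc_le_mono le_add1 plus_1_eq_Suc upt_add_eq_append le_Suc_ex add_Suc)
  have empty: "concat (map ?g (rev [Suc (length lam)..<Suc r])) = []"
    using part_beyond [of lam] by (auto simp del: upt_Suc)
  have "map (\<lambda>s. r + 1 - s) [1..<r + 1] = rev [1..<Suc r]"
    by (rule nth_equalityI) (auto simp: rev_nth simp del: upt_Suc)
  then have "map ?g (map (\<lambda>s. r + 1 - s) [1..<r + 1]) = map ?g (rev [1..<Suc r])" by (rule arg_cong)
  then have "concat (map (\<lambda>s. ?g (r + 1 - s)) [1..<r + 1]) = concat (map ?g (rev [1..<Suc r]))"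
    by (simp add: comp_def del: upt_Suc)
  also have "\<dots> = concat (map ?g (rev [1..<Suc (length lam)]))"
    unfolding up using empty by (simp del: upt_Suc)
  finally show ?thesis unfolding map_boxes by simp
qed

lemma count_map_upt: "count (mset (map f [1..<Suc n])) i = card {y \<in> {1..n}. f y = i}"
proof (induction n)
  case (Suc n)
  have "{y \<in> {1..Suc n}. f y = i} = (if f (Suc n) = i then insert (Suc n) {y \<in> {1..n}. f y = i} else {y \<in> {1..n}. f y = i})"
    by (auto simp: le_Suc_eq)
  then show ?case using Suc by simp
qed simp

lemma decreasing_lists_eq:
  assumes "sorted_wrt (\<ge>) xs" "sorted_wrt (\<ge>) ys" "mset xs = mset ys"
  shows "xs = (ys :: nat list)"
proof -
  have "sorted (rev xs)" "sorted (rev ys)" using assms(1,2) by (simp_all add: sorted_wrt_rev)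
  then have "rev xs = rev ys" using assms(3) by (metis mset_rev properties_for_sort)
  then show ?thesis by simp
qed

text \<open>The places where the concatenated word changes strand are its strict ascents.\<close>

lemma ascending_blocks_unique:
  fixes f g :: "nat \<Rightarrow> nat list"
  assumes "\<And>s. sorted_wrt (\<ge>) (f s)" "\<And>s. sorted_wrt (\<ge>) (g s)"
    and "\<And>s. 1 \<le> s \<Longrightarrow> Suc s \<le> n \<Longrightarrow> f s \<noteq> [] \<Longrightarrow> f (Suc s) \<noteq> [] \<and> last (f s) < hd (f (Suc s))"
    and "\<And>s. 1 \<le> s \<Longrightarrow> Suc s \<le> n \<Longrightarrow> g s \<noteq> [] \<Longrightarrow> g (Suc s) \<noteq> [] \<and> last (g s) < hd (g (Suc s))"
    and "concat (map f [1..<Suc n]) = concat (map g [1..<Suc n])"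
    and "1 \<le> s" "s \<le> n"
  shows "f s = g s"
  using assms(3-)
proof (induction n arbitrary: s)
  case (Suc n)
  \<comment> \<open>If the last blocks had different lengths, the longer one would contain the seam
    between the last two blocks of the other list and would have to decrease weakly across a strict
    ascent.\<close>
  have longer: False
    if e: "xs @ f' (Suc n) = ys @ g' (Suc n)" and x: "xs = concat (map f' [1..<Suc n])"
      and f': "\<And>s. 1 \<le> s \<Longrightarrow> Suc s \<le> Suc n \<Longrightarrow> f' s \<noteq> [] \<Longrightarrow> f' (Suc s) \<noteq> [] \<and> last (f' s) < hd (f' (Suc s))"
      and g': "sorted_wrt (\<ge>) (g' (Suc n))" and len: "length (f' (Suc n)) < length (g' (Suc n))"
    for f' g' :: "nat \<Rightarrow> nat list" and xs ys
  proof -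
    obtain zs where zs: "xs = ys @ zs" "g' (Suc n) = zs @ f' (Suc n)"
      using e len by (auto simp: append_eq_append_conv2)
    then have ne: "zs \<noteq> []" using len by auto
    then have "xs \<noteq> []" using zs by simp
    then obtain k where k: "1 \<le> k" "k \<le> n" "f' k \<noteq> []" using x by (auto simp: less_Suc_eq_le simp del: upt_Suc)
    have "j \<le> n \<longrightarrow> f' j \<noteq> []" if "k \<le> j" for j
      using that
    proof (induction j rule: dec_induct)
      case base
      then show ?case using k by simp
    next
      case (step j)
      then show ?case using f' [of j] k(1) by auto
    qed
    then have ne_n: "f' n \<noteq> []" using k(2) by simp
    then have nn: "f' (Suc n) \<noteq> []" "last (f' n) < hd (f' (Suc n))" using f' [of n] k ne_n by auto
    have "[1..<Suc n] = [1..<n] @ [n]" using k by simp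
    then have "last xs = last (f' n)" using x ne_n by simp
    then have "last zs < hd (f' (Suc n))" using nn zs ne by simp
    moreover have "hd (f' (Suc n)) \<le> last zs"
      using g' ne nn(1) unfolding zs(2) sorted_wrt_append by simp
    ultimately show False by simp
  qed
  let ?x = "concat (map f [1..<Suc n])" and ?y = "concat (map g [1..<Suc n])"
  have e: "?x @ f (Suc n) = ?y @ g (Suc n)" using Suc.prems(3) by simp
  have "\<not> length (f (Suc n)) < length (g (Suc n))"
    using longer [where f' = f and g' = g, OF e refl Suc.prems(1) assms(2)] by blast
  moreover have "\<not> length (g (Suc n)) < length (f (Suc n))"
    using longer [where f' = g and g' = f, OF e [symmetric] refl Suc.prems(2) assms(1)] by blast
  ultimately have eq: "?x = ?y" "f (Suc n) = g (Suc n)" using e by simp_all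
  show ?case
  proof (cases "s = Suc n")
    case False
    then show ?thesis using Suc.IH [of s] Suc.prems eq(1) by simp
  qed (use eq in simp)
qed simp

lemma shuffle_graph_unique:
  assumes "shuffle_graph r Y" "shuffle_graph r Z" "Y_word r Y = Y_word r Z"
  shows "Y = Z"
proof -
  interpret Y: shuffle_graph r Y by fact
  interpret Z: shuffle_graph r Z by fact
  have "strand_word Y s = strand_word Z s" if "1 \<le> s" "s \<le> r" for s
    by (rule ascending_blocks_unique [of "strand_word Y" "strand_word Z" r])
      (use that assms(3) Y.sorted_strand_word Z.sorted_strand_word Y.strand_word_ascent Z.strand_word_ascent
        in \<open>simp_all add: Y_word_def del: upt_Suc\<close>)
  then have W: "Y.W l s = Z.W l s" if "1 \<le> l" "1 \<le> s" "s \<le> r" for l s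
    using Y.W_count [OF that(2,3,1)] Z.W_count [OF that(2,3,1)] that by simp
  have sub: "A \<subseteq> B" if "shuffle_graph r A" "shuffle_graph r B"
    "\<And>l s. 1 \<le> l \<Longrightarrow> 1 \<le> s \<Longrightarrow> s \<le> r \<Longrightarrow> below_perm A l s = below_perm B l s" for A B
  proof
    fix x assume "x \<in> A"
    then have "x \<in> {(l, j). 1 \<le> l \<and> 1 \<le> j \<and>
        (\<exists>s. 1 \<le> s \<and> s \<le> r \<and> below_perm A (Suc l) s < l + j \<and> l + j \<le> below_perm A l s)}"
      using shuffle_graph.graph_eq [OF that(1)] by blast
    then have "x \<in> {(l, j). 1 \<le> l \<and> 1 \<le> j \<and>
        (\<exists>s. 1 \<le> s \<and> s \<le> r \<and> below_perm B (Suc l) s < l + j \<and> l + j \<le> below_perm B l s)}"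
      using that(3) by fastforce
    then show "x \<in> B" using shuffle_graph.graph_eq [OF that(2)] by blast
  qed
  have "Y \<subseteq> Z" by (rule sub [OF assms(1,2)]) (rule W)
  moreover have "Z \<subseteq> Y" by (rule sub [OF assms(2,1)]) (rule W [symmetric])
  ultimately show ?thesis by blast
qed

text \<open>A Gelfand-Tsetlin pattern: \<open>Lam l\<close> is the intended shape of the rows
  \<open>\<ge> l\<close>. Strand \<open>s\<close> starts in row \<open>s\<close> and goes up, so
  only the strands \<open>s \<ge> l\<close> can cross there; these correspond to the first
  \<open>r + 1 - l\<close> parts, whence the bound on the length.\<close>

locale tower =
  fixes r :: nat and Lam :: "nat \<Rightarrow> nat list"
  assumes partition: "1 \<le> l \<Longrightarrow> is_partition (Lam l)"
    and len: "1 \<le> l \<Longrightarrow> length (Lam l) \<le> r + 1 - l"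
    and nested: "1 \<le> l \<Longrightarrow> 1 \<le> x \<Longrightarrow> part (Lam (Suc l)) x \<le> part (Lam l) x"
    and strip: "1 \<le> l \<Longrightarrow> 1 \<le> x \<Longrightarrow> part (Lam l) (Suc x) \<le> part (Lam (Suc l)) x"
begin

abbreviation pos :: "nat \<Rightarrow> nat \<Rightarrow> nat" where "pos l s \<equiv> part (Lam l) (r + 1 - s) + s"

text \<open>Here \<open>pos l s\<close> is the value that strand \<open>s\<close> is to have after
  the rows \<open>\<ge> l\<close>; the crossings are those forced by \<open>row_iff\<close>.\<close>

definition Y :: graph where
  "Y = {(l, j). 1 \<le> l \<and> l \<le> r \<and> 1 \<le> j \<and> (\<exists>s. 1 \<le> s \<and> s \<le> r \<and> pos (Suc l) s < l + j \<and> l + j \<le> pos l s)}"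

lemma pos_small: "1 \<le> l \<Longrightarrow> s < l \<Longrightarrow> pos l s = s"
proof -
  assume a: "1 \<le> l" "s < l"
  then have "\<not> (1 \<le> r + 1 - s \<and> r + 1 - s \<le> length (Lam l))" using len [of l] by linarith
  then show ?thesis by (simp only: part_def if_False add_0)
qed

lemma pos_less: "1 \<le> l \<Longrightarrow> 1 \<le> s \<Longrightarrow> s < t \<Longrightarrow> t \<le> r \<Longrightarrow> pos l s < pos l t"
proof -
  assume a: "1 \<le> l" "1 \<le> s" "s < t" "t \<le> r"
  have "1 \<le> r + 1 - t" "r + 1 - t \<le> r + 1 - s" using a by simp_all
  then show ?thesis using part_antimono [OF partition [OF a(1)]] a(3) by (meson add_le_less_mono)
qed

lemma pos_nested: "1 \<le> l \<Longrightarrow> s \<le> r \<Longrightarrow> pos (Suc l) s \<le> pos l s"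
  using nested [of l "r + 1 - s"] by simp

lemma pos_strip: "1 \<le> l \<Longrightarrow> 1 \<le> s \<Longrightarrow> s < t \<Longrightarrow> t \<le> r \<Longrightarrow> pos l s < pos (Suc l) t"
proof -
  assume a: "1 \<le> l" "1 \<le> s" "s < t" "t \<le> r"
  have "r + 1 - s = Suc (r - s)" using a by simp
  moreover have "part (Lam l) (Suc (r - s)) \<le> part (Lam (Suc l)) (r - s)" using strip [of l "r - s"] a by simp
  moreover have "part (Lam (Suc l)) (r - s) \<le> part (Lam (Suc l)) (r + 1 - t)"
    using part_antimono [OF partition, of "Suc l" "r + 1 - t" "r - s"] a by simp
  ultimately show ?thesis using a by simp
qed

lemma graph: "is_graph Y"
proof -
  have "Y \<subseteq> (\<Union>l\<in>{1..r}. \<Union>s\<in>{1..r}. {l} \<times> {..pos l s})"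
  proof
    fix x assume "x \<in> Y"
    then obtain l j s where x: "x = (l, j)" "l \<in> {1..r}" "s \<in> {1..r}" "l + j \<le> pos l s" by (auto simp: Y_def)
    then have "x \<in> {l} \<times> {..pos l s}" by simp
    then show "x \<in> (\<Union>l\<in>{1..r}. \<Union>s\<in>{1..r}. {l} \<times> {..pos l s})" using x(2,3) by blast
  qed
  then have "finite Y" by (rule finite_subset) auto
  then show ?thesis by (auto simp: is_graph_def Y_def)
qed

text \<open>By \<open>pos_strip\<close> the intervals of different strands in one row are disjoint
  and do not touch, so both where a strand enters from below and where it leaves the place is
  free.\<close>

lemma row_boundary:
  assumes "1 \<le> l" "1 \<le> s" "s \<le> r" "l + j = pos (Suc l) s \<or> l + j = Suc (pos l s)" shows "(l, j) \<notin> Y"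
proof
  assume "(l, j) \<in> Y"
  then obtain t where t: "1 \<le> t" "t \<le> r" "pos (Suc l) t < l + j" "l + j \<le> pos l t" by (auto simp: Y_def)
  show False
    using pos_strip [OF assms(1,2), of t] pos_strip [OF assms(1) t(1), of s]
      pos_less [of "Suc l" t s] pos_nested [OF assms(1), of s] t assms
    by (cases s t rule: linorder_cases) auto
qed

text \<open>A strand comes in from below at a free place, or from the left end if
  \<open>s = l\<close> has not been moved; it runs through its own crossings and leaves at the first
  free place after them.\<close>

lemma row_strands:
  assumes l: "1 \<le> l" "l \<le> r" and q: "\<And>s. 1 \<le> s \<Longrightarrow> s \<le> r \<Longrightarrow> below_perm Y (Suc l) s = pos (Suc l) s"
    and s: "1 \<le> s" "s \<le> r"
  shows "below_perm Y l s = pos l s" "1 \<le> j \<Longrightarrow> pos (Suc l) s < l + j \<Longrightarrow> l + j \<le> pos l s \<Longrightarrow> left_strand Y l j = s"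
proof -
  have all: "below_perm Y l s = pos l s \<and> (\<forall>j. 1 \<le> j \<and> pos (Suc l) s < l + j \<and> l + j \<le> pos l s \<longrightarrow> left_strand Y l j = s)"
  proof (cases "s < l")
    case True
    then show ?thesis using below_perm_fixes [OF graph True] pos_small [of l s] pos_small [of "Suc l" s] l by simp
  next
    case False
    have ge: "l \<le> pos (Suc l) s" using False by simp
    define j0 where "j0 = pos (Suc l) s - l"
    have j0: "pos (Suc l) s = l + j0" using ge by (simp add: j0_def)
    have start: "left_strand Y l (Suc j0) = s"
    proof (cases "j0 = 0")
      case True
      then have "s = l" using False j0 by simp
      then show ?thesis using left_strand_one [OF graph l(1)] True by simp
    next
      case False
      then have "(l, j0) \<notin> Y" using row_boundary [OF l(1) s, of j0] j0 by simp
      moreover have "below_strand Y l j0 = s" using below_strand_iff [OF graph, of l j0 s] q [OF s] j0 by simp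
      ultimately show ?thesis using left_strand_Suc [OF graph l(1), of j0] False by simp
    qed
    have run: "l + j \<le> Suc (pos l s) \<longrightarrow> left_strand Y l j = s" if "Suc j0 \<le> j" for j
      using that
    proof (induction j rule: dec_induct)
      case base
      show ?case using start by simp
    next
      case (step j)
      show ?case
      proof
        assume a: "l + Suc j \<le> Suc (pos l s)"
        then have "(l, j) \<in> Y" using step(1) j0 l s by (auto simp: Y_def intro!: exI [of _ s])
        then show "left_strand Y l (Suc j) = s" using left_strand_Suc [OF graph l(1), of j] step a by simp
      qed
    qed
    define j1 where "j1 = Suc (pos l s) - l"
    have j1: "Suc (pos l s) = l + j1" "Suc j0 \<le> j1"
      using pos_nested [OF l(1) s(2)] j0 by (simp_all add: j1_def)
    have "left_strand Y l j1 = s" using run [OF j1(2)] j1(1) by simp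
    moreover have "(l, j1) \<notin> Y" using row_boundary [OF l(1) s, of j1] j1(1) by simp
    ultimately have "below_perm Y l s = pos l s" using below_perm_free [OF graph _ l(1), of j1] j1 by simp
    moreover have "left_strand Y l j = s" if "pos (Suc l) s < l + j" "l + j \<le> pos l s" for j
      using run [of j] that j0 by simp
    ultimately show ?thesis by blast
  qed
  then show "below_perm Y l s = pos l s" "1 \<le> j \<Longrightarrow> pos (Suc l) s < l + j \<Longrightarrow> l + j \<le> pos l s \<Longrightarrow> left_strand Y l j = s"
    by blast+
qed

lemma above: "r < l \<Longrightarrow> below_perm Y l = id"
proof -
  assume "r < l"
  then have "rows_ge Y l = {}" by (auto simp: rows_ge_def Y_def)
  then show ?thesis by (simp add: below_perm_def)
qed

lemma W_pos:
  assumes "1 \<le> l" "1 \<le> s" "s \<le> r" shows "below_perm Y l s = pos l s"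
proof (cases "l \<le> r")
  case True
  then have "l \<le> Suc r" by simp
  then show ?thesis using assms
  proof (induction l arbitrary: s rule: inc_induct)
    case base
    then show ?case using above [of "Suc r"] pos_small [of "Suc r" s] by simp
  next
    case (step n)
    show ?case by (rule row_strands(1)) (use step in auto)
  qed
next
  case False
  then show ?thesis using above [of l] pos_small [of l s] assms by simp
qed

lemma crossing_colors:
  assumes "(l, j) \<in> Y" shows "left_strand Y l j \<le> r" "r < below_strand Y l j"
proof -
  have l: "1 \<le> l" "l \<le> r" "1 \<le> j" using assms by (auto simp: Y_def)
  obtain s where s: "1 \<le> s" "s \<le> r" "pos (Suc l) s < l + j" "l + j \<le> pos l s"
    using assms by (auto simp: Y_def)
  have "left_strand Y l j = s"
    by (rule row_strands(2) [OF l(1,2) _ s(1,2) l(3) s(3,4)]) (rule W_pos, use l in auto)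
  then show "left_strand Y l j \<le> r" using s by simp
  show "r < below_strand Y l j"
  proof (rule ccontr)
    assume n: "\<not> ?thesis"
    have "1 \<le> below_strand Y l j" using below_strand_pos [OF graph l(1)] .
    then have "below_perm Y (Suc l) (below_strand Y l j) = pos (Suc l) (below_strand Y l j)"
      using W_pos [of "Suc l" "below_strand Y l j"] n by simp
    then have "l + j = pos (Suc l) (below_strand Y l j)" using below_strand_value [OF graph, of l j] by simp
    then show False
      using row_boundary [OF l(1) \<open>1 \<le> below_strand Y l j\<close>, of j] n assms by simp
  qed
qed

lemma rc: "rc_graph Y"
  unfolding rc_graph_iff using graph crossing_colors by fastforce

text \<open>Going upwards, two blue strands could only become inverted by crossing each other, but
  the horizontal strand of every crossing is red.\<close>

lemma W_blue:
  assumes "1 \<le> l" "r < i" "i < k" shows "below_perm Y l i < below_perm Y l k"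
proof -
  have "below_perm Y l i < below_perm Y l k" if "l \<le> Suc r" for l
    using that
  proof (induction l rule: inc_induct)
    case base
    then show ?case using above [of "Suc r"] assms by simp
  next
    case (step l)
    show ?case
    proof (cases "l = 0")
      case True
      have "rows_ge Y 0 = rows_ge Y (Suc 0)" using graph by (auto simp: rows_ge_def is_graph_def)
      then show ?thesis using step.IH True by (simp add: below_perm_def)
    next
      case False
      show ?thesis
      proof (rule ccontr)
        assume n: "\<not> ?thesis"
        have "below_perm Y l i \<noteq> below_perm Y l k"
          using generated_inj [OF generated_below_perm [OF graph]] assms by simp
        then have lt: "below_perm Y l k < below_perm Y l i" using n by simp
        define j where "j = below_perm Y (Suc l) k - l"
        have "Suc l \<le> k" using step.hyps assms by simp
        then have "below_perm Y (Suc l) k = l + j" using below_perm_ge [OF graph, of "Suc l" k] by (simp add: j_def)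
        then have "(l, j) \<in> crossings Y i k"
          using row_crossing_iff(1) [OF rc, of l i k j] False assms lt step.IH by simp
        then have "(l, j) \<in> Y \<and> left_strand Y l j = i"
          using row_crossing_iff(2) [OF rc, of l i k j] False assms by simp
        then show False using crossing_colors(1) [of l j] assms by simp
      qed
    qed
  qed
  then show ?thesis using above [of l] assms by (cases "l \<le> Suc r") auto
qed

lemma spec:
  assumes "1 \<le> l" shows "shuffle_spec (Lam l) r (below_perm Y l)"
proof -
  have "below_perm Y l \<in> S_inf"
    unfolding below_perm_def by (rule graph_perm_S_inf) (rule is_graph_rows_ge [OF graph])
  moreover have "shuffle r (below_perm Y l)"
    unfolding shuffle_def
  proof (intro allI impI)
    fix i assume i: "1 \<le> i" "i \<noteq> r"
    show "below_perm Y l i < below_perm Y l (i + 1)"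
    proof (cases "i < r")
      case True
      then show ?thesis using W_pos [OF assms, of i] W_pos [OF assms, of "Suc i"] pos_less [OF assms, of i "Suc i"] i by simp
    next
      case False
      then show ?thesis using W_blue [OF assms, of i "Suc i"] i by simp
    qed
  qed
  moreover have "part (Lam l) j + r + 1 = below_perm Y l (r + 1 - j) + j" if "j \<in> {1..r}" for j
    using W_pos [OF assms, of "r + 1 - j"] that by auto
  ultimately show ?thesis by (simp add: shuffle_spec_def)
qed

lemma shuffle_perm_tower: "1 \<le> l \<Longrightarrow> shuffle_perm (Lam l) r = below_perm Y l"
  using spec shuffle_perm_eq by blast

end

text \<open>The description in \<open>shuffle_perm\<close> needs a witness. It comes from the tower
  whose shape at \<open>l\<close> consists of the first \<open>r + 1 - l\<close> rows of the
  diagram; removing the last of these rows removes a horizontal strip.\<close>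

lemma shuffle_spec_shuffle_perm:
  assumes "is_partition lam" "length lam \<le> r" shows "shuffle_spec lam r (shuffle_perm lam r)"
proof -
  have p: "part (take n lam) x = (if x \<le> n then part lam x else 0)" for n x
    by (cases x) (auto simp: part_def)
  interpret tower r "\<lambda>l. take (r + 1 - l) lam"
  proof
    fix l :: nat assume l: "1 \<le> l"
    show "is_partition (take (r + 1 - l) lam)"
      using assms(1) set_take_subset [of "r + 1 - l" lam] by (auto simp: is_partition_def sorted_wrt_take)
    show "length (take (r + 1 - l) lam) \<le> r + 1 - l" by simp
    fix x :: nat assume x: "1 \<le> x"
    show "part (take (r + 1 - Suc l) lam) x \<le> part (take (r + 1 - l) lam) x" by (auto simp: p)
    show "part (take (r + 1 - l) lam) (Suc x) \<le> part (take (r + 1 - Suc l) lam) x"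
      using part_antimono [OF assms(1) x, of "Suc x"] by (auto simp: p)
  qed
  have "take (r + 1 - 1) lam = lam" using assms(2) by simp
  then show ?thesis using spec [of 1] shuffle_perm_tower [of 1] by simp
qed

context tower
begin

lemma sh_rows: 
  assumes "1 \<le> l" shows "sh r (rows_ge Y l) = Lam l"
  unfolding sh_def
proof (rule the_equality)
  have len_r: "length (Lam l) \<le> r" using len [OF assms] assms by simp
  show "is_partition (Lam l) \<and> length (Lam l) \<le> r \<and> graph_perm (rows_ge Y l) = shuffle_perm (Lam l) r"
    using partition [OF assms] len_r shuffle_perm_tower [OF assms] by (simp add: below_perm_def)
  fix lam assume lam: "is_partition lam \<and> length lam \<le> r \<and> graph_perm (rows_ge Y l) = shuffle_perm lam r"
  then have s: "shuffle_spec lam r (below_perm Y l)"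
    using shuffle_spec_shuffle_perm [of lam r] by (simp add: below_perm_def)
  show "lam = Lam l"
  proof (rule partition_eqI)
    show "part lam x = part (Lam l) x" if "1 \<le> x" for x
    proof (cases "x \<le> r")
      case True
      then have "1 \<le> r + 1 - x" "r + 1 - x \<le> r" "r + 1 - (r + 1 - x) = x" using that by auto
      then show ?thesis using shuffle_spec_value [OF s, of "r + 1 - x"] shuffle_spec_value [OF spec [OF assms], of "r + 1 - x"]
        by simp
    next
      case False
      then show ?thesis using lam len_r by (simp add: part_beyond)
    qed
  qed (use lam partition [OF assms] in auto)
qed

sublocale shuffle: shuffle_graph r Y
proof
  show "rc_graph Y" by (rule rc)
  show "shuffle r (graph_perm Y)"
    using spec [of 1] rows_ge_1 [OF graph] by (simp add: shuffle_spec_def below_perm_def)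
qed

lemma Y_RC: "Y \<in> RC (shuffle_perm (Lam 1) r)"
  using rc shuffle_perm_tower [of 1] rows_ge_1 [OF graph] by (simp add: RC_def below_perm_def)

text \<open>The row of the crossing that belongs to a box. It does not depend on the shape in which
  the box is considered, so one function gives the words of all the graphs
  \<open>rows_ge Y l\<close>.\<close>

definition letter :: "nat \<times> nat \<Rightarrow> nat" where
  "letter b = Max {l. l \<le> r \<and> b \<in> set (boxes (Lam l))}"

lemma nested_le: "1 \<le> l \<Longrightarrow> l \<le> i \<Longrightarrow> 1 \<le> x \<Longrightarrow> part (Lam i) x \<le> part (Lam l) x"
proof -
  assume a: "1 \<le> l" "l \<le> i" "1 \<le> x"
  show ?thesis using a(2)
  proof (induction i rule: dec_induct)
    case (step i)
    then show ?case using nested [of i x] a by simp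
  qed simp
qed

lemma Lam_empty: "r < l \<Longrightarrow> Lam l = []"
  using len [of l] by (cases "Lam l") auto

lemma letter_iff:
  assumes "1 \<le> l" "b \<in> set (boxes (Lam l))" "l \<le> i"
  shows "letter b = i \<longleftrightarrow> b \<in> set (boxes (Lam i)) \<and> b \<notin> set (boxes (Lam (Suc i)))"
proof -
  have down: "b \<in> set (boxes (Lam k))" if "b \<in> set (boxes (Lam k'))" "1 \<le> k" "k \<le> k'" for k k'
  proof -
    obtain x y where b: "b = (x, y)" by (cases b)
    then have xy: "1 \<le> x" "1 \<le> y" "y \<le> part (Lam k') x" using that(1) by (simp_all add: set_boxes)
    show ?thesis using nested_le [OF that(2,3) xy(1)] xy b by (simp add: set_boxes)
  qed
  have lr: "k \<le> r" if "b \<in> set (boxes (Lam k))" for k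
  proof (rule ccontr)
    assume "\<not> ?thesis"
    then show False using Lam_empty [of k] that by (simp add: boxes_def)
  qed
  let ?S = "{l. l \<le> r \<and> b \<in> set (boxes (Lam l))}"
  have fin: "finite ?S" by simp
  have mem: "letter b \<in> ?S" unfolding letter_def by (rule Max_in) (use assms lr in auto)
  have max: "k \<le> letter b" if "b \<in> set (boxes (Lam k))" for k
    unfolding letter_def by (rule Max_ge) (use that lr in auto)
  show ?thesis
  proof
    assume "letter b = i"
    then show "b \<in> set (boxes (Lam i)) \<and> b \<notin> set (boxes (Lam (Suc i)))" using mem max [of "Suc i"] by auto
  next
    assume i: "b \<in> set (boxes (Lam i)) \<and> b \<notin> set (boxes (Lam (Suc i)))"
    then have "i \<le> letter b" using max by blast
    moreover have "letter b \<le> i"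
    proof (rule ccontr)
      assume "\<not> ?thesis"
      then have "b \<in> set (boxes (Lam (Suc i)))" using down [of "letter b" "Suc i"] mem by simp
      then show False using i by blast
    qed
    ultimately show "letter b = i" by simp
  qed
qed

lemma letter_ge:
  assumes "1 \<le> l" "b \<in> set (boxes (Lam l))" shows "l \<le> letter b" "b \<in> set (boxes (Lam (letter b)))"
proof -
  have lr: "l \<le> r"
  proof (rule ccontr)
    assume "\<not> ?thesis"
    then show False using Lam_empty [of l] assms by (simp add: boxes_def)
  qed
  show "l \<le> letter b" unfolding letter_def by (rule Max_ge) (use assms lr in auto)
  have "letter b \<in> {l. l \<le> r \<and> b \<in> set (boxes (Lam l))}"
    unfolding letter_def by (rule Max_in) (use assms lr in auto)
  then show "b \<in> set (boxes (Lam (letter b)))" by simp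
qed

text \<open>Both lists decrease weakly, so counting suffices: the letter \<open>i\<close> occurs as
  often as the row of the diagram grows from \<open>Lam (Suc i)\<close> to \<open>Lam i\<close>, and
  this is the number of crossings of \<open>s\<close> in row \<open>i\<close>.\<close>

lemma strand_word_letters:
  assumes l: "1 \<le> l" and s: "1 \<le> s" "s \<le> r"
  shows "strand_word (rows_ge Y l) s = map (\<lambda>y. letter (r + 1 - s, y)) [1..<Suc (part (Lam l) (r + 1 - s))]"
proof (rule decreasing_lists_eq)
  let ?x = "r + 1 - s"
  have x: "1 \<le> ?x" using s by simp
  show "sorted_wrt (\<ge>) (strand_word (rows_ge Y l) s)" by (rule shuffle.sorted_strand_word)
  have mem: "(?x, y) \<in> set (boxes (Lam i)) \<longleftrightarrow> 1 \<le> y \<and> y \<le> part (Lam i) ?x" for y i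
    using x by (simp add: set_boxes)
  have dec: "letter (?x, y') \<le> letter (?x, y)" if "1 \<le> y" "y < y'" "y' \<le> part (Lam l) ?x" for y y'
  proof -
    have "l \<le> letter (?x, y')" "(?x, y') \<in> set (boxes (Lam (letter (?x, y'))))"
      using letter_ge [OF l, of "(?x, y')"] mem that by auto
    then have "(?x, y) \<in> set (boxes (Lam (letter (?x, y'))))" using mem that by simp
    then show ?thesis using letter_ge(1) [of "letter (?x, y')" "(?x, y)"] \<open>l \<le> letter (?x, y')\<close> l by simp
  qed
  show "sorted_wrt (\<ge>) (map (\<lambda>y. letter (?x, y)) [1..<Suc (part (Lam l) ?x)])"
    unfolding sorted_wrt_map
    by (rule sorted_wrt_mono_rel [OF _ sorted_wrt_upt]) (use dec in auto)
  show "mset (strand_word (rows_ge Y l) s) = mset (map (\<lambda>y. letter (?x, y)) [1..<Suc (part (Lam l) ?x)])"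
  proof (rule multiset_eqI)
    fix i
    have "count (mset (map (\<lambda>y. letter (?x, y)) [1..<Suc (part (Lam l) ?x)])) i =
        card {y \<in> {1..part (Lam l) ?x}. letter (?x, y) = i}"
      by (rule count_map_upt)
    also have "\<dots> = (if l \<le> i then below_perm Y i s - below_perm Y (Suc i) s else 0)"
    proof (cases "l \<le> i")
      case True
      have "letter (?x, y) = i \<longleftrightarrow> y \<le> part (Lam i) ?x \<and> \<not> y \<le> part (Lam (Suc i)) ?x" if "y \<in> {1..part (Lam l) ?x}" for y
        using letter_iff [OF l _ True, of "(?x, y)"] mem that by auto
      then have "{y \<in> {1..part (Lam l) ?x}. letter (?x, y) = i} = {part (Lam (Suc i)) ?x<..part (Lam i) ?x}"
        using nested_le [OF l True x] by fastforce
      then show ?thesis using W_pos [of i s] W_pos [of "Suc i" s] True l s by simp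
    next
      case False
      have "{y \<in> {1..part (Lam l) ?x}. letter (?x, y) = i} = {}"
        using letter_ge(1) [OF l] mem False by fastforce
      then show ?thesis using False by simp
    qed
    finally show "count (mset (strand_word (rows_ge Y l) s)) i =
        count (mset (map (\<lambda>y. letter (?x, y)) [1..<Suc (part (Lam l) ?x)])) i"
      using shuffle.strand_word_count [OF l s, of i] by simp
  qed
qed

lemma Y_word_letters:
  assumes "1 \<le> l" shows "Y_word r (rows_ge Y l) = map letter (boxes (Lam l))"
proof -
  have "length (Lam l) \<le> r" using len [OF assms] assms by simp
  then have "map letter (boxes (Lam l)) =
      concat (map (\<lambda>s. map (\<lambda>y. letter (r + 1 - s, y)) [1..<Suc (part (Lam l) (r + 1 - s))]) [1..<r + 1])"
    by (rule boxes_rows)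
  also have "map (\<lambda>s. map (\<lambda>y. letter (r + 1 - s, y)) [1..<Suc (part (Lam l) (r + 1 - s))]) [1..<r + 1] =
      map (strand_word (rows_ge Y l)) [1..<r + 1]"
    by (rule map_cong) (use strand_word_letters [OF assms] in auto)
  finally show ?thesis by (simp add: Y_word_def)
qed

end

section \<open>The rows together\<close>

text \<open>The rows above \<open>l\<close>, which do not matter yet, are given the shape \<open>lam\<close>, so that the shapes always
  form a tower.\<close>

definition restored ::
  "nat \<Rightarrow> nat \<Rightarrow> perm \<Rightarrow> graph \<Rightarrow> nat list \<Rightarrow> transpositions \<Rightarrow> graph \<Rightarrow> nat list \<Rightarrow> (nat \<Rightarrow> nat list) \<Rightarrow> bool" where
  "restored r l w X lam es R ks Lam \<longleftrightarrow>
     rc_graph R \<and> rows_ge R l = R \<and> graph_perm R = w \<and>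
     tower r Lam \<and> Lam l = lam \<and> ks = map (tower.letter r Lam) (boxes lam) \<and>
     (\<forall>R' Y. rows_ge R' l = R \<longrightarrow>
       (\<forall>k\<ge>l. sh r (rows_ge Y k) = Lam k \<and> Y_word r (rows_ge Y k) = map (tower.letter r Lam) (boxes (Lam k))) \<longrightarrow>
       fold (\<lambda>l Po. do { P \<leftarrow> Po; insertion_row r R' Y l P }) (rev [l..<r + 1]) (Some (rows_ge R' (r + 1), [], [])) =
         Some (X, lam, es))"

text \<open>Repeating \<open>lam\<close> above row \<open>l\<close> respects the strip condition
  because parts decrease, and the bounds on the length are weaker there.\<close>

lemma tower_extend:
  assumes t: "tower r Lam" and l: "1 \<le> l" and lam: "is_partition lam" "length lam \<le> r + 1 - l"
    and i: "\<And>x. 1 \<le> x \<Longrightarrow> part (Lam (Suc l)) x \<le> part lam x \<and> part lam (Suc x) \<le> part (Lam (Suc l)) x"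
  shows "tower r (\<lambda>k. if k \<le> l then lam else Lam k)"
proof -
  interpret tower r Lam by fact
  have anti: "part lam (Suc x) \<le> part lam x" if "1 \<le> x" for x using part_antimono [OF lam(1) that, of "Suc x"] by simp
  show ?thesis
  proof
    fix k :: nat assume k: "1 \<le> k"
    show "is_partition (if k \<le> l then lam else Lam k)" using partition [OF k] lam by simp
    show "length (if k \<le> l then lam else Lam k) \<le> r + 1 - k" using len [OF k] lam by auto
    fix x :: nat assume x: "1 \<le> x"
    show "part (if Suc k \<le> l then lam else Lam (Suc k)) x \<le> part (if k \<le> l then lam else Lam k) x"
      using nested [OF k x] i [OF x] by (cases "k = l") auto
    show "part (if k \<le> l then lam else Lam k) (Suc x) \<le> part (if Suc k \<le> l then lam else Lam (Suc k)) x"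
      using strip [OF k x] i [OF x] anti [OF x] by (cases "k = l") auto
  qed
qed

lemma boxes_mono:
  "(\<And>x. 1 \<le> x \<Longrightarrow> part mu x \<le> part lam x) \<Longrightarrow> set (boxes mu) \<subseteq> set (boxes lam)"
  by (fastforce simp: set_boxes)

text \<open>A letter is characterized by the shapes at its row and the next; both rows are
  \<open>\<ge> l\<close>, where the towers agree.\<close>

lemma letter_extend:
  assumes t: "tower r Lam" and t': "tower r Lam'" and l: "1 \<le> l" and eq: "\<And>k. l \<le> k \<Longrightarrow> Lam' k = Lam k"
    and b: "b \<in> set (boxes (Lam l))"
  shows "tower.letter r Lam' b = tower.letter r Lam b"
proof -
  let ?i = "tower.letter r Lam b"
  have i: "l \<le> ?i" using tower.letter_ge(1) [OF t l b] .
  have "b \<in> set (boxes (Lam ?i)) \<and> b \<notin> set (boxes (Lam (Suc ?i)))"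
    using tower.letter_iff [OF t l b i] by simp
  then have "b \<in> set (boxes (Lam' ?i)) \<and> b \<notin> set (boxes (Lam' (Suc ?i)))" using eq [of ?i] eq [of "Suc ?i"] i by simp
  moreover have "b \<in> set (boxes (Lam' l))" using b eq [of l] by simp
  ultimately show ?thesis using tower.letter_iff [OF t' l _ i] by blast
qed

context row_run
begin

text \<open>Strands \<open>\<le> l\<close> are fixed by the lower rows, whereas \<open>A h\<close>
  has a value above that of a blue strand, which is itself \<open>> l\<close>. For
  \<open>l = r\<close> no rectification is left.\<close>

lemma A_range: "h \<in> set (rect m) \<Longrightarrow> Suc l \<le> A h \<and> A h \<le> r"
proof -
  assume "h \<in> set (rect m)"
  then have h: "1 \<le> h" "h \<le> m" "K h" by (simp_all add: set_rect)
  note c = rect_colors [OF h]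
  have G: "is_graph (G h)" using package_graph [OF pkg [OF h(2)]] .
  have "Suc l \<le> A h"
  proof (rule ccontr)
    assume "\<not> ?thesis"
    then have "q (G h) (A h) = A h" using below_perm_fixes [OF G] by simp
    moreover have "Suc l \<le> v h" using below_perm_ge [OF G, of "Suc l" "D h"] c l_le_r by simp
    ultimately show False using c \<open>\<not> Suc l \<le> A h\<close> by simp
  qed
  then show ?thesis using c by simp
qed

lemma red_value_mono:
  assumes "i \<le> k" "k \<le> m" "a \<le> r" shows "q (G i) a \<le> q (G k) a"
  using assms(1,2)
proof (induction k rule: dec_induct)
  case (step k)
  have "q (G k) a \<le> q (G (Suc k)) a"
  proof (cases "K (Suc k)")
    case True
    have s: "1 \<le> Suc k" "Suc k \<le> m" using step.prems by simp_all
    have e: "q (G k) = q (G (Suc k)) \<circ> transpose (A (Suc k)) (D (Suc k))" using q_step(1) [OF s True] by simp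
    show ?thesis
    proof (cases "a = A (Suc k)")
      case True
      then show ?thesis using rect_colors [OF s \<open>K (Suc k)\<close>] e by simp
    next
      case False
      then show ?thesis using rect_colors [OF s \<open>K (Suc k)\<close>] e assms(3) by simp
    qed
  next
    case False
    then show ?thesis using q_step(3) [of "Suc k"] step.prems by simp
  qed
  then show ?case using step by simp
qed simp

lemma same_red:
  assumes "h \<in> set (rect m)" "h' \<in> set (rect m)" "h < h'" "A h = A h'" shows "v h < v h'"
proof -
  have h: "1 \<le> h" "h \<le> m" "K h" and h': "1 \<le> h'" "h' \<le> m" "K h'" using assms by (simp_all add: set_rect)
  have "v h < q (G h) (A h)" using rect_colors [OF h] by simp
  also have "\<dots> \<le> q (G (h' - 1)) (A h)"
    using red_value_mono [of h "h' - 1" "A h"] assms(3) h' rect_colors [OF h] by simp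
  also have "\<dots> = v h'" using q_step(1) [OF h'] assms(4) by simp
  finally show ?thesis .
qed

text \<open>The red strands of the entries in the first column are distinct, and only those below row \<open>l\<close>
  take part.\<close>

lemma length_mu: "length mu \<le> r - l"
proof -
  have "\<forall>x\<in>{1..length mu}. \<exists>h. h \<in> set (rect m) \<and> box lam h = (x, 1)"
  proof
    fix x assume x: "x \<in> {1..length mu}"
    then have "(x, 1) \<in> set (boxes mu)" using part_pos [OF mu(1), of x] by (simp add: set_boxes)
    then show "\<exists>h. h \<in> set (rect m) \<and> box lam h = (x, 1)" unfolding mu(2) by force
  qed
  then obtain h where h: "\<And>x. x \<in> {1..length mu} \<Longrightarrow> h x \<in> set (rect m) \<and> box lam (h x) = (x, 1)"
    using bchoice [of "{1..length mu}" "\<lambda>x h. h \<in> set (rect m) \<and> box lam h = (x, 1)"] by blast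
  have ne: "A (h x) \<noteq> A (h x')" if x: "x \<in> {1..length mu}" "x' \<in> {1..length mu}" "x < x'" for x x'
  proof
    assume e: "A (h x) = A (h x')"
    have I: "h x \<in> {1..m}" "h x' \<in> {1..m}" "K (h x')" using h [OF x(1)] h [OF x(2)] by (simp_all add: set_rect)
    \<comment> \<open>Down the column the new labels increase while the numbers of the boxes
      decrease; with a common red strand \<open>same_red\<close> gives the opposite order of
      labels.\<close>
    have "v (h x) < v (h x')"
      using column_all [OF I(1,2) _ _ x(3) I(3)] h [OF x(1)] h [OF x(2)] by blast
    moreover have "h x' < h x"
      using box_less_iff [of "h x'" lam "h x"] I h [OF x(1)] h [OF x(2)] x(3) m by (simp add: box_before_def)
    then have "v (h x') < v (h x)" using same_red [of "h x'" "h x"] h [OF x(1)] h [OF x(2)] e by simp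
    ultimately show False by simp
  qed
  have "inj_on (\<lambda>x. A (h x)) {1..length mu}"
  proof (rule inj_onI)
    fix x x' assume "x \<in> {1..length mu}" "x' \<in> {1..length mu}" "A (h x) = A (h x')"
    then show "x = x'" using ne [of x x'] ne [of x' x] by (cases x x' rule: linorder_cases) auto
  qed
  moreover have "(\<lambda>x. A (h x)) ` {1..length mu} \<subseteq> {Suc l..r}" using A_range h by fastforce
  ultimately have "card {1..length mu} \<le> card {Suc l..r}" by (rule card_inj_on_le) simp
  then show ?thesis by simp
qed

lemma part_semi_or_hook: "semi_shuffle r w1 \<or> hook mu"
  using semi_or_hook
proof
  assume "semi_shuffle r w"
  then show ?thesis using package_semi(2) [OF _ pkg [of 0]] by simp
next
  assume h: "hook lam"
  have "part mu x \<le> 1" if "2 \<le> x" for x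
    using mu_interlaces(1) [of x] h that by (force simp: hook_def)
  then show ?thesis by (simp add: hook_def)
qed

lemma mem_boxes_mu:
  assumes "1 \<le> i" "i \<le> m" shows "box lam i \<in> set (boxes mu) \<longleftrightarrow> K i"
proof
  assume "box lam i \<in> set (boxes mu)"
  then obtain h where h: "h \<in> set (rect m)" "box lam i = box lam h" unfolding mu(2) by auto
  then have "i = h" using box_inj [of i lam h] assms m by (simp add: set_rect)
  then show "K i" using h by (simp add: set_rect)
next
  assume "K i"
  then show "box lam i \<in> set (boxes mu)" unfolding mu(2) using assms by (simp add: set_rect)
qed

text \<open>The recovered graph takes its row \<open>l\<close> from \<open>G 0\<close>, the state
  after all inverse steps of the row, and the rest from \<open>R\<close>. Below row \<open>l\<close>
  both have permutation \<open>w1\<close> and the same number of crossings, so the union is reduced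
  with permutation \<open>w\<close>, and its row \<open>l\<close> is what the row-to-row step
  adds.\<close>

lemma restored_row:
  assumes below: "restored r (Suc l) w1 (rows_ge (G m) (Suc l)) mu (ts m) R ks Lam" and len_lam: "length lam \<le> r + 1 - l"
  shows "restored r l w (G m) lam (T m) (row (G 0) l \<union> R) (word_from_below l m (rect m) ks) (\<lambda>k. if k \<le> l then lam else Lam k)"
    (is "restored r l w _ _ _ ?R ?ks ?Lam")
proof -
  have R: "rc_graph R" "rows_ge R (Suc l) = R" "graph_perm R = w1" and t: "tower r Lam" and mu': "Lam (Suc l) = mu"
    and ks: "ks = map (tower.letter r Lam) (boxes mu)"
    and ins: "\<And>R' Y. rows_ge R' (Suc l) = R \<Longrightarrow>
       (\<And>k. Suc l \<le> k \<Longrightarrow> sh r (rows_ge Y k) = Lam k \<and> Y_word r (rows_ge Y k) = map (tower.letter r Lam) (boxes (Lam k))) \<Longrightarrow>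
       fold (\<lambda>l Po. do { P \<leftarrow> Po; insertion_row r R' Y l P }) (rev [Suc l..<r + 1]) (Some (rows_ge R' (r + 1), [], [])) =
         Some (rows_ge (G m) (Suc l), mu, ts m)"
    using below unfolding restored_def by blast+
  have P0: "package (G 0) (T 0)" and T0: "T 0 = []" using pkg [of 0] len_T [of 0] by simp_all
  have X0: "rc_graph (G 0)" "rows_ge (G 0) l = G 0" "is_graph (G 0)"
    using P0 package_graph by (simp_all add: package_def)
  have w: "graph_perm (G 0) = w"
    using P0 T0 graph_perm_below [OF X0(2)] by (simp add: package_def)
  have gR: "is_graph R" using R(1) by (rule rc_graph_is_graph)
  have split: "G 0 = row (G 0) l \<union> rows_ge (G 0) (Suc l)"
    using row_Un_rows_ge [OF X0(2)] by simp
  have gs: "is_graph (row (G 0) l)" "is_graph (rows_ge (G 0) (Suc l))"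
    using X0(3) by (auto intro: is_graph_subset simp: row_def rows_ge_def)
  have up: "row (G 0) l \<inter> Z = {}" if "rows_ge Z (Suc l) = Z" for Z
  proof -
    have "row (G 0) l \<inter> rows_ge Z (Suc l) = {}" by (auto simp: row_def rows_ge_def)
    then show ?thesis using that by simp
  qed
  have rr: "rows_ge (rows_ge (G 0) (Suc l)) (Suc l) = rows_ge (G 0) (Suc l)" by (simp add: rows_ge_rows_ge)
  have perm: "graph_perm (row (G 0) l \<union> Z) = graph_perm (row (G 0) l) \<circ> graph_perm Z" if "is_graph Z" "rows_ge Z (Suc l) = Z" for Z
  proof (rule graph_perm_Un)
    show "finite Z" "finite (row (G 0) l)" using that(1) gs(1) is_graph_finite by blast+
    fix d c assume d: "d \<in> row (G 0) l" and "c \<in> Z"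
    then have "c \<in> rows_ge Z (Suc l)" using that(2) by simp
    then show "reads_before d c" using d by (auto simp: reads_before_def row_def rows_ge_def)
  qed
  have gp: "graph_perm ?R = w"
    using perm [OF gR R(2)] perm [OF gs(2) rr] split w R(3) by (simp add: below_perm_def)
  have "card ?R = card (row (G 0) l) + card R"
    using gs(1) gR up [OF R(2)] by (intro card_Un_disjoint) (auto simp: is_graph_def)
  moreover have "card (G 0) = card (row (G 0) l) + card (rows_ge (G 0) (Suc l))"
    using arg_cong [OF split, of card] card_Un_disjoint [OF _ _ up [OF rr]] gs by (simp add: is_graph_def)
  moreover have "card R = card (rows_ge (G 0) (Suc l))"
    using R(1,3) rc_graph_rows_ge [OF X0(1), of "Suc l"] by (simp add: rc_graph_def below_perm_def)
  ultimately have "card ?R = coxeter_length w" using X0(1) w by (simp add: rc_graph_def)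
  moreover have "is_graph ?R" using gs(1) gR by (auto simp: is_graph_def)
  ultimately have rcR: "rc_graph ?R" using gp by (simp add: rc_graph_def)
  have "rows_ge (row (G 0) l \<union> rows_ge R (Suc l)) l = row (G 0) l \<union> rows_ge R (Suc l)"
    "rows_ge (row (G 0) l \<union> rows_ge R (Suc l)) (Suc l) = rows_ge R (Suc l)"
    "row (row (G 0) l \<union> rows_ge R (Suc l)) l = row (G 0) l"
    by (auto simp: rows_ge_def row_def)
  then have rows: "rows_ge ?R l = ?R" "rows_ge ?R (Suc l) = R" "row ?R l = row (G 0) l" unfolding R(2) .
  have t': "tower r ?Lam"
    using tower_extend [OF t l_pos lam len_lam] mu_interlaces mu' by simp
  let ?f = "tower.letter r ?Lam"
  have lower: "?f b = tower.letter r Lam b" if "b \<in> set (boxes mu)" for b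
    using letter_extend [OF t t', of "Suc l" b] that mu' by simp
  have here: "?f b = l \<longleftrightarrow> b \<notin> set (boxes mu)" if "b \<in> set (boxes lam)" for b
    using tower.letter_iff [OF t' l_pos, of b l] that mu' by simp
  have bx: "map ?f (boxes lam) = map (\<lambda>i. ?f (box lam i)) [1..<m + 1]"
    by (rule nth_equalityI) (simp_all add: m box_def del: upt_Suc)
  have "?ks = map ?f (boxes lam)"
    unfolding word_from_below_def bx
  proof (rule map_cong [OF refl])
    fix i assume "i \<in> set [1..<m + 1]"
    then have i: "1 \<le> i" "i \<le> m" by auto
    have bi: "box lam i \<in> set (boxes lam)" using box_in [of i lam] i m by simp
    show "(if i \<in> set (rect m) then ks ! card {i' \<in> set (rect m). i' < i} else l) = ?f (box lam i)"
    proof (cases "K i")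
      case False
      then show ?thesis using here [OF bi] mem_boxes_mu [OF i] by (simp add: set_rect)
    next
      case True
      note at = rect_at [OF i True]
      have "{i' \<in> set (rect m). i' < i} = set (rect (i - 1))" using i by (auto simp: set_rect)
      then have c: "card {i' \<in> set (rect m). i' < i} = length (rect (i - 1))" using distinct_card [OF distinct_rect] by metis
      have "ks ! length (rect (i - 1)) = tower.letter r Lam (box lam i)"
        using at(1,2) by (simp add: ks boxes_mu)
      also have "\<dots> = ?f (box lam i)" using lower mem_boxes_mu [OF i] True by simp
      finally show ?thesis using c True i by (simp add: set_rect)
    qed
  qed
  moreover have "fold (\<lambda>l Po. do { P \<leftarrow> Po; insertion_row r R' Y l P }) (rev [l..<r + 1]) (Some (rows_ge R' (r + 1), [], [])) =
      Some (G m, lam, T m)"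
    if R': "rows_ge R' l = ?R" and Y: "\<forall>k\<ge>l. sh r (rows_ge Y k) = ?Lam k \<and> Y_word r (rows_ge Y k) = map ?f (boxes (?Lam k))"
    for R' Y
  proof -
    have "rows_ge R' (Suc l) = rows_ge (rows_ge R' l) (Suc l)" by (simp add: rows_ge_rows_ge)
    then have R1: "rows_ge R' (Suc l) = R" using R' rows(2) by simp
    have "sh r (rows_ge Y k) = Lam k \<and> Y_word r (rows_ge Y k) = map (tower.letter r Lam) (boxes (Lam k))" if k: "Suc l \<le> k" for k
    proof -
      have "set (boxes (Lam k)) \<subseteq> set (boxes mu)"
        using boxes_mono tower.nested_le [OF t _ k] mu' by auto
      then have "map ?f (boxes (Lam k)) = map (tower.letter r Lam) (boxes (Lam k))"
        using lower by (intro map_cong) auto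
      moreover have "?Lam k = Lam k" "l \<le> k" using k by simp_all
      ultimately show ?thesis using Y [rule_format, of k] by simp
    qed
    note I = ins [OF R1 this]
    have Yl: "sh r (rows_ge Y l) = lam" "Y_word r (rows_ge Y l) = map ?f (boxes lam)" using Y by simp_all
    have "row R' l = row (rows_ge R' l) l" by (auto simp: row_def rows_ge_def)
    also have "\<dots> = row (G 0) l" unfolding R' by (rule rows(3))
    finally have "insertion_row r R' Y l (rows_ge (G m) (Suc l), mu, ts m) = Some (G m, lam, T m)"
    proof (rule insertion_row_result)
      show "graph_perm (rows_ge R' l) = w" using R' gp by simp
      show "sh r (rows_ge Y l) = lam" by (rule Yl)
      show "length (Y_word r (rows_ge Y l)) = m" using Yl m by simp
      fix i assume i: "1 \<le> i" "i \<le> m"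
      have bi: "box lam i \<in> set (boxes lam)" using box_in [of i lam] i m by simp
      have "Y_word r (rows_ge Y l) ! (i - 1) = ?f (box lam i)" using Yl(2) i m by (simp add: box_def)
      then show "Y_word r (rows_ge Y l) ! (i - 1) = l \<longleftrightarrow> \<not> K i" using here [OF bi] mem_boxes_mu [OF i] by simp
    qed
    moreover have "rev [l..<r + 1] = rev [Suc l..<r + 1] @ [l]" using l_le_r by (simp add: upt_conv_Cons del: upt_Suc)
    ultimately show ?thesis using I by simp
  qed
  ultimately show ?thesis unfolding restored_def using rcR rows(1) gp t' by simp
qed

end

text \<open>The assumptions for row \<open>l + 1\<close> are the facts proved about
  \<open>w1\<close>, \<open>mu\<close> and \<open>ts\<close>. The induction starts in row
  \<open>r\<close>, where \<open>A_range\<close> leaves no red strand for a rectification.\<close>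

lemma inverse_rows_restored:
  assumes "row_algorithm r l w" "l = r - n" "row_algorithm.package r l w X es" "is_partition lam" "length lam \<le> r + 1 - l"
    "length es = length (boxes lam)" "row_strict (lam, labels w es)" "column_strict (lam, labels w es)"
    "semi_shuffle r w \<or> hook lam"
  shows "\<exists>R ks Lam. inverse_rows r n X (lam, es) = Some (R, ks) \<and> restored r l w X lam es R ks Lam"
  using assms
proof (induction n arbitrary: l w X es lam)
  case 0
  interpret row_algorithm r l w by fact
  obtain G T K A D where run: "row_run r l w lam (labels w es) (length es) G T K A D"
    and e: "G (length es) = X" "T (length es) = es"
    and steps: "\<And>i. i \<le> length es \<Longrightarrow> inverse_steps r l (X, es) (length es - i) = Some ((G i, T i), K (Suc i))"
    using row_run_exists [OF 0(3,4,6-9)] by metis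
  interpret run: row_run r l w lam "labels w es" "length es" G T K A D by fact
  let ?m = "length es"
  have row: "inverse_row r l X (lam, es) = Some (G 0, run.rect ?m, rows_ge X (Suc l), run.mu, run.ts ?m)"
    using run.inverse_row_result steps e by simp
  have rect: "run.rect ?m = []"
  proof (rule ccontr)
    assume "run.rect ?m \<noteq> []"
    then have "hd (run.rect ?m) \<in> set (run.rect ?m)" by simp
    then show False using run.A_range 0(2) by fastforce
  qed
  have mu: "run.mu = []" using run.length_mu 0(2) by simp
  have b0: "boxes [] = []" by (simp add: boxes_def)
  have "tower r (\<lambda>_. [])" by unfold_locales (simp_all add: is_partition_def part_def)
  moreover have same: "rows_ge X (Suc l) = rows_ge (G 0) (Suc l)"
    using run.unwind_rows [of 0] e rect by (simp add: unwind_def)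
  moreover have "rc_graph (rows_ge (G 0) (Suc l))" using rc_graph_rows_ge package_rc run.pkg by blast
  moreover have "rows_ge (rows_ge (G 0) (Suc l)) (Suc l) = rows_ge (G 0) (Suc l)" by (simp add: rows_ge_rows_ge)
  \<comment> \<open>Row \<open>r\<close> has inverse insertions only, so the rows below it are
    unchanged and count as recovered, with empty word and empty shapes.\<close>
  ultimately have "restored r (Suc l) run.w1 (rows_ge (G ?m) (Suc l)) run.mu (run.ts ?m) (rows_ge (G 0) (Suc l)) [] (\<lambda>_. [])"
    using 0(2) e unfolding restored_def mu rect by (simp add: below_perm_def b0)
  then have res: "restored r l w (G ?m) lam (T ?m) (row (G 0) l \<union> rows_ge (G 0) (Suc l)) (word_from_below l ?m (run.rect ?m) [])
      (\<lambda>k. if k \<le> l then lam else [])"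
    by (rule run.restored_row) (rule 0(5))
  have "package (G 0) (T 0)" using run.pkg [of 0] by simp
  then have "rows_ge (G 0) l = G 0" by (simp add: package_def)
  then have "row (G 0) l \<union> rows_ge (G 0) (Suc l) = G 0" by (rule row_Un_rows_ge)
  then show ?case using res row rect e 0(2) by auto
next
  case (Suc n)
  interpret row_algorithm r l w by fact
  obtain G T K A D where run: "row_run r l w lam (labels w es) (length es) G T K A D"
    and e: "G (length es) = X" "T (length es) = es"
    and steps: "\<And>i. i \<le> length es \<Longrightarrow> inverse_steps r l (X, es) (length es - i) = Some ((G i, T i), K (Suc i))"
    using row_run_exists [OF Suc.prems(3,4,6-9)] by metis
  interpret run: row_run r l w lam "labels w es" "length es" G T K A D by fact
  let ?m = "length es" and ?X = "rows_ge X (Suc l)"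
  have row: "inverse_row r l X (lam, es) = Some (G 0, run.rect ?m, ?X, run.mu, run.ts ?m)"
    using run.inverse_row_result steps e by simp
  have l: "Suc l = r - n" "l < r" using Suc.prems(2) l_pos by auto
  have "generated run.w1" using generated_below_perm package_graph run.pkg by blast
  then have alg: "row_algorithm r (Suc l) run.w1" using l by unfold_locales auto
  have rcX: "rc_graph ?X" using rc_graph_rows_ge package_rc [OF Suc.prems(3)] by blast
  have "run.w1 \<circ> trans_perm (run.ts ?m) = below_perm ?X (Suc l)"
    using run.q_ts [of ?m] e by (simp add: below_perm_def rows_ge_rows_ge)
  moreover have "rows_ge ?X (Suc l) = ?X" by (simp add: rows_ge_rows_ge)
  ultimately have P: "row_algorithm.package r (Suc l) run.w1 ?X (run.ts ?m)"
    unfolding row_algorithm.package_def [OF alg] using rcX run.chain_ts [of ?m] by simp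
  have "\<exists>R ks Lam. inverse_rows r n ?X (run.mu, run.ts ?m) = Some (R, ks) \<and>
      restored r (Suc l) run.w1 ?X run.mu (run.ts ?m) R ks Lam"
  proof (rule Suc.IH [OF alg l(1) P run.mu(1)])
    show "length run.mu \<le> r + 1 - Suc l" using run.length_mu by simp
    show "length (run.ts ?m) = length (boxes run.mu)" by (simp add: run.boxes_mu)
  qed (use run.ts_strict run.part_semi_or_hook in auto)
  then obtain R ks Lam where R: "inverse_rows r n ?X (run.mu, run.ts ?m) = Some (R, ks)"
    "restored r (Suc l) run.w1 ?X run.mu (run.ts ?m) R ks Lam" by blast
  then have "restored r l w X lam es (row (G 0) l \<union> R) (word_from_below l ?m (run.rect ?m) ks) (\<lambda>k. if k \<le> l then lam else Lam k)"
    using run.restored_row [OF _ Suc.prems(5)] e by simp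
  moreover have "inverse_rows r (Suc n) X (lam, es) = Some (row (G 0) l \<union> R, word_from_below l ?m (run.rect ?m) ks)"
    using row R(1) Suc.prems(2) by (simp add: Let_def)
  ultimately show ?case by blast
qed

text \<open>The permutation of \<open>U\<close> is a product of adjacent transpositions; undoing the
  transpositions of the chain one by one shows the same of \<open>w\<close>.\<close>

lemma generated_chain_start:
  "generated (w \<circ> trans_perm es) \<Longrightarrow> \<forall>(a, b)\<in>set es. 1 \<le> a \<and> 1 \<le> b \<Longrightarrow> generated w"
proof (induction es rule: rev_induct)
  case (snoc e es)
  obtain a b where e: "e = (a, b)" by (cases e)
  then have g: "generated (w \<circ> trans_perm es \<circ> transpose a b)"
    using snoc.prems(1) by (simp add: trans_perm_append comp_assoc del: comp_apply)
  have "1 \<le> a" "1 \<le> b" using snoc.prems(2) e by auto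
  then have "generated (w \<circ> trans_perm es \<circ> transpose a b \<circ> transpose a b)"
    using generated_comp_transpose g by blast
  then have "generated (w \<circ> trans_perm es)" by (simp add: comp_assoc del: comp_apply)
  then show ?case using snoc by (simp del: comp_apply)
qed simp

theorem theorem2p3:
  fixes r :: nat and lam :: "nat list" and u w :: perm
    and U :: graph and T :: "(nat \<times> nat) tableau"
  assumes "1 \<le> r"
    and "is_partition lam" and "length lam \<le> r"
    and "u \<in> S_inf" and "w \<in> S_inf"
    and "U \<in> RC u"
    and "full_tableau r lam T"
    and "semi_shuffle r w \<or> hook lam"
    and "bruhat_package r w U T"
    and "row_strict (E w T)" and "column_strict (E w T)"
  shows "\<exists>R Y. inverse_insertion r U T = Some (R, Y) \<and>
           R \<in> RC w \<and> Y \<in> RC (shuffle_perm lam r) \<and>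
           insertion r R Y = Some (U, T)"
proof -
  obtain es where T: "T = (lam, es)" using assms(7) by (cases T) (auto simp: full_tableau_def)
  have es: "\<forall>(a, b)\<in>set es. 1 \<le> a \<and> a \<le> r \<and> r < b" "length es = length (boxes lam)"
    using assms(7) T by (auto simp: full_tableau_def partial_tableau_def)
  have U: "rc_graph U" "w \<circ> trans_perm es = graph_perm U" "chain r w es"
    using assms(9) T by (simp_all add: bruhat_package_def bruhat_chain_iff)
  have gU: "is_graph U" using U(1) by (rule rc_graph_is_graph)
  have "generated w"
    by (rule generated_chain_start [of w es]) (use es(1) U(2) generated_graph_perm [OF gU] in auto)
  then have alg: "row_algorithm r 1 w" using assms(1) by unfold_locales auto
  have U1: "rows_ge U 1 = U" by (rule rows_ge_1 [OF gU])
  have P: "row_algorithm.package r 1 w U es"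
    unfolding row_algorithm.package_def [OF alg] using U U1 by (simp add: below_perm_def del: One_nat_def)
  have st: "row_strict (lam, labels w es)" "column_strict (lam, labels w es)"
    using assms(10,11) T by (simp_all add: E_labels)
  obtain R ks Lam where R: "inverse_rows r (r - 1) U (lam, es) = Some (R, ks)" "restored r 1 w U lam es R ks Lam"
    using inverse_rows_restored [OF alg _ P assms(2) _ es(2) st assms(8), of "r - 1"] assms(1,3) by auto
  then have RR: "rc_graph R" "graph_perm R = w" "rows_ge R 1 = R" and t: "tower r Lam" and L1: "Lam 1 = lam"
    and ks: "ks = map (tower.letter r Lam) (boxes lam)"
    by (simp_all add: restored_def)
  interpret tower r Lam by (rule t)
  have Y1: "rows_ge Y 1 = Y" by (rule rows_ge_1 [OF graph])
  have Yks: "Y_word r Y = ks" using Y_word_letters [of 1] Y1 L1 ks by simp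
  have YRC: "Y \<in> RC (shuffle_perm lam r)" using Y_RC L1 by simp
  \<comment> \<open>Any competing graph also belongs to a shuffle, so its word determines it; this
    is the uniqueness demanded by the choice of \<open>Y\<close>.\<close>
  have "Z = Y" if "is_partition mu" "length mu \<le> r" "Z \<in> RC (shuffle_perm mu r)" "Y_word r Z = ks" for Z mu
  proof (rule shuffle_graph_unique [where r = r])
    show "shuffle_graph r Z"
      using that(3) shuffle_spec_shuffle_perm [OF that(1,2)]
      by unfold_locales (auto simp: RC_def shuffle_spec_def)
    show "shuffle_graph r Y" by unfold_locales
    show "Y_word r Z = Y_word r Y" using that(4) Yks by simp
  qed
  then have "{Z. (\<exists>mu. is_partition mu \<and> length mu \<le> r \<and> Z \<in> RC (shuffle_perm mu r)) \<and> Y_word r Z = ks} = {Y}"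
    using assms(2,3) YRC Yks by blast
  then have "inverse_insertion r U T = Some (R, Y)"
    unfolding inverse_insertion_def T R(1) bind.bind_lunit prod.case only_eq_Some [symmetric] by simp
  moreover have "insertion r R Y = Some (U, T)"
    using R(2) sh_rows Y_word_letters RR(3) unfolding restored_def insertion_def T by simp
  moreover have "R \<in> RC w" using RR by (simp add: RC_def)
  ultimately show ?thesis using YRC by blast
qed

end
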